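(* Let $\mathcal N\in\mathcal C(\mathcal H_A\otimes\mathcal H_J,\mathcal H_B)$ and $\mathfrak I:=\{\mathcal N_\sigma:\sigma\in\mathcal S(\mathcal H_J)\}$ where $\mathcal N_\sigma(\rho):=\mathcal N(\rho\otimes\sigma)$. Then $\overline{\mathcal A}_{r,CET}(\mathcal N)=\overline C_{CET}(\mathfrak I)$.
   Context: Finite-dimensional Hilbert spaces; $F(\rho,\sigma)=\|\sqrt\rho\sqrt\sigma\|_1^2$. For $n\in\mathbb N$ and $\sigma\in\mathcal S(\mathcal H_J^{\otimes n})$, $\mathcal N_{n,\sigma}(\cdot):=\mathcal N^{\otimes n}(\cdot\otimes\sigma)$ (tensor factors arranged naturally); the AVQC with quantum jammer is the family $\{\mathcal N_{n,\sigma}\}$. An $(n,M_1,M_2)$ CET code $\mathcal C=(\mathcal P_m,\mathcal R_m)_{m=1}^{M_1}$: $\mathcal F_A\subset\mathcal F_B$, $\dim\mathcal F_A=M_2$, $\mathcal P_m$ CPTP $\mathcal L(\mathcal F_A)\to\mathcal L(\mathcal H_A^{\otimes n})$, $\mathcal R_m$ CP trace non-increasing $\mathcal L(\mathcal H_B^{\otimes n})\to\mathcal L(\mathcal F_B)$, $\sum_m\mathcal R_m$ trace preserving; $\mathcal R=\sum_m|m\rangle\langle m|\otimes\mathcal R_m$; for a channel $\mathcal M$, $\overline P_{CET}(\mathcal C,\mathcal M)=\frac1{M_1}\sum_mF(|m\rangle\langle m|\otimes\Phi,(\mathrm{id}\otimes\mathcal R\circ\mathcal M\circ\mathcal P_m)(\Phi))$,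 $\Phi$ maximally entangled on $\mathcal F_A\otimes\mathcal F_A$. A random code is a probability measure $\mu_n$ on codes. $\overline{\mathcal A}_{r,CET}(\mathcal N)$ is the set of $(R_1,R_2)\ge0$ for which there are random codes $\mu_n$ with $\liminf\frac1n\log M_{i,n}\ge R_i$ and $\lim_n\inf_{\sigma\in\mathcal S(\mathcal H_J^{\otimes n})}\int\overline P_{CET}(\cdot,\mathcal N_{n,\sigma})d\mu_n=1$. For a compound channel $\mathfrak I=\{\mathcal M_t\}_t$, $\overline C_{CET}(\mathfrak I)$ is the set of $(R_1,R_2)\ge0$ such that for all $\epsilon,\delta>0$ and large $n$ there is an $(n,M_{1,n},M_{2,n})$ CET code with $\frac1n\log M_{i,n}\ge R_i-\delta$ and $\inf_t\overline P_{CET}(\mathcal C,\mathcal M_t^{\otimes n})\ge1-\epsilon$. *)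

theory Defs
  imports "HOL-Probability.Probability"
begin

text \<open>A finite-dimensional Hilbert space is represented by a finite index set I of an
orthonormal basis; an operator on it is a complex matrix indexed by I x I, i.e. a function
'i => 'i => complex which vanishes outside I x I.  The tensor product of spaces with bases
I and J has basis I x J; the n-th tensor power has basis the lists of length n over I.\<close>

type_synonym 'i op = "'i \<Rightarrow> 'i \<Rightarrow> complex"

definition is_op :: "'i set \<Rightarrow> 'i op \<Rightarrow> bool" where
  "is_op I X \<longleftrightarrow> (\<forall>i j. (i \<notin> I \<or> j \<notin> I) \<longrightarrow> X i j = 0)"

definition op_mult :: "'i set \<Rightarrow> 'i op \<Rightarrow> 'i op \<Rightarrow> 'i op" where
  "op_mult I X Y = (\<lambda>i k. \<Sum>j\<in>I. X i j * Y j k)"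

definition op_adj :: "'i op \<Rightarrow> 'i op" where
  "op_adj X = (\<lambda>i j. cnj (X j i))"

definition op_trace :: "'i set \<Rightarrow> 'i op \<Rightarrow> complex" where
  "op_trace I X = (\<Sum>i\<in>I. X i i)"

definition unit_op :: "'i \<Rightarrow> 'i \<Rightarrow> 'i op" where
  "unit_op a b = (\<lambda>i j. if i = a \<and> j = b then 1 else 0)"

definition psd :: "'i set \<Rightarrow> 'i op \<Rightarrow> bool" where
  "psd I X \<longleftrightarrow> is_op I X \<and>
     (\<forall>v :: 'i \<Rightarrow> complex. Im (\<Sum>i\<in>I. \<Sum>j\<in>I. cnj (v i) * X i j * v j) = 0 \<and>
                           Re (\<Sum>i\<in>I. \<Sum>j\<in>I. cnj (v i) * X i j * v j) \<ge> 0)"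

definition states :: "'i set \<Rightarrow> 'i op set" where
  "states I = {X. psd I X \<and> op_trace I X = 1}"

definition op_sqrt :: "'i set \<Rightarrow> 'i op \<Rightarrow> 'i op" where
  "op_sqrt I A = (THE B. psd I B \<and> op_mult I B B = A)"

definition op_abs :: "'i set \<Rightarrow> 'i op \<Rightarrow> 'i op" where
  "op_abs I X = op_sqrt I (op_mult I (op_adj X) X)"

definition trace_norm :: "'i set \<Rightarrow> 'i op \<Rightarrow> real" where
  "trace_norm I X = Re (op_trace I (op_abs I X))"

definition fidelity :: "'i set \<Rightarrow> 'i op \<Rightarrow> 'i op \<Rightarrow> real" where
  "fidelity I \<rho> \<sigma> = (trace_norm I (op_mult I (op_sqrt I \<rho>) (op_sqrt I \<sigma>)))\<^sup>2"

definition op_tensor :: "'i op \<Rightarrow> 'j op \<Rightarrow> ('i \<times> 'j) op" where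
  "op_tensor X Y = (\<lambda>(i, j) (i', j'). X i i' * Y j j')"

definition lin_map :: "'i set \<Rightarrow> 'o set \<Rightarrow> ('i op \<Rightarrow> 'o op) \<Rightarrow> bool" where
  "lin_map I Out T \<longleftrightarrow>
     (\<forall>X. is_op I X \<longrightarrow> is_op Out (T X)) \<and>
     (\<forall>X Y c. is_op I X \<longrightarrow> is_op I Y \<longrightarrow>
        T (\<lambda>i j. X i j + c * Y i j) = (\<lambda>a b. T X a b + c * T Y a b))"

definition id_ten :: "'k set \<Rightarrow> ('i op \<Rightarrow> 'o op) \<Rightarrow> ('k \<times> 'i) op \<Rightarrow> ('k \<times> 'o) op" where
  "id_ten K T Z = (\<lambda>(k, y) (k', y'). if k \<in> K \<and> k' \<in> K
       then T (\<lambda>i i'. Z (k, i) (k', i')) y y' else 0)"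

definition cp_map :: "'i set \<Rightarrow> 'o set \<Rightarrow> ('i op \<Rightarrow> 'o op) \<Rightarrow> bool" where
  "cp_map I Out T \<longleftrightarrow> lin_map I Out T \<and>
     (\<forall>m::nat. \<forall>Z. psd ({..<m} \<times> I) Z \<longrightarrow> psd ({..<m} \<times> Out) (id_ten {..<m} T Z))"

definition trace_pres :: "'i set \<Rightarrow> 'o set \<Rightarrow> ('i op \<Rightarrow> 'o op) \<Rightarrow> bool" where
  "trace_pres I Out T \<longleftrightarrow> (\<forall>X. is_op I X \<longrightarrow> op_trace Out (T X) = op_trace I X)"

definition trace_nonincr :: "'i set \<Rightarrow> 'o set \<Rightarrow> ('i op \<Rightarrow> 'o op) \<Rightarrow> bool" where
  "trace_nonincr I Out T \<longleftrightarrow> (\<forall>X. psd I X \<longrightarrow> Re (op_trace Out (T X)) \<le> Re (op_trace I X))"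

definition channel :: "'i set \<Rightarrow> 'o set \<Rightarrow> ('i op \<Rightarrow> 'o op) \<Rightarrow> bool" where
  "channel I Out T \<longleftrightarrow> cp_map I Out T \<and> trace_pres I Out T"

definition lists_n :: "'i set \<Rightarrow> nat \<Rightarrow> 'i list set" where
  "lists_n I n = {xs \<in> lists I. length xs = n}"

text \<open>T^{tensor n}, defined on matrix units and extended linearly.\<close>
definition ch_pow :: "'i set \<Rightarrow> 'o set \<Rightarrow> nat \<Rightarrow> ('i op \<Rightarrow> 'o op) \<Rightarrow> 'i list op \<Rightarrow> 'o list op" where
  "ch_pow I Out n T X = (\<lambda>zs ws. if zs \<in> lists_n Out n \<and> ws \<in> lists_n Out n then
      (\<Sum>xs\<in>lists_n I n. \<Sum>ys\<in>lists_n I n.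
          X xs ys * (\<Prod>k<n. T (unit_op (xs ! k) (ys ! k)) (zs ! k) (ws ! k)))
      else 0)"

text \<open>rho (on H_A^n) tensor sigma (on H_J^n), arranged naturally on (H_A tensor H_J)^n.\<close>
definition list_tensor :: "'a list op \<Rightarrow> 'j list op \<Rightarrow> ('a \<times> 'j) list op" where
  "list_tensor \<rho> \<sigma> = (\<lambda>ps qs. \<rho> (map fst ps) (map fst qs) * \<sigma> (map snd ps) (map snd qs))"

definition avqc_ch :: "'a set \<Rightarrow> 'j set \<Rightarrow> 'b set \<Rightarrow> nat \<Rightarrow> (('a \<times> 'j) op \<Rightarrow> 'b op)
    \<Rightarrow> 'j list op \<Rightarrow> 'a list op \<Rightarrow> 'b list op" where
  "avqc_ch A J B n N \<sigma> = (\<lambda>\<rho>. ch_pow (A \<times> J) B n N (list_tensor \<rho> \<sigma>))"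

definition jam_ch :: "(('a \<times> 'j) op \<Rightarrow> 'b op) \<Rightarrow> 'j op \<Rightarrow> 'a op \<Rightarrow> 'b op" where
  "jam_ch N \<sigma> = (\<lambda>\<rho>. N (op_tensor \<rho> \<sigma>))"

text \<open>A CET code is (F_A, F_B, P, R): bases F_A of the subspace \<F>_A and F_B of \<F>_B
(F_A a subset of F_B), encoders P m and decoders R m for messages m in {1..M1}.\<close>
type_synonym ('a, 'b) cet_code =
  "nat set \<times> nat set \<times> (nat \<Rightarrow> nat op \<Rightarrow> 'a list op) \<times> (nat \<Rightarrow> 'b list op \<Rightarrow> nat op)"

definition is_cet_code :: "'a set \<Rightarrow> 'b set \<Rightarrow> nat \<Rightarrow> nat \<Rightarrow> nat \<Rightarrow> ('a, 'b) cet_code \<Rightarrow> bool" where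
  "is_cet_code A B n M1 M2 c = (case c of (FA, FB, P, R) \<Rightarrow>
      finite FB \<and> FA \<subseteq> FB \<and> card FA = M2 \<and>
      (\<forall>m\<in>{1..M1}. channel FA (lists_n A n) (P m)) \<and>
      (\<forall>m\<in>{1..M1}. cp_map (lists_n B n) FB (R m) \<and> trace_nonincr (lists_n B n) FB (R m)) \<and>
      trace_pres (lists_n B n) FB (\<lambda>Y a b. \<Sum>m\<in>{1..M1}. R m Y a b))"

text \<open>Maximally entangled state on F_A tensor F_A (viewed inside F_A tensor F_B).\<close>
definition max_ent :: "nat set \<Rightarrow> (nat \<times> nat) op" where
  "max_ent FA = (\<lambda>(k, x) (k', x'). if k \<in> FA \<and> k' \<in> FA \<and> x = k \<and> x' = k'
                                  then 1 / of_nat (card FA) else 0)"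

text \<open>R = sum_m |m><m| tensor R_m.\<close>
definition full_dec :: "nat \<Rightarrow> (nat \<Rightarrow> 'b list op \<Rightarrow> nat op) \<Rightarrow> 'b list op \<Rightarrow> (nat \<times> nat) op" where
  "full_dec M1 R = (\<lambda>Y (m, x) (m', x'). if m = m' \<and> m \<in> {1..M1} then R m Y x x' else 0)"

definition Pbar_cet :: "nat \<Rightarrow> ('a, 'b) cet_code \<Rightarrow> ('a list op \<Rightarrow> 'b list op) \<Rightarrow> real" where
  "Pbar_cet M1 c Mch = (case c of (FA, FB, P, R) \<Rightarrow>
     (1 / real M1) * (\<Sum>m\<in>{1..M1}.
        fidelity (FA \<times> ({1..M1} \<times> FB))
          (\<lambda>(k, (m1, x)) (k', (m2, x')). if m1 = m \<and> m2 = m then max_ent FA (k, x) (k', x') else 0)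
          (id_ten FA (\<lambda>X. full_dec M1 R (Mch (P m X))) (max_ent FA))))"

definition AVQC_random_CET_region :: "'a set \<Rightarrow> 'j set \<Rightarrow> 'b set \<Rightarrow> (('a \<times> 'j) op \<Rightarrow> 'b op)
    \<Rightarrow> (real \<times> real) set" where
  "AVQC_random_CET_region A J B N = {(R1, R2). R1 \<ge> 0 \<and> R2 \<ge> 0 \<and>
     (\<exists>(M1::nat \<Rightarrow> nat) (M2::nat \<Rightarrow> nat) (\<mu>::nat \<Rightarrow> ('a, 'b) cet_code measure).
        (\<forall>n. prob_space (\<mu> n) \<and> (\<forall>c\<in>space (\<mu> n). is_cet_code A B n (M1 n) (M2 n) c) \<and>
             (\<forall>\<sigma>\<in>states (lists_n J n).
                (\<lambda>c. Pbar_cet (M1 n) c (avqc_ch A J B n N \<sigma>)) \<in> borel_measurable (\<mu> n))) \<and>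
        Liminf sequentially (\<lambda>n. ereal (log 2 (real (M1 n)) / real n)) \<ge> ereal R1 \<and>
        Liminf sequentially (\<lambda>n. ereal (log 2 (real (M2 n)) / real n)) \<ge> ereal R2 \<and>
        (\<lambda>n. INF \<sigma>\<in>states (lists_n J n).
               integral\<^sup>L (\<mu> n) (\<lambda>c. Pbar_cet (M1 n) c (avqc_ch A J B n N \<sigma>))) \<longlonglongrightarrow> 1)}"

definition compound_CET_region :: "'a set \<Rightarrow> 'b set \<Rightarrow> 't set \<Rightarrow> ('t \<Rightarrow> 'a op \<Rightarrow> 'b op)
    \<Rightarrow> (real \<times> real) set" where
  "compound_CET_region A B T Mt = {(R1, R2). R1 \<ge> 0 \<and> R2 \<ge> 0 \<and>
     (\<forall>\<epsilon>>0. \<forall>\<delta>>0. \<exists>n0. \<forall>n\<ge>n0. \<exists>M1 M2 (c :: ('a, 'b) cet_code).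
        is_cet_code A B n M1 M2 c \<and>
        log 2 (real M1) / real n \<ge> R1 - \<delta> \<and> log 2 (real M2) / real n \<ge> R2 - \<delta> \<and>
        (INF t\<in>T. Pbar_cet M1 c (ch_pow A B n (Mt t))) \<ge> 1 - \<epsilon>)}"

end

theory Submission
  imports Defs "HOL-Combinatorics.Combinatorics" "HOL-Real_Asymp.Real_Asymp"
begin

text \<open>
  The error of a code is a positive functional of the state of the jammer. If a code is used with \<open>l\<close>
  junk inputs appended and all inputs randomly permuted, the jammer may be assumed to use the \<open>n\<close>-system
  marginal \<open>\<rho>\<close> of a permutation invariant state on \<open>n + l\<close> systems. A de Finetti type bound says that
  a positive functional which is at most \<open>\<epsilon>\<close> on the powers \<open>\<sigma>\<^sup>\<otimes>\<^sup>n\<close> is at most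
  \<open>2 ((n + l) / l) ^ (d - 1) * \<epsilon>\<close> on \<open>\<rho>\<close>, where \<open>d\<close> is the square of the dimension of the jammer. With
  \<open>l\<close> a small fraction of \<open>n\<close> the factor is a constant, so a code for the compound channel gives a random
  code for the jammed channel without any assumption on the speed of convergence. The bound is proved by
  representing the purifying symmetric vector through a finite family of product vectors, of size
  polynomial in \<open>n\<close>.

  Conversely, because it suffices to test the bound on that polynomial family of states, polynomially many
  codes drawn greedily from a random code have a small average error for all \<open>\<sigma>\<^sup>\<otimes>\<^sup>n\<close> simultaneously. The
  index of the code to be used is sent ahead with short codes of length \<open>s\<close>, about \<open>n ^ (1 / q)\<close> for a
  fixed \<open>q\<close>: these carry exponentially many messages, and as they too are only good on average, each member of
  their family is used once and the decoder takes the majority. If both rates vanish, a trivial code will do.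
\<close>

subsection \<open>Positive kernels\<close>

text \<open>The factor 2 ((n + l) / l) ^ (d - 1) is a quotient of two frame bounds. Expanding the
  purified symmetric vector on n + l systems into product vectors costs the inverse of the lower
  bound \<open>t\<close> of the family at length n + l; discarding l systems and removing the cross
  terms between different product vectors costs the upper bound \<open>L\<close> at length l. Up to
  a common factor both are close to inverse dimensions of symmetric subspaces, whose quotient is at
  most ((n + l) / l) ^ (d - 1); the 2 pays for replacing the uniform measure on the unit sphere by
  finitely many rational moduli and roots of unity. With l fixed the factor would be polynomial in
  n, and an error tending to zero slowly could not absorb it: hence a positive fraction of junk
  inputs. The same bound with l = n, applied to the 2n-th tensor power of \<sigma>, lets the finite
  family control every \<sigma> in the derandomisation. All of this needs an error linear in the
  jammer's state, which holds because the target state is pure, so that the fidelity is a matrix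
  element of the output.\<close>

lemma sum_Times:
  assumes "finite A" "finite B"
  shows "sum f (A \<times> B) = (\<Sum>a\<in>A. \<Sum>b\<in>B. f (a, b))"
  by (simp add: sum.cartesian_product)

definition sform :: "'i set \<Rightarrow> 'i op \<Rightarrow> ('i \<Rightarrow> complex) \<Rightarrow> ('i \<Rightarrow> complex) \<Rightarrow> complex" where
  "sform I X u v = (\<Sum>i\<in>I. \<Sum>j\<in>I. cnj (u i) * X i j * v j)"

text \<open>Unlike \<open>psd\<close> this ignores the values outside I, so kernels can be given by
  formulas that are meaningful only on I, reindexed, and multiplied entrywise.\<close>

definition pos_kernel :: "'i set \<Rightarrow> 'i op \<Rightarrow> bool" where
  "pos_kernel I X \<longleftrightarrow> (\<forall>v. Im (sform I X v v) = 0 \<and> Re (sform I X v v) \<ge> 0)"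

lemma psd_iff: "psd I X \<longleftrightarrow> is_op I X \<and> pos_kernel I X"
  by (simp add: psd_def pos_kernel_def sform_def)

lemma sform_add_right: "sform I X u (\<lambda>i. v i + c * w i) = sform I X u v + c * sform I X u w"
  by (simp add: sform_def algebra_simps sum.distrib sum_distrib_left)

lemma sform_add_left: "sform I X (\<lambda>i. v i + c * w i) u = sform I X v u + cnj c * sform I X w u"
  by (simp add: sform_def algebra_simps sum.distrib sum_distrib_left)

lemma sform_unit:
  assumes "finite I" "a \<in> I" "b \<in> I"
  shows "sform I X (\<lambda>i. if i = a then 1 else 0) (\<lambda>i. if i = b then 1 else 0) = X a b"
proof -
  have "sform I X (\<lambda>i. if i = a then 1 else 0) (\<lambda>i. if i = b then 1 else 0)
     = (\<Sum>i\<in>I. if i = a then \<Sum>j\<in>I. if j = b then X i j else 0 else 0)"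
    unfolding sform_def by (intro sum.cong refl) (auto intro!: sum.cong)
  then show ?thesis using assms by simp
qed

text \<open>Polarisation: reality of the form at u + v gives the imaginary part of the symmetry,
  reality at u + i v the real part.\<close>

lemma pos_kernel_sform_cnj:
  assumes "pos_kernel I X"
  shows "sform I X v u = cnj (sform I X u v)"
proof -
  have q: "Im (sform I X w w) = 0" for w
    using assms by (simp add: pos_kernel_def)
  have 1: "Im (sform I X u v + sform I X v u) = 0"
    using q[of "\<lambda>i. u i + 1 * v i"] q[of u] q[of v]
    by (simp only: sform_add_left sform_add_right) simp
  have 2: "Im (\<i> * sform I X u v - \<i> * sform I X v u) = 0"
    using q[of "\<lambda>i. u i + \<i> * v i"] q[of u] q[of v]
    by (simp only: sform_add_left sform_add_right) (simp add: algebra_simps)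
  show ?thesis using 1 2 by (simp add: complex_eq_iff)
qed

lemma pos_kernel_cnj:
  assumes "finite I" "pos_kernel I X" "a \<in> I" "b \<in> I"
  shows "X b a = cnj (X a b)"
  using pos_kernel_sform_cnj[OF assms(2), of "\<lambda>i. if i = b then 1 else 0" "\<lambda>i. if i = a then 1 else 0"]
  unfolding sform_unit[OF assms(1,3,4)] sform_unit[OF assms(1,4,3)] .

lemma psd_cnj:
  assumes "finite I" "psd I X"
  shows "X b a = cnj (X a b)"
proof (cases "a \<in> I \<and> b \<in> I")
  case True
  then show ?thesis using pos_kernel_cnj[OF assms(1)] assms(2) by (simp add: psd_iff)
next
  case False
  then show ?thesis using assms(2) by (auto simp: psd_iff is_op_def)
qed

lemma pos_kernel_cauchy_schwarz:
  assumes "pos_kernel I X"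
  shows "(cmod (sform I X u v))\<^sup>2 \<le> Re (sform I X u u) * Re (sform I X v v)"
proof -
  define z where "z = sform I X u v"
  define a where "a = Re (sform I X u u)"
  define b where "b = Re (sform I X v v)"
  have uu: "sform I X u u = of_real a" and vv: "sform I X v v = of_real b" and b0: "b \<ge> 0"
    using assms by (auto simp: pos_kernel_def a_def b_def complex_eq_iff)
  have vu: "sform I X v u = cnj z"
    unfolding z_def by (rule pos_kernel_sform_cnj[OF assms])
  \<comment> \<open>The form at u - t cnj(z) v, a real quadratic polynomial in t; t = 1 / b
    minimises it.\<close>
  have key: "a - 2 * t * (cmod z)\<^sup>2 + t\<^sup>2 * (cmod z)\<^sup>2 * b \<ge> 0" for t :: real
  proof -
    define c where "c = - of_real t * cnj z"
    have zz: "z * cnj z = of_real ((cmod z)\<^sup>2)"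
      by (simp only: complex_norm_square)
    have "0 \<le> Re (sform I X (\<lambda>i. u i + c * v i) (\<lambda>i. u i + c * v i))"
      using assms by (simp add: pos_kernel_def)
    also have "sform I X (\<lambda>i. u i + c * v i) (\<lambda>i. u i + c * v i)
        = of_real a + c * z + cnj c * (cnj z + c * of_real b)"
      by (simp only: sform_add_left sform_add_right uu vv vu z_def[symmetric])
    also have "\<dots> = of_real a - 2 * of_real t * (z * cnj z) + of_real (t\<^sup>2) * of_real b * (z * cnj z)"
      by (simp add: c_def algebra_simps power2_eq_square)
    also have "\<dots> = of_real (a - 2 * t * (cmod z)\<^sup>2 + t\<^sup>2 * (cmod z)\<^sup>2 * b)"
      unfolding zz by (simp add: algebra_simps)
    finally show ?thesis by simp
  qed
  show ?thesis
  proof (cases "b = 0")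
    case True
    have "(cmod z)\<^sup>2 = 0"
    proof (rule ccontr)
      assume ne: "(cmod z)\<^sup>2 \<noteq> 0"
      \<comment> \<open>For b = 0 the polynomial is linear in t and must not become negative; this t
        would give it the value -1.\<close>
      have "a - 2 * ((a + 1) / (2 * (cmod z)\<^sup>2)) * (cmod z)\<^sup>2 = -1"
        using ne by (simp add: field_simps)
      with key[of "(a + 1) / (2 * (cmod z)\<^sup>2)"] True show False by simp
    qed
    then show ?thesis using b0 True by (simp add: z_def b_def)
  next
    case False
    with b0 have bp: "b > 0" by simp
    have "(1/b)\<^sup>2 * (cmod z)\<^sup>2 * b = (cmod z)\<^sup>2 / b"
      using bp by (simp add: power2_eq_square)
    with key[of "1/b"] have "a - (cmod z)\<^sup>2 / b \<ge> 0" by simp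
    then show ?thesis using bp by (simp add: z_def a_def b_def field_simps)
  qed
qed

text \<open>Cauchy-Schwarz against the unit vectors. It drives the uniqueness of square
  roots.\<close>

lemma pos_kernel_apply_0:
  assumes "finite I" "pos_kernel I X" "Re (sform I X v v) = 0" "i \<in> I"
  shows "(\<Sum>j\<in>I. X i j * v j) = 0"
proof -
  have "(cmod (sform I X (\<lambda>k. if k = i then 1 else 0) v))\<^sup>2 \<le> 0"
    using pos_kernel_cauchy_schwarz[OF assms(2), of "\<lambda>k. if k = i then 1 else 0" v] assms(3) by simp
  moreover have "sform I X (\<lambda>k. if k = i then 1 else 0) v = (\<Sum>j\<in>I. X i j * v j)"
  proof -
    have "sform I X (\<lambda>k. if k = i then 1 else 0) v = (\<Sum>k\<in>I. if k = i then \<Sum>j\<in>I. X k j * v j else 0)"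
      unfolding sform_def by (intro sum.cong refl) auto
    then show ?thesis using assms by simp
  qed
  ultimately show ?thesis by simp
qed

lemma pos_kernel_diag:
  assumes "finite I" "pos_kernel I X" "i \<in> I"
  shows "Im (X i i) = 0" "Re (X i i) \<ge> 0"
proof -
  have "Im (sform I X (\<lambda>k. if k = i then 1 else 0) (\<lambda>k. if k = i then 1 else 0)) = 0 \<and>
     0 \<le> Re (sform I X (\<lambda>k. if k = i then 1 else 0) (\<lambda>k. if k = i then 1 else 0))"
    using assms(2) unfolding pos_kernel_def by (rule spec)
  then show "Im (X i i) = 0" "Re (X i i) \<ge> 0"
    using sform_unit[OF assms(1,3,3), of X] by simp_all
qed

lemma pos_kernel_cong:
  assumes "\<And>i j. i \<in> I \<Longrightarrow> j \<in> I \<Longrightarrow> X i j = Y i j"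
  shows "pos_kernel I X \<longleftrightarrow> pos_kernel I Y"
  unfolding pos_kernel_def sform_def using assms by (simp cong: sum.cong)

lemma pos_kernel_zero: "pos_kernel I (\<lambda>i j. 0)"
  by (simp add: pos_kernel_def sform_def)

lemma pos_kernel_add:
  "pos_kernel I X \<Longrightarrow> pos_kernel I Y \<Longrightarrow> pos_kernel I (\<lambda>i j. X i j + Y i j)"
  by (simp add: pos_kernel_def sform_def algebra_simps sum.distrib)

lemma pos_kernel_sum:
  assumes "\<And>s. s \<in> S \<Longrightarrow> pos_kernel I (X s)"
  shows "pos_kernel I (\<lambda>i j. \<Sum>s\<in>S. X s i j)"
  using assms
proof (induction S rule: infinite_finite_induct)
  case (insert x F)
  then show ?case by (simp add: pos_kernel_add)
qed (simp_all add: pos_kernel_zero)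

lemma pos_kernel_scale:
  assumes "pos_kernel I X" "r \<ge> 0"
  shows "pos_kernel I (\<lambda>i j. complex_of_real r * X i j)"
proof -
  have "sform I (\<lambda>i j. complex_of_real r * X i j) v v = of_real r * sform I X v v" for v
    by (simp add: sform_def sum_distrib_left algebra_simps)
  then show ?thesis using assms by (simp add: pos_kernel_def)
qed

lemma pos_kernel_outer: "pos_kernel I (\<lambda>i j. v i * cnj (v j))"
proof -
  have "sform I (\<lambda>i j. v i * cnj (v j)) w w = of_real ((cmod (\<Sum>i\<in>I. cnj (w i) * v i))\<^sup>2)" for w
  proof -
    have "sform I (\<lambda>i j. v i * cnj (v j)) w w
       = (\<Sum>i\<in>I. cnj (w i) * v i) * (\<Sum>j\<in>I. cnj (cnj (w j) * v j))"
      by (simp add: sform_def sum_product mult_ac)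
    also have "\<dots> = of_real ((cmod (\<Sum>i\<in>I. cnj (w i) * v i))\<^sup>2)"
      by (simp only: complex_norm_square cnj_sum)
    finally show ?thesis .
  qed
  then show ?thesis by (simp add: pos_kernel_def)
qed

text \<open>The form of the pulled back kernel at v is the form of X at the push-forward of v, that
  is, at the sums of v over the fibres of f. So f may fail to be injective.\<close>

lemma pos_kernel_reindex:
  assumes "finite I" "finite K" "f ` K \<subseteq> I" "pos_kernel I X"
  shows "pos_kernel K (\<lambda>i j. X (f i) (f j))"
proof -
  have "sform K (\<lambda>i j. X (f i) (f j)) v v
      = sform I X (\<lambda>a. \<Sum>i\<in>{i\<in>K. f i = a}. v i) (\<lambda>a. \<Sum>i\<in>{i\<in>K. f i = a}. v i)" for v
  proof -
    have "sform I X (\<lambda>a. \<Sum>i\<in>{i\<in>K. f i = a}. v i) (\<lambda>a. \<Sum>i\<in>{i\<in>K. f i = a}. v i)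
       = (\<Sum>a\<in>I. \<Sum>b\<in>I. \<Sum>i\<in>{i\<in>K. f i = a}. \<Sum>j\<in>{j\<in>K. f j = b}. cnj (v i) * X a b * v j)"
      unfolding sform_def
      by (intro sum.cong refl) (simp add: sum_distrib_left sum_distrib_right mult_ac)
    also have "\<dots> = (\<Sum>a\<in>I. \<Sum>b\<in>I. \<Sum>i\<in>{i\<in>K. f i = a}. \<Sum>j\<in>{j\<in>K. f j = b}. cnj (v i) * X (f i) (f j) * v j)"
      by (intro sum.cong refl) simp
    also have "\<dots> = (\<Sum>a\<in>I. \<Sum>i\<in>{i\<in>K. f i = a}. \<Sum>b\<in>I. \<Sum>j\<in>{j\<in>K. f j = b}. cnj (v i) * X (f i) (f j) * v j)"
      by (intro sum.cong refl sum.swap)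
    also have "\<dots> = (\<Sum>a\<in>I. \<Sum>i\<in>{i\<in>K. f i = a}. \<Sum>j\<in>K. cnj (v i) * X (f i) (f j) * v j)"
      by (intro sum.cong refl sum.group) (use assms in auto)
    also have "\<dots> = (\<Sum>i\<in>K. \<Sum>j\<in>K. cnj (v i) * X (f i) (f j) * v j)"
      by (intro sum.group) (use assms in auto)
    finally show ?thesis by (simp add: sform_def)
  qed
  then show ?thesis using assms(4) by (simp add: pos_kernel_def)
qed

text \<open>Test vectors that are constant in the second coordinate. Together with Schur products of
  reindexed kernels this is how positivity of composed maps is obtained below: multiply the kernels,
  then sum out the shared system.\<close>

lemma pos_kernel_contract:
  assumes "finite S" "finite I" "pos_kernel (S \<times> I) X"
  shows "pos_kernel S (\<lambda>s t. \<Sum>i\<in>I. \<Sum>j\<in>I. X (s, i) (t, j))"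
proof -
  have "sform S (\<lambda>s t. \<Sum>i\<in>I. \<Sum>j\<in>I. X (s, i) (t, j)) v v = sform (S \<times> I) X (\<lambda>p. v (fst p)) (\<lambda>p. v (fst p))" for v
  proof -
    have "sform (S \<times> I) X (\<lambda>p. v (fst p)) (\<lambda>p. v (fst p))
       = (\<Sum>s\<in>S. \<Sum>i\<in>I. \<Sum>t\<in>S. \<Sum>j\<in>I. cnj (v s) * X (s, i) (t, j) * v t)"
      unfolding sform_def by (simp add: sum_Times assms)
    also have "\<dots> = (\<Sum>s\<in>S. \<Sum>t\<in>S. \<Sum>i\<in>I. \<Sum>j\<in>I. cnj (v s) * X (s, i) (t, j) * v t)"
      by (intro sum.cong refl sum.swap)
    also have "\<dots> = sform S (\<lambda>s t. \<Sum>i\<in>I. \<Sum>j\<in>I. X (s, i) (t, j)) v v"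
      by (simp add: sform_def sum_distrib_left sum_distrib_right mult_ac)
    finally show ?thesis by simp
  qed
  then show ?thesis using assms(3) by (simp add: pos_kernel_def)
qed

subsection \<open>Square roots of positive operators\<close>

definition idop :: "'i set \<Rightarrow> 'i op" where
  "idop I = (\<lambda>i j. if i \<in> I \<and> i = j then 1 else 0)"

definition mat_app :: "'i set \<Rightarrow> 'i op \<Rightarrow> ('i \<Rightarrow> complex) \<Rightarrow> 'i \<Rightarrow> complex" where
  "mat_app I X v = (\<lambda>i. \<Sum>j\<in>I. X i j * v j)"

primrec op_power :: "'i set \<Rightarrow> 'i op \<Rightarrow> nat \<Rightarrow> 'i op" where
  "op_power I Z 0 = idop I"
| "op_power I Z (Suc k) = op_mult I Z (op_power I Z k)"

lemma op_mult_assoc: "op_mult I (op_mult I X Y) Z = op_mult I X (op_mult I Y Z)"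
proof (intro ext)
  fix i k
  have "op_mult I (op_mult I X Y) Z i k = (\<Sum>b\<in>I. \<Sum>a\<in>I. X i a * Y a b * Z b k)"
    by (simp add: op_mult_def sum_distrib_right)
  also have "\<dots> = (\<Sum>a\<in>I. \<Sum>b\<in>I. X i a * Y a b * Z b k)"
    by (rule sum.swap)
  also have "\<dots> = op_mult I X (op_mult I Y Z) i k"
    by (simp add: op_mult_def sum_distrib_left mult.assoc)
  finally show "op_mult I (op_mult I X Y) Z i k = op_mult I X (op_mult I Y Z) i k" .
qed

lemma is_op_op_mult: "is_op I X \<Longrightarrow> is_op I Y \<Longrightarrow> is_op I (op_mult I X Y)"
  by (auto simp: is_op_def op_mult_def)

lemma is_op_idop: "is_op I (idop I)"
  by (auto simp: is_op_def idop_def)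

lemma op_mult_idop:
  assumes "finite I" "is_op I X"
  shows "op_mult I (idop I) X = X" "op_mult I X (idop I) = X"
proof -
  have "op_mult I (idop I) X i k = (\<Sum>j\<in>I. if j = i then X i k else 0)" for i k
    unfolding op_mult_def idop_def by (intro sum.cong refl) auto
  then show "op_mult I (idop I) X = X"
    using assms by (intro ext) (auto simp: is_op_def)
  have "op_mult I X (idop I) i k = (\<Sum>j\<in>I. if j = k then X i k else 0)" for i k
    unfolding op_mult_def idop_def by (intro sum.cong refl) auto
  then show "op_mult I X (idop I) = X"
    using assms by (intro ext) (auto simp: is_op_def)
qed

lemma is_op_op_power: "is_op I Z \<Longrightarrow> is_op I (op_power I Z k)"
  by (induction k) (auto simp: is_op_idop is_op_op_mult)

lemma op_power_add:
  assumes "finite I" "is_op I Z"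
  shows "op_mult I (op_power I Z k) (op_power I Z l) = op_power I Z (k + l)"
  by (induction k) (simp_all add: op_mult_idop assms is_op_op_power op_mult_assoc)

lemma mat_app_op_mult: "mat_app I (op_mult I X Y) v = mat_app I X (mat_app I Y v)"
proof (intro ext)
  fix i
  have "mat_app I (op_mult I X Y) v i = (\<Sum>k\<in>I. \<Sum>j\<in>I. X i j * Y j k * v k)"
    by (simp add: mat_app_def op_mult_def sum_distrib_right)
  also have "\<dots> = (\<Sum>j\<in>I. \<Sum>k\<in>I. X i j * Y j k * v k)" by (rule sum.swap)
  also have "\<dots> = mat_app I X (mat_app I Y v) i"
    by (simp add: mat_app_def sum_distrib_left mult.assoc)
  finally show "mat_app I (op_mult I X Y) v i = mat_app I X (mat_app I Y v) i" .
qed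

lemma sform_mat_app: "sform I X u v = (\<Sum>i\<in>I. cnj (u i) * mat_app I X v i)"
  by (simp add: sform_def mat_app_def sum_distrib_left mult.assoc)

lemma sum_cnj_self: "(\<Sum>i\<in>I. cnj (u i) * u i) = complex_of_real (\<Sum>i\<in>I. (cmod (u i))\<^sup>2)"
  by (simp only: of_real_sum complex_norm_square mult.commute)

lemma cmod_sum_cnj_le:
  "cmod (\<Sum>i\<in>I. cnj (u i) * v i) \<le> ((\<Sum>i\<in>I. (cmod (u i))\<^sup>2) + (\<Sum>i\<in>I. (cmod (v i))\<^sup>2)) / 2"
proof -
  have "cmod (\<Sum>i\<in>I. cnj (u i) * v i) \<le> (\<Sum>i\<in>I. cmod (u i) * cmod (v i))"
    by (rule order_trans[OF norm_sum]) (simp add: norm_mult)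
  also have "\<dots> \<le> (\<Sum>i\<in>I. ((cmod (u i))\<^sup>2 + (cmod (v i))\<^sup>2) / 2)"
  proof (rule sum_mono)
    fix i
    show "cmod (u i) * cmod (v i) \<le> ((cmod (u i))\<^sup>2 + (cmod (v i))\<^sup>2) / 2"
      using sum_squares_bound[of "cmod (u i)" "cmod (v i)"] by simp
  qed
  finally show ?thesis by (simp add: sum.distrib sum_divide_distrib add_divide_distrib)
qed

text \<open>With w = A v and q the form at v, the squared norm of v - w / t is that of v, minus 2 q
  / t, plus that of w over t squared; the last term is at most q / t because the squared norm of w
  is at most t q.\<close>

lemma contraction_of_pos:
  assumes fin: "finite I" and A: "pos_kernel I A"
    and t: "t > 0" "\<And>v. Re (sform I A v v) \<le> t * (\<Sum>i\<in>I. (cmod (v i))\<^sup>2)"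
  shows "(\<Sum>i\<in>I. (cmod (mat_app I (\<lambda>i j. idop I i j - A i j / of_real t) v i))\<^sup>2) \<le> (\<Sum>i\<in>I. (cmod (v i))\<^sup>2)"
proof -
  define w where "w = mat_app I A v"
  define q where "q = Re (sform I A v v)"
  define W where "W = (\<Sum>i\<in>I. (cmod (w i))\<^sup>2)"
  have q: "sform I A v v = of_real q" and q0: "q \<ge> 0"
    using A by (auto simp: pos_kernel_def q_def complex_eq_iff)
  have W0: "W \<ge> 0" by (simp add: W_def sum_nonneg)
  have wv: "sform I A w v = of_real W"
    by (simp add: sform_mat_app w_def[symmetric] sum_cnj_self W_def)
  \<comment> \<open>Cauchy-Schwarz for the pair (A v, v), followed by the upper bound on A at A v
    itself; cancelling W leaves W \<le> t q.\<close>
  have "W\<^sup>2 \<le> Re (sform I A w w) * q"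
    using pos_kernel_cauchy_schwarz[OF A, of w v] wv W0 by (simp add: q_def)
  also have "\<dots> \<le> t * W * q"
    using t(2)[of w] q0 by (intro mult_right_mono) (simp_all add: W_def)
  finally have "W * W \<le> W * (t * q)" by (simp add: power2_eq_square mult_ac)
  then have Wq: "W \<le> t * q"
    using W0 t(1) q0 by (cases "W = 0") (auto simp: mult_le_cancel_left)
  have app: "mat_app I (\<lambda>i j. idop I i j - A i j / of_real t) v i = v i - w i / of_real t" if "i \<in> I" for i
  proof -
    have "(\<Sum>j\<in>I. idop I i j * v j) = (\<Sum>j\<in>I. if j = i then v i else 0)"
      by (intro sum.cong refl) (auto simp: idop_def that)
    then show ?thesis
      using that fin
      by (simp add: mat_app_def w_def left_diff_distrib sum_subtractf sum_divide_distrib)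
  qed
  have vw: "(\<Sum>i\<in>I. cnj (v i) * w i) = of_real q"
    using q by (simp add: sform_mat_app w_def)
  have "(\<Sum>i\<in>I. (cmod (v i - w i / of_real t))\<^sup>2)
     = (\<Sum>i\<in>I. (cmod (v i))\<^sup>2 - 2 / t * Re (cnj (v i) * w i) + (cmod (w i))\<^sup>2 / t\<^sup>2)"
  proof (intro sum.cong refl)
    fix i
    show "(cmod (v i - w i / of_real t))\<^sup>2 = (cmod (v i))\<^sup>2 - 2 / t * Re (cnj (v i) * w i) + (cmod (w i))\<^sup>2 / t\<^sup>2"
      using t(1) unfolding cmod_power2
      by (simp add: power2_eq_square field_simps)
  qed
  also have "\<dots> = (\<Sum>i\<in>I. (cmod (v i))\<^sup>2) - 2 / t * Re (\<Sum>i\<in>I. cnj (v i) * w i) + W / t\<^sup>2"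
    by (simp only: sum.distrib sum_subtractf sum_distrib_left sum_divide_distrib W_def Re_sum)
  also have "\<dots> = (\<Sum>i\<in>I. (cmod (v i))\<^sup>2) - 2 / t * q + W / t\<^sup>2"
    by (simp add: vw)
  also have "\<dots> \<le> (\<Sum>i\<in>I. (cmod (v i))\<^sup>2) - 2 / t * q + t * q / t\<^sup>2"
    using Wq by (intro add_left_mono divide_right_mono) auto
  also have "\<dots> \<le> (\<Sum>i\<in>I. (cmod (v i))\<^sup>2)"
    using t(1) q0 by (simp add: power2_eq_square)
  finally show ?thesis using app by (simp cong: sum.cong)
qed

lemma op_power_contraction:
  assumes fin: "finite I"
    and Z: "\<And>v. (\<Sum>i\<in>I. (cmod (mat_app I Z v i))\<^sup>2) \<le> (\<Sum>i\<in>I. (cmod (v i))\<^sup>2)"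
  shows "(\<Sum>i\<in>I. (cmod (mat_app I (op_power I Z k) v i))\<^sup>2) \<le> (\<Sum>i\<in>I. (cmod (v i))\<^sup>2)"
proof (induction k)
  case 0
  have "mat_app I (idop I) v i = v i" if "i \<in> I" for i
  proof -
    have "mat_app I (idop I) v i = (\<Sum>j\<in>I. if j = i then v i else 0)"
      unfolding mat_app_def by (intro sum.cong refl) (auto simp: idop_def that)
    then show ?thesis using that fin by simp
  qed
  then show ?case by simp
next
  case (Suc k)
  show ?case using order_trans[OF Z Suc.IH] by (simp add: mat_app_op_mult)
qed

lemma op_power_entry_le:
  assumes fin: "finite I" and op: "is_op I Z"
    and Z: "\<And>v. (\<Sum>i\<in>I. (cmod (mat_app I Z v i))\<^sup>2) \<le> (\<Sum>i\<in>I. (cmod (v i))\<^sup>2)"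
  shows "cmod (op_power I Z k i j) \<le> 1"
proof (cases "i \<in> I \<and> j \<in> I")
  case True
  define e :: "'a \<Rightarrow> complex" where "e = (\<lambda>l. if l = j then 1 else 0)"
  have "mat_app I (op_power I Z k) e i = (\<Sum>l\<in>I. if l = j then op_power I Z k i j else 0)"
    unfolding mat_app_def e_def by (intro sum.cong refl) auto
  then have 1: "mat_app I (op_power I Z k) e i = op_power I Z k i j"
    using True fin by simp
  have "(cmod (op_power I Z k i j))\<^sup>2 \<le> (\<Sum>i\<in>I. (cmod (mat_app I (op_power I Z k) e i))\<^sup>2)"
    unfolding 1[symmetric] using True fin by (intro member_le_sum) auto
  also have "\<dots> \<le> (\<Sum>i\<in>I. (cmod (e i))\<^sup>2)" by (rule op_power_contraction[OF fin Z])
  also have "\<dots> = (\<Sum>i\<in>I. if i = j then 1 else 0)" by (intro sum.cong) (auto simp: e_def)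
  also have "\<dots> = 1" using True fin by simp
  finally show ?thesis using power2_le_imp_le[of "cmod (op_power I Z k i j)" 1] by simp
next
  case False
  then show ?thesis using is_op_op_power[OF op, of k] by (auto simp: is_op_def)
qed

lemma op_power_cnj:
  assumes fin: "finite I" and op: "is_op I Z" and h: "\<And>i j. Z j i = cnj (Z i j)"
  shows "op_power I Z k j i = cnj (op_power I Z k i j)"
proof (induction k arbitrary: i j)
  case 0
  show ?case by (auto simp: idop_def)
next
  case (Suc k)
  have "op_power I Z (Suc k) = op_mult I (op_power I Z k) Z"
    using op_power_add[OF fin op, of k 1] op by (simp add: op_mult_idop fin)
  then have "op_power I Z (Suc k) j i = (\<Sum>l\<in>I. op_power I Z k j l * Z l i)"
    by (simp add: op_mult_def)
  also have "\<dots> = (\<Sum>l\<in>I. cnj (op_power I Z k l j) * cnj (Z i l))"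
    using Suc.IH h by metis
  also have "\<dots> = cnj (op_power I Z (Suc k) i j)"
    by (simp add: op_mult_def mult.commute)
  finally show ?case .
qed

text \<open>The Taylor coefficients of \<open>sqrt (1 - z)\<close>.\<close>
definition sqrt_coeff :: "nat \<Rightarrow> real" where
  "sqrt_coeff k = (1/2 gchoose k) * (-1) ^ k"

lemma sqrt_coeff_0: "sqrt_coeff 0 = 1"
  by (simp add: sqrt_coeff_def)

lemma gbinomial_Suc_quotient: "((a::real) gchoose Suc k) = (a gchoose k) * ((a - real k) / real (Suc k))"
  unfolding gbinomial_prod_rev prod.lessThan_Suc fact_Suc lessThan_atLeast0[symmetric]
  by (simp add: field_simps)

lemma sqrt_coeff_Suc_le: "sqrt_coeff (Suc k) \<le> 0"
proof (induction k)
  case 0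
  show ?case by (simp add: sqrt_coeff_def)
next
  case (Suc k)
  have q: "(real (Suc k) - 1/2) / real (Suc (Suc k)) = - ((1/2 - real (Suc k)) / real (Suc (Suc k)))"
    by (metis minus_diff_eq minus_divide_left)
  have "sqrt_coeff (Suc (Suc k)) = sqrt_coeff (Suc k) * ((real (Suc k) - 1/2) / real (Suc (Suc k)))"
    unfolding sqrt_coeff_def gbinomial_Suc_quotient[of _ "Suc k"] power_Suc[of _ "Suc k"]
      q by (simp only: mult_minus_left mult_minus_right mult_1 mult_ac)
  moreover have "(real (Suc k) - 1/2) / real (Suc (Suc k)) \<ge> 0" by simp
  ultimately show ?case using Suc by (simp only: mult_nonpos_nonneg)
qed

text \<open>For 0 < x < 1 the whole series is 1 - sqrt (1 - x), which is at most 1 and has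
  non-negative terms. A partial sum is a polynomial in x, so the bound survives x \<rightarrow>
  1.\<close>

lemma sqrt_coeff_sum_le: "(\<Sum>k<n. - sqrt_coeff (Suc k)) \<le> 1"
proof -
  have le: "(\<Sum>k<n. - sqrt_coeff (Suc k) * x ^ Suc k) \<le> 1" if x: "0 < x" "x < 1" for x :: real
  proof -
    have "(\<lambda>k. (1/2 gchoose k) * (-x) ^ k) sums (1 + (-x)) powr (1/2)"
      by (rule gen_binomial_real) (use x in auto)
    then have s: "(\<lambda>k. sqrt_coeff k * x ^ k) sums ((1 - x) powr (1/2))"
      by (simp add: sqrt_coeff_def power_minus[of x] mult.assoc)
    have "(\<lambda>k. sqrt_coeff (Suc k) * x ^ Suc k) sums ((1 - x) powr (1/2) - 1)"
      using sums_split_initial_segment[OF s, of 1] by (simp add: sqrt_coeff_0)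
    then have "(\<lambda>k. - (sqrt_coeff (Suc k) * x ^ Suc k)) sums (- ((1 - x) powr (1/2) - 1))"
      by (rule sums_minus)
    then have s': "(\<lambda>k. - sqrt_coeff (Suc k) * x ^ Suc k) sums (1 - (1 - x) powr (1/2))"
      by simp
    have "(\<Sum>k<n. - sqrt_coeff (Suc k) * x ^ Suc k) \<le> (\<Sum>k. - sqrt_coeff (Suc k) * x ^ Suc k)"
      using s' sqrt_coeff_Suc_le x
      by (intro sum_le_suminf) (auto simp: sums_iff mult_nonpos_nonneg)
    also have "\<dots> = 1 - (1 - x) powr (1/2)" using s' by (simp add: sums_iff)
    finally show ?thesis using powr_ge_zero[of "1 - x" "1/2"] by linarith
  qed
  have "((\<lambda>x. \<Sum>k<n. - sqrt_coeff (Suc k) * x ^ Suc k) \<longlongrightarrow> (\<Sum>k<n. - sqrt_coeff (Suc k) * 1 ^ Suc k)) (at_left 1)"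
    by (intro tendsto_intros)
  moreover have "\<forall>\<^sub>F x in at_left (1::real). (\<Sum>k<n. - sqrt_coeff (Suc k) * x ^ Suc k) \<le> 1"
    using le eventually_at_left_real[of 0 1] by (auto elim!: eventually_mono)
  ultimately have "(\<Sum>k<n. - sqrt_coeff (Suc k) * 1 ^ Suc k) \<le> 1"
    by (intro tendsto_upperbound[of _ _ "at_left (1::real)"]) auto
  then show ?thesis by simp
qed

lemma summable_sqrt_coeff: "summable (\<lambda>k. \<bar>sqrt_coeff k\<bar>)"
proof -
  have "summable (\<lambda>k. \<bar>sqrt_coeff (Suc k)\<bar>)"
  proof (rule summableI_nonneg_bounded[where x = 1])
    fix n
    show "(\<Sum>k<n. \<bar>sqrt_coeff (Suc k)\<bar>) \<le> 1"
      using sqrt_coeff_sum_le[of n] sqrt_coeff_Suc_le by simp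
  qed simp
  then show ?thesis using summable_Suc_iff by blast
qed

text \<open>The square of the series is 1 - z, coefficient by coefficient: Vandermonde with 1/2 +
  1/2 = 1.\<close>

lemma sqrt_coeff_convolution:
  "(\<Sum>k\<le>n. sqrt_coeff k * sqrt_coeff (n - k)) = (if n = 0 then 1 else if n = 1 then -1 else 0)"
proof -
  have "(\<Sum>k\<le>n. sqrt_coeff k * sqrt_coeff (n - k))
      = (-1) ^ n * (\<Sum>k\<le>n. (1/2 gchoose k) * (1/2 gchoose (n - k)))"
    unfolding sum_distrib_left
  proof (intro sum.cong refl)
    fix k assume "k \<in> {..n}"
    then have "(-1::real) ^ n = (-1) ^ k * (-1) ^ (n - k)"
      by (simp add: power_add[symmetric])
    then show "sqrt_coeff k * sqrt_coeff (n - k) = (-1) ^ n * ((1/2 gchoose k) * (1/2 gchoose (n - k)))"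
      by (simp add: sqrt_coeff_def)
  qed
  also have "\<dots> = (-1) ^ n * ((1::real) gchoose n)"
    using gbinomial_Vandermonde[of "1/2::real" "1/2" n] by (simp add: atLeast0AtMost)
  also have "(1::real) gchoose n = of_nat (1 choose n)"
    using binomial_gbinomial[of 1 n, where ?'a = real] by simp
  also have "(-1) ^ n * real (1 choose n) = (if n = 0 then 1 else if n = 1 then -1 else 0)"
  proof -
    consider "n = 0" | "n = 1" | "n > 1" by linarith
    then show ?thesis by cases (auto simp: binomial_eq_0)
  qed
  finally show ?thesis .
qed

text \<open>Instead of diagonalising A, insert the contraction Z = 1 - A / t into the series of sqrt
  (1 - z) and multiply by sqrt t. Summability of the coefficients and boundedness of the entries of
  the powers of Z make every entry converge absolutely.\<close>

lemma psd_sqrt_exists: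
  assumes fin: "finite I" and A: "psd I A"
  shows "\<exists>B. psd I B \<and> op_mult I B B = A"
proof -
  have opA: "is_op I A" and pA: "pos_kernel I A" using A by (auto simp: psd_iff)
  \<comment> \<open>The sum of all absolute entries dominates the operator norm; the extra 1 keeps t
    positive when A vanishes.\<close>
  define S where "S = (\<Sum>i\<in>I. \<Sum>j\<in>I. cmod (A i j))"
  define t where "t = 1 + S"
  have S0: "S \<ge> 0" by (simp add: S_def sum_nonneg)
  have t0: "t > 0" using S0 by (simp add: t_def)
  have tb: "Re (sform I A v v) \<le> t * (\<Sum>i\<in>I. (cmod (v i))\<^sup>2)" for v
  proof -
    have vi: "(cmod (v i))\<^sup>2 \<le> (\<Sum>i\<in>I. (cmod (v i))\<^sup>2)" if "i \<in> I" for i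
      using that fin by (intro member_le_sum) auto
    have "Re (sform I A v v) \<le> cmod (sform I A v v)" by (rule complex_Re_le_cmod)
    also have "\<dots> \<le> (\<Sum>i\<in>I. \<Sum>j\<in>I. cmod (v i) * cmod (A i j) * cmod (v j))"
      unfolding sform_def
      by (intro order_trans[OF norm_sum] sum_mono) (simp add: norm_mult)
    also have "\<dots> \<le> (\<Sum>i\<in>I. \<Sum>j\<in>I. cmod (A i j) * (\<Sum>i\<in>I. (cmod (v i))\<^sup>2))"
    proof (intro sum_mono)
      fix i j assume ij: "i \<in> I" "j \<in> I"
      have "2 * (cmod (v i) * cmod (v j)) \<le> (cmod (v i))\<^sup>2 + (cmod (v j))\<^sup>2"
        using sum_squares_bound[of "cmod (v i)" "cmod (v j)"] by simp
      then have "cmod (v i) * cmod (v j) \<le> (\<Sum>i\<in>I. (cmod (v i))\<^sup>2)"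
        using vi[OF ij(1)] vi[OF ij(2)] by linarith
      then show "cmod (v i) * cmod (A i j) * cmod (v j) \<le> cmod (A i j) * (\<Sum>i\<in>I. (cmod (v i))\<^sup>2)"
        using mult_left_mono[of "cmod (v i) * cmod (v j)" "\<Sum>i\<in>I. (cmod (v i))\<^sup>2" "cmod (A i j)"]
        by (simp add: mult_ac)
    qed
    also have "\<dots> = S * (\<Sum>i\<in>I. (cmod (v i))\<^sup>2)"
      by (simp add: S_def sum_distrib_right)
    also have "\<dots> \<le> t * (\<Sum>i\<in>I. (cmod (v i))\<^sup>2)"
      by (intro mult_right_mono) (auto simp: t_def sum_nonneg)
    finally show ?thesis .
  qed
  define Z where "Z = (\<lambda>i j. idop I i j - A i j / of_real t)"
  have opZ: "is_op I Z" using opA by (auto simp: Z_def is_op_def idop_def)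
  have cA: "A j i = cnj (A i j)" for i j
    by (rule psd_cnj[OF fin A])
  have hZ: "Z j i = cnj (Z i j)" for i j
    using cA[of i j] by (auto simp: Z_def idop_def)
  have Zc: "(\<Sum>i\<in>I. (cmod (mat_app I Z v i))\<^sup>2) \<le> (\<Sum>i\<in>I. (cmod (v i))\<^sup>2)" for v
    unfolding Z_def by (rule contraction_of_pos[OF fin pA t0 tb])
  define P where "P = op_power I Z"
  define C where "C = (\<lambda>i j. \<Sum>k. of_real (sqrt_coeff k) * P k i j)"
  have Ple: "cmod (P k i j) \<le> 1" for k i j
    unfolding P_def by (rule op_power_entry_le[OF fin opZ Zc])
  have sn: "summable (\<lambda>k. cmod (of_real (sqrt_coeff k) * P k i j))" for i j
  proof (rule summable_comparison_test'[OF summable_sqrt_coeff])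
    fix k :: nat
    show "norm (cmod (of_real (sqrt_coeff k) * P k i j)) \<le> \<bar>sqrt_coeff k\<bar>"
      using mult_left_mono[OF Ple, of "\<bar>sqrt_coeff k\<bar>" k i j] by (simp add: norm_mult)
  qed
  have sC: "(\<lambda>k. of_real (sqrt_coeff k) * P k i j) sums C i j" for i j
    unfolding C_def using summable_norm_cancel[OF sn] by (simp add: summable_sums)
  have opC: "is_op I C"
    using is_op_op_power[OF opZ] by (auto simp: is_op_def C_def P_def)
  have CC: "op_mult I C C = (\<lambda>i j. A i j / of_real t)"
  proof (intro ext)
    fix i j
    have "(\<lambda>n. \<Sum>l\<in>I. \<Sum>k\<le>n. (of_real (sqrt_coeff k) * P k i l) * (of_real (sqrt_coeff (n - k)) * P (n - k) l j))
        sums (\<Sum>l\<in>I. C i l * C l j)"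
      unfolding C_def by (intro sums_sum Cauchy_product_sums sn)
    also have "(\<lambda>n. \<Sum>l\<in>I. \<Sum>k\<le>n. (of_real (sqrt_coeff k) * P k i l) * (of_real (sqrt_coeff (n - k)) * P (n - k) l j))
        = (\<lambda>n. of_real (if n = 0 then 1 else if n = 1 then -1 else 0) * P n i j)"
    proof
      fix n
      have "(\<Sum>l\<in>I. \<Sum>k\<le>n. (of_real (sqrt_coeff k) * P k i l) * (of_real (sqrt_coeff (n - k)) * P (n - k) l j))
         = (\<Sum>k\<le>n. \<Sum>l\<in>I. (of_real (sqrt_coeff k) * P k i l) * (of_real (sqrt_coeff (n - k)) * P (n - k) l j))"
        by (rule sum.swap)
      also have "\<dots> = (\<Sum>k\<le>n. of_real (sqrt_coeff k * sqrt_coeff (n - k)) * op_mult I (P k) (P (n - k)) i j)"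
        by (simp add: op_mult_def sum_distrib_left mult_ac)
      also have "\<dots> = (\<Sum>k\<le>n. of_real (sqrt_coeff k * sqrt_coeff (n - k)) * P n i j)"
        by (intro sum.cong refl) (simp add: P_def op_power_add[OF fin opZ])
      also have "\<dots> = of_real (\<Sum>k\<le>n. sqrt_coeff k * sqrt_coeff (n - k)) * P n i j"
        by (simp add: sum_distrib_right)
      finally show "(\<Sum>l\<in>I. \<Sum>k\<le>n. (of_real (sqrt_coeff k) * P k i l) * (of_real (sqrt_coeff (n - k)) * P (n - k) l j))
         = of_real (if n = 0 then 1 else if n = 1 then -1 else 0) * P n i j"
        by (simp only: sqrt_coeff_convolution)
    qed
    finally have 1: "(\<lambda>n. of_real (if n = 0 then 1 else if n = 1 then -1 else 0) * P n i j) sums (\<Sum>l\<in>I. C i l * C l j)" .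
    have "(\<lambda>n. of_real (if n = 0 then 1 else if n = 1 then -1 else 0) * P n i j)
        sums (\<Sum>n\<in>{0, 1}. of_real (if n = 0 then 1 else if n = 1 then -1 else 0) * P n i j)"
      by (rule sums_finite) auto
    then have "(\<Sum>l\<in>I. C i l * C l j) = P 0 i j - P 1 i j"
      using sums_unique2[OF 1] by simp
    also have "\<dots> = A i j / of_real t"
      using opZ by (simp add: P_def op_mult_idop fin Z_def)
    finally show "op_mult I C C i j = A i j / of_real t" by (simp add: op_mult_def)
  qed
  \<comment> \<open>The constant term contributes the squared norm of v. All later coefficients are
    non-positive with total mass at most 1 and meet forms bounded by that norm, so they cannot
    outweigh it.\<close>
  have pC: "pos_kernel I C"
    unfolding pos_kernel_def
  proof
    fix v
    define nv where "nv = (\<Sum>i\<in>I. (cmod (v i))\<^sup>2)"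
    have "(\<lambda>k. \<Sum>i\<in>I. \<Sum>j\<in>I. cnj (v i) * (of_real (sqrt_coeff k) * P k i j) * v j) sums sform I C v v"
      unfolding sform_def by (intro sums_sum sums_mult sums_mult2 sC)
    then have s: "(\<lambda>k. of_real (sqrt_coeff k) * sform I (P k) v v) sums sform I C v v"
      by (simp add: sform_def sum_distrib_left mult_ac)
    have re: "Im (sform I (P k) v v) = 0" for k
    proof -
      have "sform I (P k) v v = (\<Sum>i\<in>I. \<Sum>j\<in>I. cnj (cnj (v j) * P k j i * v i))"
        unfolding sform_def P_def
        by (intro sum.cong refl) (subst op_power_cnj[OF fin opZ hZ], simp)
      also have "\<dots> = cnj (sform I (P k) v v)"
        unfolding sform_def by (subst sum.swap) simp
      finally show ?thesis by (simp add: complex_eq_iff)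
    qed
    have le: "cmod (sform I (P k) v v) \<le> nv" for k
    proof -
      have "cmod (sform I (P k) v v) \<le> (nv + (\<Sum>i\<in>I. (cmod (mat_app I (P k) v i))\<^sup>2)) / 2"
        unfolding sform_mat_app nv_def by (rule cmod_sum_cnj_le)
      also have "\<dots> \<le> (nv + nv) / 2"
        using op_power_contraction[OF fin Zc, of k v] by (simp add: nv_def P_def)
      finally show ?thesis by simp
    qed
    have P0: "sform I (P 0) v v = of_real nv"
    proof -
      have "mat_app I (P 0) v i = v i" if "i \<in> I" for i
      proof -
        have "mat_app I (P 0) v i = (\<Sum>j\<in>I. if j = i then v i else 0)"
          unfolding mat_app_def P_def by (intro sum.cong refl) (auto simp: idop_def that)
        then show ?thesis using that fin by simp
      qed
      then show ?thesis by (simp add: sform_mat_app nv_def sum_cnj_self del: of_real_sum)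
    qed
    have "(\<lambda>k. Im (of_real (sqrt_coeff k) * sform I (P k) v v)) sums Im (sform I C v v)"
      by (rule sums_Im[OF s])
    then have "(\<lambda>k. 0) sums Im (sform I C v v)" by (simp add: re)
    then have im: "Im (sform I C v v) = 0" using sums_unique2 sums_zero by blast
    have "(\<lambda>k. Re (of_real (sqrt_coeff k) * sform I (P k) v v)) sums Re (sform I C v v)"
      by (rule sums_Re[OF s])
    then have r: "(\<lambda>k. sqrt_coeff k * Re (sform I (P k) v v)) sums Re (sform I C v v)" by simp
    have "Re (sform I C v v) \<ge> 0"
    proof (rule tendsto_lowerbound[OF r[unfolded sums_def]])
      show "\<forall>\<^sub>F n in sequentially. 0 \<le> (\<Sum>k<n. sqrt_coeff k * Re (sform I (P k) v v))"
      proof (rule eventually_sequentiallyI[of 1])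
        fix n :: nat assume "1 \<le> n"
        then obtain m where n: "n = Suc m" by (cases n) auto
        have "(\<Sum>k<m. - sqrt_coeff (Suc k) * Re (sform I (P (Suc k)) v v)) \<le> (\<Sum>k<m. - sqrt_coeff (Suc k) * nv)"
          using sqrt_coeff_Suc_le order_trans[OF complex_Re_le_cmod le]
          by (intro sum_mono mult_left_mono) auto
        also have "\<dots> = (\<Sum>k<m. - sqrt_coeff (Suc k)) * nv" by (simp only: sum_distrib_right)
        also have "\<dots> \<le> 1 * nv"
          by (intro mult_right_mono sqrt_coeff_sum_le) (simp add: nv_def sum_nonneg)
        finally have "nv + (\<Sum>k<m. sqrt_coeff (Suc k) * Re (sform I (P (Suc k)) v v)) \<ge> 0"
          by (simp add: sum_negf)
        then show "0 \<le> (\<Sum>k<n. sqrt_coeff k * Re (sform I (P k) v v))"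
          unfolding n sum.lessThan_Suc_shift by (simp add: sqrt_coeff_0 P0)
      qed
    qed simp
    with im show "Im (sform I C v v) = 0 \<and> 0 \<le> Re (sform I C v v)" by simp
  qed
  define B where "B = (\<lambda>i j. complex_of_real (sqrt t) * C i j)"
  have "pos_kernel I B" unfolding B_def by (rule pos_kernel_scale[OF pC]) (use t0 in simp)
  moreover have "is_op I B" using opC by (auto simp: B_def is_op_def)
  moreover have "op_mult I B B = A"
  proof (intro ext)
    fix i j
    have "op_mult I B B i j = complex_of_real (sqrt t * sqrt t) * op_mult I C C i j"
      unfolding B_def op_mult_def sum_distrib_left of_real_mult by (intro sum.cong refl) (simp only: mult_ac)
    also have "\<dots> = A i j" using t0 by (simp add: CC)
    finally show "op_mult I B B i j = A i j" .
  qed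
  ultimately show ?thesis by (auto simp: psd_iff)
qed

text \<open>For D = B - C, equality of the squares gives D B + C D = 0. Hence the traces of D B D
  and D C D add up to zero; both are non-negative, so B and C annihilate the columns of D. Then D D
  = 0, and D is Hermitian.\<close>

lemma psd_sqrt_unique:
  assumes fin: "finite I" and B: "psd I B" and C: "psd I C" and eq: "op_mult I B B = op_mult I C C"
  shows "B = C"
proof -
  have opB: "is_op I B" and pB: "pos_kernel I B" and opC: "is_op I C" and pC: "pos_kernel I C"
    using B C by (auto simp: psd_iff)
  define D where "D = (\<lambda>i j. B i j - C i j)"
  have hD: "D j i = cnj (D i j)" for i j
    unfolding D_def complex_cnj_diff psd_cnj[OF fin B, of j i] psd_cnj[OF fin C, of j i] ..
  have cyc: "op_trace I (op_mult I X Y) = op_trace I (op_mult I Y X)" for X Y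
    unfolding op_trace_def op_mult_def by (subst sum.swap) (simp add: mult.commute)
  let ?S = "\<lambda>X. \<Sum>c\<in>I. sform I X (\<lambda>i. D i c) (\<lambda>i. D i c)"
  have S: "?S X = op_trace I (op_mult I D (op_mult I X D))" for X
    unfolding sform_def op_trace_def op_mult_def
    by (intro sum.cong refl) (subst hD, simp add: sum_distrib_left mult.assoc)
  have e: "op_mult I D B i k + op_mult I C D i k = 0" for i k
    using fun_cong[OF fun_cong[OF eq, of i], of k]
    by (simp add: D_def op_mult_def algebra_simps sum_subtractf sum.distrib)
  have "?S B + ?S C = op_trace I (op_mult I (op_mult I D B) D) + op_trace I (op_mult I (op_mult I C D) D)"
    unfolding S op_mult_assoc[symmetric] by (subst (2) cyc) (simp add: op_mult_assoc)
  also have "\<dots> = (\<Sum>i\<in>I. \<Sum>k\<in>I. (op_mult I D B i k + op_mult I C D i k) * D k i)"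
    by (simp add: op_trace_def op_mult_def[of I _ D] sum.distrib distrib_right)
  also have "\<dots> = 0" by (simp add: e)
  finally have sum0: "Re (?S B) + Re (?S C) = 0"
    by (metis plus_complex.sel(1) zero_complex.sel(1))
  have nnB: "Re (sform I B (\<lambda>i. D i c) (\<lambda>i. D i c)) \<ge> 0" for c
    using pB by (simp add: pos_kernel_def)
  have nnC: "Re (sform I C (\<lambda>i. D i c) (\<lambda>i. D i c)) \<ge> 0" for c
    using pC by (simp add: pos_kernel_def)
  have "Re (?S B) \<ge> 0" "Re (?S C) \<ge> 0"
    by (auto intro!: sum_nonneg simp: nnB nnC)
  with sum0 have "Re (?S B) = 0" "Re (?S C) = 0" by linarith+
  then have zB: "Re (sform I B (\<lambda>i. D i c) (\<lambda>i. D i c)) = 0" and zC: "Re (sform I C (\<lambda>i. D i c) (\<lambda>i. D i c)) = 0"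
    if "c \<in> I" for c
    using that fin by (simp_all add: sum_nonneg_eq_0_iff nnB nnC)
  have D0: "D i c = 0" if ic: "i \<in> I" "c \<in> I" for i c
  proof -
    have "(\<Sum>j\<in>I. D c j * D j c) = (\<Sum>j\<in>I. B c j * D j c) - (\<Sum>j\<in>I. C c j * D j c)"
      by (simp add: D_def left_diff_distrib sum_subtractf)
    also have "\<dots> = 0"
      using pos_kernel_apply_0[OF fin pB zB, of c c] pos_kernel_apply_0[OF fin pC zC, of c c] ic by simp
    finally have "(\<Sum>j\<in>I. D c j * D j c) = 0" .
    moreover have "(\<Sum>j\<in>I. D c j * D j c) = (\<Sum>j\<in>I. cnj (D j c) * D j c)"
      by (intro sum.cong refl) (subst hD, simp)
    ultimately have "complex_of_real (\<Sum>j\<in>I. (cmod (D j c))\<^sup>2) = 0"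
      by (simp only: sum_cnj_self)
    then have "(\<Sum>j\<in>I. (cmod (D j c))\<^sup>2) = 0" by (simp only: of_real_eq_0_iff)
    then show ?thesis using fin ic by (simp add: sum_nonneg_eq_0_iff)
  qed
  show ?thesis
  proof (intro ext)
    fix i j
    show "B i j = C i j"
      using D0[of i j] opB opC by (cases "i \<in> I \<and> j \<in> I") (auto simp: D_def is_op_def)
  qed
qed

section \<open>Rank-one decompositions, Schur products and the fidelity with a pure state\<close>

lemma op_sqrt_eqI:
  assumes "finite I" "psd I B" "op_mult I B B = A"
  shows "op_sqrt I A = B"
  unfolding op_sqrt_def using assms psd_sqrt_unique[OF assms(1)] by (intro the_equality) auto

lemma op_sqrt_psd:
  assumes "finite I" "psd I A"
  shows "psd I (op_sqrt I A)" "op_mult I (op_sqrt I A) (op_sqrt I A) = A"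
  using psd_sqrt_exists[OF assms] op_sqrt_eqI[OF assms(1)] by metis+

lemma psd_op_mult_self_eq:
  assumes "finite I" "psd I B"
  shows "op_mult I B B i j = (\<Sum>r\<in>I. B i r * cnj (B j r))"
proof -
  show ?thesis
    unfolding op_mult_def by (intro sum.cong refl arg_cong2[of _ _ _ _ times] psd_cnj[OF assms])
qed

text \<open>The columns of the square root take the place of scaled eigenvectors.\<close>

lemma pos_kernel_decomp:
  assumes fin: "finite I" and X: "pos_kernel I X"
  obtains V where "\<And>i j. i \<in> I \<Longrightarrow> j \<in> I \<Longrightarrow> X i j = (\<Sum>r\<in>I. V r i * cnj (V r j))"
proof -
  define Y where "Y = (\<lambda>i j. if i \<in> I \<and> j \<in> I then X i j else 0)"
  have "psd I Y"
    using X pos_kernel_cong[of I X Y] by (auto simp: psd_iff Y_def is_op_def)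
  then obtain B where B: "psd I B" "op_mult I B B = Y"
    using psd_sqrt_exists[OF fin] by blast
  have "X i j = (\<Sum>r\<in>I. B i r * cnj (B j r))" if "i \<in> I" "j \<in> I" for i j
    using psd_op_mult_self_eq[OF fin B(1), of i j] B(2) that by (simp add: Y_def)
  then show ?thesis by (rule that[of "\<lambda>r i. B i r"])
qed

text \<open>The Schur product theorem: a rank-one kernel acts on Y by multiplying the test vector
  entrywise, and X is a sum of such kernels.\<close>

lemma pos_kernel_mult:
  assumes fin: "finite I" and X: "pos_kernel I X" and Y: "pos_kernel I Y"
  shows "pos_kernel I (\<lambda>i j. X i j * Y i j)"
proof -
  obtain V where V: "\<And>i j. i \<in> I \<Longrightarrow> j \<in> I \<Longrightarrow> X i j = (\<Sum>r\<in>I. V r i * cnj (V r j))"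
    using pos_kernel_decomp[OF fin X] by metis
  have "pos_kernel I (\<lambda>i j. V r i * cnj (V r j) * Y i j)" for r
  proof -
    have "sform I (\<lambda>i j. V r i * cnj (V r j) * Y i j) v v
       = sform I Y (\<lambda>i. cnj (V r i) * v i) (\<lambda>i. cnj (V r i) * v i)" for v
      by (simp add: sform_def mult_ac)
    then show ?thesis using Y by (simp add: pos_kernel_def)
  qed
  then have "pos_kernel I (\<lambda>i j. \<Sum>r\<in>I. V r i * cnj (V r j) * Y i j)"
    by (rule pos_kernel_sum)
  then show ?thesis
    by (rule iffD1[OF pos_kernel_cong, rotated]) (simp add: V sum_distrib_right)
qed

lemma pos_kernel_prod:
  assumes "finite I" "\<And>k. k \<in> S \<Longrightarrow> pos_kernel I (X k)"
  shows "pos_kernel I (\<lambda>i j. \<Prod>k\<in>S. X k i j)"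
  using assms(2)
proof (induction S rule: infinite_finite_induct)
  case (insert x F)
  then show ?case by (simp add: pos_kernel_mult assms(1))
qed (use pos_kernel_outer[of I "\<lambda>_. 1"] in simp_all)

text \<open>Let S be the square root of Y and w = S \<phi>. The projector is its own root, and its
  product with S is the rank-one operator from w to \<phi>. Its modulus is the rank-one operator of
  w divided by the norm of w, so the trace norm is the norm of w, whose square is the form of Y at
  \<phi>.\<close>

lemma fidelity_pure:
  assumes fin: "finite I" and op: "is_op I (\<lambda>i j. \<phi> i * cnj (\<phi> j))"
    and proj: "op_mult I (\<lambda>i j. \<phi> i * cnj (\<phi> j)) (\<lambda>i j. \<phi> i * cnj (\<phi> j)) = (\<lambda>i j. \<phi> i * cnj (\<phi> j))"
    and Y: "psd I Y"
  shows "fidelity I (\<lambda>i j. \<phi> i * cnj (\<phi> j)) Y = Re (sform I Y \<phi> \<phi>)"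
proof -
  let ?P = "\<lambda>i j. \<phi> i * cnj (\<phi> j)"
  define S where "S = op_sqrt I Y"
  have psdP: "psd I ?P" using op pos_kernel_outer by (simp add: psd_iff)
  have sP: "op_sqrt I ?P = ?P" by (rule op_sqrt_eqI[OF fin psdP proj])
  have S: "psd I S" "op_mult I S S = Y" using op_sqrt_psd[OF fin Y] by (auto simp: S_def)
  have hS: "S j i = cnj (S i j)" for i j
    by (rule psd_cnj[OF fin S(1)])
  define w where "w = mat_app I S \<phi>"
  define a where "a = (\<Sum>i\<in>I. (cmod (w i))\<^sup>2)"
  have a0: "a \<ge> 0" by (simp add: a_def sum_nonneg)
  have X: "op_mult I ?P S i j = \<phi> i * cnj (w j)" for i j
  proof -
    have "op_mult I ?P S i j = (\<Sum>k\<in>I. \<phi> i * (cnj (\<phi> k) * cnj (S j k)))"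
      unfolding op_mult_def by (intro sum.cong refl) (subst hS, simp)
    then show ?thesis by (simp add: w_def mat_app_def sum_distrib_left mult.commute)
  qed
  have phi0: "\<phi> i = 0" if "i \<notin> I" for i
    using op that by (auto simp: is_op_def)
  have w0: "w i = 0" if "i \<notin> I" for i
    using S(1) that by (simp add: w_def mat_app_def psd_iff is_op_def)
  have wa: "(\<Sum>k\<in>I. cnj (w k) * w k) = of_real a"
    by (simp only: sum_cnj_self a_def)
  have aY: "complex_of_real a = sform I Y \<phi> \<phi>"
  proof -
    have "(\<Sum>k\<in>I. cnj (w k) * w k) = (\<Sum>k\<in>I. \<Sum>i\<in>I. cnj (\<phi> i) * (cnj (S k i) * w k))"
      by (subst (1) w_def) (simp add: mat_app_def sum_distrib_left sum_distrib_right mult_ac)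
    also have "\<dots> = (\<Sum>i\<in>I. \<Sum>k\<in>I. cnj (\<phi> i) * (S i k * w k))"
      by (subst sum.swap, intro sum.cong refl) (subst hS, simp)
    also have "\<dots> = (\<Sum>i\<in>I. cnj (\<phi> i) * mat_app I S (mat_app I S \<phi>) i)"
      by (simp add: mat_app_def[of I S w] sum_distrib_left w_def[symmetric])
    also have "\<dots> = sform I Y \<phi> \<phi>"
      by (simp add: sform_mat_app mat_app_op_mult[symmetric] S(2))
    finally show ?thesis by (simp add: wa)
  qed
  define n where "n = (\<Sum>k\<in>I. (cmod (\<phi> k))\<^sup>2)"
  have nn: "(\<Sum>k\<in>I. cnj (\<phi> k) * \<phi> k) = of_real n"
    by (simp only: sum_cnj_self n_def)
  \<comment> \<open>The projection hypothesis means that \<phi> is a unit vector or zero; zero does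
    occur, for a code with empty \<open>FA\<close>.\<close>
  have n1: "\<phi> i * of_real n = \<phi> i" for i
  proof (cases "i \<in> I \<and> \<phi> i \<noteq> 0")
    case True
    have "op_mult I ?P ?P i i = \<phi> i * (\<Sum>k\<in>I. cnj (\<phi> k) * \<phi> k) * cnj (\<phi> i)"
      by (simp add: op_mult_def sum_distrib_left sum_distrib_right mult_ac)
    then have "\<phi> i * of_real n * cnj (\<phi> i) = \<phi> i * cnj (\<phi> i)"
      using fun_cong[OF fun_cong[OF proj, of i], of i] by (simp add: nn)
    then show ?thesis using True by simp
  qed (use phi0 in auto)
  have Q: "op_mult I ?P S = (\<lambda>i j. \<phi> i * cnj (w j))" by (intro ext X)
  have XX: "op_mult I (op_adj (op_mult I ?P S)) (op_mult I ?P S) = (\<lambda>i j. w i * cnj (w j))"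
  proof (intro ext)
    fix i j
    have "op_mult I (op_adj (op_mult I ?P S)) (op_mult I ?P S) i j
        = w i * (\<Sum>k\<in>I. cnj (\<phi> k) * \<phi> k) * cnj (w j)"
      unfolding Q by (simp add: op_mult_def op_adj_def sum_distrib_left sum_distrib_right mult_ac)
    also have "\<dots> = w i * of_real n * cnj (w j)" by (simp add: nn)
    also have "w i * of_real n = w i"
      by (simp add: w_def mat_app_def sum_distrib_right mult.assoc n1)
    finally show "op_mult I (op_adj (op_mult I ?P S)) (op_mult I ?P S) i j = w i * cnj (w j)" .
  qed
  \<comment> \<open>If a = 0 then w = 0, and 1 / sqrt a = 0 by the convention for division, so the
    formula covers this case as well.\<close>
  have abs: "op_abs I (op_mult I ?P S) = (\<lambda>i j. complex_of_real (1 / sqrt a) * (w i * cnj (w j)))"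
    unfolding op_abs_def XX
  proof (rule op_sqrt_eqI[OF fin])
    show "psd I (\<lambda>i j. complex_of_real (1 / sqrt a) * (w i * cnj (w j)))"
      unfolding psd_iff
    proof
      show "pos_kernel I (\<lambda>i j. complex_of_real (1 / sqrt a) * (w i * cnj (w j)))"
        by (intro pos_kernel_scale pos_kernel_outer) (use a0 in simp)
    qed (use w0 in \<open>auto simp: is_op_def\<close>)
    show "op_mult I (\<lambda>i j. complex_of_real (1 / sqrt a) * (w i * cnj (w j)))
          (\<lambda>i j. complex_of_real (1 / sqrt a) * (w i * cnj (w j))) = (\<lambda>i j. w i * cnj (w j))"
    proof (intro ext)
      fix i j
      have "op_mult I (\<lambda>i j. complex_of_real (1 / sqrt a) * (w i * cnj (w j)))
          (\<lambda>i j. complex_of_real (1 / sqrt a) * (w i * cnj (w j))) i j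
          = of_real (1 / sqrt a * (1 / sqrt a)) * (w i * cnj (w j)) * (\<Sum>k\<in>I. cnj (w k) * w k)"
        unfolding op_mult_def sum_distrib_left of_real_mult by (intro sum.cong refl) (simp only: mult_ac)
      also have "\<dots> = of_real (1 / sqrt a * (1 / sqrt a) * a) * (w i * cnj (w j))"
        by (simp add: wa)
      also have "\<dots> = w i * cnj (w j)"
      proof (cases "a = 0")
        case True
        then have "w i = 0" using w0 fin by (cases "i \<in> I") (auto simp: a_def sum_nonneg_eq_0_iff)
        then show ?thesis by simp
      next
        case False
        then have "1 / sqrt a * (1 / sqrt a) * a = 1" using a0 by (simp add: field_simps)
        then show ?thesis by simp
      qed
      finally show "op_mult I (\<lambda>i j. complex_of_real (1 / sqrt a) * (w i * cnj (w j)))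
          (\<lambda>i j. complex_of_real (1 / sqrt a) * (w i * cnj (w j))) i j = w i * cnj (w j)" .
    qed
  qed
  have "op_trace I (op_abs I (op_mult I ?P S)) = of_real (1 / sqrt a) * (\<Sum>k\<in>I. cnj (w k) * w k)"
    by (simp add: abs op_trace_def sum_distrib_left mult_ac)
  also have "\<dots> = of_real (sqrt a)"
    unfolding wa using a0 by (simp add: real_div_sqrt flip: of_real_divide of_real_mult)
  finally have "fidelity I ?P Y = a"
    using a0 by (simp add: fidelity_def sP trace_norm_def S_def[symmetric])
  then show ?thesis using aY by (metis Re_complex_of_real)
qed

subsection \<open>Completely positive maps\<close>

text \<open>The Choi matrix of T. For linear maps its positivity is equivalent to complete
  positivity, by \<open>cp_map_kernel\<close> and \<open>cp_mapI\<close>.\<close>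

definition map_kernel :: "('i op \<Rightarrow> 'o op) \<Rightarrow> ('i \<times> 'o) op" where
  "map_kernel T = (\<lambda>(i, a) (j, b). T (unit_op i j) a b)"

lemma map_kernel_simp [simp]: "map_kernel T (i, a) (j, b) = T (unit_op i j) a b"
  by (simp add: map_kernel_def)

lemma is_op_unit: "i \<in> I \<Longrightarrow> j \<in> I \<Longrightarrow> is_op I (unit_op i j)"
  by (auto simp: is_op_def unit_op_def)

lemma pos_kernel_mult_reindex:
  assumes "finite S" "finite I" "finite K" "pos_kernel I X" "pos_kernel K Y" "f ` S \<subseteq> I" "g ` S \<subseteq> K"
  shows "pos_kernel S (\<lambda>p q. X (f p) (f q) * Y (g p) (g q))"
  by (rule pos_kernel_mult[OF assms(1) pos_kernel_reindex[OF assms(2,1,6,4)] pos_kernel_reindex[OF assms(3,1,7,5)]])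

lemma lin_map_is_op: "lin_map I Out T \<Longrightarrow> is_op I X \<Longrightarrow> is_op Out (T X)"
  by (simp add: lin_map_def)

lemma lin_map_add_scaled:
  assumes "lin_map I Out T" "is_op I X" "is_op I Y"
  shows "T (\<lambda>i j. X i j + c * Y i j) = (\<lambda>a b. T X a b + c * T Y a b)"
  by (rule assms(1)[unfolded lin_map_def, THEN conjunct2, rule_format, OF assms(2,3)])

lemma lin_map_zero:
  assumes "lin_map I Out T"
  shows "T (\<lambda>i j. 0) = (\<lambda>a b. 0)"
proof -
  have op0: "is_op I (\<lambda>i j. 0)" by (simp add: is_op_def)
  have "T (\<lambda>i j. 0) a b = T (\<lambda>i j. 0) a b + T (\<lambda>i j. 0) a b" for a b
    using fun_cong[OF fun_cong[OF lin_map_add_scaled[OF assms op0 op0, of 1], of a], of b] by simp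
  then show ?thesis by (simp add: fun_eq_iff)
qed

lemma lin_map_scale:
  assumes "lin_map I Out T" "is_op I X"
  shows "T (\<lambda>i j. c * X i j) = (\<lambda>a b. c * T X a b)"
proof -
  have op0: "is_op I (\<lambda>i j. 0)" by (simp add: is_op_def)
  show ?thesis
    using lin_map_add_scaled[OF assms(1) op0 assms(2), of c] lin_map_zero[OF assms(1)] by simp
qed

lemma lin_map_sum:
  assumes T: "lin_map I Out T" and "\<And>s. s \<in> S \<Longrightarrow> is_op I (X s)"
  shows "T (\<lambda>i j. \<Sum>s\<in>S. c s * X s i j) = (\<lambda>a b. \<Sum>s\<in>S. c s * T (X s) a b)"
  using assms(2)
proof (induction S rule: infinite_finite_induct)
  case (insert x F)
  have "T (\<lambda>i j. (\<Sum>s\<in>F. c s * X s i j) + c x * X x i j)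
      = (\<lambda>a b. T (\<lambda>i j. \<Sum>s\<in>F. c s * X s i j) a b + c x * T (X x) a b)"
    by (rule lin_map_add_scaled[OF T]) (use insert.prems in \<open>auto simp: is_op_def\<close>)
  then show ?case using insert by (simp add: add.commute)
qed (use lin_map_zero[OF T] in simp_all)

lemma lin_map_expand:
  assumes T: "lin_map I Out T" and fin: "finite I" and X: "is_op I X"
  shows "T X a b = (\<Sum>i\<in>I. \<Sum>j\<in>I. X i j * T (unit_op i j) a b)"
proof -
  have "X i j = (\<Sum>p\<in>I \<times> I. X (fst p) (snd p) * unit_op (fst p) (snd p) i j)" for i j
  proof -
    have "(\<Sum>p\<in>I \<times> I. X (fst p) (snd p) * unit_op (fst p) (snd p) i j)
        = (\<Sum>p\<in>I \<times> I. if p = (i, j) then X i j else 0)"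
      by (intro sum.cong refl) (auto simp: unit_op_def)
    then show ?thesis using X fin by (auto simp: is_op_def)
  qed
  then have "X = (\<lambda>i j. \<Sum>p\<in>I \<times> I. X (fst p) (snd p) * unit_op (fst p) (snd p) i j)"
    by (intro ext)
  then have "T X = T (\<lambda>i j. \<Sum>p\<in>I \<times> I. X (fst p) (snd p) * unit_op (fst p) (snd p) i j)"
    by (rule arg_cong)
  also have "\<dots> = (\<lambda>a b. \<Sum>p\<in>I \<times> I. X (fst p) (snd p) * T (unit_op (fst p) (snd p)) a b)"
    by (rule lin_map_sum[OF T]) (auto intro!: is_op_unit)
  finally show ?thesis by (simp add: sum_Times fin)
qed

lemma lin_map_comp:
  assumes "lin_map I Out T" "lin_map Out Out' S"
  shows "lin_map I Out' (\<lambda>X. S (T X))"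
  using assms by (simp add: lin_map_def)

lemma cp_map_lin: "cp_map I Out T \<Longrightarrow> lin_map I Out T"
  by (simp add: cp_map_def)

text \<open>Apply T to one half of the unnormalised maximally entangled vector. Since
  \<open>cp_map\<close> quantifies over reference systems of the form {..<m} only, the basis I is
  first enumerated by h.\<close>

lemma cp_map_kernel:
  assumes fin: "finite I" "finite Out" and T: "cp_map I Out T"
  shows "pos_kernel (I \<times> Out) (map_kernel T)"
proof -
  obtain h where h: "bij_betw h {0..<card I} I" using ex_bij_betw_nat_finite[OF fin(1)] by blast
  define g where "g = inv_into {0..<card I} h"
  have g: "g i < card I" "h (g i) = i" if "i \<in> I" for i
  proof -
    have "g i \<in> {0..<card I}" unfolding g_def
      using that h by (metis bij_betw_def inv_into_into)
    then show "g i < card I" by simp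
    show "h (g i) = i" unfolding g_def using that h by (metis bij_betw_inv_into_right)
  qed
  define u where "u = (\<lambda>(k, i). if k < card I \<and> i = h k then (1::complex) else 0)"
  define Z where "Z = (\<lambda>p q. u p * cnj (u q))"
  have hI: "k < card I \<Longrightarrow> h k \<in> I" for k using h by (auto simp: bij_betw_def)
  have "psd ({..<card I} \<times> I) Z"
    unfolding psd_iff Z_def using hI by (auto simp: is_op_def u_def intro!: pos_kernel_outer)
  then have "pos_kernel ({..<card I} \<times> Out) (id_ten {..<card I} T Z)"
    using T by (simp add: cp_map_def psd_iff)
  then have "pos_kernel (I \<times> Out) (\<lambda>p q. id_ten {..<card I} T Z (g (fst p), snd p) (g (fst q), snd q))"
    by (intro pos_kernel_reindex[of "{..<card I} \<times> Out" _ "\<lambda>p. (g (fst p), snd p)"]) (use fin g in auto)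
  moreover have "id_ten {..<card I} T Z (g (fst p), snd p) (g (fst q), snd q) = map_kernel T p q"
    if "p \<in> I \<times> Out" "q \<in> I \<times> Out" for p q
  proof -
    have "(\<lambda>i i'. Z (g (fst p), i) (g (fst q), i')) = unit_op (fst p) (fst q)"
      using that g by (intro ext) (auto simp: Z_def u_def unit_op_def)
    then show ?thesis using that g by (auto simp: id_ten_def map_kernel_def case_prod_unfold)
  qed
  ultimately show ?thesis by (rule iffD1[OF pos_kernel_cong, rotated])
qed

text \<open>By linearity the output is Z times the Choi matrix of T, entrywise on K \<times> Out
  \<times> I, with I summed out: a Schur product followed by a contraction.\<close>

lemma pos_kernel_id_ten:
  assumes fin: "finite I" "finite Out" "finite K" and T: "lin_map I Out T"
    and k: "pos_kernel (I \<times> Out) (map_kernel T)" and Z: "psd (K \<times> I) Z"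
  shows "psd (K \<times> Out) (id_ten K T Z)"
proof -
  have opZ: "is_op (K \<times> I) Z" and pZ: "pos_kernel (K \<times> I) Z" using Z by (auto simp: psd_iff)
  have opk: "is_op I (\<lambda>i i'. Z (k, i) (k', i'))" for k k'
    using opZ by (auto simp: is_op_def)
  have opT: "is_op (K \<times> Out) (id_ten K T Z)"
    using lin_map_is_op[OF T opk] by (auto simp: is_op_def id_ten_def)
  have "pos_kernel ((K \<times> Out) \<times> I)
     (\<lambda>p q. Z (fst (fst p), snd p) (fst (fst q), snd q) * map_kernel T (snd p, snd (fst p)) (snd q, snd (fst q)))"
    by (rule pos_kernel_mult_reindex[where f = "\<lambda>p. (fst (fst p), snd p)" and g = "\<lambda>p. (snd p, snd (fst p))", OF _ _ _ pZ k])
      (use fin in auto)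
  from pos_kernel_contract[OF _ fin(1) this]
  have "pos_kernel (K \<times> Out) (\<lambda>s t. \<Sum>i\<in>I. \<Sum>j\<in>I. Z (fst s, i) (fst t, j) * map_kernel T (i, snd s) (j, snd t))"
    using fin by simp
  then have "pos_kernel (K \<times> Out) (id_ten K T Z)"
  proof (rule iffD1[OF pos_kernel_cong, rotated])
    fix s t assume "s \<in> K \<times> Out" "t \<in> K \<times> Out"
    then show "(\<Sum>i\<in>I. \<Sum>j\<in>I. Z (fst s, i) (fst t, j) * map_kernel T (i, snd s) (j, snd t)) = id_ten K T Z s t"
      by (auto simp: id_ten_def lin_map_expand[OF T fin(1) opk])
  qed
  with opT show ?thesis by (simp add: psd_iff)
qed

lemma cp_mapI:
  assumes "finite I" "finite Out" "lin_map I Out T" "pos_kernel (I \<times> Out) (map_kernel T)"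
  shows "cp_map I Out T"
  unfolding cp_map_def by (intro conjI allI impI assms(3) pos_kernel_id_ten[OF assms(1,2) _ assms(3,4)]) auto

lemma cp_map_psd:
  assumes fin: "finite I" "finite Out" and T: "cp_map I Out T" and X: "psd I X"
  shows "psd Out (T X)"
proof -
  have opX: "is_op I X" and pX: "pos_kernel I X" using X by (auto simp: psd_iff)
  have "pos_kernel (Out \<times> I) (\<lambda>p q. X (snd p) (snd q) * map_kernel T (snd p, fst p) (snd q, fst q))"
    by (rule pos_kernel_mult_reindex[where f = snd and g = "\<lambda>p. (snd p, fst p)", OF _ _ _ pX cp_map_kernel[OF fin T]])
      (use fin in auto)
  from pos_kernel_contract[OF fin(2,1) this]
  have "pos_kernel Out (\<lambda>s t. \<Sum>i\<in>I. \<Sum>j\<in>I. X i j * map_kernel T (i, s) (j, t))" by simp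
  moreover have "T X = (\<lambda>s t. \<Sum>i\<in>I. \<Sum>j\<in>I. X i j * map_kernel T (i, s) (j, t))"
    by (intro ext) (simp add: lin_map_expand[OF cp_map_lin[OF T] fin(1) opX])
  ultimately show ?thesis
    using lin_map_is_op[OF cp_map_lin[OF T] opX] by (simp add: psd_iff)
qed

text \<open>The Choi matrix of the composite is the Schur product of the two Choi matrices with the
  intermediate system summed out.\<close>

lemma cp_map_comp:
  assumes fin: "finite I" "finite Out" "finite Out'" and T: "cp_map I Out T" and S: "cp_map Out Out' S"
  shows "cp_map I Out' (\<lambda>X. S (T X))"
proof (rule cp_mapI[OF fin(1,3) lin_map_comp[OF cp_map_lin[OF T] cp_map_lin[OF S]]])
  have "pos_kernel ((I \<times> Out') \<times> Out)
     (\<lambda>p q. map_kernel T (fst (fst p), snd p) (fst (fst q), snd q) * map_kernel S (snd p, snd (fst p)) (snd q, snd (fst q)))"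
    by (rule pos_kernel_mult_reindex[where f = "\<lambda>p. (fst (fst p), snd p)" and g = "\<lambda>p. (snd p, snd (fst p))",
          OF _ _ _ cp_map_kernel[OF fin(1,2) T] cp_map_kernel[OF fin(2,3) S]])
      (use fin in auto)
  from pos_kernel_contract[OF _ fin(2) this]
  have "pos_kernel (I \<times> Out') (\<lambda>s t. \<Sum>a\<in>Out. \<Sum>b\<in>Out. map_kernel T (fst s, a) (fst t, b) * map_kernel S (a, snd s) (b, snd t))"
    using fin by simp
  then show "pos_kernel (I \<times> Out') (map_kernel (\<lambda>X. S (T X)))"
  proof (rule iffD1[OF pos_kernel_cong, rotated])
    fix s t assume st: "s \<in> I \<times> Out'" "t \<in> I \<times> Out'"
    have "is_op Out (T (unit_op (fst s) (fst t)))"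
      by (rule lin_map_is_op[OF cp_map_lin[OF T]]) (use st in \<open>auto intro!: is_op_unit\<close>)
    from lin_map_expand[OF cp_map_lin[OF S] fin(2) this]
    show "(\<Sum>a\<in>Out. \<Sum>b\<in>Out. map_kernel T (fst s, a) (fst t, b) * map_kernel S (a, snd s) (b, snd t))
        = map_kernel (\<lambda>X. S (T X)) s t"
      by (simp add: map_kernel_def case_prod_unfold)
  qed
qed

lemma op_trace_unit: "finite I \<Longrightarrow> i \<in> I \<Longrightarrow> op_trace I (unit_op i j) = (if i = j then 1 else 0)"
proof -
  assume "finite I" "i \<in> I"
  have "op_trace I (unit_op i j) = (\<Sum>k\<in>I. if k = i then (if i = j then 1 else 0) else 0)"
    unfolding op_trace_def unit_op_def by (intro sum.cong refl) auto
  then show ?thesis using \<open>finite I\<close> \<open>i \<in> I\<close> by simp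
qed

lemma psd_unit: "i \<in> I \<Longrightarrow> psd I (unit_op i i)"
proof -
  assume i: "i \<in> I"
  have "unit_op i i = (\<lambda>a b. (if a = i then 1 else 0) * cnj (if b = i then 1 else 0))"
    by (intro ext) (auto simp: unit_op_def)
  then have "pos_kernel I (unit_op i i)" by (simp only: pos_kernel_outer)
  then show ?thesis using is_op_unit[OF i i] by (simp add: psd_iff)
qed

lemma psd_trace:
  assumes "finite I" "psd I X"
  shows "op_trace I X = of_real (Re (op_trace I X))" "Re (op_trace I X) \<ge> 0"
proof -
  have "Im (op_trace I X) = 0"
    unfolding op_trace_def using pos_kernel_diag[OF assms(1)] assms(2) by (simp add: psd_iff)
  then show "op_trace I X = of_real (Re (op_trace I X))" by (simp add: complex_eq_iff)
  show "Re (op_trace I X) \<ge> 0"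
    unfolding op_trace_def using pos_kernel_diag[OF assms(1)] assms(2) by (auto simp: psd_iff intro!: sum_nonneg)
qed

subsection \<open>Sums over lists\<close>

lemma lists_n_eq: "lists_n I n = {xs. set xs \<subseteq> I \<and> length xs = n}"
  by (auto simp: lists_n_def)

lemma finite_lists_n [simp]: "finite I \<Longrightarrow> finite (lists_n I n)"
  by (simp add: lists_n_eq finite_lists_length_eq)

lemma lists_n_length: "xs \<in> lists_n I n \<Longrightarrow> length xs = n"
  by (simp add: lists_n_def)

lemma lists_n_nth: "xs \<in> lists_n I n \<Longrightarrow> k < n \<Longrightarrow> xs ! k \<in> I"
  by (auto simp: lists_n_eq subset_iff)

lemma lists_n_0 [simp]: "lists_n I 0 = {[]}"
  by (auto simp: lists_n_eq)

lemma bij_betw_append: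
  "bij_betw (\<lambda>p. fst p @ snd p) (lists_n I n \<times> lists_n I l) (lists_n I (n + l))"
  by (rule bij_betw_byWitness[where f' = "\<lambda>xs. (take n xs, drop n xs)"])
    (auto simp: lists_n_eq dest: in_set_takeD in_set_dropD)

lemma append_lists_n: "xs \<in> lists_n I n \<Longrightarrow> ys \<in> lists_n I l \<Longrightarrow> xs @ ys \<in> lists_n I (n + l)"
  by (auto simp: lists_n_eq)

lemma sum_lists_append:
  assumes "finite I"
  shows "(\<Sum>xs\<in>lists_n I (n + l). f xs) = (\<Sum>xs\<in>lists_n I n. \<Sum>ys\<in>lists_n I l. f (xs @ ys))"
  using sum.reindex_bij_betw[OF bij_betw_append, of f I n l] assms by (simp add: sum_Times)

lemma bij_betw_zip:
  "bij_betw (\<lambda>p. zip (fst p) (snd p)) (lists_n A n \<times> lists_n J n) (lists_n (A \<times> J) n)"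
  by (rule bij_betw_byWitness[where f' = "\<lambda>xs. (map fst xs, map snd xs)"])
    (auto simp: lists_n_eq zip_map_fst_snd subset_iff elim!: in_set_zipE)

lemma sum_lists_zip:
  assumes "finite A" "finite J"
  shows "(\<Sum>ps\<in>lists_n (A \<times> J) n. f ps) = (\<Sum>as\<in>lists_n A n. \<Sum>js\<in>lists_n J n. f (zip as js))"
  using sum.reindex_bij_betw[OF bij_betw_zip, of f A n J] assms by (simp add: sum_Times)

lemma bij_betw_singleton_list: "bij_betw (\<lambda>x. [x]) I (lists_n I 1)"
  by (rule bij_betw_byWitness[where f' = hd]) (auto simp: lists_n_eq length_Suc_conv)

lemma sum_lists_prod:
  fixes f :: "nat \<Rightarrow> 'i \<Rightarrow> 'c::comm_semiring_1"
  assumes fin: "finite I"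
  shows "(\<Sum>xs\<in>lists_n I n. \<Prod>k<n. f k (xs ! k)) = (\<Prod>k<n. \<Sum>i\<in>I. f k i)"
proof (induction n)
  case (Suc n)
  have "(\<Sum>xs\<in>lists_n I (Suc n). \<Prod>k<Suc n. f k (xs ! k))
      = (\<Sum>xs\<in>lists_n I n. \<Sum>ys\<in>lists_n I 1. \<Prod>k<Suc n. f k ((xs @ ys) ! k))"
    using sum_lists_append[OF fin, of "\<lambda>xs. \<Prod>k<Suc n. f k (xs ! k)" n 1] by simp
  also have "\<dots> = (\<Sum>xs\<in>lists_n I n. \<Sum>x\<in>I. \<Prod>k<Suc n. f k ((xs @ [x]) ! k))"
    by (intro sum.cong refl sum.reindex_bij_betw[OF bij_betw_singleton_list, symmetric])
  also have "\<dots> = (\<Sum>xs\<in>lists_n I n. \<Sum>x\<in>I. (\<Prod>k<n. f k (xs ! k)) * f n x)"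
    by (intro sum.cong refl) (simp add: lists_n_length nth_append)
  also have "\<dots> = (\<Sum>xs\<in>lists_n I n. \<Prod>k<n. f k (xs ! k)) * (\<Sum>x\<in>I. f n x)"
    by (simp add: sum_product)
  finally show ?case by (simp add: Suc)
qed simp

subsection \<open>Tensor powers of the channel\<close>

definition tensor_list :: "'i set \<Rightarrow> nat \<Rightarrow> 'i op \<Rightarrow> 'i list op" where
  "tensor_list I n X = (\<lambda>xs ys. if xs \<in> lists_n I n \<and> ys \<in> lists_n I n
     then \<Prod>k<n. X (xs ! k) (ys ! k) else 0)"

lemma psd_tensor_list:
  assumes "finite I" "pos_kernel I X"
  shows "psd (lists_n I n) (tensor_list I n X)"
proof -
  have "pos_kernel (lists_n I n) (\<lambda>xs ys. \<Prod>k<n. X (xs ! k) (ys ! k))"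
  proof (rule pos_kernel_prod)
    fix k assume "k \<in> {..<n}"
    then show "pos_kernel (lists_n I n) (\<lambda>xs ys. X (xs ! k) (ys ! k))"
      by (intro pos_kernel_reindex[where f = "\<lambda>xs. xs ! k", OF _ _ _ assms(2)])
        (use assms in \<open>auto simp: lists_n_nth\<close>)
  qed (use assms in auto)
  then have "pos_kernel (lists_n I n) (tensor_list I n X)"
    by (rule iffD1[OF pos_kernel_cong, rotated]) (simp add: tensor_list_def)
  then show ?thesis by (auto simp: psd_iff is_op_def tensor_list_def)
qed

lemma op_trace_tensor_list:
  assumes "finite I"
  shows "op_trace (lists_n I n) (tensor_list I n X) = op_trace I X ^ n"
proof -
  have "op_trace (lists_n I n) (tensor_list I n X) = (\<Sum>xs\<in>lists_n I n. \<Prod>k<n. X (xs ! k) (xs ! k))"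
    by (simp add: op_trace_def tensor_list_def)
  also have "\<dots> = (\<Prod>k<n. op_trace I X)"
    using sum_lists_prod[OF assms, where f = "\<lambda>_ i. X i i"] by (simp add: op_trace_def)
  finally show ?thesis by simp
qed

lemma tensor_list_states:
  assumes "finite I" "\<sigma> \<in> states I"
  shows "tensor_list I n \<sigma> \<in> states (lists_n I n)"
  using assms psd_tensor_list[of I \<sigma> n] op_trace_tensor_list[of I n \<sigma>] by (auto simp: states_def psd_iff)

text \<open>The Choi matrix of the n-th power of N with sender, jammer and receiver kept as three
  separate lists, so that each party can be permuted, split or summed out alone.\<close>

definition joint_kernel :: "(('a \<times> 'j) op \<Rightarrow> 'b op) \<Rightarrow> nat \<Rightarrow> ('a list \<times> 'j list \<times> 'b list) op" where
  "joint_kernel N n = (\<lambda>(as, js, zs) (as', js', zs').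
     \<Prod>k<n. N (unit_op (as ! k, js ! k) (as' ! k, js' ! k)) (zs ! k) (zs' ! k))"

lemma joint_kernel_simp:
  "joint_kernel N n (as, js, zs) (as', js', zs') =
     (\<Prod>k<n. N (unit_op (as ! k, js ! k) (as' ! k, js' ! k)) (zs ! k) (zs' ! k))"
  by (simp add: joint_kernel_def)

lemma avqc_ch_eq:
  assumes fin: "finite A" "finite J" and "zs \<in> lists_n B n" "ws \<in> lists_n B n"
  shows "avqc_ch A J B n N \<sigma> \<rho> zs ws =
    (\<Sum>as\<in>lists_n A n. \<Sum>js\<in>lists_n J n. \<Sum>as'\<in>lists_n A n. \<Sum>js'\<in>lists_n J n.
       \<rho> as as' * \<sigma> js js' * joint_kernel N n (as, js, zs) (as', js', ws))"
proof -
  have "avqc_ch A J B n N \<sigma> \<rho> zs ws =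
    (\<Sum>as\<in>lists_n A n. \<Sum>js\<in>lists_n J n. \<Sum>as'\<in>lists_n A n. \<Sum>js'\<in>lists_n J n.
       list_tensor \<rho> \<sigma> (zip as js) (zip as' js')
        * (\<Prod>k<n. N (unit_op (zip as js ! k) (zip as' js' ! k)) (zs ! k) (ws ! k)))"
    using assms by (simp add: avqc_ch_def ch_pow_def sum_lists_zip)
  also have "\<dots> = (\<Sum>as\<in>lists_n A n. \<Sum>js\<in>lists_n J n. \<Sum>as'\<in>lists_n A n. \<Sum>js'\<in>lists_n J n.
       \<rho> as as' * \<sigma> js js' * joint_kernel N n (as, js, zs) (as', js', ws))"
    by (intro sum.cong refl) (simp add: list_tensor_def joint_kernel_simp lists_n_length)
  finally show ?thesis .
qed

lemma is_op_avqc_ch: "is_op (lists_n B n) (avqc_ch A J B n N \<sigma> \<rho>)"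
  by (auto simp: is_op_def avqc_ch_def ch_pow_def)

lemma avqc_ch_linear:
  assumes "finite A" "finite J"
  shows "avqc_ch A J B n N (\<lambda>i j. \<sigma> i j + c * \<tau> i j) \<rho> zs ws
     = avqc_ch A J B n N \<sigma> \<rho> zs ws + c * avqc_ch A J B n N \<tau> \<rho> zs ws"
    "avqc_ch A J B n N \<sigma> (\<lambda>i j. \<rho> i j + c * \<rho>' i j) zs ws
     = avqc_ch A J B n N \<sigma> \<rho> zs ws + c * avqc_ch A J B n N \<sigma> \<rho>' zs ws"
proof -
  show "avqc_ch A J B n N (\<lambda>i j. \<sigma> i j + c * \<tau> i j) \<rho> zs ws
     = avqc_ch A J B n N \<sigma> \<rho> zs ws + c * avqc_ch A J B n N \<tau> \<rho> zs ws"
    by (cases "zs \<in> lists_n B n \<and> ws \<in> lists_n B n")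
      (auto simp: avqc_ch_eq assms algebra_simps sum.distrib sum_distrib_left avqc_ch_def ch_pow_def list_tensor_def)
  show "avqc_ch A J B n N \<sigma> (\<lambda>i j. \<rho> i j + c * \<rho>' i j) zs ws
     = avqc_ch A J B n N \<sigma> \<rho> zs ws + c * avqc_ch A J B n N \<sigma> \<rho>' zs ws"
    by (cases "zs \<in> lists_n B n \<and> ws \<in> lists_n B n")
      (auto simp: avqc_ch_eq assms algebra_simps sum.distrib sum_distrib_left avqc_ch_def ch_pow_def list_tensor_def)
qed

lemma lin_map_avqc_ch:
  assumes "finite A" "finite J"
  shows "lin_map (lists_n A n) (lists_n B n) (avqc_ch A J B n N \<sigma>)"
  unfolding lin_map_def using is_op_avqc_ch avqc_ch_linear(2)[OF assms] by blast

lemma avqc_ch_unit: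
  assumes fin: "finite A" "finite J" and as: "as \<in> lists_n A n" "as' \<in> lists_n A n"
    and zs: "zs \<in> lists_n B n" "zs' \<in> lists_n B n"
  shows "avqc_ch A J B n N \<sigma> (unit_op as as') zs zs' =
    (\<Sum>js\<in>lists_n J n. \<Sum>js'\<in>lists_n J n. \<sigma> js js' * joint_kernel N n (as, js, zs) (as', js', zs'))"
proof -
  have "avqc_ch A J B n N \<sigma> (unit_op as as') zs zs' =
    (\<Sum>bs\<in>lists_n A n. \<Sum>js\<in>lists_n J n. \<Sum>bs'\<in>lists_n A n. \<Sum>js'\<in>lists_n J n.
       unit_op as as' bs bs' * \<sigma> js js' * joint_kernel N n (bs, js, zs) (bs', js', zs'))"
    by (rule avqc_ch_eq[OF fin zs])
  also have "\<dots> = (\<Sum>bs\<in>lists_n A n. \<Sum>bs'\<in>lists_n A n. \<Sum>js\<in>lists_n J n. \<Sum>js'\<in>lists_n J n.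
       unit_op as as' bs bs' * \<sigma> js js' * joint_kernel N n (bs, js, zs) (bs', js', zs'))"
    by (intro sum.cong refl sum.swap)
  also have "\<dots> = (\<Sum>bs\<in>lists_n A n. if bs = as then \<Sum>bs'\<in>lists_n A n. if bs' = as' then
      (\<Sum>js\<in>lists_n J n. \<Sum>js'\<in>lists_n J n. \<sigma> js js' * joint_kernel N n (as, js, zs) (as', js', zs')) else 0 else 0)"
    by (intro sum.cong refl) (auto simp: unit_op_def intro!: sum.neutral sum.cong)
  finally show ?thesis using as fin by simp
qed

lemma pos_kernel_joint_kernel:
  assumes fin: "finite A" "finite J" "finite B" and N: "cp_map (A \<times> J) B N"
  shows "pos_kernel (lists_n A n \<times> lists_n J n \<times> lists_n B n) (joint_kernel N n)"
proof -
  have "pos_kernel (lists_n A n \<times> lists_n J n \<times> lists_n B n)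
     (\<lambda>p q. \<Prod>k<n. map_kernel N ((fst p ! k, fst (snd p) ! k), snd (snd p) ! k) ((fst q ! k, fst (snd q) ! k), snd (snd q) ! k))"
  proof (rule pos_kernel_prod)
    fix k assume "k \<in> {..<n}"
    then show "pos_kernel (lists_n A n \<times> lists_n J n \<times> lists_n B n)
      (\<lambda>p q. map_kernel N ((fst p ! k, fst (snd p) ! k), snd (snd p) ! k) ((fst q ! k, fst (snd q) ! k), snd (snd q) ! k))"
      by (intro pos_kernel_reindex[where f = "\<lambda>p. ((fst p ! k, fst (snd p) ! k), snd (snd p) ! k)", OF _ _ _ cp_map_kernel[OF _ _ N]])
        (use fin in \<open>auto simp: lists_n_nth\<close>)
  qed (use fin in auto)
  then show ?thesis by (simp add: joint_kernel_def case_prod_unfold)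
qed

lemma cp_map_avqc_ch:
  assumes fin: "finite A" "finite J" "finite B" and N: "cp_map (A \<times> J) B N"
    and \<sigma>: "pos_kernel (lists_n J n) \<sigma>"
  shows "cp_map (lists_n A n) (lists_n B n) (avqc_ch A J B n N \<sigma>)"
proof (rule cp_mapI[OF _ _ lin_map_avqc_ch[OF fin(1,2)]])
  have "pos_kernel ((lists_n A n \<times> lists_n B n) \<times> lists_n J n)
     (\<lambda>p q. \<sigma> (snd p) (snd q) * joint_kernel N n (fst (fst p), snd p, snd (fst p)) (fst (fst q), snd q, snd (fst q)))"
    by (rule pos_kernel_mult_reindex[where f = snd and g = "\<lambda>p. (fst (fst p), snd p, snd (fst p))",
          OF _ _ _ \<sigma> pos_kernel_joint_kernel[OF fin N]])
      (use fin in auto)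
  from pos_kernel_contract[OF _ _ this]
  have "pos_kernel (lists_n A n \<times> lists_n B n) (\<lambda>s t. \<Sum>js\<in>lists_n J n. \<Sum>js'\<in>lists_n J n.
      \<sigma> js js' * joint_kernel N n (fst s, js, snd s) (fst t, js', snd t))"
    using fin by simp
  then show "pos_kernel (lists_n A n \<times> lists_n B n) (map_kernel (avqc_ch A J B n N \<sigma>))"
    by (rule iffD1[OF pos_kernel_cong, rotated]) (auto simp: avqc_ch_unit fin)
qed (use fin in auto)

text \<open>Trace preservation of N position by position. This is what later allows the outputs of
  the junk inputs to be discarded.\<close>

lemma trace_joint_kernel:
  assumes fin: "finite A" "finite J" "finite B" and N: "trace_pres (A \<times> J) B N"
    and as: "as \<in> lists_n A n" "as' \<in> lists_n A n" and js: "js \<in> lists_n J n" "js' \<in> lists_n J n"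
  shows "(\<Sum>zs\<in>lists_n B n. joint_kernel N n (as, js, zs) (as', js', zs)) = (if as = as' \<and> js = js' then 1 else 0)"
proof -
  have "(\<Sum>zs\<in>lists_n B n. joint_kernel N n (as, js, zs) (as', js', zs))
     = (\<Prod>k<n. op_trace B (N (unit_op (as ! k, js ! k) (as' ! k, js' ! k))))"
    unfolding joint_kernel_simp op_trace_def by (rule sum_lists_prod[OF fin(3)])
  also have "\<dots> = (\<Prod>k<n. if as ! k = as' ! k \<and> js ! k = js' ! k then 1 else 0)"
  proof (intro prod.cong refl)
    fix k assume k: "k \<in> {..<n}"
    then have *: "(as ! k, js ! k) \<in> A \<times> J" "(as' ! k, js' ! k) \<in> A \<times> J"
      using as js by (auto simp: lists_n_nth)
    have "op_trace B (N (unit_op (as ! k, js ! k) (as' ! k, js' ! k)))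
        = op_trace (A \<times> J) (unit_op (as ! k, js ! k) (as' ! k, js' ! k))"
      using N is_op_unit[OF *] by (simp add: trace_pres_def)
    then show "op_trace B (N (unit_op (as ! k, js ! k) (as' ! k, js' ! k))) = (if as ! k = as' ! k \<and> js ! k = js' ! k then 1 else 0)"
      using op_trace_unit[of "A \<times> J", OF _ *(1)] fin by simp
  qed
  also have "\<dots> = (if as = as' \<and> js = js' then 1 else 0)"
  proof (cases "as = as' \<and> js = js'")
    case False
    have "\<exists>k<n. \<not> (as ! k = as' ! k \<and> js ! k = js' ! k)"
    proof (rule ccontr)
      assume "\<not> (\<exists>k<n. \<not> (as ! k = as' ! k \<and> js ! k = js' ! k))"
      then have "as = as'" "js = js'" using as js by (auto intro!: nth_equalityI simp: lists_n_length)
      with False show False by simp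
    qed
    then show ?thesis using False by (auto intro!: prod_zero)
  qed simp
  finally show ?thesis .
qed

lemma op_trace_avqc_ch:
  assumes fin: "finite A" "finite J" "finite B" and N: "trace_pres (A \<times> J) B N"
  shows "op_trace (lists_n B n) (avqc_ch A J B n N \<sigma> \<rho>) = op_trace (lists_n A n) \<rho> * op_trace (lists_n J n) \<sigma>"
proof -
  let ?A = "lists_n A n" and ?J = "lists_n J n" and ?B = "lists_n B n"
  have "op_trace ?B (avqc_ch A J B n N \<sigma> \<rho>) = (\<Sum>zs\<in>?B. \<Sum>as\<in>?A. \<Sum>js\<in>?J. \<Sum>as'\<in>?A. \<Sum>js'\<in>?J.
       \<rho> as as' * \<sigma> js js' * joint_kernel N n (as, js, zs) (as', js', zs))"
    unfolding op_trace_def by (intro sum.cong refl) (simp add: avqc_ch_eq fin)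
  also have "\<dots> = (\<Sum>as\<in>?A. \<Sum>js\<in>?J. \<Sum>as'\<in>?A. \<Sum>js'\<in>?J. \<Sum>zs\<in>?B.
       \<rho> as as' * \<sigma> js js' * joint_kernel N n (as, js, zs) (as', js', zs))"
    unfolding sum.swap[of _ _ ?B] ..
  also have "\<dots> = (\<Sum>as\<in>?A. \<Sum>js\<in>?J. \<Sum>as'\<in>?A. \<Sum>js'\<in>?J.
       \<rho> as as' * \<sigma> js js' * (if as = as' \<and> js = js' then 1 else 0))"
    unfolding sum_distrib_left[symmetric]
    by (intro sum.cong refl arg_cong2[of _ _ _ _ times] trace_joint_kernel[OF fin N])
  also have "\<dots> = (\<Sum>as\<in>?A. \<Sum>js\<in>?J. \<Sum>as'\<in>?A. if as' = as then \<Sum>js'\<in>?J. if js' = js then \<rho> as as * \<sigma> js js else 0 else 0)"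
    by (intro sum.cong refl) (auto intro!: sum.cong)
  also have "\<dots> = (\<Sum>as\<in>?A. \<Sum>js\<in>?J. \<rho> as as * \<sigma> js js)" using fin by (simp cong: sum.cong)
  finally show ?thesis by (simp add: op_trace_def sum_product)
qed

text \<open>The link between the two models: the compound channel with parameter \<sigma> is the
  jammed channel whose jammer plays a tensor power. The product of sums over J becomes a sum over
  pairs of jammer lists.\<close>

lemma ch_pow_jam_ch:
  assumes fin: "finite A" "finite J" and N: "lin_map (A \<times> J) B N" and \<sigma>: "is_op J \<sigma>"
  shows "ch_pow A B n (jam_ch N \<sigma>) \<rho> = avqc_ch A J B n N (tensor_list J n \<sigma>) \<rho>"
proof (intro ext)
  fix zs ws
  show "ch_pow A B n (jam_ch N \<sigma>) \<rho> zs ws = avqc_ch A J B n N (tensor_list J n \<sigma>) \<rho> zs ws"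
  proof (cases "zs \<in> lists_n B n \<and> ws \<in> lists_n B n")
    case True
    have jam: "jam_ch N \<sigma> (unit_op a a') z w = (\<Sum>p\<in>J \<times> J. \<sigma> (fst p) (snd p) * N (unit_op (a, fst p) (a', snd p)) z w)"
      if "a \<in> A" "a' \<in> A" for a a' z w
    proof -
      have "is_op (A \<times> J) (op_tensor (unit_op a a') \<sigma>)"
        using that \<sigma> by (auto simp: is_op_def op_tensor_def unit_op_def)
      from lin_map_expand[OF N _ this]
      have "jam_ch N \<sigma> (unit_op a a') z w = (\<Sum>b\<in>A. \<Sum>j\<in>J. \<Sum>b'\<in>A. \<Sum>j'\<in>J.
          unit_op a a' b b' * \<sigma> j j' * N (unit_op (b, j) (b', j')) z w)"
        using fin by (simp add: jam_ch_def sum_Times op_tensor_def)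
      also have "\<dots> = (\<Sum>b\<in>A. \<Sum>b'\<in>A. \<Sum>j\<in>J. \<Sum>j'\<in>J.
          unit_op a a' b b' * \<sigma> j j' * N (unit_op (b, j) (b', j')) z w)"
        by (intro sum.cong refl sum.swap)
      also have "\<dots> = (\<Sum>b\<in>A. if b = a then \<Sum>b'\<in>A. if b' = a' then \<Sum>j\<in>J. \<Sum>j'\<in>J.
          \<sigma> j j' * N (unit_op (a, j) (a', j')) z w else 0 else 0)"
        by (intro sum.cong refl) (auto simp: unit_op_def intro!: sum.neutral sum.cong)
      finally show ?thesis using that fin by (simp add: sum_Times)
    qed
    have "ch_pow A B n (jam_ch N \<sigma>) \<rho> zs ws = (\<Sum>as\<in>lists_n A n. \<Sum>as'\<in>lists_n A n.
        \<rho> as as' * (\<Prod>k<n. \<Sum>p\<in>J \<times> J. \<sigma> (fst p) (snd p) * N (unit_op (as ! k, fst p) (as' ! k, snd p)) (zs ! k) (ws ! k)))"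
      using True by (auto simp: ch_pow_def lists_n_nth intro!: sum.cong prod.cong jam)
    also have "\<dots> = (\<Sum>as\<in>lists_n A n. \<Sum>as'\<in>lists_n A n. \<rho> as as' * (\<Sum>ps\<in>lists_n (J \<times> J) n.
         \<Prod>k<n. \<sigma> (fst (ps ! k)) (snd (ps ! k)) * N (unit_op (as ! k, fst (ps ! k)) (as' ! k, snd (ps ! k))) (zs ! k) (ws ! k)))"
      by (intro sum.cong refl arg_cong2[of _ _ _ _ times] sum_lists_prod[symmetric]) (use fin in simp)
    also have "\<dots> = (\<Sum>as\<in>lists_n A n. \<Sum>as'\<in>lists_n A n. \<Sum>js\<in>lists_n J n. \<Sum>js'\<in>lists_n J n.
       \<rho> as as' * tensor_list J n \<sigma> js js' * joint_kernel N n (as, js, zs) (as', js', ws))"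
      by (intro sum.cong refl)
        (simp add: sum_lists_zip fin sum_distrib_left tensor_list_def joint_kernel_simp lists_n_length prod.distrib mult.assoc)
    also have "\<dots> = (\<Sum>as\<in>lists_n A n. \<Sum>js\<in>lists_n J n. \<Sum>as'\<in>lists_n A n. \<Sum>js'\<in>lists_n J n.
       \<rho> as as' * tensor_list J n \<sigma> js js' * joint_kernel N n (as, js, zs) (as', js', ws))"
      by (intro sum.cong refl sum.swap)
    also have "\<dots> = avqc_ch A J B n N (tensor_list J n \<sigma>) \<rho> zs ws"
      using True by (simp add: avqc_ch_eq fin)
    finally show ?thesis .
  qed (auto simp: avqc_ch_def ch_pow_def)
qed

subsection \<open>Success probability of a code\<close>

text \<open>The overlap of the output with the target state, \<open>\<langle>\<Phi>|(id \<otimes> R m \<circ> M \<circ> P m)(\<Phi>)|\<Phi>\<rangle>\<close> averaged over \<open>m\<close>;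
  unlike \<open>Pbar_cet\<close> it is visibly linear in \<open>M\<close>.\<close>
definition code_fid :: "nat \<Rightarrow> ('a, 'b) cet_code \<Rightarrow> ('a list op \<Rightarrow> 'b list op) \<Rightarrow> complex" where
  "code_fid M1 c M = (case c of (FA, FB, P, R) \<Rightarrow>
     (\<Sum>m\<in>{1..M1}. \<Sum>k\<in>FA. \<Sum>k'\<in>FA. R m (M (P m (unit_op k k'))) k k') / (of_nat M1 * (of_nat (card FA))\<^sup>2))"

lemma is_cet_codeD:
  assumes "is_cet_code A B n M1 M2 (FA, FB, P, R)"
  shows "finite FB" "FA \<subseteq> FB" "card FA = M2" "finite FA"
    "\<And>m. m \<in> {1..M1} \<Longrightarrow> channel FA (lists_n A n) (P m)"
    "\<And>m. m \<in> {1..M1} \<Longrightarrow> cp_map (lists_n B n) FB (R m)"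
    "\<And>m. m \<in> {1..M1} \<Longrightarrow> trace_nonincr (lists_n B n) FB (R m)"
    "trace_pres (lists_n B n) FB (\<lambda>Y a b. \<Sum>m\<in>{1..M1}. R m Y a b)"
  using assms by (auto simp: is_cet_code_def intro: finite_subset)

lemma trace_nonincr_of_sum:
  assumes fin: "finite I" "finite Out" "finite S"
    and cp: "\<And>m. m \<in> S \<Longrightarrow> cp_map I Out (R m)"
    and tp: "trace_pres I Out (\<lambda>Y a b. \<Sum>m\<in>S. R m Y a b)" and m: "m \<in> S"
  shows "trace_nonincr I Out (R m)"
  unfolding trace_nonincr_def
proof (intro allI impI)
  fix X assume X: "psd I X"
  have "op_trace I X = op_trace Out (\<lambda>a b. \<Sum>m\<in>S. R m X a b)"
    using tp X by (simp add: trace_pres_def psd_iff)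
  also have "\<dots> = (\<Sum>m\<in>S. op_trace Out (R m X))"
    unfolding op_trace_def by (rule sum.swap)
  finally have "Re (op_trace I X) = (\<Sum>m\<in>S. Re (op_trace Out (R m X)))" by simp
  also have "\<dots> \<ge> Re (op_trace Out (R m X))"
    using psd_trace(2)[OF fin(2) cp_map_psd[OF fin(1,2) cp X]] fin(3) m by (intro member_le_sum) auto
  finally show "Re (op_trace Out (R m X)) \<le> Re (op_trace I X)" .
qed

lemma max_ent_slice:
  assumes "k \<in> FA" "k' \<in> FA"
  shows "(\<lambda>i i'. max_ent FA (k, i) (k', i')) = (\<lambda>i j. (1 / of_nat (card FA)) * unit_op k k' i j)"
  using assms by (intro ext) (auto simp: max_ent_def unit_op_def)

text \<open>The left side is the form at the all-ones vector, whose squared norm is card I, and a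
  positive form is bounded by its trace times the squared norm.\<close>

lemma pos_kernel_diag_sum_le:
  assumes fin: "finite I" and G: "pos_kernel I G"
  shows "Re (\<Sum>k\<in>I. \<Sum>k'\<in>I. G k k') \<le> card I * (\<Sum>k\<in>I. Re (G k k))"
proof -
  obtain V where V: "\<And>i j. i \<in> I \<Longrightarrow> j \<in> I \<Longrightarrow> G i j = (\<Sum>r\<in>I. V r i * cnj (V r j))"
    using pos_kernel_decomp[OF fin G] by metis
  have "(\<Sum>k\<in>I. \<Sum>k'\<in>I. G k k') = (\<Sum>k\<in>I. \<Sum>k'\<in>I. \<Sum>r\<in>I. V r k * cnj (V r k'))"
    by (simp add: V)
  also have "\<dots> = (\<Sum>k\<in>I. \<Sum>r\<in>I. \<Sum>k'\<in>I. V r k * cnj (V r k'))"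
    by (intro sum.cong refl sum.swap)
  also have "\<dots> = (\<Sum>r\<in>I. \<Sum>k\<in>I. \<Sum>k'\<in>I. V r k * cnj (V r k'))"
    by (rule sum.swap)
  also have "\<dots> = (\<Sum>r\<in>I. (\<Sum>k\<in>I. V r k) * cnj (\<Sum>k\<in>I. V r k))"
    by (simp add: sum_product)
  also have "\<dots> = (\<Sum>r\<in>I. of_real ((cmod (\<Sum>k\<in>I. V r k))\<^sup>2))"
    by (simp only: complex_norm_square)
  finally have "Re (\<Sum>k\<in>I. \<Sum>k'\<in>I. G k k') = (\<Sum>r\<in>I. (cmod (\<Sum>k\<in>I. V r k))\<^sup>2)" by simp
  also have "\<dots> \<le> (\<Sum>r\<in>I. (\<Sum>k\<in>I. cmod (V r k))\<^sup>2)"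
    by (intro sum_mono power_mono norm_sum) auto
  also have "\<dots> \<le> (\<Sum>r\<in>I. (\<Sum>k\<in>I. (cmod (V r k))\<^sup>2) * card I)"
    by (intro sum_mono sum_squared_le_sum_of_squares)
  also have "\<dots> = card I * (\<Sum>k\<in>I. \<Sum>r\<in>I. (cmod (V r k))\<^sup>2)"
    by (subst sum.swap) (simp add: sum_distrib_left sum_distrib_right mult.commute)
  also have "(\<Sum>k\<in>I. \<Sum>r\<in>I. (cmod (V r k))\<^sup>2) = (\<Sum>k\<in>I. Re (G k k))"
  proof (intro sum.cong refl)
    fix k assume "k \<in> I"
    then have "G k k = (\<Sum>r\<in>I. of_real ((cmod (V r k))\<^sup>2))"
      by (simp only: V complex_norm_square)
    then show "(\<Sum>r\<in>I. (cmod (V r k))\<^sup>2) = Re (G k k)" by simp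
  qed
  finally show ?thesis .
qed

context
  fixes A :: "'a set" and B :: "'b set" and n M1 M2 :: nat
    and FA FB :: "nat set" and P :: "nat \<Rightarrow> nat op \<Rightarrow> 'a list op" and R :: "nat \<Rightarrow> 'b list op \<Rightarrow> nat op"
    and M :: "'a list op \<Rightarrow> 'b list op"
  assumes finA: "finite A" and finB: "finite B"
    and code: "is_cet_code A B n M1 M2 (FA, FB, P, R)"
    and M: "cp_map (lists_n A n) (lists_n B n) M"
begin

private lemma fins: "finite FA" "finite FB" "finite (lists_n A n)" "finite (lists_n B n)" "FA \<subseteq> FB"
  using is_cet_codeD(1,2,4)[OF code] finA finB by simp_all

private lemma cp_PM: "m \<in> {1..M1} \<Longrightarrow> cp_map FA (lists_n B n) (\<lambda>X. M (P m X))"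
  using is_cet_codeD(5)[OF code] by (intro cp_map_comp[OF fins(1,3,4) _ M]) (simp add: channel_def)

private lemma cp_PMR: "m \<in> {1..M1} \<Longrightarrow> m' \<in> {1..M1} \<Longrightarrow> cp_map FA FB (\<lambda>X. R m' (M (P m X)))"
  by (rule cp_map_comp[OF fins(1,4,2) cp_PM is_cet_codeD(6)[OF code]])

private lemma pos_kernel_PMR:
  assumes "m \<in> {1..M1}"
  shows "pos_kernel FA (\<lambda>k k'. R m (M (P m (unit_op k k'))) k k')"
proof -
  have "(\<lambda>k. (k, k)) ` FA \<subseteq> FA \<times> FB" using fins by auto
  from pos_kernel_reindex[OF _ fins(1) this cp_map_kernel[OF fins(1,2) cp_PMR[OF assms assms]]]
  show ?thesis using fins by simp
qed

lemma code_fid_nonneg: "Im (code_fid M1 (FA, FB, P, R) M) = 0" "Re (code_fid M1 (FA, FB, P, R) M) \<ge> 0"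
proof -
  define S where "S = (\<Sum>m\<in>{1..M1}. \<Sum>k\<in>FA. \<Sum>k'\<in>FA. R m (M (P m (unit_op k k'))) k k')"
  have *: "sform FA (\<lambda>k k'. R m (M (P m (unit_op k k'))) k k') (\<lambda>_. 1) (\<lambda>_. 1)
     = (\<Sum>k\<in>FA. \<Sum>k'\<in>FA. R m (M (P m (unit_op k k'))) k k')" for m
    by (simp add: sform_def)
  have im: "Im S = 0" and re: "Re S \<ge> 0"
    using pos_kernel_PMR unfolding pos_kernel_def *[symmetric] S_def by (auto intro!: sum_nonneg)
  have eq: "code_fid M1 (FA, FB, P, R) M = S / of_real (real M1 * (real (card FA))\<^sup>2)"
    by (simp add: code_fid_def S_def)
  show "Im (code_fid M1 (FA, FB, P, R) M) = 0" "Re (code_fid M1 (FA, FB, P, R) M) \<ge> 0"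
    unfolding eq Im_divide_of_real Re_divide_of_real using im re by auto
qed

text \<open>Entanglement fidelity is at most the mean success for the basis states of
  \<open>FA\<close>. It gives the upper bound \<open>code_fid_le\<close>, and it allows a CET code
  to be read as a classical code.\<close>

lemma code_fid_le_diag:
  "Re (code_fid M1 (FA, FB, P, R) M)
   \<le> (\<Sum>m\<in>{1..M1}. \<Sum>k\<in>FA. Re (R m (M (P m (unit_op k k))) k k)) / (real M1 * real (card FA))"
proof -
  define S where "S = (\<Sum>m\<in>{1..M1}. \<Sum>k\<in>FA. \<Sum>k'\<in>FA. R m (M (P m (unit_op k k'))) k k')"
  define T where "T = (\<Sum>m\<in>{1..M1}. \<Sum>k\<in>FA. Re (R m (M (P m (unit_op k k))) k k))"
  have "Re S = (\<Sum>m\<in>{1..M1}. Re (\<Sum>k\<in>FA. \<Sum>k'\<in>FA. R m (M (P m (unit_op k k'))) k k'))" by (simp add: S_def)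
  also have "\<dots> \<le> (\<Sum>m\<in>{1..M1}. card FA * (\<Sum>k\<in>FA. Re (R m (M (P m (unit_op k k))) k k)))"
    by (intro sum_mono pos_kernel_diag_sum_le[OF fins(1) pos_kernel_PMR])
  finally have S: "Re S \<le> card FA * T" by (simp add: T_def sum_distrib_left)
  have "Re (code_fid M1 (FA, FB, P, R) M) = Re S / (real M1 * (real (card FA))\<^sup>2)"
  proof -
    have eq: "code_fid M1 (FA, FB, P, R) M = S / of_real (real M1 * (real (card FA))\<^sup>2)"
      by (simp add: code_fid_def S_def)
    show ?thesis unfolding eq Re_divide_of_real ..
  qed
  also have "\<dots> \<le> (card FA * T) / (real M1 * (real (card FA))\<^sup>2)"
    by (intro divide_right_mono S) auto
  also have "\<dots> = T / (real M1 * real (card FA))"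
    by (simp add: power2_eq_square)
  finally show ?thesis by (simp add: T_def)
qed

lemma code_fid_le:
  assumes t: "\<And>X. is_op (lists_n A n) X \<Longrightarrow> op_trace (lists_n B n) (M X) = of_real t * op_trace (lists_n A n) X" and t0: "t \<ge> 0"
  shows "Re (code_fid M1 (FA, FB, P, R) M) \<le> t"
proof -
  have "(\<Sum>m\<in>{1..M1}. \<Sum>k\<in>FA. Re (R m (M (P m (unit_op k k))) k k)) \<le> (\<Sum>m\<in>{1..M1}. \<Sum>k\<in>FA. t)"
  proof (intro sum_mono)
    fix m k assume m: "m \<in> {1..M1}" and k: "k \<in> FA"
    have ps: "psd FB (R m (M (P m (unit_op k k))))"
      by (rule cp_map_psd[OF fins(1,2) cp_PMR[OF m m] psd_unit[OF k]])
    have psM: "psd (lists_n B n) (M (P m (unit_op k k)))"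
      by (rule cp_map_psd[OF fins(1,4) cp_PM[OF m] psd_unit[OF k]])
    have "Re (R m (M (P m (unit_op k k))) k k) \<le> Re (op_trace FB (R m (M (P m (unit_op k k)))))"
      unfolding op_trace_def Re_sum
      using pos_kernel_diag(2)[OF fins(2)] ps k fins by (intro member_le_sum) (auto simp: psd_iff)
    also have "\<dots> \<le> Re (op_trace (lists_n B n) (M (P m (unit_op k k))))"
      using is_cet_codeD(7)[OF code m] psM by (simp add: trace_nonincr_def)
    also have "\<dots> = Re (of_real t * op_trace FA (unit_op k k))"
    proof -
      have P: "lin_map FA (lists_n A n) (P m)" "trace_pres FA (lists_n A n) (P m)"
        using is_cet_codeD(5)[OF code m] by (simp_all add: channel_def cp_map_def)
      show ?thesis
        using P(2) is_op_unit[OF k k] t[OF lin_map_is_op[OF P(1) is_op_unit[OF k k]]] by (simp add: trace_pres_def)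
    qed
    also have "\<dots> = t" using fins k by (simp add: op_trace_unit)
    finally show "Re (R m (M (P m (unit_op k k))) k k) \<le> t" .
  qed
  then have "(\<Sum>m\<in>{1..M1}. \<Sum>k\<in>FA. Re (R m (M (P m (unit_op k k))) k k)) / (real M1 * real (card FA))
     \<le> (real M1 * real (card FA) * t) / (real M1 * real (card FA))"
    by (intro divide_right_mono) auto
  also have "\<dots> \<le> t" using t0 by simp
  finally show ?thesis using code_fid_le_diag by linarith
qed

text \<open>The target is the projector of a maximally entangled vector in the block of the true
  message, so \<open>fidelity_pure\<close> applies, and only the decoder branch m of the
  block-diagonal output overlaps with it.\<close>

lemma Pbar_cet_eq: "Pbar_cet M1 (FA, FB, P, R) M = Re (code_fid M1 (FA, FB, P, R) M)"
proof -
  let ?I = "FA \<times> ({1..M1} \<times> FB)"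
  have finI: "finite ?I" using fins by simp
  have fid: "fidelity ?I
          (\<lambda>(k, (m1, x)) (k', (m2, x')). if m1 = m \<and> m2 = m then max_ent FA (k, x) (k', x') else 0)
          (id_ten FA (\<lambda>X. full_dec M1 R (M (P m X))) (max_ent FA))
     = Re ((\<Sum>k\<in>FA. \<Sum>k'\<in>FA. R m (M (P m (unit_op k k'))) k k') / (of_nat (card FA))\<^sup>2)"
    if m: "m \<in> {1..M1}" for m
  proof -
    define s where "s = complex_of_real (1 / sqrt (card FA))"
    define \<phi> where "\<phi> = (\<lambda>(k, (m1, x)). if m1 = m \<and> k \<in> FA \<and> x = k then s else 0)"
    have ss: "s * cnj s = 1 / of_nat (card FA)"
      by (simp add: s_def flip: of_real_mult)
    have target: "(\<lambda>(k, (m1, x)) (k', (m2, x')). if m1 = m \<and> m2 = m then max_ent FA (k, x) (k', x') else 0)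
        = (\<lambda>p q. \<phi> p * cnj (\<phi> q))"
      by (intro ext) (auto simp: \<phi>_def max_ent_def ss)
    have phi_sum: "(\<Sum>p\<in>?I. g p * \<phi> p) = (\<Sum>k\<in>FA. g (k, (m, k)) * s)" for g
    proof -
      have "(\<Sum>p\<in>?I. g p * \<phi> p) = (\<Sum>k\<in>FA. \<Sum>m1\<in>{1..M1}. \<Sum>x\<in>FB. g (k, (m1, x)) * \<phi> (k, (m1, x)))"
        using fins by (simp add: sum_Times)
      also have "\<dots> = (\<Sum>k\<in>FA. \<Sum>m1\<in>{1..M1}. if m1 = m then \<Sum>x\<in>FB. if x = k then g (k, (m, k)) * s else 0 else 0)"
        by (intro sum.cong refl) (auto simp: \<phi>_def intro!: sum.neutral sum.cong)
      also have "\<dots> = (\<Sum>k\<in>FA. g (k, (m, k)) * s)"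
        using fins m by (intro sum.cong refl) (auto simp: subset_iff)
      finally show ?thesis .
    qed
    have opT: "is_op ?I (\<lambda>p q. \<phi> p * cnj (\<phi> q))"
      using m fins by (auto simp: is_op_def \<phi>_def split: if_splits)
    \<comment> \<open>For empty \<open>FA\<close> the vector \<phi> is zero instead of normalised;
      the projection identity holds all the same.\<close>
    have norm: "\<phi> p * (\<Sum>q\<in>?I. cnj (\<phi> q) * \<phi> q) = \<phi> p" for p
    proof (cases "FA = {}")
      case True
      then show ?thesis by (auto simp: \<phi>_def split: prod.splits)
    next
      case False
      have "(\<Sum>q\<in>?I. cnj (\<phi> q) * \<phi> q) = (\<Sum>k\<in>FA. cnj s * s)"
        unfolding phi_sum by (intro sum.cong refl) (simp add: \<phi>_def)
      also have "\<dots> = 1" using False fins by (simp add: ss mult.commute[of "cnj s"])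
      finally show ?thesis by simp
    qed
    have proj: "op_mult ?I (\<lambda>p q. \<phi> p * cnj (\<phi> q)) (\<lambda>p q. \<phi> p * cnj (\<phi> q)) = (\<lambda>p q. \<phi> p * cnj (\<phi> q))"
    proof (intro ext)
      fix p q
      have "op_mult ?I (\<lambda>p q. \<phi> p * cnj (\<phi> q)) (\<lambda>p q. \<phi> p * cnj (\<phi> q)) p q
          = (\<phi> p * (\<Sum>r\<in>?I. cnj (\<phi> r) * \<phi> r)) * cnj (\<phi> q)"
        unfolding op_mult_def sum_distrib_left sum_distrib_right by (intro sum.cong refl) (simp only: mult_ac)
      then show "op_mult ?I (\<lambda>p q. \<phi> p * cnj (\<phi> q)) (\<lambda>p q. \<phi> p * cnj (\<phi> q)) p q = \<phi> p * cnj (\<phi> q)"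
        by (simp only: norm)
    qed
    define Y where "Y = id_ten FA (\<lambda>X. full_dec M1 R (M (P m X))) (max_ent FA)"
    have Yeq: "Y (k, (m1, x)) (k', (m2, x')) = (if k \<in> FA \<and> k' \<in> FA \<and> m1 = m2 \<and> m1 \<in> {1..M1}
        then (1 / of_nat (card FA)) * R m1 (M (P m (unit_op k k'))) x x' else 0)" for k m1 x k' m2 x'
      using lin_map_scale[OF cp_map_lin[OF cp_PMR[OF m]] is_op_unit, of m1 k k' "1 / of_nat (card FA)"]
      by (auto simp: Y_def id_ten_def full_dec_def max_ent_slice)
    \<comment> \<open>The output is block diagonal in the message register: a sum over m1 of the
      projector on message m1 times the Choi matrix of the corresponding branch.\<close>
    have "pos_kernel ?I Y"
    proof -
      have "pos_kernel ?I (\<lambda>p q. complex_of_real (1 / card FA) * ((if fst (snd p) = m1 then 1 else 0) * cnj (if fst (snd q) = m1 then 1 else 0)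
           * map_kernel (\<lambda>X. R m1 (M (P m X))) (fst p, snd (snd p)) (fst q, snd (snd q))))"
        if "m1 \<in> {1..M1}" for m1
      proof -
        have o: "pos_kernel ?I (\<lambda>p q. (if fst (snd p) = m1 then 1 else 0) * cnj (if fst (snd q) = m1 then 1 else 0))"
          by (rule pos_kernel_outer)
        have k: "pos_kernel ?I (\<lambda>p q. map_kernel (\<lambda>X. R m1 (M (P m X))) (fst p, snd (snd p)) (fst q, snd (snd q)))"
          by (rule pos_kernel_reindex[where f = "\<lambda>p. (fst p, snd (snd p))", OF _ _ _ cp_map_kernel[OF fins(1,2) cp_PMR[OF m that]]])
            (use fins in auto)
        show ?thesis by (rule pos_kernel_scale[OF pos_kernel_mult[OF finI o k]]) simp
      qed
      then have "pos_kernel ?I (\<lambda>p q. \<Sum>m1\<in>{1..M1}. complex_of_real (1 / card FA) * ((if fst (snd p) = m1 then 1 else 0) * cnj (if fst (snd q) = m1 then 1 else 0)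
           * map_kernel (\<lambda>X. R m1 (M (P m X))) (fst p, snd (snd p)) (fst q, snd (snd q))))"
        by (rule pos_kernel_sum)
      moreover have "(\<Sum>m1\<in>{1..M1}. complex_of_real (1 / card FA) * ((if fst (snd p) = m1 then 1 else 0) * cnj (if fst (snd q) = m1 then 1 else 0)
           * map_kernel (\<lambda>X. R m1 (M (P m X))) (fst p, snd (snd p)) (fst q, snd (snd q)))) = Y p q"
        if "p \<in> ?I" "q \<in> ?I" for p q
      proof -
        obtain k m1 x k' m2 x' where pq: "p = (k, (m1, x))" "q = (k', (m2, x'))" by (cases p, cases q) auto
        have "(\<Sum>m1'\<in>{1..M1}. complex_of_real (1 / card FA) * ((if fst (snd p) = m1' then 1 else 0) * cnj (if fst (snd q) = m1' then 1 else 0)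
           * map_kernel (\<lambda>X. R m1' (M (P m X))) (fst p, snd (snd p)) (fst q, snd (snd q))))
         = (\<Sum>m1'\<in>{1..M1}. if m1' = m1 then (if m1 = m2 then (1 / of_nat (card FA)) * R m1 (M (P m (unit_op k k'))) x x' else 0) else 0)"
          by (intro sum.cong refl) (auto simp: pq)
        then show ?thesis using that by (auto simp: Yeq pq)
      qed
      ultimately show ?thesis by (rule iffD1[OF pos_kernel_cong, rotated])
    qed
    moreover have "is_op ?I Y"
    proof -
      have "R m1 (M (P m (unit_op k k'))) x x' = 0" if "k \<in> FA" "k' \<in> FA" "m1 \<in> {1..M1}" "x \<notin> FB \<or> x' \<notin> FB" for k k' m1 x x'
        using lin_map_is_op[OF cp_map_lin[OF cp_PMR[OF m that(3)]] is_op_unit[OF that(1,2)]] that(4)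
        by (auto simp: is_op_def)
      then show ?thesis unfolding is_op_def by (auto simp: Yeq)
    qed
    ultimately have psdY: "psd ?I Y" by (simp add: psd_iff)
    have "sform ?I Y \<phi> \<phi> = (\<Sum>p\<in>?I. cnj (\<phi> p) * (\<Sum>q\<in>?I. Y p q * \<phi> q))"
      by (simp add: sform_def sum_distrib_left mult.assoc)
    also have "\<dots> = (\<Sum>p\<in>?I. cnj (cnj (\<Sum>k'\<in>FA. Y p (k', (m, k')) * s) * \<phi> p))"
      unfolding phi_sum by (simp add: mult.commute)
    also have "\<dots> = cnj (\<Sum>p\<in>?I. cnj (\<Sum>k'\<in>FA. Y p (k', (m, k')) * s) * \<phi> p)"
      by (rule cnj_sum[symmetric])
    also have "\<dots> = cnj (\<Sum>k\<in>FA. cnj (\<Sum>k'\<in>FA. Y (k, (m, k)) (k', (m, k')) * s) * s)"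
      unfolding phi_sum ..
    also have "\<dots> = (\<Sum>k\<in>FA. \<Sum>k'\<in>FA. Y (k, (m, k)) (k', (m, k')) * (s * cnj s))"
      by (simp add: sum_distrib_right mult.assoc)
    also have "\<dots> = (\<Sum>k\<in>FA. \<Sum>k'\<in>FA. R m (M (P m (unit_op k k'))) k k' / (of_nat (card FA))\<^sup>2)"
      using m by (intro sum.cong refl) (simp add: Yeq ss power2_eq_square)
    finally have sf: "sform ?I Y \<phi> \<phi> = (\<Sum>k\<in>FA. \<Sum>k'\<in>FA. R m (M (P m (unit_op k k'))) k k') / (of_nat (card FA))\<^sup>2"
      by (simp add: sum_divide_distrib)
    show ?thesis
      unfolding target Y_def[symmetric] fidelity_pure[OF finI opT proj psdY] sf ..
  qed
  have "Pbar_cet M1 (FA, FB, P, R) M = (1 / real M1) * (\<Sum>m\<in>{1..M1}.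
       Re ((\<Sum>k\<in>FA. \<Sum>k'\<in>FA. R m (M (P m (unit_op k k'))) k k') / (of_nat (card FA))\<^sup>2))"
    unfolding Pbar_cet_def prod.case by (intro arg_cong2[of _ _ _ _ times] refl sum.cong fid)
  also have "\<dots> = Re ((\<Sum>m\<in>{1..M1}. (\<Sum>k\<in>FA. \<Sum>k'\<in>FA. R m (M (P m (unit_op k k'))) k k') / (of_nat (card FA))\<^sup>2) / of_real (real M1))"
    by (simp only: Re_divide_of_real Re_sum) simp
  also have "\<dots> = Re (code_fid M1 (FA, FB, P, R) M)"
    by (simp add: code_fid_def sum_divide_distrib mult.commute)
  finally show ?thesis .
qed

end

lemma Pbar_cet_code_fid:
  assumes "finite A" "finite B" "is_cet_code A B n M1 M2 c" "cp_map (lists_n A n) (lists_n B n) M"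
  shows "Pbar_cet M1 c M = Re (code_fid M1 c M)" "code_fid M1 c M = of_real (Pbar_cet M1 c M)"
    "Pbar_cet M1 c M \<ge> 0"
proof -
  obtain FA FB P R where c: "c = (FA, FB, P, R)" by (cases c)
  show "Pbar_cet M1 c M = Re (code_fid M1 c M)" "code_fid M1 c M = of_real (Pbar_cet M1 c M)"
    "Pbar_cet M1 c M \<ge> 0"
    using Pbar_cet_eq[OF assms(1,2) assms(3)[unfolded c] assms(4)] code_fid_nonneg[OF assms(1,2) assms(3)[unfolded c] assms(4)]
    by (simp_all add: c complex_eq_iff)
qed

lemma Pbar_cet_le:
  assumes "finite A" "finite B" "is_cet_code A B n M1 M2 c" "cp_map (lists_n A n) (lists_n B n) M"
    and "\<And>X. is_op (lists_n A n) X \<Longrightarrow> op_trace (lists_n B n) (M X) = of_real t * op_trace (lists_n A n) X" "t \<ge> 0"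
  shows "Pbar_cet M1 c M \<le> t"
proof -
  obtain FA FB P R where c: "c = (FA, FB, P, R)" by (cases c)
  show ?thesis
    using code_fid_le[OF assms(1,2) assms(3)[unfolded c] assms(4-6)] Pbar_cet_code_fid(1)[OF assms(1-4)] by (simp add: c)
qed

subsection \<open>A finite family of product vectors spanning the symmetric subspace\<close>

text \<open>Vandermonde's identity in the upper index. Pascal's rule on the second factor lowers e
  as well as m, hence the generalisation over e.\<close>

lemma sum_choose_choose:
  "(\<Sum>j\<le>m. (j choose a) * ((m - j) choose e)) = Suc m choose (a + e + 1)"
proof (induction m arbitrary: e)
  case 0
  show ?case by (cases a; cases e) auto
next
  case (Suc m)
  show ?case
  proof (cases e)
    case 0
    then show ?thesis using sum_choose_upper[of a "Suc m"] by simp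
  next
    case (Suc f)
    have "(\<Sum>j\<le>Suc m. (j choose a) * ((Suc m - j) choose e))
        = (\<Sum>j\<le>m. (j choose a) * ((m - j) choose f) + (j choose a) * ((m - j) choose Suc f))"
      using Suc by (simp add: Suc_diff_le algebra_simps)
    also have "\<dots> = (Suc m choose (a + f + 1)) + (Suc m choose (a + Suc f + 1))"
      by (simp only: sum.distrib Suc.IH)
    also have "\<dots> = Suc (Suc m) choose (a + e + 1)" using Suc by simp
    finally show ?thesis .
  qed
qed

text \<open>The lattice points of a dilated simplex: q x / Q will be the squared modulus of
  coordinate x of a unit vector.\<close>

definition compositions :: "'d set \<Rightarrow> nat \<Rightarrow> ('d \<Rightarrow> nat) set" where
  "compositions D Q = {q \<in> PiE D (\<lambda>_. {..Q}). sum q D = Q}"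

lemma finite_compositions: "finite D \<Longrightarrow> finite (compositions D Q)"
  unfolding compositions_def by (simp add: finite_PiE)

lemma compositions_le:
  assumes "finite D" "q \<in> compositions D Q" "x \<in> D"
  shows "q x \<le> Q"
  using assms by (auto simp: compositions_def)

text \<open>The box size U is separated from the total Q because splitting off a coordinate of value
  j lowers the total to Q - j while the box remains.\<close>

lemma sum_compositions_choose_bounded:
  assumes "finite D" "D \<noteq> {}" "Q \<le> U"
  shows "(\<Sum>q\<in>PiE D (\<lambda>_. {..U}). if sum q D = Q then \<Prod>x\<in>D. (q x choose k x) else 0)
     = (Q + card D - 1) choose (sum k D + card D - 1)"
  using assms
proof (induction D arbitrary: Q rule: finite_ne_induct)
  case (singleton x)
  define g where "g = (\<lambda>y. (\<lambda>_::'a. undefined::nat)(x := y))"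
  have img: "PiE {x} (\<lambda>_. {..U}) = g ` {..U}"
    unfolding PiE_insert_eq g_def by auto
  have gx: "g y x = y" for y by (simp add: g_def)
  have inj: "inj_on g {..U}" by (rule inj_onI) (metis gx)
  have "(\<Sum>q\<in>PiE {x} (\<lambda>_. {..U}). if sum q {x} = Q then \<Prod>x\<in>{x}. (q x choose k x) else 0)
     = (\<Sum>y\<in>{..U}. if y = Q then (Q choose k x) else 0)"
    unfolding img by (simp add: sum.reindex[OF inj] gx cong: if_cong)
  also have "\<dots> = Q choose k x" using singleton by simp
  finally show ?case by simp
next
  case (insert x F)
  define b where "b = card F - 1"
  have cF: "card F = b + 1" using insert by (simp add: b_def card_gt_0_iff Suc_leI)
  have "(\<Sum>q\<in>PiE (insert x F) (\<lambda>_. {..U}). if sum q (insert x F) = Q then \<Prod>x\<in>insert x F. (q x choose k x) else 0)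
     = (\<Sum>j\<le>U. \<Sum>q\<in>PiE F (\<lambda>_. {..U}). if j + sum q F = Q then (j choose k x) * (\<Prod>x\<in>F. (q x choose k x)) else 0)"
  proof -
    have s: "sum (q(x := j)) F = sum q F" for q :: "'a \<Rightarrow> nat" and j
      using insert by (intro sum.cong) auto
    have p: "(\<Prod>y\<in>F. ((q(x := j)) y choose k y)) = (\<Prod>y\<in>F. (q y choose k y))" for q :: "'a \<Rightarrow> nat" and j
      using insert by (intro prod.cong) auto
    show ?thesis
      unfolding PiE_insert_eq
      by (subst sum.reindex[OF inj_combinator[OF insert(3)]])
        (use insert(1,3) in \<open>simp add: s p sum_Times finite_PiE case_prod_unfold fun_upd_same cong: if_cong del: fun_upd_apply\<close>)
  qed
  also have "\<dots> = (\<Sum>j\<le>U. if j \<le> Q then (j choose k x) * (\<Sum>q\<in>PiE F (\<lambda>_. {..U}). if sum q F = Q - j then (\<Prod>x\<in>F. (q x choose k x)) else 0) else 0)"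
  proof (intro sum.cong refl)
    fix j
    show "(\<Sum>q\<in>PiE F (\<lambda>_. {..U}). if j + sum q F = Q then (j choose k x) * (\<Prod>x\<in>F. (q x choose k x)) else 0)
      = (if j \<le> Q then (j choose k x) * (\<Sum>q\<in>PiE F (\<lambda>_. {..U}). if sum q F = Q - j then (\<Prod>x\<in>F. (q x choose k x)) else 0) else 0)"
      by (auto simp: sum_distrib_left intro!: sum.cong sum.neutral)
  qed
  also have "\<dots> = (\<Sum>j\<le>Q. (j choose k x) * ((Q - j + card F - 1) choose (sum k F + card F - 1)))"
    using insert(5) insert(4)[of "Q - _"]
    by (intro sum.mono_neutral_cong_right) auto
  also have "\<dots> = (\<Sum>j\<le>Q. (j choose k x) * ((Q + b - j) choose (sum k F + b)))"
    by (intro sum.cong refl) (simp add: cF)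
  also have "\<dots> = (\<Sum>j\<le>Q + b. (j choose k x) * ((Q + b - j) choose (sum k F + b)))"
    by (intro sum.mono_neutral_left) auto
  also have "\<dots> = Suc (Q + b) choose (k x + (sum k F + b) + 1)"
    by (rule sum_choose_choose)
  also have "\<dots> = (Q + card (insert x F) - 1) choose (sum k (insert x F) + card (insert x F) - 1)"
    using insert by (simp add: cF algebra_simps)
  finally show ?case .
qed

lemma sum_compositions_choose:
  assumes "finite D" "D \<noteq> {}"
  shows "(\<Sum>q\<in>compositions D Q. \<Prod>x\<in>D. (q x choose k x)) = (Q + card D - 1) choose (sum k D + card D - 1)"
proof -
  have "(\<Sum>q\<in>compositions D Q. \<Prod>x\<in>D. (q x choose k x))
      = (\<Sum>q\<in>PiE D (\<lambda>_. {..Q}). if sum q D = Q then \<Prod>x\<in>D. (q x choose k x) else 0)"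
    unfolding compositions_def using assms by (intro sum.mono_neutral_cong_left) (auto simp: finite_PiE)
  then show ?thesis using sum_compositions_choose_bounded[OF assms order_refl] by simp
qed

text \<open>Unnormalised moments of the uniform distribution on the lattice points. They have no
  convenient closed form, whereas sums of products of binomial coefficients do; powers are therefore
  enclosed between falling and rising factorials.\<close>

definition comp_moment :: "'d set \<Rightarrow> nat \<Rightarrow> ('d \<Rightarrow> nat) \<Rightarrow> nat" where
  "comp_moment D Q k = (\<Sum>q\<in>compositions D Q. \<Prod>x\<in>D. q x ^ k x)"

lemma comp_moment_ge:
  assumes "finite D" "D \<noteq> {}"
  shows "(\<Prod>x\<in>D. fact (k x)) * ((Q + card D - 1) choose (sum k D + card D - 1)) \<le> comp_moment D Q k"
proof -
  have "(\<Prod>x\<in>D. fact (k x)) * ((Q + card D - 1) choose (sum k D + card D - 1))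
     = (\<Sum>q\<in>compositions D Q. \<Prod>x\<in>D. (q x choose k x) * fact (k x))"
    unfolding sum_compositions_choose[OF assms, symmetric]
    by (simp add: sum_distrib_left prod.distrib mult.commute)
  also have "\<dots> \<le> comp_moment D Q k"
    unfolding comp_moment_def by (intro sum_mono prod_mono conjI binomial_fact_pow) auto
  finally show ?thesis .
qed

lemma power_le_fact_choose: "q ^ k \<le> fact k * ((q + k) choose k)" for q k :: nat
proof (induction k)
  case (Suc k)
  have "q ^ Suc k \<le> (q + Suc k) * (fact k * ((q + k) choose k))"
    unfolding power_Suc by (intro mult_mono Suc) auto
  also have "\<dots> = fact k * (Suc (q + k) * ((q + k) choose k))" by (simp only: add_Suc_right mult_ac)
  also have "Suc (q + k) * ((q + k) choose k) = (Suc (q + k) choose Suc k) * Suc k"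
    by (rule Suc_times_binomial_eq)
  finally show ?case by (simp only: fact_Suc of_nat_id add_Suc_right mult_ac)
qed simp

text \<open>A power is at most the rising factorial, a binomial coefficient at q + k up to fact k.
  The shift by k embeds the compositions of Q into those of Q + sum k, where the binomial sum is
  exact.\<close>

lemma comp_moment_le:
  assumes fin: "finite D" "D \<noteq> {}"
  shows "comp_moment D Q k \<le> (\<Prod>x\<in>D. fact (k x)) * ((Q + sum k D + card D - 1) choose (sum k D + card D - 1))"
proof -
  define h where "h = (\<lambda>q::'a \<Rightarrow> nat. restrict (\<lambda>x. q x + k x) D)"
  have inj: "inj_on h (compositions D Q)"
  proof (rule inj_onI)
    fix q q' assume q: "q \<in> compositions D Q" "q' \<in> compositions D Q" and e: "h q = h q'"
    have "q x = q' x" for x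
    proof (cases "x \<in> D")
      case True
      then show ?thesis using fun_cong[OF e, of x] by (simp add: h_def restrict_apply')
    next
      case False
      have "q \<in> PiE D (\<lambda>_. {..Q})" "q' \<in> PiE D (\<lambda>_. {..Q})" using q by (simp_all add: compositions_def)
      then show ?thesis using PiE_arb[OF _ False] by metis
    qed
    then show "q = q'" ..
  qed
  have img: "h ` compositions D Q \<subseteq> compositions D (Q + sum k D)"
  proof safe
    fix q assume q: "q \<in> compositions D Q"
    have "q x + k x \<le> Q + sum k D" if "x \<in> D" for x
      using compositions_le[OF fin(1) q that] member_le_sum[of x D k] that fin by auto
    moreover have "(\<Sum>x\<in>D. h q x) = Q + sum k D"
      using q by (simp add: h_def sum.distrib compositions_def)
    ultimately show "h q \<in> compositions D (Q + sum k D)" by (auto simp: compositions_def h_def)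
  qed
  have "comp_moment D Q k \<le> (\<Sum>q\<in>compositions D Q. \<Prod>x\<in>D. fact (k x) * ((q x + k x) choose k x))"
    unfolding comp_moment_def by (intro sum_mono prod_mono conjI power_le_fact_choose) auto
  also have "\<dots> = (\<Prod>x\<in>D. fact (k x)) * (\<Sum>q\<in>compositions D Q. \<Prod>x\<in>D. (h q x choose k x))"
    by (simp add: prod.distrib sum_distrib_left h_def)
  also have "(\<Sum>q\<in>compositions D Q. \<Prod>x\<in>D. (h q x choose k x))
      = (\<Sum>q\<in>h ` compositions D Q. \<Prod>x\<in>D. (q x choose k x))"
    by (simp add: sum.reindex[OF inj])
  also have "\<dots> \<le> (\<Sum>q\<in>compositions D (Q + sum k D). \<Prod>x\<in>D. (q x choose k x))"
    by (intro sum_mono2 finite_compositions fin img) auto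
  also have "\<dots> = (Q + sum k D + card D - 1) choose (sum k D + card D - 1)"
    by (rule sum_compositions_choose[OF fin])
  finally show ?thesis by simp
qed

section \<open>Lists with a given multiset of entries\<close>

lemma count_mset_notin: "x \<notin> set ps \<Longrightarrow> count (mset ps) x = 0"
  by (simp add: count_eq_zero_iff)

text \<open>The multinomial coefficient. The product of factorials also stands in both bounds on
  \<open>comp_moment\<close>, so size times moment is bounded independently of the type.\<close>

lemma card_lists_with_mset:
  assumes fin: "finite D" and ps: "ps \<in> lists_n D K"
  shows "card {qs \<in> lists_n D K. mset qs = mset ps} * (\<Prod>x\<in>D. fact (count (mset ps) x)) = fact K"
proof -
  have "{qs \<in> lists_n D K. mset qs = mset ps} = permutations_of_multiset (mset ps)"
    using ps by (auto simp: permutations_of_multiset_def lists_n_eq dest: mset_eq_setD mset_eq_length)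
  moreover have "(\<Prod>x\<in>D. fact (count (mset ps) x)) = (\<Prod>x\<in>set_mset (mset ps). fact (count (mset ps) x) :: nat)"
    using ps fin by (intro prod.mono_neutral_right) (auto simp: lists_n_eq count_mset_notin)
  moreover have "size (mset ps) = K" using ps by (simp add: lists_n_length)
  ultimately show ?thesis using card_permutations_of_multiset_aux[of "mset ps"] by simp
qed

lemma sum_count_mset:
  assumes "finite D" "ps \<in> lists_n D K"
  shows "(\<Sum>x\<in>D. count (mset ps) x) = K"
proof -
  have "(\<Sum>x\<in>D. count (mset ps) x) = (\<Sum>x\<in>set_mset (mset ps). count (mset ps) x)"
    using assms by (intro sum.mono_neutral_right) (auto simp: lists_n_eq count_eq_zero_iff)
  also have "\<dots> = size (mset ps)" by (simp add: size_multiset_overloaded_eq)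
  finally show ?thesis using assms by (simp add: lists_n_length)
qed

lemma prod_list_map_count:
  fixes f :: "'d \<Rightarrow> complex"
  assumes "finite D" "set ps \<subseteq> D"
  shows "prod_list (map f ps) = (\<Prod>x\<in>D. f x ^ count (mset ps) x)"
  using assms(2)
proof (induction ps)
  case (Cons a ps)
  have "(\<Prod>x\<in>D. f x ^ count (mset (a # ps)) x) = (\<Prod>x\<in>D. f x ^ count (mset ps) x * (if x = a then f a else 1))"
    by (intro prod.cong refl) auto
  also have "\<dots> = (\<Prod>x\<in>D. f x ^ count (mset ps) x) * f a"
    using Cons.prems assms(1) by (simp add: prod.distrib)
  finally show ?case using Cons by simp
qed simp

section \<open>Product vectors with discretised moduli and phases\<close>

definition unity_root :: "nat \<Rightarrow> nat \<Rightarrow> complex" where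
  "unity_root m j = exp (2 * of_real pi * \<i> * of_nat j / of_nat m)"

lemma unity_root_power: "unity_root m t ^ a = unity_root m a ^ t"
  by (simp add: unity_root_def mult_ac flip: exp_of_nat_mult)

lemma norm_unity_root: "cmod (unity_root m j) = 1"
  by (simp add: unity_root_def)

lemma unity_root_cnj: "unity_root m j * cnj (unity_root m j) = 1"
  using norm_unity_root[of m j] by (metis complex_norm_square of_real_1 one_power2)

lemma unity_root_period: "m > 0 \<Longrightarrow> unity_root m j ^ m = 1"
  using complex_root_unity[of m j] by (simp add: unity_root_def)

lemma unity_root_orthogonal:
  assumes "a < m" "b < m"
  shows "(\<Sum>t<m. unity_root m t ^ a * cnj (unity_root m t ^ b)) = (if a = b then of_nat m else 0)"
proof -
  define z where "z = unity_root m a * cnj (unity_root m b)"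
  have eq: "unity_root m t ^ a * cnj (unity_root m t ^ b) = z ^ t" for t
    unfolding z_def unity_root_power[of m t] by (simp add: power_mult_distrib)
  have zm: "z ^ m = 1"
    using assms unity_root_period[of m] by (simp add: z_def power_mult_distrib flip: complex_cnj_power)
  show ?thesis
  proof (cases "a = b")
    case True
    then have "z = 1" by (simp add: z_def unity_root_cnj)
    then show ?thesis unfolding eq using True by simp
  next
    case False
    have "z \<noteq> 1"
    proof
      assume "z = 1"
      then have "z * unity_root m b = unity_root m b" by simp
      then have "unity_root m a = unity_root m b"
        using unity_root_cnj[of m b] by (simp add: z_def mult_ac)
      then show False
        using complex_root_unity_eq[of m a b] assms False by (simp add: unity_root_def)
    qed
    then show ?thesis unfolding eq using geometric_sum[of z m] zm False by simp
  qed
qed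

text \<open>A discrete stand-in for the uniform measure on the unit sphere: squared moduli uniform
  on the lattice simplex, independent phases uniform on the m-th roots of unity.\<close>

definition sym_index :: "'d set \<Rightarrow> nat \<Rightarrow> nat \<Rightarrow> (('d \<Rightarrow> nat) \<times> ('d \<Rightarrow> nat)) set" where
  "sym_index D Q m = compositions D Q \<times> PiE D (\<lambda>_. {..<m})"

definition sym_vec :: "nat \<Rightarrow> nat \<Rightarrow> ('d \<Rightarrow> nat) \<times> ('d \<Rightarrow> nat) \<Rightarrow> 'd \<Rightarrow> complex" where
  "sym_vec Q m s x = of_real (sqrt (real (fst s x) / real Q)) * unity_root m (snd s x)"

lemma finite_sym_index: "finite D \<Longrightarrow> finite (sym_index D Q m)"
  by (simp add: sym_index_def finite_compositions finite_PiE)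

lemma card_sym_index:
  assumes "finite D"
  shows "card (sym_index D Q m) \<le> (Q + 1) ^ card D * m ^ card D"
proof -
  have "card (compositions D Q) \<le> card (PiE D (\<lambda>_. {..Q}))"
    using assms by (intro card_mono) (auto simp: compositions_def finite_PiE)
  then show ?thesis using assms by (simp add: sym_index_def card_cartesian_product card_PiE)
qed

lemma norm_sym_vec:
  assumes "finite D" "s \<in> sym_index D Q m" "Q > 0"
  shows "(\<Sum>x\<in>D. (cmod (sym_vec Q m s x))\<^sup>2) = 1"
proof -
  have "(\<Sum>x\<in>D. (cmod (sym_vec Q m s x))\<^sup>2) = (\<Sum>x\<in>D. real (fst s x) / real Q)"
    by (simp add: sym_vec_def norm_mult norm_unity_root)
  also have "\<dots> = real (\<Sum>x\<in>D. fst s x) / Q" by (simp add: sum_divide_distrib)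
  also have "\<dots> = 1" using assms by (auto simp: sym_index_def compositions_def)
  finally show ?thesis .
qed

text \<open>Summing over the phases kills every pair of lists with different multiplicities, because
  all of these are at most K and thus below m. For equal types the phases cancel and only the moment
  of the moduli remains.\<close>

lemma sym_vec_moment:
  assumes fin: "finite D" and K: "K < m" and ps: "ps \<in> lists_n D K" and qs: "qs \<in> lists_n D K"
  shows "(\<Sum>s\<in>sym_index D Q m. prod_list (map (sym_vec Q m s) ps) * cnj (prod_list (map (sym_vec Q m s) qs)))
    = (if mset ps = mset qs then of_real (real m ^ card D * real (comp_moment D Q (count (mset ps))) / real Q ^ K) else 0)"
proof -
  let ?a = "count (mset ps)" and ?b = "count (mset qs)"
  have sub: "set ps \<subseteq> D" "set qs \<subseteq> D" using ps qs by (auto simp: lists_n_eq)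
  have lt: "?a x < m" "?b x < m" for x
    using count_le_size[of "mset ps" x] count_le_size[of "mset qs" x] ps qs K by (auto simp: lists_n_length)
  define w where "w = (\<lambda>q::'a \<Rightarrow> nat. \<Prod>x\<in>D. complex_of_real (sqrt (q x / Q)) ^ (?a x + ?b x))"
  have "(\<Sum>s\<in>sym_index D Q m. prod_list (map (sym_vec Q m s) ps) * cnj (prod_list (map (sym_vec Q m s) qs)))
     = (\<Sum>q\<in>compositions D Q. \<Sum>\<theta>\<in>PiE D (\<lambda>_. {..<m}).
         w q * (\<Prod>x\<in>D. unity_root m (\<theta> x) ^ ?a x * cnj (unity_root m (\<theta> x) ^ ?b x)))"
    using fin unfolding sym_index_def
    by (simp add: sum_Times finite_compositions finite_PiE prod_list_map_count[OF fin sub(1)] prod_list_map_count[OF fin sub(2)]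
        sym_vec_def w_def power_mult_distrib power_add prod.distrib mult_ac)
  also have "\<dots> = (\<Sum>q\<in>compositions D Q. w q * (\<Prod>x\<in>D. \<Sum>t<m. unity_root m t ^ ?a x * cnj (unity_root m t ^ ?b x)))"
    using prod_sum_PiE[OF fin, where B = "\<lambda>_. {..<m}" and f = "\<lambda>x t. unity_root m t ^ ?a x * cnj (unity_root m t ^ ?b x)"]
    by (simp add: sum_distrib_left)
  also have "\<dots> = (\<Sum>q\<in>compositions D Q. w q * (\<Prod>x\<in>D. if ?a x = ?b x then of_nat m else 0))"
    by (intro sum.cong prod.cong arg_cong2[of _ _ _ _ times] refl unity_root_orthogonal lt)
  also have "\<dots> = (if mset ps = mset qs then of_real (real m ^ card D * real (comp_moment D Q (count (mset ps))) / real Q ^ K) else 0)"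
  proof (cases "mset ps = mset qs")
    case True
    have "w q = of_real (real (\<Prod>x\<in>D. q x ^ ?a x) / Q ^ K)" for q
    proof -
      have "w q = of_real (\<Prod>x\<in>D. (q x / Q) ^ ?a x)"
        unfolding w_def True[symmetric] of_real_prod
        by (intro prod.cong refl) (simp add: power_add flip: of_real_power of_real_mult power_mult_distrib)
      also have "(\<Prod>x\<in>D. (q x / Q) ^ ?a x) = real (\<Prod>x\<in>D. q x ^ ?a x) / Q ^ (\<Sum>x\<in>D. ?a x)"
        by (simp add: power_divide prod_dividef power_sum)
      finally show ?thesis by (simp add: sum_count_mset[OF fin ps])
    qed
    then have "(\<Sum>q\<in>compositions D Q. w q * (\<Prod>x\<in>D. if ?a x = ?b x then of_nat m else 0))
       = of_real (\<Sum>q\<in>compositions D Q. real (\<Prod>x\<in>D. q x ^ ?a x) / Q ^ K * m ^ card D)"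
      using True by simp
    also have "(\<Sum>q\<in>compositions D Q. real (\<Prod>x\<in>D. q x ^ ?a x) / Q ^ K * m ^ card D)
       = real m ^ card D * real (comp_moment D Q ?a) / real Q ^ K"
      by (simp add: comp_moment_def sum_divide_distrib sum_distrib_left mult.commute)
    finally show ?thesis using True by simp
  next
    case False
    have "\<exists>x\<in>D. ?a x \<noteq> ?b x"
    proof (rule ccontr)
      assume "\<not> (\<exists>x\<in>D. ?a x \<noteq> ?b x)"
      moreover have "?a x = 0 \<and> ?b x = 0" if "x \<notin> D" for x
        using sub that by (auto simp: count_eq_zero_iff)
      ultimately have "mset ps = mset qs" by (intro multiset_eqI) metis
      with False show False by simp
    qed
    then have "(\<Prod>x\<in>D. if ?a x = ?b x then complex_of_nat m else 0) = 0" using fin by (auto intro!: prod_zero)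
    then show ?thesis using False by simp
  qed
  finally show ?thesis .
qed

text \<open>Factor by factor: 1 / (l + i) is at most (N / l) / (N + i). This compares the dimensions
  of two symmetric subspaces and is the origin of the power of (n + l) / l.\<close>

lemma fact_quotient_le:
  assumes "0 < l" "l \<le> (N::nat)"
  shows "real (fact l) / fact (l + d) \<le> (real N / l) ^ d * (fact N / fact (N + d))"
proof (induction d)
  case (Suc d)
  have "real (fact l) / fact (l + Suc d) = (fact l / fact (l + d)) * (1 / real (l + Suc d))"
    by (simp add: field_simps)
  also have "\<dots> \<le> ((real N / l) ^ d * (fact N / fact (N + d))) * ((real N / l) * (1 / real (N + Suc d)))"
    using Suc
  proof (intro mult_mono)
    have "l * Suc d \<le> N * Suc d" using assms by (intro mult_le_mono1)
    then have "l * (N + Suc d) \<le> N * (l + Suc d)" by (simp only: distrib_left mult.commute[of l N])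
    then have "real l * real (N + Suc d) \<le> real N * real (l + Suc d)" by (metis of_nat_le_iff of_nat_mult)
    moreover define a c where "a = real (l + Suc d)" and "c = real (N + Suc d)"
    ultimately have "real l * c \<le> real N * a" "a > 0" "c > 0" "real l > 0" using assms by auto
    then have "1 / a \<le> real N / real l * (1 / c)" by (simp add: field_simps)
    then show "1 / real (l + Suc d) \<le> real N / real l * (1 / real (N + Suc d))"
      by (simp only: a_def c_def)
  qed auto
  also have "\<dots> = (real N / l) ^ Suc d * (fact N / fact (N + Suc d))"
    by (simp add: field_simps)
  finally show ?case .
qed simp

lemma fact_div_le_power: "real (fact (n + k)) \<le> fact n * real (n + k) ^ k"
proof (induction k)
  case (Suc k)
  have "real (fact (n + Suc k)) = real (n + Suc k) * real (fact (n + k))"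
    by (simp add: algebra_simps)
  also have "\<dots> \<le> real (n + Suc k) * (fact n * real (n + k) ^ k)"
    using Suc by (intro mult_left_mono) auto
  also have "\<dots> \<le> real (n + Suc k) * (fact n * real (n + Suc k) ^ k)"
    by (intro mult_left_mono power_mono) auto
  finally show ?case by (simp add: mult_ac)
qed simp

lemma fact_div_ge_power: "fact n * real n ^ k \<le> real (fact (n + k))"
proof (induction k)
  case (Suc k)
  have "fact n * real n ^ Suc k \<le> real (n + Suc k) * (fact n * real n ^ k)"
  proof -
    have "real n * (fact n * real n ^ k) \<le> real (n + Suc k) * (fact n * real n ^ k)"
      by (intro mult_right_mono) auto
    then show ?thesis by (simp add: mult_ac)
  qed
  also have "\<dots> \<le> real (n + Suc k) * real (fact (n + k))" using Suc by (intro mult_left_mono) auto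
  finally show ?case by (simp add: algebra_simps)
qed simp

text \<open>Both sides are eigenvalues of moment operators of the discretised family of product vectors; the
  discretisation \<open>Q\<close> has to be quadratic in \<open>N\<close> for the ratio to be bounded.\<close>
lemma moment_ratio:
  fixes l N d Q :: nat
  assumes l: "0 < l" "l \<le> N" and Q: "Q = 4 * (N + d + 1)\<^sup>2"
  shows "real (fact l * ((Q + l + d) choose (l + d))) / real Q ^ l
     \<le> 2 * (real N / l) ^ d * (real (fact N * ((Q + d) choose (N + d))) / real Q ^ N)"
proof -
  have Qp: "Q > 0" using Q by simp
  have NQ: "N \<le> Q" using Q by (simp add: power2_eq_square)
  have c1: "real ((Q + l + d) choose (l + d)) \<le> real (Q + l + d) ^ (l + d) / fact (l + d)"
  proof -
    have "real ((Q + l + d) choose (l + d)) = fact (Q + l + d) / (fact (l + d) * fact (Q + l + d - (l + d)))"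
      by (rule binomial_fact) simp
    also have "\<dots> = fact (Q + (l + d)) / (fact (l + d) * fact Q)" by (simp add: add.assoc)
    also have "\<dots> \<le> (fact Q * real (Q + (l + d)) ^ (l + d)) / (fact (l + d) * fact Q)"
      using fact_div_le_power[of Q "l + d"] by (intro divide_right_mono) auto
    finally show ?thesis by (simp add: add.assoc)
  qed
  have c2: "real (Q - N) ^ (N + d) / fact (N + d) \<le> real ((Q + d) choose (N + d))"
  proof -
    have "real ((Q + d) choose (N + d)) = fact (Q + d) / (fact (N + d) * fact (Q + d - (N + d)))"
      using NQ by (intro binomial_fact) simp
    also have "\<dots> = fact ((Q - N) + (N + d)) / (fact (N + d) * fact (Q - N))" using NQ by simp
    also have "\<dots> \<ge> (fact (Q - N) * real (Q - N) ^ (N + d)) / (fact (N + d) * fact (Q - N))"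
      using fact_div_ge_power[of "Q - N" "N + d"] by (intro divide_right_mono) auto
    finally show ?thesis by simp
  qed
  have q1: "real Q = 4 * (real (N + d + 1))\<^sup>2" by (simp add: Q)
  have b0: "3/4 \<le> (1 - real N / Q) ^ (N + d)"
  proof -
    have "1 + real (N + d) * (- (real N / Q)) \<le> (1 + - (real N / Q)) ^ (N + d)"
      using NQ Qp by (intro Bernoulli_inequality) (simp add: field_simps)
    moreover have "real (N + d) * (real N / Q) \<le> 1/4"
    proof -
      have "real (N + d) * real N \<le> real (N + d + 1) * real (N + d + 1)" by (intro mult_mono) auto
      then show ?thesis using Qp q1 by (simp add: field_simps power2_eq_square)
    qed
    ultimately show ?thesis by simp
  qed
  have b1: "(1 + real (l + d) / Q) ^ (l + d) \<le> 4/3"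
  proof -
    define x where "x = real (l + d) / Q"
    have x0: "0 \<le> x" by (simp add: x_def)
    have sx: "real (l + d) * x \<le> 1/4"
    proof -
      have "real (l + d) * real (l + d) \<le> real (N + d + 1) * real (N + d + 1)" using l by (intro mult_mono) auto
      then show ?thesis using Qp q1 by (simp add: x_def field_simps power2_eq_square)
    qed
    have x1: "x \<le> 1/4"
    proof -
      have "1 * x \<le> real (l + d) * x" using l x0 by (intro mult_right_mono) auto
      then show ?thesis using sx by linarith
    qed
    have "1 + real (l + d) * (- x) \<le> (1 + - x) ^ (l + d)"
      using x1 by (intro Bernoulli_inequality) linarith
    then have lo: "3/4 \<le> (1 - x) ^ (l + d)" using sx by simp
    \<comment> \<open>Since (1 + x) (1 - x) is at most 1, Bernoulli's lower bound on the powers of 1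
      - x becomes an upper bound on the powers of 1 + x.\<close>
    have "(1 + x) * (1 - x) = 1 - x\<^sup>2" by (simp add: algebra_simps power2_eq_square)
    then have "(1 + x) ^ (l + d) * (1 - x) ^ (l + d) = (1 - x\<^sup>2) ^ (l + d)"
      by (simp only: power_mult_distrib[symmetric])
    also have "\<dots> \<le> 1" using x0 x1 by (intro power_le_one) (simp_all add: power_le_one)
    finally have "(1 + x) ^ (l + d) * (1 - x) ^ (l + d) \<le> 1" .
    moreover have "(1 + x) ^ (l + d) * (3/4) \<le> (1 + x) ^ (l + d) * (1 - x) ^ (l + d)"
      using lo x0 by (intro mult_left_mono) auto
    ultimately show ?thesis unfolding x_def[symmetric] by linarith
  qed
  have "real (fact l * ((Q + l + d) choose (l + d))) / real Q ^ l
     \<le> fact l * (real (Q + l + d) ^ (l + d) / fact (l + d)) / real Q ^ l"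
    unfolding of_nat_mult of_nat_fact by (intro divide_right_mono mult_left_mono c1) auto
  also have "\<dots> = (fact l / fact (l + d)) * ((1 + real (l + d) / Q) ^ (l + d) * real Q ^ d)"
  proof -
    have "real (Q + l + d) = real Q * (1 + real (l + d) / Q)" using Qp by (simp add: field_simps)
    then have "real (Q + l + d) ^ (l + d) = (1 + real (l + d) / Q) ^ (l + d) * real Q ^ d * real Q ^ l"
      by (simp add: power_mult_distrib power_add mult_ac)
    then show ?thesis using Qp by simp
  qed
  \<comment> \<open>The two discretisation errors are at most 4/3 and at least 3/4, and 4/3 \<le> 2
    * 3/4: this is the factor 2.\<close>
  also have "\<dots> \<le> ((real N / l) ^ d * (fact N / fact (N + d))) * ((2 * (1 - real N / Q) ^ (N + d)) * real Q ^ d)"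
    using b0 b1 fact_quotient_le[OF l, of d]
    by (intro mult_mono mult_right_mono) auto
  also have "\<dots> = 2 * (real N / l) ^ d * (fact N * (real (Q - N) ^ (N + d) / fact (N + d)) / real Q ^ N)"
  proof -
    have "real (Q - N) = real Q * (1 - real N / Q)" using Qp NQ by (simp add: field_simps of_nat_diff)
    then have "real (Q - N) ^ (N + d) = (1 - real N / Q) ^ (N + d) * real Q ^ d * real Q ^ N"
      by (simp add: power_mult_distrib power_add mult_ac)
    then show ?thesis using Qp by simp
  qed
  also have "\<dots> \<le> 2 * (real N / l) ^ d * (fact N * real ((Q + d) choose (N + d)) / real Q ^ N)"
    using c2 by (intro mult_left_mono divide_right_mono) auto
  finally show ?thesis by simp
qed

subsection \<open>A de Finetti bound\<close>

text \<open>Bilinear, without conjugation: the trace of G times the transpose of X. In this form it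
  is the Schur product of G and X evaluated at the all-ones vector.\<close>

definition pairing :: "'i set \<Rightarrow> 'i op \<Rightarrow> 'i op \<Rightarrow> complex" where
  "pairing I G X = (\<Sum>i\<in>I. \<Sum>j\<in>I. G i j * X i j)"

definition reduced :: "'j set \<Rightarrow> nat \<Rightarrow> nat \<Rightarrow> 'j list op \<Rightarrow> 'j list op" where
  "reduced J n l \<omega> = (\<lambda>xs ys. if xs \<in> lists_n J n \<and> ys \<in> lists_n J n
     then \<Sum>us\<in>lists_n J l. \<omega> (xs @ us) (ys @ us) else 0)"

section \<open>Frame bounds from moments that are diagonal in the type\<close>

lemma of_real_eq_cmod: "complex_of_real a = z \<Longrightarrow> a \<ge> 0 \<Longrightarrow> a = cmod z"
  by auto

lemma cmod_add_square_le: "cmod a * cmod b \<le> ((cmod a)\<^sup>2 + (cmod b)\<^sup>2) / 2"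
  using sum_squares_bound[of "cmod a" "cmod b"] by simp

text \<open>An upper frame bound for the vectors \<open>v s\<close>, whose Gram-type kernel is supported on pairs with
  equal type \<open>\<tau>\<close>.\<close>
lemma frame_upper_bound:
  fixes v :: "'s \<Rightarrow> 'x \<Rightarrow> complex" and \<tau> :: "'x \<Rightarrow> 't" and mom :: "'t \<Rightarrow> real"
  assumes fin: "finite F" "finite X"
    and mom: "\<And>p q. p \<in> X \<Longrightarrow> q \<in> X \<Longrightarrow>
       (\<Sum>s\<in>F. v s p * cnj (v s q)) = (if \<tau> p = \<tau> q then of_real (mom (\<tau> p)) else 0)"
    and mom0: "\<And>p. p \<in> X \<Longrightarrow> mom (\<tau> p) \<ge> 0"
    and up: "\<And>p. p \<in> X \<Longrightarrow> mom (\<tau> p) * card {q\<in>X. \<tau> q = \<tau> p} \<le> L"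
  shows "(\<Sum>s\<in>F. (cmod (\<Sum>q\<in>X. cnj (v s q) * w q))\<^sup>2) \<le> L * (\<Sum>q\<in>X. (cmod (w q))\<^sup>2)"
proof -
  let ?e = "\<lambda>p q. if \<tau> p = \<tau> q then mom (\<tau> p) else 0"
  have "complex_of_real (\<Sum>s\<in>F. (cmod (\<Sum>q\<in>X. cnj (v s q) * w q))\<^sup>2)
     = (\<Sum>s\<in>F. (\<Sum>q\<in>X. cnj (v s q) * w q) * cnj (\<Sum>q\<in>X. cnj (v s q) * w q))"
    by (simp only: of_real_sum complex_norm_square)
  also have "\<dots> = (\<Sum>s\<in>F. \<Sum>q\<in>X. \<Sum>p\<in>X. w q * cnj (w p) * (v s p * cnj (v s q)))"
    by (simp add: sum_product mult_ac)
  also have "\<dots> = (\<Sum>q\<in>X. \<Sum>p\<in>X. \<Sum>s\<in>F. w q * cnj (w p) * (v s p * cnj (v s q)))"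
    unfolding sum.swap[of _ _ F] ..
  also have "\<dots> = (\<Sum>q\<in>X. \<Sum>p\<in>X. w q * cnj (w p) * of_real (?e p q))"
    unfolding sum_distrib_left[symmetric] by (intro sum.cong refl) (simp add: mom)
  finally have "complex_of_real (\<Sum>s\<in>F. (cmod (\<Sum>q\<in>X. cnj (v s q) * w q))\<^sup>2)
     = (\<Sum>q\<in>X. \<Sum>p\<in>X. w q * cnj (w p) * of_real (?e p q))" .
  then have "(\<Sum>s\<in>F. (cmod (\<Sum>q\<in>X. cnj (v s q) * w q))\<^sup>2)
     = cmod (\<Sum>q\<in>X. \<Sum>p\<in>X. w q * cnj (w p) * of_real (?e p q))"
    by (rule of_real_eq_cmod) (simp add: sum_nonneg)
  also have "\<dots> \<le> (\<Sum>q\<in>X. \<Sum>p\<in>X. cmod (w q) * cmod (w p) * ?e p q)"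
    by (intro order_trans[OF norm_sum] sum_mono) (auto simp: norm_mult mom0)
  \<comment> \<open>Schur's test: after the arithmetic-geometric inequality the symmetry in p and q
    leaves only the row sums of the moment matrix.\<close>
  also have "\<dots> \<le> (\<Sum>q\<in>X. \<Sum>p\<in>X. ((cmod (w q))\<^sup>2 + (cmod (w p))\<^sup>2) / 2 * ?e p q)"
    by (intro sum_mono mult_right_mono cmod_add_square_le) (auto simp: mom0)
  also have "\<dots> = (\<Sum>q\<in>X. \<Sum>p\<in>X. (cmod (w q))\<^sup>2 / 2 * ?e p q) + (\<Sum>q\<in>X. \<Sum>p\<in>X. (cmod (w p))\<^sup>2 / 2 * ?e p q)"
    by (simp only: add_divide_distrib distrib_right sum.distrib)
  also have "(\<Sum>q\<in>X. \<Sum>p\<in>X. (cmod (w p))\<^sup>2 / 2 * ?e p q) = (\<Sum>q\<in>X. \<Sum>p\<in>X. (cmod (w q))\<^sup>2 / 2 * ?e p q)"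
    by (subst sum.swap) (intro sum.cong refl, auto)
  also have "(\<Sum>q\<in>X. \<Sum>p\<in>X. (cmod (w q))\<^sup>2 / 2 * ?e p q) + (\<Sum>q\<in>X. \<Sum>p\<in>X. (cmod (w q))\<^sup>2 / 2 * ?e p q)
     = (\<Sum>q\<in>X. (cmod (w q))\<^sup>2 * (\<Sum>p\<in>X. ?e p q))"
    by (simp add: sum.distrib[symmetric] sum_distrib_left distrib_right[symmetric] del: if_split)
  also have "\<dots> \<le> (\<Sum>q\<in>X. (cmod (w q))\<^sup>2 * L)"
  proof (intro sum_mono mult_left_mono)
    fix q assume q: "q \<in> X"
    have "(\<Sum>p\<in>X. ?e p q) = (\<Sum>p\<in>{p\<in>X. \<tau> p = \<tau> q}. mom (\<tau> q))"
      using fin by (intro sum.mono_neutral_cong_right) auto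
    also have "\<dots> \<le> L" using up[OF q] by (simp add: mult.commute)
    finally show "(\<Sum>p\<in>X. ?e p q) \<le> L" .
  qed simp
  finally show ?thesis by (simp only: sum_distrib_left mult.commute[of L])
qed

text \<open>The adjoint of the analysis map has the same norm. The weights in Young's inequality are
  chosen so that the frame bound returns exactly half of the left side, which is then
  absorbed.\<close>

lemma frame_synthesis_bound:
  fixes v :: "'s \<Rightarrow> 'x \<Rightarrow> complex"
  assumes L: "L > 0" and frame: "\<And>w. (\<Sum>s\<in>F. (cmod (\<Sum>q\<in>X. cnj (v s q) * w q))\<^sup>2) \<le> L * (\<Sum>q\<in>X. (cmod (w q))\<^sup>2)"
  shows "(\<Sum>q\<in>X. (cmod (\<Sum>s\<in>F. v s q * z s))\<^sup>2) \<le> L * (\<Sum>s\<in>F. (cmod (z s))\<^sup>2)"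
proof -
  define y where "y = (\<lambda>q. \<Sum>s\<in>F. v s q * z s)"
  define b where "b = (\<lambda>s. \<Sum>q\<in>X. cnj (v s q) * y q)"
  define Y where "Y = (\<Sum>q\<in>X. (cmod (y q))\<^sup>2)"
  have "complex_of_real Y = (\<Sum>q\<in>X. y q * cnj (y q))" by (simp only: Y_def of_real_sum complex_norm_square)
  also have "\<dots> = (\<Sum>q\<in>X. \<Sum>s\<in>F. z s * (v s q * cnj (y q)))"
    by (subst (1) y_def) (simp add: sum_distrib_left sum_distrib_right mult_ac)
  also have "\<dots> = (\<Sum>s\<in>F. \<Sum>q\<in>X. z s * (v s q * cnj (y q)))" by (rule sum.swap)
  also have "\<dots> = (\<Sum>s\<in>F. z s * cnj (b s))" by (simp add: b_def sum_distrib_left)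
  finally have "Y = cmod (\<Sum>s\<in>F. z s * cnj (b s))"
    by (rule of_real_eq_cmod) (simp add: Y_def sum_nonneg)
  also have "\<dots> \<le> (\<Sum>s\<in>F. cmod (z s) * cmod (b s))"
    by (intro order_trans[OF norm_sum] sum_mono) (simp add: norm_mult)
  also have "\<dots> \<le> (\<Sum>s\<in>F. L / 2 * (cmod (z s))\<^sup>2 + 1 / (2 * L) * (cmod (b s))\<^sup>2)"
  proof (intro sum_mono)
    fix s
    have "0 \<le> (L * cmod (z s) - cmod (b s))\<^sup>2" by simp
    then have "2 * (L * (cmod (z s) * cmod (b s))) \<le> L\<^sup>2 * (cmod (z s))\<^sup>2 + (cmod (b s))\<^sup>2"
      by (simp add: power2_diff power_mult_distrib mult_ac)
    then show "cmod (z s) * cmod (b s) \<le> L / 2 * (cmod (z s))\<^sup>2 + 1 / (2 * L) * (cmod (b s))\<^sup>2"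
      using L by (simp add: field_simps power2_eq_square)
  qed
  also have "\<dots> = L / 2 * (\<Sum>s\<in>F. (cmod (z s))\<^sup>2) + 1 / (2 * L) * (\<Sum>s\<in>F. (cmod (b s))\<^sup>2)"
    by (simp only: sum.distrib sum_distrib_left)
  also have "\<dots> \<le> L / 2 * (\<Sum>s\<in>F. (cmod (z s))\<^sup>2) + 1 / (2 * L) * (L * Y)"
    unfolding b_def Y_def using L by (intro add_left_mono mult_left_mono frame) auto
  also have "1 / (2 * L) * (L * Y) = Y / 2" using L by simp
  finally show ?thesis unfolding Y_def y_def by simp
qed

text \<open>On vectors that depend only on the type the moment operator multiplies by an eigenvalue
  c. Dividing \<psi> by c before taking inner products with the family gives coefficients that
  reproduce \<psi> (the canonical dual frame).\<close>

lemma frame_representation: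
  fixes v :: "'s \<Rightarrow> 'x \<Rightarrow> complex" and \<tau> :: "'x \<Rightarrow> 't" and mom :: "'t \<Rightarrow> real"
  assumes fin: "finite F" "finite X"
    and mom: "\<And>p q. p \<in> X \<Longrightarrow> q \<in> X \<Longrightarrow>
       (\<Sum>s\<in>F. v s p * cnj (v s q)) = (if \<tau> p = \<tau> q then of_real (mom (\<tau> p)) else 0)"
    and low: "\<And>p. p \<in> X \<Longrightarrow> t \<le> mom (\<tau> p) * card {q\<in>X. \<tau> q = \<tau> p}" and t: "t > 0"
    and sym: "\<And>p q. p \<in> X \<Longrightarrow> q \<in> X \<Longrightarrow> \<tau> p = \<tau> q \<Longrightarrow> \<psi> p = \<psi> q"
  obtains f where "\<And>p. p \<in> X \<Longrightarrow> \<psi> p = (\<Sum>s\<in>F. v s p * f s)"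
    "(\<Sum>s\<in>F. (cmod (f s))\<^sup>2) \<le> (\<Sum>p\<in>X. (cmod (\<psi> p))\<^sup>2) / t"
proof -
  \<comment> \<open>The eigenvalue on the type of p: the common matrix entry times the size of the
    type class.\<close>
  define c where "c = (\<lambda>p. mom (\<tau> p) * card {q\<in>X. \<tau> q = \<tau> p})"
  define f where "f = (\<lambda>s. \<Sum>q\<in>X. cnj (v s q) * (\<psi> q / of_real (c q)))"
  have c0: "c p > 0" "c p \<ge> t" if "p \<in> X" for p using low[OF that] t by (auto simp: c_def)
  have cc: "c q = c p" if "\<tau> q = \<tau> p" for p q using that by (simp add: c_def)
  have rep: "\<psi> p = (\<Sum>s\<in>F. v s p * f s)" if p: "p \<in> X" for p
  proof -
    have "(\<Sum>s\<in>F. v s p * f s) = (\<Sum>s\<in>F. \<Sum>q\<in>X. (\<psi> q / of_real (c q)) * (v s p * cnj (v s q)))"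
      by (simp add: f_def sum_distrib_left mult_ac)
    also have "\<dots> = (\<Sum>q\<in>X. (\<psi> q / of_real (c q)) * (\<Sum>s\<in>F. v s p * cnj (v s q)))"
      by (subst sum.swap) (simp add: sum_distrib_left)
    also have "\<dots> = (\<Sum>q\<in>X. if \<tau> q = \<tau> p then \<psi> p / of_real (c p) * of_real (mom (\<tau> p)) else 0)"
    proof (intro sum.cong refl)
      fix q assume q: "q \<in> X"
      show "\<psi> q / of_real (c q) * (\<Sum>s\<in>F. v s p * cnj (v s q))
         = (if \<tau> q = \<tau> p then \<psi> p / of_real (c p) * of_real (mom (\<tau> p)) else 0)"
      proof (cases "\<tau> q = \<tau> p")
        case True
        then show ?thesis unfolding mom[OF p q] cc[OF True] sym[OF q p True] by simp
      next
        case False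
        then show ?thesis unfolding mom[OF p q] by auto
      qed
    qed
    also have "\<dots> = (\<Sum>q\<in>{q\<in>X. \<tau> q = \<tau> p}. \<psi> p / of_real (c p) * of_real (mom (\<tau> p)))"
      using fin by (intro sum.mono_neutral_cong_right) auto
    also have "\<dots> = \<psi> p / of_real (c p) * of_real (c p)"
      by (simp add: c_def)
    also have "\<dots> = \<psi> p" using c0[OF p] by simp
    finally show ?thesis by simp
  qed
  have "complex_of_real (\<Sum>s\<in>F. (cmod (f s))\<^sup>2) = (\<Sum>s\<in>F. cnj (f s) * f s)"
    by (rule sum_cnj_self[symmetric])
  also have "\<dots> = (\<Sum>s\<in>F. \<Sum>q\<in>X. cnj (\<psi> q / of_real (c q)) * (v s q * f s))"
    by (subst (1) f_def) (simp add: sum_distrib_left sum_distrib_right mult_ac)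
  also have "\<dots> = (\<Sum>q\<in>X. cnj (\<psi> q / of_real (c q)) * (\<Sum>s\<in>F. v s q * f s))"
    by (subst sum.swap) (simp add: sum_distrib_left)
  also have "\<dots> = (\<Sum>q\<in>X. cnj (\<psi> q / of_real (c q)) * \<psi> q)"
    by (intro sum.cong refl) (simp add: rep[symmetric])
  also have "\<dots> = (\<Sum>q\<in>X. of_real ((cmod (\<psi> q))\<^sup>2 / c q))"
    by (intro sum.cong refl) (simp add: complex_norm_square mult.commute flip: of_real_power)
  finally have "complex_of_real (\<Sum>s\<in>F. (cmod (f s))\<^sup>2) = complex_of_real (\<Sum>q\<in>X. (cmod (\<psi> q))\<^sup>2 / c q)"
    by (simp only: of_real_sum)
  then have "(\<Sum>s\<in>F. (cmod (f s))\<^sup>2) = (\<Sum>q\<in>X. (cmod (\<psi> q))\<^sup>2 / c q)" by (simp only: of_real_eq_iff)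
  also have "\<dots> \<le> (\<Sum>q\<in>X. (cmod (\<psi> q))\<^sup>2 / t)"
    using c0 t by (intro sum_mono divide_left_mono) (auto simp: mult_pos_pos)
  finally show ?thesis using that[OF rep] by (simp add: sum_divide_distrib)
qed

section \<open>Purification of a permutation invariant state\<close>

definition partial_state :: "'j set \<Rightarrow> ('j \<times> 'j \<Rightarrow> complex) \<Rightarrow> 'j op" where
  "partial_state J \<phi> = (\<lambda>x y. if x \<in> J \<and> y \<in> J then \<Sum>e\<in>J. \<phi> (x, e) * cnj (\<phi> (y, e)) else 0)"

lemma partial_state_states:
  assumes "finite J" "(\<Sum>x\<in>J \<times> J. (cmod (\<phi> x))\<^sup>2) = 1"
  shows "partial_state J \<phi> \<in> states J"
proof -
  have "pos_kernel J (\<lambda>x y. \<Sum>e\<in>J. \<phi> (x, e) * cnj (\<phi> (y, e)))"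
    by (intro pos_kernel_sum pos_kernel_outer[where v = "\<lambda>x. \<phi> (x, _)"])
  then have "pos_kernel J (partial_state J \<phi>)"
    by (rule iffD1[OF pos_kernel_cong, rotated]) (simp add: partial_state_def)
  moreover have "op_trace J (partial_state J \<phi>) = of_real (\<Sum>x\<in>J \<times> J. (cmod (\<phi> x))\<^sup>2)"
    using assms(1) unfolding op_trace_def partial_state_def of_real_sum complex_norm_square
    by (simp add: sum_Times)
  ultimately show ?thesis using assms(2) by (auto simp: states_def psd_iff is_op_def partial_state_def)
qed

lemma prod_list_map_zip:
  fixes f :: "'a \<times> 'b \<Rightarrow> complex"
  assumes "length xs = n" "length ys = n"
  shows "prod_list (map f (zip xs ys)) = (\<Prod>k<n. f (xs ! k, ys ! k))"
  using assms by (subst prod.list_conv_set_nth) (auto simp: atLeast0LessThan intro!: prod.cong)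

lemma sum_swap_pairs:
  "(\<Sum>a\<in>A. \<Sum>b\<in>B. \<Sum>c\<in>C. \<Sum>d\<in>D. g a b c d) = (\<Sum>c\<in>C. \<Sum>d\<in>D. \<Sum>a\<in>A. \<Sum>b\<in>B. g a b c d)"
proof -
  have "(\<Sum>a\<in>A. \<Sum>b\<in>B. \<Sum>c\<in>C. \<Sum>d\<in>D. g a b c d) = (\<Sum>a\<in>A. \<Sum>c\<in>C. \<Sum>b\<in>B. \<Sum>d\<in>D. g a b c d)"
    by (intro sum.cong refl sum.swap)
  also have "\<dots> = (\<Sum>c\<in>C. \<Sum>a\<in>A. \<Sum>b\<in>B. \<Sum>d\<in>D. g a b c d)" by (rule sum.swap)
  also have "\<dots> = (\<Sum>c\<in>C. \<Sum>a\<in>A. \<Sum>d\<in>D. \<Sum>b\<in>B. g a b c d)"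
    by (intro sum.cong refl sum.swap)
  also have "\<dots> = (\<Sum>c\<in>C. \<Sum>d\<in>D. \<Sum>a\<in>A. \<Sum>b\<in>B. g a b c d)"
    by (intro sum.cong refl sum.swap)
  finally show ?thesis .
qed

lemma pairing_tensor_partial_state:
  assumes fin: "finite J"
    and G: "\<And>xs ys. xs \<in> lists_n J n \<Longrightarrow> ys \<in> lists_n J n \<Longrightarrow> G xs ys = (\<Sum>r\<in>I. V r xs * cnj (V r ys))"
  shows "pairing (lists_n J n) G (tensor_list J n (partial_state J \<phi>))
     = of_real (\<Sum>r\<in>I. \<Sum>es\<in>lists_n J n. (cmod (\<Sum>xs\<in>lists_n J n. V r xs * prod_list (map \<phi> (zip xs es))))\<^sup>2)"
proof -
  let ?L = "lists_n J n" and ?p = "\<lambda>xs es. prod_list (map \<phi> (zip xs es))"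
  have t: "tensor_list J n (partial_state J \<phi>) xs ys = (\<Sum>es\<in>?L. ?p xs es * cnj (?p ys es))"
    if "xs \<in> ?L" "ys \<in> ?L" for xs ys
  proof -
    have "tensor_list J n (partial_state J \<phi>) xs ys = (\<Prod>k<n. \<Sum>e\<in>J. \<phi> (xs ! k, e) * cnj (\<phi> (ys ! k, e)))"
      using that by (auto simp: tensor_list_def partial_state_def lists_n_nth intro!: prod.cong)
    also have "\<dots> = (\<Sum>es\<in>?L. \<Prod>k<n. \<phi> (xs ! k, es ! k) * cnj (\<phi> (ys ! k, es ! k)))"
      using sum_lists_prod[OF fin, where f = "\<lambda>k e. \<phi> (xs ! k, e) * cnj (\<phi> (ys ! k, e))"] by simp
    also have "\<dots> = (\<Sum>es\<in>?L. ?p xs es * cnj (?p ys es))"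
      using that by (intro sum.cong refl) (simp add: prod_list_map_zip lists_n_length prod.distrib)
    finally show ?thesis .
  qed
  have "pairing ?L G (tensor_list J n (partial_state J \<phi>))
     = (\<Sum>xs\<in>?L. \<Sum>ys\<in>?L. \<Sum>r\<in>I. \<Sum>es\<in>?L. (V r xs * ?p xs es) * cnj (V r ys * ?p ys es))"
    unfolding pairing_def by (intro sum.cong refl) (simp add: G t sum_product mult_ac)
  also have "\<dots> = (\<Sum>r\<in>I. \<Sum>es\<in>?L. \<Sum>xs\<in>?L. \<Sum>ys\<in>?L. (V r xs * ?p xs es) * cnj (V r ys * ?p ys es))"
    by (rule sum_swap_pairs)
  also have "\<dots> = (\<Sum>r\<in>I. \<Sum>es\<in>?L. (\<Sum>xs\<in>?L. V r xs * ?p xs es) * cnj (\<Sum>xs\<in>?L. V r xs * ?p xs es))"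
    by (simp add: sum_product)
  finally show ?thesis by (simp only: of_real_sum complex_norm_square)
qed

lemma permute_lists_n:
  assumes "\<pi> permutes {..<m}" "xs \<in> lists_n J m"
  shows "permute_list \<pi> xs \<in> lists_n J m"
  using assms by (auto simp: lists_n_eq)

lemma permute_list_inverse:
  assumes "\<pi> permutes {..<m}" "length xs = m"
  shows "permute_list \<pi> (permute_list (inv \<pi>) xs) = xs" "permute_list (inv \<pi>) (permute_list \<pi> xs) = xs"
proof -
  have p: "\<pi> permutes {..<length xs}" "inv \<pi> permutes {..<length xs}"
    using assms permutes_inv by auto
  show "permute_list \<pi> (permute_list (inv \<pi>) xs) = xs" "permute_list (inv \<pi>) (permute_list \<pi> xs) = xs"
    using permute_list_compose[OF p(1), of "inv \<pi>"] permute_list_compose[OF p(2), of \<pi>]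
      permutes_inv_o[OF p(1)] by simp_all
qed

lemma bij_betw_permute_list:
  assumes "\<pi> permutes {..<m}"
  shows "bij_betw (permute_list \<pi>) (lists_n J m) (lists_n J m)"
  by (rule bij_betw_byWitness[where f' = "permute_list (inv \<pi>)"])
    (use assms permutes_inv[OF assms] in \<open>auto simp: permute_list_inverse lists_n_length permute_lists_n\<close>)

text \<open>The permuted square root is again positive and squares to the same \<omega>, so
  uniqueness identifies it with the original one.\<close>

lemma op_sqrt_permute:
  assumes fin: "finite J" and \<omega>: "psd (lists_n J m) \<omega>" and \<pi>: "\<pi> permutes {..<m}"
    and inv: "\<And>xs ys. xs \<in> lists_n J m \<Longrightarrow> ys \<in> lists_n J m \<Longrightarrow> \<omega> (permute_list \<pi> xs) (permute_list \<pi> ys) = \<omega> xs ys"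
    and xs: "xs \<in> lists_n J m" "ys \<in> lists_n J m"
  shows "op_sqrt (lists_n J m) \<omega> (permute_list \<pi> xs) (permute_list \<pi> ys) = op_sqrt (lists_n J m) \<omega> xs ys"
proof -
  let ?L = "lists_n J m"
  define B where "B = op_sqrt ?L \<omega>"
  have B: "psd ?L B" "op_mult ?L B B = \<omega>" using op_sqrt_psd[OF _ \<omega>] fin by (auto simp: B_def)
  define C where "C = (\<lambda>xs ys. if xs \<in> ?L \<and> ys \<in> ?L then B (permute_list \<pi> xs) (permute_list \<pi> ys) else 0)"
  have "pos_kernel ?L (\<lambda>xs ys. B (permute_list \<pi> xs) (permute_list \<pi> ys))"
    by (rule pos_kernel_reindex[of ?L ?L "permute_list \<pi>" B]) (use fin B(1) permute_lists_n[OF \<pi>] in \<open>auto simp: psd_iff\<close>)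
  then have "pos_kernel ?L C"
    by (rule iffD1[OF pos_kernel_cong, rotated]) (simp add: C_def)
  then have C: "psd ?L C" by (auto simp: psd_iff is_op_def C_def)
  have "op_mult ?L C C = \<omega>"
  proof (intro ext)
    fix xs ys
    show "op_mult ?L C C xs ys = \<omega> xs ys"
    proof (cases "xs \<in> ?L \<and> ys \<in> ?L")
      case True
      then have "op_mult ?L C C xs ys = (\<Sum>zs\<in>?L. B (permute_list \<pi> xs) (permute_list \<pi> zs) * B (permute_list \<pi> zs) (permute_list \<pi> ys))"
        by (simp add: op_mult_def C_def)
      also have "\<dots> = (\<Sum>zs\<in>?L. B (permute_list \<pi> xs) zs * B zs (permute_list \<pi> ys))"
        by (rule sum.reindex_bij_betw[OF bij_betw_permute_list[OF \<pi>], where g = "\<lambda>zs. B (permute_list \<pi> xs) zs * B zs (permute_list \<pi> ys)"])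
      also have "\<dots> = \<omega> (permute_list \<pi> xs) (permute_list \<pi> ys)" by (simp add: B(2)[symmetric] op_mult_def)
      finally show ?thesis using True inv by simp
    next
      case False
      then show ?thesis using \<omega> by (auto simp: op_mult_def C_def psd_iff is_op_def intro!: sum.neutral)
    qed
  qed
  then have "C = B" using psd_sqrt_unique[OF _ C B(1)] B(2) fin by simp
  from fun_cong[OF fun_cong[OF this, of xs], of ys] show ?thesis using xs by (simp add: C_def B_def)
qed

text \<open>The square root of \<omega>, read as a vector \<psi> on lists over J \<times> J,
  purifies \<omega>: the second entries are the environment. Reducing to n systems sums over the
  environment of these and over both parts of the other l systems.\<close>

lemma reduced_eq_sqrt:
  assumes fin: "finite J" and \<omega>: "psd (lists_n J (n + l)) \<omega>"
    and xs: "xs \<in> lists_n J n" "ys \<in> lists_n J n"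
  defines "\<psi> \<equiv> \<lambda>ps. op_sqrt (lists_n J (n + l)) \<omega> (map fst ps) (map snd ps)"
  shows "reduced J n l \<omega> xs ys
     = (\<Sum>es\<in>lists_n J n. \<Sum>qs\<in>lists_n (J \<times> J) l. \<psi> (zip xs es @ qs) * cnj (\<psi> (zip ys es @ qs)))"
proof -
  let ?L = "lists_n J (n + l)"
  define B where "B = op_sqrt ?L \<omega>"
  have B: "psd ?L B" "op_mult ?L B B = \<omega>" using op_sqrt_psd[OF _ \<omega>] fin by (auto simp: B_def)
  have w: "\<omega> as bs = (\<Sum>es\<in>?L. B as es * cnj (B bs es))" for as bs
    using psd_op_mult_self_eq[OF _ B(1), of as bs] B(2) fin by simp
  have "reduced J n l \<omega> xs ys = (\<Sum>us\<in>lists_n J l. \<Sum>es\<in>lists_n J n. \<Sum>es'\<in>lists_n J l.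
      B (xs @ us) (es @ es') * cnj (B (ys @ us) (es @ es')))"
    using xs by (simp add: reduced_def w sum_lists_append fin)
  also have "\<dots> = (\<Sum>es\<in>lists_n J n. \<Sum>us\<in>lists_n J l. \<Sum>es'\<in>lists_n J l.
      B (xs @ us) (es @ es') * cnj (B (ys @ us) (es @ es')))"
    by (rule sum.swap)
  also have "\<dots> = (\<Sum>es\<in>lists_n J n. \<Sum>us\<in>lists_n J l. \<Sum>es'\<in>lists_n J l.
      \<psi> (zip xs es @ zip us es') * cnj (\<psi> (zip ys es @ zip us es')))"
    using xs by (intro sum.cong refl) (simp add: \<psi>_def B_def lists_n_length)
  finally show ?thesis by (simp add: sum_lists_zip fin)
qed

lemma sum_square_sqrt:
  assumes fin: "finite J" and \<omega>: "psd (lists_n J m) \<omega>"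
  shows "(\<Sum>ps\<in>lists_n (J \<times> J) m. (cmod (op_sqrt (lists_n J m) \<omega> (map fst ps) (map snd ps)))\<^sup>2)
     = Re (op_trace (lists_n J m) \<omega>)"
proof -
  let ?L = "lists_n J m"
  define B where "B = op_sqrt ?L \<omega>"
  have B: "psd ?L B" "op_mult ?L B B = \<omega>" using op_sqrt_psd[OF _ \<omega>] fin by (auto simp: B_def)
  have "op_trace ?L \<omega> = (\<Sum>xs\<in>?L. \<Sum>es\<in>?L. B xs es * cnj (B xs es))"
    unfolding op_trace_def B(2)[symmetric] by (intro sum.cong refl psd_op_mult_self_eq[OF _ B(1)]) (use fin in simp)
  also have "\<dots> = of_real (\<Sum>xs\<in>?L. \<Sum>es\<in>?L. (cmod (B xs es))\<^sup>2)"
    by (simp only: of_real_sum complex_norm_square)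
  finally have "Re (op_trace ?L \<omega>) = (\<Sum>xs\<in>?L. \<Sum>es\<in>?L. (cmod (B xs es))\<^sup>2)"
    by (simp only: Re_complex_of_real)
  also have "\<dots> = (\<Sum>ps\<in>lists_n (J \<times> J) m. (cmod (B (map fst ps) (map snd ps)))\<^sup>2)"
    by (simp add: sum_lists_zip fin lists_n_length)
  finally show ?thesis by (simp add: B_def)
qed

text \<open>S is fixed before G, \<omega> and \<epsilon>: the derandomisation selects its samples
  against S, which is also why its cardinality has to be polynomial in n + l.\<close>

lemma de_finetti_bound:
  fixes J :: "'j set" and n l :: nat
  assumes finJ: "finite J" and ne: "J \<noteq> {}" and l: "l > 0"
  obtains S where "finite S" "S \<subseteq> states J"
    "card S \<le> (5 * (n + l + card (J \<times> J))\<^sup>2) ^ card (J \<times> J) * (n + l + card (J \<times> J)) ^ card (J \<times> J)"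
    "\<And>G \<omega> \<epsilon>. pos_kernel (lists_n J n) G \<Longrightarrow> psd (lists_n J (n + l)) \<omega> \<Longrightarrow>
       (\<And>\<pi> xs ys. \<pi> permutes {..<n + l} \<Longrightarrow> xs \<in> lists_n J (n + l) \<Longrightarrow> ys \<in> lists_n J (n + l) \<Longrightarrow>
          \<omega> (permute_list \<pi> xs) (permute_list \<pi> ys) = \<omega> xs ys) \<Longrightarrow>
       \<epsilon> \<ge> 0 \<Longrightarrow> (\<And>\<sigma>. \<sigma> \<in> S \<Longrightarrow> Re (pairing (lists_n J n) G (tensor_list J n \<sigma>)) \<le> \<epsilon>) \<Longrightarrow>
       Re (pairing (lists_n J n) G (reduced J n l \<omega>))
         \<le> 2 * (real (n + l) / l) ^ (card (J \<times> J) - 1) * \<epsilon> * Re (op_trace (lists_n J (n + l)) \<omega>)"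
proof -
  let ?D = "J \<times> J"
  have finD: "finite ?D" "?D \<noteq> {}" using finJ ne by auto
  define e where "e = card ?D - 1"
  have cD: "card ?D = e + 1" using finD by (simp add: e_def card_gt_0_iff Suc_leI del: card_cartesian_product)
  define N where "N = n + l"
  \<comment> \<open>Q is the discretisation required by \<open>moment_ratio\<close>; m = N + 1 below
    exceeds every exponent that occurs at lengths up to N.\<close>
  define Q where "Q = 4 * (N + e + 1)\<^sup>2"
  have Q0: "Q > 0" by (simp add: Q_def)
  define m where "m = N + 1"
  define F where "F = sym_index ?D Q m"
  define \<phi> where "\<phi> = (\<lambda>s. sym_vec Q m s :: 'j \<times> 'j \<Rightarrow> complex)"
  define v where "v = (\<lambda>s ps. prod_list (map (\<phi> s) ps))"
  define S where "S = (\<lambda>s. partial_state J (\<phi> s)) ` F"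
  define mom where "mom = (\<lambda>K M. real m ^ card ?D * real (comp_moment ?D Q (count M)) / real Q ^ K)"
  define t where "t = real m ^ card ?D * (real (fact N * ((Q + e) choose (N + e))) / real Q ^ N)"
  define L where "L = real m ^ card ?D * (real (fact l * ((Q + l + e) choose (l + e))) / real Q ^ l)"
  have finF: "finite F" unfolding F_def by (rule finite_sym_index[OF finD(1)])
  have m0: "real m ^ card ?D > 0" by (simp add: m_def)
  have "N + e \<le> Q + e" by (simp add: Q_def power2_eq_square)
  then have t0: "t > 0" using m0 Q0 unfolding t_def by (intro mult_pos_pos divide_pos_pos) auto
  have L0: "L > 0" using m0 Q0 unfolding L_def by (intro mult_pos_pos divide_pos_pos) auto
  have Lt: "L \<le> 2 * (real N / l) ^ e * t"
    using mult_left_mono[OF moment_ratio[of l N Q e, OF l _ Q_def], of "real m ^ card ?D"] m0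
    by (simp add: L_def t_def N_def mult_ac)
  have mom: "(\<Sum>s\<in>F. v s p * cnj (v s q)) = (if mset p = mset q then of_real (mom K (mset p)) else 0)"
    if "K \<le> N" "p \<in> lists_n ?D K" "q \<in> lists_n ?D K" for K p q
    unfolding v_def F_def \<phi>_def mom_def using that by (intro sym_vec_moment[OF finD(1)]) (auto simp: m_def)
  \<comment> \<open>The size of the type class cancels the factorials in the bounds on the moment,
    so all eigenvalues at length K lie between two numbers that do not depend on the type.\<close>
  have bnd: "real m ^ card ?D * (real (fact K * ((Q + e) choose (K + e))) / real Q ^ K) \<le> mom K (mset p) * card {q \<in> lists_n ?D K. mset q = mset p}"
      "mom K (mset p) * card {q \<in> lists_n ?D K. mset q = mset p} \<le> real m ^ card ?D * (real (fact K * ((Q + K + e) choose (K + e))) / real Q ^ K)"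
    if p: "p \<in> lists_n ?D K" for K p
  proof -
    let ?c = "card {q \<in> lists_n ?D K. mset q = mset p}" and ?f = "\<Prod>x\<in>?D. fact (count (mset p) x) :: nat"
    have cf: "?c * ?f = fact K" by (rule card_lists_with_mset[OF finD(1) p])
    have sc: "sum (count (mset p)) ?D = K" by (rule sum_count_mset[OF finD(1) p])
    have "fact K * ((Q + e) choose (K + e)) = ?c * (?f * ((Q + e) choose (K + e)))" by (simp only: cf[symmetric] mult.assoc)
    also have "\<dots> \<le> ?c * comp_moment ?D Q (count (mset p))"
      using comp_moment_ge[OF finD, of "count (mset p)" Q] by (intro mult_left_mono) (simp_all add: sc cD del: card_cartesian_product)
    finally have 1: "real (fact K * ((Q + e) choose (K + e))) \<le> real (?c * comp_moment ?D Q (count (mset p)))"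
      by (simp only: of_nat_le_iff)
    have "?c * comp_moment ?D Q (count (mset p)) \<le> ?c * (?f * ((Q + K + e) choose (K + e)))"
      using comp_moment_le[OF finD, of Q "count (mset p)"] by (intro mult_left_mono) (simp_all add: sc cD del: card_cartesian_product)
    also have "\<dots> = fact K * ((Q + K + e) choose (K + e))" by (simp only: cf[symmetric] mult.assoc)
    finally have 2: "real (?c * comp_moment ?D Q (count (mset p))) \<le> real (fact K * ((Q + K + e) choose (K + e)))"
      by (simp only: of_nat_le_iff)
    have 3: "mom K (mset p) * ?c = real m ^ card ?D * (real (?c * comp_moment ?D Q (count (mset p))) / real Q ^ K)"
      by (simp add: mom_def mult_ac del: card_cartesian_product)
    show "real m ^ card ?D * (real (fact K * ((Q + e) choose (K + e))) / real Q ^ K) \<le> mom K (mset p) * ?c"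
      unfolding 3 using 1 m0 by (intro mult_left_mono divide_right_mono) auto
    show "mom K (mset p) * ?c \<le> real m ^ card ?D * (real (fact K * ((Q + K + e) choose (K + e))) / real Q ^ K)"
      unfolding 3 using 2 m0 by (intro mult_left_mono divide_right_mono) auto
  qed
  have mom0: "mom K M \<ge> 0" for K M by (simp add: mom_def)
  have frame: "(\<Sum>s\<in>F. (cmod (\<Sum>q\<in>lists_n ?D l. cnj (v s q) * w q))\<^sup>2) \<le> L * (\<Sum>q\<in>lists_n ?D l. (cmod (w q))\<^sup>2)" for w
    by (rule frame_upper_bound[where \<tau> = mset and mom = "mom l", OF finF _ mom mom0])
      (use finD bnd(2)[of _ l] in \<open>auto simp: N_def L_def\<close>)
  show ?thesis
  proof (rule that)
    show "finite S" using finF by (simp add: S_def)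
    show "S \<subseteq> states J"
      unfolding S_def F_def \<phi>_def using norm_sym_vec[OF finD(1) _ Q0] partial_state_states[OF finJ] by blast
    have "card S \<le> card F" unfolding S_def using finF by (rule card_image_le)
    also have "\<dots> \<le> (Q + 1) ^ card ?D * m ^ card ?D" unfolding F_def by (rule card_sym_index[OF finD(1)])
    also have "\<dots> \<le> (5 * (N + card ?D)\<^sup>2) ^ card ?D * (N + card ?D) ^ card ?D"
    proof (intro mult_mono power_mono)
      show "Q + 1 \<le> 5 * (N + card ?D)\<^sup>2" by (simp add: Q_def cD power2_eq_square del: card_cartesian_product)
      show "m \<le> N + card ?D" by (simp add: m_def cD del: card_cartesian_product)
    qed auto
    finally show "card S \<le> (5 * (n + l + card ?D)\<^sup>2) ^ card ?D * (n + l + card ?D) ^ card ?D" by (simp only: N_def)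
  next
    fix G \<omega> and \<epsilon> :: real
    assume G: "pos_kernel (lists_n J n) G" and \<omega>: "psd (lists_n J (n + l)) \<omega>"
      and inv: "\<And>\<pi> xs ys. \<pi> permutes {..<n + l} \<Longrightarrow> xs \<in> lists_n J (n + l) \<Longrightarrow> ys \<in> lists_n J (n + l) \<Longrightarrow>
          \<omega> (permute_list \<pi> xs) (permute_list \<pi> ys) = \<omega> xs ys"
      and \<epsilon>: "\<epsilon> \<ge> 0" and S: "\<And>\<sigma>. \<sigma> \<in> S \<Longrightarrow> Re (pairing (lists_n J n) G (tensor_list J n \<sigma>)) \<le> \<epsilon>"
    let ?Ln = "lists_n J n"
    define \<psi> where "\<psi> = (\<lambda>ps. op_sqrt (lists_n J (n + l)) \<omega> (map fst ps) (map snd ps))"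
    define T where "T = Re (op_trace (lists_n J (n + l)) \<omega>)"
    \<comment> \<open>Lists with the same multiset differ by a permutation, which acts on system and
      environment at once, and the square root inherits the invariance of \<omega>.\<close>
    have sym: "\<psi> p = \<psi> q" if pq: "p \<in> lists_n ?D N" "q \<in> lists_n ?D N" "mset p = mset q" for p q
    proof -
      obtain \<pi> where \<pi>: "\<pi> permutes {..<length q}" "permute_list \<pi> q = p"
        using mset_eq_permutation[OF pq(3)] by blast
      have len: "length q = n + l" using pq by (simp add: lists_n_length N_def)
      have mem: "map fst q \<in> lists_n J (n + l)" "map snd q \<in> lists_n J (n + l)"
        using pq(2) by (auto simp: lists_n_eq N_def)
      have "map fst p = permute_list \<pi> (map fst q)" "map snd p = permute_list \<pi> (map snd q)"
        using \<pi> by (simp_all add: permute_list_map)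
      then show ?thesis
        unfolding \<psi>_def using op_sqrt_permute[OF finJ \<omega> \<pi>(1)[unfolded len] inv mem] \<pi>(1) len by simp
    qed
    have finX: "finite (lists_n ?D N)" using finD(1) by (rule finite_lists_n)
    obtain f where f: "\<And>p. p \<in> lists_n ?D N \<Longrightarrow> \<psi> p = (\<Sum>s\<in>F. v s p * f s)"
        and f2: "(\<Sum>s\<in>F. (cmod (f s))\<^sup>2) \<le> (\<Sum>p\<in>lists_n ?D N. (cmod (\<psi> p))\<^sup>2) / t"
      using frame_representation[of F "lists_n ?D N" v mset "mom N" t \<psi>, OF finF finX mom[OF order_refl] _ t0 sym]
        bnd(1)[of _ N] unfolding t_def by blast
    have "(\<Sum>p\<in>lists_n ?D N. (cmod (\<psi> p))\<^sup>2) = T"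
      unfolding \<psi>_def N_def T_def by (rule sum_square_sqrt[OF finJ \<omega>])
    with f2 have fT: "(\<Sum>s\<in>F. (cmod (f s))\<^sup>2) \<le> T / t" by simp
    have T0: "T \<ge> 0" unfolding T_def using psd_trace(2)[OF _ \<omega>] finJ by simp
    obtain V where V: "\<And>i j. i \<in> ?Ln \<Longrightarrow> j \<in> ?Ln \<Longrightarrow> G i j = (\<Sum>r\<in>?Ln. V r i * cnj (V r j))"
      using pos_kernel_decomp[OF _ G] finJ by (metis finite_lists_n)
    have red: "reduced J n l \<omega> xs ys = (\<Sum>p\<in>?Ln \<times> lists_n ?D l. \<psi> (zip xs (fst p) @ snd p) * cnj (\<psi> (zip ys (fst p) @ snd p)))"
      if "xs \<in> ?Ln" "ys \<in> ?Ln" for xs ys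
      unfolding reduced_eq_sqrt[OF finJ \<omega> that] \<psi>_def by (simp add: sum_Times finJ del: map_append)
    have "pairing ?Ln G (reduced J n l \<omega>) = (\<Sum>xs\<in>?Ln. \<Sum>ys\<in>?Ln. \<Sum>r\<in>?Ln. \<Sum>p\<in>?Ln \<times> lists_n ?D l.
        (V r xs * \<psi> (zip xs (fst p) @ snd p)) * cnj (V r ys * \<psi> (zip ys (fst p) @ snd p)))"
      unfolding pairing_def
      by (intro sum.cong refl) (simp add: V red sum_product mult_ac)
    also have "\<dots> = (\<Sum>r\<in>?Ln. \<Sum>p\<in>?Ln \<times> lists_n ?D l. \<Sum>xs\<in>?Ln. \<Sum>ys\<in>?Ln.
        (V r xs * \<psi> (zip xs (fst p) @ snd p)) * cnj (V r ys * \<psi> (zip ys (fst p) @ snd p)))"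
      by (rule sum_swap_pairs)
    also have "\<dots> = (\<Sum>r\<in>?Ln. \<Sum>p\<in>?Ln \<times> lists_n ?D l.
        (\<Sum>xs\<in>?Ln. V r xs * \<psi> (zip xs (fst p) @ snd p)) * cnj (\<Sum>xs\<in>?Ln. V r xs * \<psi> (zip xs (fst p) @ snd p)))"
      by (simp add: sum_product)
    also have "\<dots> = of_real (\<Sum>r\<in>?Ln. \<Sum>p\<in>?Ln \<times> lists_n ?D l. (cmod (\<Sum>xs\<in>?Ln. V r xs * \<psi> (zip xs (fst p) @ snd p)))\<^sup>2)"
      by (simp only: of_real_sum complex_norm_square)
    finally have "Re (pairing ?Ln G (reduced J n l \<omega>))
       = (\<Sum>r\<in>?Ln. \<Sum>es\<in>?Ln. \<Sum>qs\<in>lists_n ?D l. (cmod (\<Sum>xs\<in>?Ln. V r xs * \<psi> (zip xs es @ qs)))\<^sup>2)"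
      by (simp add: sum_Times finJ finD)
    \<comment> \<open>For fixed r and es the vector in qs is a combination of the product vectors of
      length l. The upper frame bound at that length replaces the square of the sum over s by a sum
      of squares; each square then belongs to a single product vector and thus to one test state in
      S.\<close>
    also have "\<dots> \<le> (\<Sum>r\<in>?Ln. \<Sum>es\<in>?Ln. L * (\<Sum>s\<in>F. (cmod (f s * (\<Sum>xs\<in>?Ln. V r xs * v s (zip xs es))))\<^sup>2))"
    proof (intro sum_mono)
      fix r es assume es: "es \<in> ?Ln"
      have "(\<Sum>xs\<in>?Ln. V r xs * \<psi> (zip xs es @ qs)) = (\<Sum>s\<in>F. v s qs * (f s * (\<Sum>xs\<in>?Ln. V r xs * v s (zip xs es))))"
        if qs: "qs \<in> lists_n ?D l" for qs
      proof -
        have "\<psi> (zip xs es @ qs) = (\<Sum>s\<in>F. v s (zip xs es) * v s qs * f s)" if "xs \<in> ?Ln" for xs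
        proof -
          have "zip xs es \<in> lists_n ?D n"
            using bij_betw_apply[OF bij_betw_zip, of "(xs, es)" J n J] that es by simp
          then have "zip xs es @ qs \<in> lists_n ?D N" unfolding N_def using qs by (rule append_lists_n)
          from f[OF this] show ?thesis by (simp add: v_def)
        qed
        then have "(\<Sum>xs\<in>?Ln. V r xs * \<psi> (zip xs es @ qs)) = (\<Sum>xs\<in>?Ln. \<Sum>s\<in>F. V r xs * (v s (zip xs es) * v s qs * f s))"
          by (simp add: sum_distrib_left)
        also have "\<dots> = (\<Sum>s\<in>F. \<Sum>xs\<in>?Ln. V r xs * (v s (zip xs es) * v s qs * f s))" by (rule sum.swap)
        also have "\<dots> = (\<Sum>s\<in>F. v s qs * (f s * (\<Sum>xs\<in>?Ln. V r xs * v s (zip xs es))))"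
          by (simp add: sum_distrib_left mult_ac)
        finally show ?thesis .
      qed
      then have "(\<Sum>qs\<in>lists_n ?D l. (cmod (\<Sum>xs\<in>?Ln. V r xs * \<psi> (zip xs es @ qs)))\<^sup>2)
         = (\<Sum>qs\<in>lists_n ?D l. (cmod (\<Sum>s\<in>F. v s qs * (f s * (\<Sum>xs\<in>?Ln. V r xs * v s (zip xs es)))))\<^sup>2)"
        by simp
      also have "\<dots> \<le> L * (\<Sum>s\<in>F. (cmod (f s * (\<Sum>xs\<in>?Ln. V r xs * v s (zip xs es))))\<^sup>2)"
        by (rule frame_synthesis_bound[OF L0 frame])
      finally show "(\<Sum>qs\<in>lists_n ?D l. (cmod (\<Sum>xs\<in>?Ln. V r xs * \<psi> (zip xs es @ qs)))\<^sup>2)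
         \<le> L * (\<Sum>s\<in>F. (cmod (f s * (\<Sum>xs\<in>?Ln. V r xs * v s (zip xs es))))\<^sup>2)" .
    qed
    also have "\<dots> = L * (\<Sum>r\<in>?Ln. \<Sum>es\<in>?Ln. \<Sum>s\<in>F. (cmod (f s))\<^sup>2 * (cmod (\<Sum>xs\<in>?Ln. V r xs * v s (zip xs es)))\<^sup>2)"
      by (simp only: sum_distrib_left[of L, symmetric] norm_mult power_mult_distrib)
    also have "(\<Sum>r\<in>?Ln. \<Sum>es\<in>?Ln. \<Sum>s\<in>F. (cmod (f s))\<^sup>2 * (cmod (\<Sum>xs\<in>?Ln. V r xs * v s (zip xs es)))\<^sup>2)
       = (\<Sum>s\<in>F. (cmod (f s))\<^sup>2 * (\<Sum>r\<in>?Ln. \<Sum>es\<in>?Ln. (cmod (\<Sum>xs\<in>?Ln. V r xs * v s (zip xs es)))\<^sup>2))"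
      unfolding sum_distrib_left sum.swap[of _ _ F] ..
    also have "\<dots> = (\<Sum>s\<in>F. (cmod (f s))\<^sup>2 * Re (pairing ?Ln G (tensor_list J n (partial_state J (\<phi> s)))))"
      by (intro sum.cong refl) (simp add: pairing_tensor_partial_state[OF finJ V] v_def)
    also have "L * \<dots> \<le> L * (\<Sum>s\<in>F. (cmod (f s))\<^sup>2 * \<epsilon>)"
      using L0 by (intro mult_left_mono sum_mono S) (auto simp: S_def)
    also have "\<dots> = L * \<epsilon> * (\<Sum>s\<in>F. (cmod (f s))\<^sup>2)"
      unfolding sum_distrib_right[symmetric] by simp
    also have "\<dots> \<le> L * \<epsilon> * (T / t)" using L0 \<epsilon> fT by (intro mult_left_mono) auto
    also have "\<dots> = L * (\<epsilon> * T / t)" by simp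
    also have "\<dots> \<le> (2 * (real N / l) ^ e * t) * (\<epsilon> * T / t)"
      using Lt \<epsilon> T0 t0 by (intro mult_right_mono) auto
    also have "\<dots> = 2 * (real N / l) ^ e * \<epsilon> * T" using t0 by simp
    finally show "Re (pairing ?Ln G (reduced J n l \<omega>))
         \<le> 2 * (real (n + l) / l) ^ (card ?D - 1) * \<epsilon> * Re (op_trace (lists_n J (n + l)) \<omega>)"
      by (simp only: N_def e_def T_def)
  qed
qed

subsection \<open>The error of a code as a positive functional of the jamming state\<close>

text \<open>The error for the matrix units of the jammer. Pairing it with an arbitrary jamming
  operator gives trace minus fidelity, so the whole error is described by one kernel.\<close>

definition err_kernel :: "'a set \<Rightarrow> 'j set \<Rightarrow> 'b set \<Rightarrow> (('a \<times> 'j) op \<Rightarrow> 'b op) \<Rightarrow> nat \<Rightarrow> nat \<Rightarrow> ('a, 'b) cet_code \<Rightarrow> 'j list op" where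
  "err_kernel A J B N n M1 c = (\<lambda>xs ys. (if xs = ys then 1 else 0) - code_fid M1 c (avqc_ch A J B n N (unit_op xs ys)))"

lemma code_fid_avqc_expand:
  assumes fin: "finite A" "finite J" "finite B" and c: "is_cet_code A B n M1 M2 c" and \<omega>: "is_op (lists_n J n) \<omega>"
  shows "code_fid M1 c (avqc_ch A J B n N \<omega>) =
    (\<Sum>xs\<in>lists_n J n. \<Sum>ys\<in>lists_n J n. \<omega> xs ys * code_fid M1 c (avqc_ch A J B n N (unit_op xs ys)))"
proof -
  obtain FA FB P R where ceq: "c = (FA, FB, P, R)" by (cases c)
  let ?L = "lists_n J n" and ?C = "of_nat M1 * (of_nat (card FA))\<^sup>2 :: complex"
  have lin: "lin_map ?L (lists_n B n) (\<lambda>\<sigma>. avqc_ch A J B n N \<sigma> \<rho>)" for \<rho>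
    unfolding lin_map_def using is_op_avqc_ch avqc_ch_linear(1)[OF fin(1,2)] by blast
  have R: "R m (avqc_ch A J B n N \<omega> \<rho>) x y = (\<Sum>xs\<in>?L. \<Sum>ys\<in>?L. \<omega> xs ys * R m (avqc_ch A J B n N (unit_op xs ys) \<rho>) x y)"
    if m: "m \<in> {1..M1}" for m \<rho> x y
    by (rule lin_map_expand[OF lin_map_comp[OF lin cp_map_lin[OF is_cet_codeD(6)[OF c[unfolded ceq] m]]] _ \<omega>]) (use fin in simp)
  have "code_fid M1 c (avqc_ch A J B n N \<omega>) = (\<Sum>m\<in>{1..M1}. \<Sum>p\<in>FA \<times> FA. \<Sum>xs\<in>?L. \<Sum>ys\<in>?L.
      \<omega> xs ys * R m (avqc_ch A J B n N (unit_op xs ys) (P m (unit_op (fst p) (snd p)))) (fst p) (snd p)) / ?C"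
    using is_cet_codeD(4)[OF c[unfolded ceq]] unfolding ceq code_fid_def prod.case
    by (intro arg_cong2[of _ _ _ _ divide] refl sum.cong) (simp_all add: R sum_Times)
  also have "(\<Sum>m\<in>{1..M1}. \<Sum>p\<in>FA \<times> FA. \<Sum>xs\<in>?L. \<Sum>ys\<in>?L.
      \<omega> xs ys * R m (avqc_ch A J B n N (unit_op xs ys) (P m (unit_op (fst p) (snd p)))) (fst p) (snd p))
     = (\<Sum>xs\<in>?L. \<Sum>ys\<in>?L. \<Sum>m\<in>{1..M1}. \<Sum>p\<in>FA \<times> FA.
      \<omega> xs ys * R m (avqc_ch A J B n N (unit_op xs ys) (P m (unit_op (fst p) (snd p)))) (fst p) (snd p))"
    by (rule sum_swap_pairs)
  also have "\<dots> / ?C = (\<Sum>xs\<in>?L. \<Sum>ys\<in>?L. \<omega> xs ys * code_fid M1 c (avqc_ch A J B n N (unit_op xs ys)))"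
    using is_cet_codeD(4)[OF c[unfolded ceq]]
    by (simp add: ceq code_fid_def sum_Times sum_distrib_left sum_divide_distrib)
  finally show ?thesis .
qed

lemma pairing_err_kernel:
  assumes fin: "finite A" "finite J" "finite B" and c: "is_cet_code A B n M1 M2 c" and \<omega>: "is_op (lists_n J n) \<omega>"
  shows "pairing (lists_n J n) (err_kernel A J B N n M1 c) \<omega>
     = op_trace (lists_n J n) \<omega> - code_fid M1 c (avqc_ch A J B n N \<omega>)"
proof -
  let ?L = "lists_n J n"
  have "pairing ?L (err_kernel A J B N n M1 c) \<omega>
     = (\<Sum>xs\<in>?L. \<Sum>ys\<in>?L. (if ys = xs then \<omega> xs xs else 0) - \<omega> xs ys * code_fid M1 c (avqc_ch A J B n N (unit_op xs ys)))"
    unfolding pairing_def err_kernel_def by (intro sum.cong refl) (simp add: algebra_simps)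
  also have "\<dots> = op_trace ?L \<omega> - code_fid M1 c (avqc_ch A J B n N \<omega>)"
    using fin by (simp add: sum_subtractf op_trace_def code_fid_avqc_expand[OF fin c \<omega>])
  finally show ?thesis .
qed

lemma Pbar_avqc:
  assumes fin: "finite A" "finite J" "finite B" and N: "channel (A \<times> J) B N"
    and c: "is_cet_code A B n M1 M2 c" and \<omega>: "psd (lists_n J n) \<omega>"
  shows "code_fid M1 c (avqc_ch A J B n N \<omega>) = of_real (Pbar_cet M1 c (avqc_ch A J B n N \<omega>))"
    "0 \<le> Pbar_cet M1 c (avqc_ch A J B n N \<omega>)"
    "Pbar_cet M1 c (avqc_ch A J B n N \<omega>) \<le> Re (op_trace (lists_n J n) \<omega>)"
proof -
  have N': "cp_map (A \<times> J) B N" "trace_pres (A \<times> J) B N" using N by (auto simp: channel_def)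
  have cp: "cp_map (lists_n A n) (lists_n B n) (avqc_ch A J B n N \<omega>)"
    by (rule cp_map_avqc_ch[OF fin N'(1)]) (use \<omega> in \<open>simp add: psd_iff\<close>)
  show "code_fid M1 c (avqc_ch A J B n N \<omega>) = of_real (Pbar_cet M1 c (avqc_ch A J B n N \<omega>))"
    "0 \<le> Pbar_cet M1 c (avqc_ch A J B n N \<omega>)"
    by (rule Pbar_cet_code_fid[OF fin(1,3) c cp])+
  have tr: "op_trace (lists_n B n) (avqc_ch A J B n N \<omega> X)
      = of_real (Re (op_trace (lists_n J n) \<omega>)) * op_trace (lists_n A n) X" for X
    unfolding op_trace_avqc_ch[OF fin N'(2)] using psd_trace(1)[OF _ \<omega>] fin by (simp add: mult.commute)
  show "Pbar_cet M1 c (avqc_ch A J B n N \<omega>) \<le> Re (op_trace (lists_n J n) \<omega>)"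
    by (rule Pbar_cet_le[OF fin(1,3) c cp tr]) (use psd_trace(2)[OF _ \<omega>] fin in simp)
qed

lemma pairing_err_kernel_psd:
  assumes fin: "finite A" "finite J" "finite B" and N: "channel (A \<times> J) B N"
    and c: "is_cet_code A B n M1 M2 c" and \<omega>: "psd (lists_n J n) \<omega>"
  shows "pairing (lists_n J n) (err_kernel A J B N n M1 c) \<omega>
     = of_real (Re (op_trace (lists_n J n) \<omega>) - Pbar_cet M1 c (avqc_ch A J B n N \<omega>))"
  using pairing_err_kernel[OF fin c] \<omega> Pbar_avqc(1)[OF fin N c \<omega>] psd_trace(1)[OF _ \<omega>] fin
  by (simp add: psd_iff)

text \<open>The form at v is trace minus success for an unnormalised pure jamming operator, and the
  success never exceeds the trace.\<close>

lemma pos_kernel_err_kernel: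
  assumes fin: "finite A" "finite J" "finite B" and N: "channel (A \<times> J) B N"
    and c: "is_cet_code A B n M1 M2 c"
  shows "pos_kernel (lists_n J n) (err_kernel A J B N n M1 c)"
  unfolding pos_kernel_def
proof
  fix v
  let ?L = "lists_n J n"
  \<comment> \<open>Conjugated because \<open>pairing\<close> is bilinear, and cut off outside the
    lists so that its outer product is an operator.\<close>
  define u where "u = (\<lambda>xs. if xs \<in> ?L then cnj (v xs) else 0)"
  have \<omega>: "psd ?L (\<lambda>xs ys. u xs * cnj (u ys))"
    unfolding psd_iff using pos_kernel_outer by (auto simp: is_op_def u_def)
  have "sform ?L (err_kernel A J B N n M1 c) v v = pairing ?L (err_kernel A J B N n M1 c) (\<lambda>xs ys. u xs * cnj (u ys))"
    unfolding sform_def pairing_def by (intro sum.cong refl) (simp add: u_def mult_ac)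
  then show "Im (sform ?L (err_kernel A J B N n M1 c) v v) = 0 \<and> 0 \<le> Re (sform ?L (err_kernel A J B N n M1 c) v v)"
    using pairing_err_kernel_psd[OF fin N c \<omega>] Pbar_avqc(3)[OF fin N c \<omega>] by simp
qed

subsection \<open>Permuting and padding a code\<close>

lemma joint_kernel_permute:
  assumes \<pi>: "\<pi> permutes {..<m}" and len: "length as = m" "length js = m" "length zs = m"
    "length as' = m" "length js' = m" "length zs' = m"
  shows "joint_kernel N m (permute_list \<pi> as, permute_list \<pi> js, permute_list \<pi> zs)
      (permute_list \<pi> as', permute_list \<pi> js', permute_list \<pi> zs') = joint_kernel N m (as, js, zs) (as', js', zs')"
proof -
  have "joint_kernel N m (permute_list \<pi> as, permute_list \<pi> js, permute_list \<pi> zs)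
      (permute_list \<pi> as', permute_list \<pi> js', permute_list \<pi> zs')
     = (\<Prod>k<m. N (unit_op (as ! \<pi> k, js ! \<pi> k) (as' ! \<pi> k, js' ! \<pi> k)) (zs ! \<pi> k) (zs' ! \<pi> k))"
    unfolding joint_kernel_simp by (intro prod.cong refl) (use \<pi> len in \<open>simp add: permute_list_nth\<close>)
  also have "\<dots> = joint_kernel N m (as, js, zs) (as', js', zs')"
    unfolding joint_kernel_simp
    by (rule prod.reindex_bij_betw[OF permutes_imp_bij[OF \<pi>],
        where g = "\<lambda>k. N (unit_op (as ! k, js ! k) (as' ! k, js' ! k)) (zs ! k) (zs' ! k)"])
  finally show ?thesis .
qed

lemma joint_kernel_append:
  assumes "length as = n" "length js = n" "length zs = n" "length as' = n" "length js' = n" "length zs' = n"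
  shows "joint_kernel N (n + l) (as @ as2, js @ js2, zs @ zs2) (as' @ as2', js' @ js2', zs' @ zs2')
     = joint_kernel N n (as, js, zs) (as', js', zs') * joint_kernel N l (as2, js2, zs2) (as2', js2', zs2')"
proof -
  have "(\<Prod>k<n + l. f k) = (\<Prod>k<n. f k) * (\<Prod>k<l. f (n + k))" for f :: "nat \<Rightarrow> complex"
    by (induction l) (simp_all add: mult.assoc)
  then show ?thesis unfolding joint_kernel_simp using assms by (simp add: nth_append)
qed

text \<open>Covariance of the memoryless channel: permuting the outputs amounts to permuting the
  inputs of sender and jammer alike.\<close>

lemma avqc_ch_permute:
  assumes fin: "finite A" "finite J" and \<pi>: "\<pi> permutes {..<m}" and zs: "zs \<in> lists_n B m" "zs' \<in> lists_n B m"
  shows "avqc_ch A J B m N \<sigma> \<rho> (permute_list \<pi> zs) (permute_list \<pi> zs')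
    = avqc_ch A J B m N (\<lambda>xs ys. \<sigma> (permute_list \<pi> xs) (permute_list \<pi> ys))
        (\<lambda>xs ys. \<rho> (permute_list \<pi> xs) (permute_list \<pi> ys)) zs zs'"
proof -
  let ?A = "lists_n A m" and ?J = "lists_n J m" and ?p = "permute_list \<pi>"
  note reA = sum.reindex_bij_betw[OF bij_betw_permute_list[OF \<pi>, of A], symmetric]
  note reJ = sum.reindex_bij_betw[OF bij_betw_permute_list[OF \<pi>, of J], symmetric]
  have "avqc_ch A J B m N \<sigma> \<rho> (?p zs) (?p zs') = (\<Sum>as\<in>?A. \<Sum>js\<in>?J. \<Sum>as'\<in>?A. \<Sum>js'\<in>?J.
       \<rho> as as' * \<sigma> js js' * joint_kernel N m (as, js, ?p zs) (as', js', ?p zs'))"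
    by (rule avqc_ch_eq[OF fin permute_lists_n[OF \<pi> zs(1)] permute_lists_n[OF \<pi> zs(2)]])
  also have "\<dots> = (\<Sum>as\<in>?A. \<Sum>js\<in>?J. \<Sum>as'\<in>?A. \<Sum>js'\<in>?J.
       \<rho> (?p as) (?p as') * \<sigma> (?p js) (?p js') * joint_kernel N m (?p as, ?p js, ?p zs) (?p as', ?p js', ?p zs'))"
    by (rule trans[OF reA], rule sum.cong[OF refl], rule trans[OF reJ], rule sum.cong[OF refl],
        rule trans[OF reA], rule sum.cong[OF refl], rule reJ)
  also have "\<dots> = (\<Sum>as\<in>?A. \<Sum>js\<in>?J. \<Sum>as'\<in>?A. \<Sum>js'\<in>?J.
       \<rho> (?p as) (?p as') * \<sigma> (?p js) (?p js') * joint_kernel N m (as, js, zs) (as', js', zs'))"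
    by (intro sum.cong refl) (simp add: joint_kernel_permute[OF \<pi>] lists_n_length zs[THEN lists_n_length])
  also have "\<dots> = avqc_ch A J B m N (\<lambda>xs ys. \<sigma> (?p xs) (?p ys)) (\<lambda>xs ys. \<rho> (?p xs) (?p ys)) zs zs'"
    by (simp add: avqc_ch_eq[OF fin zs])
  finally show ?thesis .
qed

lemma sum_swap_first_triple:
  "(\<Sum>u\<in>U. \<Sum>a\<in>A. \<Sum>b\<in>B. \<Sum>c\<in>C. \<Sum>d\<in>D. g u a b c d) = (\<Sum>a\<in>A. \<Sum>b\<in>B. \<Sum>c\<in>C. \<Sum>d\<in>D. \<Sum>u\<in>U. g u a b c d)"
  unfolding sum.swap[of _ _ U] ..

text \<open>The padding systems are traced out; trace preservation of \<open>N\<close> turns this into a partial trace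
  of the jamming state.\<close>
lemma reduced_avqc_ch:
  assumes fin: "finite A" "finite J" "finite B" and N: "trace_pres (A \<times> J) B N" and \<tau>: "\<tau> \<in> lists_n A l"
    and \<rho>: "\<And>as as2 as' as2'. as \<in> lists_n A n \<Longrightarrow> as2 \<in> lists_n A l \<Longrightarrow> as' \<in> lists_n A n \<Longrightarrow> as2' \<in> lists_n A l \<Longrightarrow>
       \<rho>' (as @ as2) (as' @ as2') = \<rho> as as' * unit_op \<tau> \<tau> as2 as2'"
  shows "reduced B n l (avqc_ch A J B (n + l) N \<sigma> \<rho>') = avqc_ch A J B n N (reduced J n l \<sigma>) \<rho>"
proof (intro ext)
  fix zs zs'
  let ?A = "lists_n A n" and ?J = "lists_n J n" and ?A2 = "lists_n A l" and ?J2 = "lists_n J l" and ?B2 = "lists_n B l"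
  show "reduced B n l (avqc_ch A J B (n + l) N \<sigma> \<rho>') zs zs' = avqc_ch A J B n N (reduced J n l \<sigma>) \<rho> zs zs'"
  proof (cases "zs \<in> lists_n B n \<and> zs' \<in> lists_n B n")
    case True
    then have zs: "zs \<in> lists_n B n" "zs' \<in> lists_n B n" by auto
    have "reduced B n l (avqc_ch A J B (n + l) N \<sigma> \<rho>') zs zs'
       = (\<Sum>us\<in>?B2. avqc_ch A J B (n + l) N \<sigma> \<rho>' (zs @ us) (zs' @ us))"
      using zs by (simp add: reduced_def)
    also have "\<dots> = (\<Sum>us\<in>?B2. \<Sum>as\<in>lists_n A (n + l). \<Sum>js\<in>lists_n J (n + l). \<Sum>as'\<in>lists_n A (n + l). \<Sum>js'\<in>lists_n J (n + l).
       \<rho>' as as' * \<sigma> js js' * joint_kernel N (n + l) (as, js, zs @ us) (as', js', zs' @ us))"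
      by (intro sum.cong refl avqc_ch_eq fin append_lists_n zs)
    also have "\<dots> = (\<Sum>as\<in>lists_n A (n + l). \<Sum>js\<in>lists_n J (n + l). \<Sum>as'\<in>lists_n A (n + l). \<Sum>js'\<in>lists_n J (n + l). \<Sum>us\<in>?B2.
       \<rho>' as as' * \<sigma> js js' * joint_kernel N (n + l) (as, js, zs @ us) (as', js', zs' @ us))"
      by (rule sum_swap_first_triple)
    also have "\<dots> = (\<Sum>as\<in>?A. \<Sum>as2\<in>?A2. \<Sum>js\<in>?J. \<Sum>js2\<in>?J2. \<Sum>as'\<in>?A. \<Sum>as2'\<in>?A2. \<Sum>js'\<in>?J. \<Sum>js2'\<in>?J2. \<Sum>us\<in>?B2.
       \<rho>' (as @ as2) (as' @ as2') * \<sigma> (js @ js2) (js' @ js2')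
        * joint_kernel N (n + l) (as @ as2, js @ js2, zs @ us) (as' @ as2', js' @ js2', zs' @ us))"
      by (simp only: sum_lists_append[OF fin(1)] sum_lists_append[OF fin(2)])
    \<comment> \<open>Trace preservation forces as2 = as2' and js2 = js2', the padding forces as2
      and as2' to be \<tau>. The conditions are nested so that the corresponding sums can be
      eliminated one after the other.\<close>
    also have "\<dots> = (\<Sum>as\<in>?A. \<Sum>as2\<in>?A2. \<Sum>js\<in>?J. \<Sum>js2\<in>?J2. \<Sum>as'\<in>?A. \<Sum>as2'\<in>?A2. \<Sum>js'\<in>?J. \<Sum>js2'\<in>?J2.
       (if as2' = \<tau> then if js2' = js2 then if as2 = \<tau> then
         \<rho> as as' * \<sigma> (js @ js2) (js' @ js2) * joint_kernel N n (as, js, zs) (as', js', zs') else 0 else 0 else 0))"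
    proof (intro sum.cong refl)
      fix as as2 js js2 as' as2' js' js2'
      assume mem: "as \<in> ?A" "as2 \<in> ?A2" "js \<in> ?J" "js2 \<in> ?J2" "as' \<in> ?A" "as2' \<in> ?A2" "js' \<in> ?J" "js2' \<in> ?J2"
      have "(\<Sum>us\<in>?B2. \<rho>' (as @ as2) (as' @ as2') * \<sigma> (js @ js2) (js' @ js2')
        * joint_kernel N (n + l) (as @ as2, js @ js2, zs @ us) (as' @ as2', js' @ js2', zs' @ us))
       = \<rho>' (as @ as2) (as' @ as2') * \<sigma> (js @ js2) (js' @ js2') * (joint_kernel N n (as, js, zs) (as', js', zs') *
          (\<Sum>us\<in>?B2. joint_kernel N l (as2, js2, us) (as2', js2', us)))"
        using mem zs by (simp add: joint_kernel_append lists_n_length sum_distrib_left)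
      then show "(\<Sum>us\<in>?B2. \<rho>' (as @ as2) (as' @ as2') * \<sigma> (js @ js2) (js' @ js2')
        * joint_kernel N (n + l) (as @ as2, js @ js2, zs @ us) (as' @ as2', js' @ js2', zs' @ us))
        = (if as2' = \<tau> then if js2' = js2 then if as2 = \<tau> then
         \<rho> as as' * \<sigma> (js @ js2) (js' @ js2) * joint_kernel N n (as, js, zs) (as', js', zs') else 0 else 0 else 0)"
        unfolding trace_joint_kernel[OF fin N mem(2,6,4,8)] \<rho>[OF mem(1,2,5,6)] by (auto simp: unit_op_def)
    qed
    also have "\<dots> = (\<Sum>as\<in>?A. \<Sum>as2\<in>?A2. \<Sum>js\<in>?J. \<Sum>js2\<in>?J2. \<Sum>as'\<in>?A. \<Sum>as2'\<in>?A2. \<Sum>js'\<in>?J.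
       (if as2' = \<tau> then if as2 = \<tau> then
         \<rho> as as' * \<sigma> (js @ js2) (js' @ js2) * joint_kernel N n (as, js, zs) (as', js', zs') else 0 else 0))"
      using fin by (intro sum.cong refl) auto
    also have "\<dots> = (\<Sum>as\<in>?A. \<Sum>as2\<in>?A2. \<Sum>js\<in>?J. \<Sum>js2\<in>?J2. \<Sum>as'\<in>?A. \<Sum>js'\<in>?J. \<Sum>as2'\<in>?A2.
       (if as2' = \<tau> then if as2 = \<tau> then
         \<rho> as as' * \<sigma> (js @ js2) (js' @ js2) * joint_kernel N n (as, js, zs) (as', js', zs') else 0 else 0))"
      by (intro sum.cong refl sum.swap)
    also have "\<dots> = (\<Sum>as\<in>?A. \<Sum>as2\<in>?A2. \<Sum>js\<in>?J. \<Sum>js2\<in>?J2. \<Sum>as'\<in>?A. \<Sum>js'\<in>?J.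
       (if as2 = \<tau> then
         \<rho> as as' * \<sigma> (js @ js2) (js' @ js2) * joint_kernel N n (as, js, zs) (as', js', zs') else 0))"
      using fin \<tau> by (intro sum.cong refl) simp
    also have "\<dots> = (\<Sum>as\<in>?A. \<Sum>as2\<in>?A2. if as2 = \<tau> then \<Sum>js\<in>?J. \<Sum>js2\<in>?J2. \<Sum>as'\<in>?A. \<Sum>js'\<in>?J.
         \<rho> as as' * \<sigma> (js @ js2) (js' @ js2) * joint_kernel N n (as, js, zs) (as', js', zs') else 0)"
      by (intro sum.cong refl) auto
    also have "\<dots> = (\<Sum>as\<in>?A. \<Sum>js\<in>?J. \<Sum>js2\<in>?J2. \<Sum>as'\<in>?A. \<Sum>js'\<in>?J.
         \<rho> as as' * \<sigma> (js @ js2) (js' @ js2) * joint_kernel N n (as, js, zs) (as', js', zs'))"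
      using fin \<tau> by simp
    also have "\<dots> = (\<Sum>as\<in>?A. \<Sum>js\<in>?J. \<Sum>as'\<in>?A. \<Sum>js2\<in>?J2. \<Sum>js'\<in>?J.
         \<rho> as as' * \<sigma> (js @ js2) (js' @ js2) * joint_kernel N n (as, js, zs) (as', js', zs'))"
      by (intro sum.cong refl sum.swap)
    also have "\<dots> = (\<Sum>as\<in>?A. \<Sum>js\<in>?J. \<Sum>as'\<in>?A. \<Sum>js'\<in>?J. \<Sum>js2\<in>?J2.
         \<rho> as as' * \<sigma> (js @ js2) (js' @ js2) * joint_kernel N n (as, js, zs) (as', js', zs'))"
      by (intro sum.cong refl sum.swap)
    also have "\<dots> = (\<Sum>as\<in>?A. \<Sum>js\<in>?J. \<Sum>as'\<in>?A. \<Sum>js'\<in>?J.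
         \<rho> as as' * reduced J n l \<sigma> js js' * joint_kernel N n (as, js, zs) (as', js', zs'))"
      by (intro sum.cong refl) (simp add: reduced_def sum_distrib_left sum_distrib_right)
    also have "\<dots> = avqc_ch A J B n N (reduced J n l \<sigma>) \<rho> zs zs'"
      by (simp add: avqc_ch_eq[OF fin(1,2) zs])
    finally show ?thesis .
  qed (auto simp: reduced_def avqc_ch_def ch_pow_def)
qed

definition pad_enc :: "'a set \<Rightarrow> nat \<Rightarrow> nat \<Rightarrow> 'a list \<Rightarrow> (nat \<Rightarrow> nat) \<Rightarrow> 'a list op \<Rightarrow> 'a list op" where
  "pad_enc A n l \<tau> \<pi> \<rho> = (\<lambda>as as'. if as \<in> lists_n A (n + l) \<and> as' \<in> lists_n A (n + l)
     then \<rho> (take n (permute_list \<pi> as)) (take n (permute_list \<pi> as'))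
        * unit_op \<tau> \<tau> (drop n (permute_list \<pi> as)) (drop n (permute_list \<pi> as')) else 0)"

definition pad_dec :: "'b set \<Rightarrow> nat \<Rightarrow> nat \<Rightarrow> (nat \<Rightarrow> nat) \<Rightarrow> 'b list op \<Rightarrow> 'b list op" where
  "pad_dec B n l \<pi> Y = reduced B n l (\<lambda>zs zs'. Y (permute_list (inv \<pi>) zs) (permute_list (inv \<pi>) zs'))"

definition pad_code :: "'a set \<Rightarrow> 'b set \<Rightarrow> nat \<Rightarrow> nat \<Rightarrow> 'a list \<Rightarrow> (nat \<Rightarrow> nat) \<Rightarrow> ('a, 'b) cet_code \<Rightarrow> ('a, 'b) cet_code" where
  "pad_code A B n l \<tau> \<pi> c = (case c of (FA, FB, P, R) \<Rightarrow>
     (FA, FB, \<lambda>m X. pad_enc A n l \<tau> \<pi> (P m X), \<lambda>m Y. R m (pad_dec B n l \<pi> Y)))"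

lemma take_drop_lists_n:
  assumes "xs \<in> lists_n I (n + l)"
  shows "take n xs \<in> lists_n I n" "drop n xs \<in> lists_n I l"
  using assms by (auto simp: lists_n_eq dest: in_set_takeD in_set_dropD)

lemma pad_enc_channel:
  assumes fin: "finite A" and \<tau>: "\<tau> \<in> lists_n A l" and \<pi>: "\<pi> permutes {..<n + l}"
  shows "channel (lists_n A n) (lists_n A (n + l)) (pad_enc A n l \<tau> \<pi>)"
proof -
  let ?L = "lists_n A (n + l)" and ?p = "permute_list \<pi>"
  have lin: "lin_map (lists_n A n) ?L (pad_enc A n l \<tau> \<pi>)"
    by (auto simp: lin_map_def is_op_def pad_enc_def algebra_simps fun_eq_iff)
  \<comment> \<open>The encoder is conjugation by an isometry, so its Choi matrix has rank
    one.\<close>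
  define u where "u = (\<lambda>(bs, as). if take n (?p as) = bs \<and> drop n (?p as) = \<tau> then 1 else (0::complex))"
  have "pos_kernel (lists_n A n \<times> ?L) (\<lambda>p q. u p * cnj (u q))" by (rule pos_kernel_outer)
  then have "pos_kernel (lists_n A n \<times> ?L) (map_kernel (pad_enc A n l \<tau> \<pi>))"
    by (rule iffD1[OF pos_kernel_cong, rotated]) (auto simp: u_def pad_enc_def unit_op_def)
  then have cp: "cp_map (lists_n A n) ?L (pad_enc A n l \<tau> \<pi>)"
    using fin by (intro cp_mapI lin) auto
  have "op_trace ?L (pad_enc A n l \<tau> \<pi> X) = op_trace (lists_n A n) X" for X
  proof -
    let ?g = "\<lambda>bs. X (take n bs) (take n bs) * unit_op \<tau> \<tau> (drop n bs) (drop n bs)"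
    have "op_trace ?L (pad_enc A n l \<tau> \<pi> X) = (\<Sum>as\<in>?L. ?g (?p as))"
      by (simp add: op_trace_def pad_enc_def)
    also have "\<dots> = (\<Sum>bs\<in>?L. ?g bs)"
      by (rule sum.reindex_bij_betw[OF bij_betw_permute_list[OF \<pi>]])
    also have "\<dots> = (\<Sum>bs\<in>lists_n A n. \<Sum>cs\<in>lists_n A l. if cs = \<tau> then X bs bs else 0)"
      unfolding sum_lists_append[OF fin] by (intro sum.cong refl) (simp add: lists_n_length unit_op_def)
    also have "\<dots> = op_trace (lists_n A n) X"
      using fin \<tau> by (simp add: op_trace_def)
    finally show ?thesis .
  qed
  with cp show ?thesis by (simp add: channel_def trace_pres_def)
qed

lemma pad_dec_channel:
  fixes B :: "'b set"
  assumes fin: "finite B" and \<pi>: "\<pi> permutes {..<n + l}"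
  shows "channel (lists_n B (n + l)) (lists_n B n) (pad_dec B n l \<pi>)"
proof -
  let ?L = "lists_n B (n + l)" and ?p = "permute_list (inv \<pi>)"
  have \<pi>': "inv \<pi> permutes {..<n + l}" by (rule permutes_inv[OF \<pi>])
  have lin: "lin_map ?L (lists_n B n) (pad_dec B n l \<pi>)"
    by (auto simp: lin_map_def is_op_def pad_dec_def reduced_def sum.distrib sum_distrib_left fun_eq_iff)
  \<comment> \<open>One Kraus operator for each value us of the discarded systems.\<close>
  define u where "u = (\<lambda>(us :: 'b list) (zs, ws). if ?p (ws @ us) = zs then 1 else (0::complex))"
  have "pos_kernel (?L \<times> lists_n B n) (\<lambda>p q. \<Sum>us\<in>lists_n B l. u us p * cnj (u us q))"
    by (intro pos_kernel_sum pos_kernel_outer)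
  then have "pos_kernel (?L \<times> lists_n B n) (map_kernel (pad_dec B n l \<pi>))"
    by (rule iffD1[OF pos_kernel_cong, rotated]) (auto simp: u_def pad_dec_def reduced_def unit_op_def intro!: sum.cong)
  then have cp: "cp_map ?L (lists_n B n) (pad_dec B n l \<pi>)"
    using fin by (intro cp_mapI lin) auto
  have "op_trace (lists_n B n) (pad_dec B n l \<pi> Y) = op_trace ?L Y" for Y
  proof -
    have "op_trace (lists_n B n) (pad_dec B n l \<pi> Y) = (\<Sum>zs\<in>?L. Y (?p zs) (?p zs))"
      by (simp add: op_trace_def pad_dec_def reduced_def sum_lists_append fin)
    also have "\<dots> = op_trace ?L Y"
      unfolding op_trace_def by (rule sum.reindex_bij_betw[OF bij_betw_permute_list[OF \<pi>']])
    finally show ?thesis .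
  qed
  with cp show ?thesis by (simp add: channel_def trace_pres_def)
qed

lemma channel_comp:
  assumes "finite I" "finite Out" "finite Out'" "channel I Out T" "channel Out Out' S"
  shows "channel I Out' (\<lambda>X. S (T X))"
  using assms cp_map_comp[of I Out Out' T S] lin_map_is_op[of I Out T]
  by (simp add: channel_def trace_pres_def cp_map_def)

lemma is_cet_codeI:
  assumes fin: "finite B" "finite FB" and "FA \<subseteq> FB" "card FA = M2"
    and "\<And>m. m \<in> {1..M1} \<Longrightarrow> channel FA (lists_n A n) (P m)"
    and R: "\<And>m. m \<in> {1..M1} \<Longrightarrow> cp_map (lists_n B n) FB (R m)"
    and tp: "trace_pres (lists_n B n) FB (\<lambda>Y a b. \<Sum>m\<in>{1..M1}. R m Y a b)"
  shows "is_cet_code A B n M1 M2 (FA, FB, P, R)"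
  using assms trace_nonincr_of_sum[OF finite_lists_n[OF fin(1)] fin(2) finite_atLeastAtMost R tp]
  by (simp add: is_cet_code_def)

lemma is_cet_code_pad_code:
  assumes fin: "finite A" "finite B" and c: "is_cet_code A B n M1 M2 c"
    and \<tau>: "\<tau> \<in> lists_n A l" and \<pi>: "\<pi> permutes {..<n + l}"
  shows "is_cet_code A B (n + l) M1 M2 (pad_code A B n l \<tau> \<pi> c)"
proof -
  obtain FA FB P R where ceq: "c = (FA, FB, P, R)" by (cases c)
  note D = is_cet_codeD[OF c[unfolded ceq]]
  note dec = pad_dec_channel[OF fin(2) \<pi>]
  show ?thesis
    unfolding ceq pad_code_def prod.case
  proof (rule is_cet_codeI[OF fin(2) D(1-3)])
    fix m assume m: "m \<in> {1..M1}"
    show "channel FA (lists_n A (n + l)) (\<lambda>X. pad_enc A n l \<tau> \<pi> (P m X))"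
      by (rule channel_comp[OF _ _ _ D(5)[OF m] pad_enc_channel[OF fin(1) \<tau> \<pi>]]) (use D(4) fin in auto)
    show "cp_map (lists_n B (n + l)) FB (\<lambda>Y. R m (pad_dec B n l \<pi> Y))"
      by (rule cp_map_comp[OF _ _ _ _ D(6)[OF m]]) (use D(1) fin dec in \<open>auto simp: channel_def\<close>)
  next
    show "trace_pres (lists_n B (n + l)) FB (\<lambda>Y a b. \<Sum>m\<in>{1..M1}. R m (pad_dec B n l \<pi> Y) a b)"
      using D(8) dec by (simp add: trace_pres_def channel_def cp_map_def lin_map_def)
  qed
qed

text \<open>By covariance the permutation of the code passes to the jamming state, and by trace
  preservation the padding becomes a partial trace. What remains is the original code against a
  marginal of the permuted state.\<close>

lemma code_fid_pad_code:
  assumes fin: "finite A" "finite J" "finite B" and N: "channel (A \<times> J) B N"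
    and \<tau>: "\<tau> \<in> lists_n A l" and \<pi>: "\<pi> permutes {..<n + l}"
  shows "code_fid M1 (pad_code A B n l \<tau> \<pi> c) (avqc_ch A J B (n + l) N \<sigma>)
    = code_fid M1 c (avqc_ch A J B n N (reduced J n l (\<lambda>xs ys. \<sigma> (permute_list (inv \<pi>) xs) (permute_list (inv \<pi>) ys))))"
proof -
  obtain FA FB P R where ceq: "c = (FA, FB, P, R)" by (cases c)
  let ?p = "permute_list (inv \<pi>)"
  have \<pi>': "inv \<pi> permutes {..<n + l}" by (rule permutes_inv[OF \<pi>])
  have "pad_dec B n l \<pi> (avqc_ch A J B (n + l) N \<sigma> (pad_enc A n l \<tau> \<pi> \<rho>))
     = avqc_ch A J B n N (reduced J n l (\<lambda>xs ys. \<sigma> (?p xs) (?p ys))) \<rho>" for \<rho>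
  proof -
    have "pad_dec B n l \<pi> (avqc_ch A J B (n + l) N \<sigma> (pad_enc A n l \<tau> \<pi> \<rho>))
       = reduced B n l (avqc_ch A J B (n + l) N (\<lambda>xs ys. \<sigma> (?p xs) (?p ys)) (\<lambda>xs ys. pad_enc A n l \<tau> \<pi> \<rho> (?p xs) (?p ys)))"
      unfolding pad_dec_def reduced_def
      by (intro ext) (auto simp: avqc_ch_permute[OF fin(1,2) \<pi>'] append_lists_n intro!: sum.cong)
    also have "\<dots> = avqc_ch A J B n N (reduced J n l (\<lambda>xs ys. \<sigma> (?p xs) (?p ys))) \<rho>"
    proof (rule reduced_avqc_ch[OF fin _ \<tau>])
      show "trace_pres (A \<times> J) B N" using N by (simp add: channel_def)
      fix as as2 as' as2'
      assume mem: "as \<in> lists_n A n" "as2 \<in> lists_n A l" "as' \<in> lists_n A n" "as2' \<in> lists_n A l"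
      then have "as @ as2 \<in> lists_n A (n + l)" "as' @ as2' \<in> lists_n A (n + l)" by (auto intro: append_lists_n)
      then show "pad_enc A n l \<tau> \<pi> \<rho> (?p (as @ as2)) (?p (as' @ as2')) = \<rho> as as' * unit_op \<tau> \<tau> as2 as2'"
        using mem by (simp add: pad_enc_def permute_lists_n[OF \<pi>'] permute_list_inverse(1)[OF \<pi>] lists_n_length)
    qed
    finally show ?thesis .
  qed
  then show ?thesis by (simp add: ceq pad_code_def code_fid_def)
qed

definition perm_average :: "'j set \<Rightarrow> nat \<Rightarrow> 'j list op \<Rightarrow> 'j list op" where
  "perm_average J m \<sigma> = (\<lambda>xs ys. if xs \<in> lists_n J m \<and> ys \<in> lists_n J m
     then \<Sum>\<pi> | \<pi> permutes {..<m}. complex_of_real (1 / fact m) * \<sigma> (permute_list \<pi> xs) (permute_list \<pi> ys) else 0)"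

lemma psd_permute:
  assumes fin: "finite J" and \<sigma>: "psd (lists_n J m) \<sigma>" and \<pi>: "\<pi> permutes {..<m}"
  shows "pos_kernel (lists_n J m) (\<lambda>xs ys. \<sigma> (permute_list \<pi> xs) (permute_list \<pi> ys))"
  by (rule pos_kernel_reindex[of "lists_n J m" "lists_n J m" "permute_list \<pi>" \<sigma>])
    (use fin \<sigma> permute_lists_n[OF \<pi>] in \<open>auto simp: psd_iff\<close>)

lemma perm_average_states:
  assumes fin: "finite J" and \<sigma>: "\<sigma> \<in> states (lists_n J m)"
  shows "perm_average J m \<sigma> \<in> states (lists_n J m)"
proof -
  let ?L = "lists_n J m"
  have psd: "psd ?L \<sigma>" and tr: "op_trace ?L \<sigma> = 1" using \<sigma> by (auto simp: states_def)
  have "pos_kernel ?L (\<lambda>xs ys. \<Sum>\<pi> | \<pi> permutes {..<m}. complex_of_real (1 / fact m) * \<sigma> (permute_list \<pi> xs) (permute_list \<pi> ys))"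
    by (rule pos_kernel_sum, rule pos_kernel_scale, rule psd_permute[OF fin psd]) auto
  then have "pos_kernel ?L (perm_average J m \<sigma>)"
    by (rule iffD1[OF pos_kernel_cong, rotated]) (simp add: perm_average_def)
  moreover have "op_trace ?L (perm_average J m \<sigma>) = 1"
  proof -
    have "op_trace ?L (perm_average J m \<sigma>)
        = (\<Sum>\<pi> | \<pi> permutes {..<m}. complex_of_real (1 / fact m) * (\<Sum>xs\<in>?L. \<sigma> (permute_list \<pi> xs) (permute_list \<pi> xs)))"
      unfolding op_trace_def perm_average_def by (simp add: sum_distrib_left) (rule sum.swap)
    also have "\<dots> = (\<Sum>\<pi> | \<pi> permutes {..<m}. complex_of_real (1 / fact m) * op_trace ?L \<sigma>)"
      unfolding op_trace_def
      by (intro sum.cong refl arg_cong2[of _ _ _ _ times]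
          sum.reindex_bij_betw[OF bij_betw_permute_list, where g = "\<lambda>xs. \<sigma> xs xs"]) auto
    also have "\<dots> = 1" using card_permutations[of "{..<m}" m] by (simp add: tr)
    finally show ?thesis .
  qed
  ultimately show ?thesis by (auto simp: states_def psd_iff is_op_def perm_average_def)
qed

lemma perm_average_permute:
  assumes \<pi>: "\<pi> permutes {..<m}" and xs: "xs \<in> lists_n J m" "ys \<in> lists_n J m"
  shows "perm_average J m \<sigma> (permute_list \<pi> xs) (permute_list \<pi> ys) = perm_average J m \<sigma> xs ys"
proof -
  have len: "length xs = m" "length ys = m" using xs by (auto simp: lists_n_length)
  have "perm_average J m \<sigma> (permute_list \<pi> xs) (permute_list \<pi> ys)
     = (\<Sum>\<rho> | \<rho> permutes {..<m}. complex_of_real (1 / fact m) * \<sigma> (permute_list (\<pi> \<circ> \<rho>) xs) (permute_list (\<pi> \<circ> \<rho>) ys))"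
    using xs permute_lists_n[OF \<pi>] len unfolding perm_average_def
    by (auto simp: permute_list_compose intro!: sum.cong)
  also have "\<dots> = (\<Sum>\<rho> | \<rho> permutes {..<m}. complex_of_real (1 / fact m) * \<sigma> (permute_list \<rho> xs) (permute_list \<rho> ys))"
    by (rule setum_permutations_compose_left[OF \<pi>, symmetric])
  finally show ?thesis using xs by (simp add: perm_average_def)
qed

text \<open>Averaging over the permuted codes makes the effective jamming state permutation
  invariant on n + l systems, and the original code sees its n-system marginal. The de Finetti bound
  then needs the compound error only for the states in S.\<close>

lemma random_code_of_code:
  fixes c :: "('a, 'b) cet_code" and N :: "('a \<times> 'j) op \<Rightarrow> 'b op"
  assumes fin: "finite A" "finite J" "finite B" and ne: "A \<noteq> {}" "J \<noteq> {}" and N: "channel (A \<times> J) B N"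
    and c: "is_cet_code A B n M1 M2 c" and l: "l > 0" and \<epsilon>: "\<epsilon> \<ge> 0"
    and good: "\<And>\<sigma>. \<sigma> \<in> states J \<Longrightarrow> Pbar_cet M1 c (ch_pow A B n (jam_ch N \<sigma>)) \<ge> 1 - \<epsilon>"
  obtains \<mu> :: "('a, 'b) cet_code measure" where "prob_space \<mu>" "\<And>c. c \<in> space \<mu> \<Longrightarrow> is_cet_code A B (n + l) M1 M2 c"
    "\<And>f :: ('a, 'b) cet_code \<Rightarrow> real. f \<in> borel_measurable \<mu>"
    "\<And>\<sigma>. \<sigma> \<in> states (lists_n J (n + l)) \<Longrightarrow>
       1 - 2 * (real (n + l) / l) ^ (card (J \<times> J) - 1) * \<epsilon> \<le> integral\<^sup>L \<mu> (\<lambda>c. Pbar_cet M1 c (avqc_ch A J B (n + l) N \<sigma>))"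
proof -
  let ?Ln = "lists_n J n" and ?L = "lists_n J (n + l)"
  obtain a0 where a0: "a0 \<in> A" using ne by auto
  define \<tau> where "\<tau> = replicate l a0"
  have \<tau>: "\<tau> \<in> lists_n A l" using a0 by (auto simp: \<tau>_def lists_n_eq)
  define Perms where "Perms = {\<pi>. \<pi> permutes {..<n + l}}"
  have fin_Perms: "finite Perms" "Perms \<noteq> {}" "card Perms = fact (n + l)"
    unfolding Perms_def using finite_permutations[of "{..<n + l}"] card_permutations[of "{..<n + l}" "n + l"]
    by (auto intro!: exI[of _ id] permutes_id)
  define h where "h = (\<lambda>\<pi>. pad_code A B n l \<tau> \<pi> c)"
  \<comment> \<open>On the finite set of permuted codes all subsets are measurable, so measurability
    is automatic and integrals are averages over permutations.\<close>
  define \<mu> where "\<mu> = distr (uniform_count_measure Perms) (count_space (h ` Perms)) h"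
  have meas: "h \<in> measurable (uniform_count_measure Perms) (count_space (h ` Perms))"
    by (auto simp: measurable_def space_uniform_count_measure sets_uniform_count_measure)
  show ?thesis
  proof (rule that)
    show "prob_space \<mu>" unfolding \<mu>_def
      by (intro prob_space.prob_space_distr prob_space_uniform_count_measure fin_Perms meas)
    show "is_cet_code A B (n + l) M1 M2 c'" if "c' \<in> space \<mu>" for c'
      using that is_cet_code_pad_code[OF fin(1,3) c \<tau>] by (auto simp: \<mu>_def h_def Perms_def)
    show "f \<in> borel_measurable \<mu>" for f :: "('a, 'b) cet_code \<Rightarrow> real"
      by (simp add: \<mu>_def)
    fix \<sigma> assume \<sigma>: "\<sigma> \<in> states ?L"
    then have psd: "psd ?L \<sigma>" by (simp add: states_def)
    let ?s = "\<lambda>\<pi>. reduced J n l (\<lambda>xs ys. \<sigma> (permute_list \<pi> xs) (permute_list \<pi> ys))"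
    define G where "G = err_kernel A J B N n M1 c"
    obtain S where S: "S \<subseteq> states J" and bound: "\<And>G \<omega> \<epsilon>. pos_kernel ?Ln G \<Longrightarrow> psd ?L \<omega> \<Longrightarrow>
       (\<And>\<pi> xs ys. \<pi> permutes {..<n + l} \<Longrightarrow> xs \<in> ?L \<Longrightarrow> ys \<in> ?L \<Longrightarrow>
          \<omega> (permute_list \<pi> xs) (permute_list \<pi> ys) = \<omega> xs ys) \<Longrightarrow>
       \<epsilon> \<ge> 0 \<Longrightarrow> (\<And>\<sigma>. \<sigma> \<in> S \<Longrightarrow> Re (pairing ?Ln G (tensor_list J n \<sigma>)) \<le> \<epsilon>) \<Longrightarrow>
       Re (pairing ?Ln G (reduced J n l \<omega>)) \<le> 2 * (real (n + l) / l) ^ (card (J \<times> J) - 1) * \<epsilon> * Re (op_trace ?L \<omega>)"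
      by (rule de_finetti_bound[OF fin(2) ne(2) l, of n]) blast
    have Gs: "Re (pairing ?Ln G (tensor_list J n s)) \<le> \<epsilon>" if "s \<in> S" for s
    proof -
      have s: "s \<in> states J" using that S by auto
      then have ts: "tensor_list J n s \<in> states ?Ln" by (rule tensor_list_states[OF fin(2)])
      have "ch_pow A B n (jam_ch N s) = avqc_ch A J B n N (tensor_list J n s)"
        using s N by (intro ext ch_pow_jam_ch[OF fin(1,2), THEN fun_cong, THEN fun_cong])
          (auto simp: states_def psd_def channel_def cp_map_def)
      with good[OF s] show ?thesis
        using pairing_err_kernel_psd[OF fin N c, of "tensor_list J n s"] ts by (simp add: G_def states_def)
    qed
    have red_psd: "psd ?Ln (reduced J n l \<omega>)" if "pos_kernel ?L \<omega>" for \<omega>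
    proof -
      have "pos_kernel ?Ln (\<lambda>xs ys. \<Sum>us\<in>lists_n J l. \<omega> (xs @ us) (ys @ us))"
        by (intro pos_kernel_sum pos_kernel_reindex[of ?L ?Ln "\<lambda>xs. xs @ _" \<omega>])
          (use fin that in \<open>auto intro: append_lists_n\<close>)
      then have "pos_kernel ?Ln (reduced J n l \<omega>)"
        by (rule iffD1[OF pos_kernel_cong, rotated]) (simp add: reduced_def)
      then show ?thesis by (auto simp: psd_iff is_op_def reduced_def)
    qed
    have red_tr: "op_trace ?Ln (reduced J n l \<omega>) = op_trace ?L \<omega>" for \<omega>
      by (simp add: op_trace_def reduced_def sum_lists_append fin)
    have P: "Pbar_cet M1 (h \<pi>) (avqc_ch A J B (n + l) N \<sigma>) = 1 - Re (pairing ?Ln G (?s (inv \<pi>)))" if "\<pi> \<in> Perms" for \<pi>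
    proof -
      have \<pi>: "\<pi> permutes {..<n + l}" "inv \<pi> permutes {..<n + l}" using that permutes_inv by (auto simp: Perms_def)
      have p: "psd ?Ln (?s (inv \<pi>))" by (rule red_psd[OF psd_permute[OF fin(2) psd \<pi>(2)]])
      have "op_trace ?Ln (?s (inv \<pi>)) = op_trace ?L \<sigma>"
        unfolding red_tr unfolding op_trace_def by (rule sum.reindex_bij_betw[OF bij_betw_permute_list[OF \<pi>(2)]])
      then have tr: "Re (op_trace ?Ln (?s (inv \<pi>))) = 1" using \<sigma> by (simp add: states_def)
      have "complex_of_real (Pbar_cet M1 (h \<pi>) (avqc_ch A J B (n + l) N \<sigma>)) = code_fid M1 (h \<pi>) (avqc_ch A J B (n + l) N \<sigma>)"
        using Pbar_avqc(1)[OF fin N _ psd] is_cet_code_pad_code[OF fin(1,3) c \<tau> \<pi>(1)] by (simp add: h_def)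
      also have "\<dots> = code_fid M1 c (avqc_ch A J B n N (?s (inv \<pi>)))"
        unfolding h_def by (rule code_fid_pad_code[OF fin N \<tau> \<pi>(1)])
      also have "\<dots> = of_real (Pbar_cet M1 c (avqc_ch A J B n N (?s (inv \<pi>))))"
        by (rule Pbar_avqc(1)[OF fin N c p])
      finally show ?thesis
        using pairing_err_kernel_psd[OF fin N c p] tr by (simp add: G_def)
    qed
    have "integral\<^sup>L \<mu> (\<lambda>c. Pbar_cet M1 c (avqc_ch A J B (n + l) N \<sigma>))
       = integral\<^sup>L (uniform_count_measure Perms) (\<lambda>\<pi>. Pbar_cet M1 (h \<pi>) (avqc_ch A J B (n + l) N \<sigma>))"
      unfolding \<mu>_def by (rule integral_distr[OF meas]) simp
    also have "\<dots> = (\<Sum>\<pi>\<in>Perms. Pbar_cet M1 (h \<pi>) (avqc_ch A J B (n + l) N \<sigma>)) / card Perms"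
      by (rule integral_uniform_count_measure[OF fin_Perms(1)])
    also have "(\<Sum>\<pi>\<in>Perms. Pbar_cet M1 (h \<pi>) (avqc_ch A J B (n + l) N \<sigma>)) = (\<Sum>\<pi>\<in>Perms. 1 - Re (pairing ?Ln G (?s (inv \<pi>))))"
      by (intro sum.cong refl P)
    \<comment> \<open>The code for \<pi> meets the jamming state permuted by the inverse; summing
      over the whole group removes the inverse.\<close>
    also have "\<dots> = (\<Sum>\<pi>\<in>Perms. 1 - Re (pairing ?Ln G (?s \<pi>)))"
      unfolding Perms_def by (rule sum_permutations_inverse[symmetric])
    also have "\<dots> / card Perms = 1 - (\<Sum>\<pi>\<in>Perms. Re (pairing ?Ln G (?s \<pi>))) / fact (n + l)"
      by (simp add: sum_subtractf fin_Perms(3) diff_divide_distrib)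
    also have "(\<Sum>\<pi>\<in>Perms. Re (pairing ?Ln G (?s \<pi>))) / fact (n + l) = Re (pairing ?Ln G (reduced J n l (perm_average J (n + l) \<sigma>)))"
    proof -
      have "reduced J n l (perm_average J (n + l) \<sigma>) xs ys = (\<Sum>\<pi>\<in>Perms. of_real (1 / fact (n + l)) * ?s \<pi> xs ys)"
        if "xs \<in> ?Ln" "ys \<in> ?Ln" for xs ys
      proof -
        have "reduced J n l (perm_average J (n + l) \<sigma>) xs ys = (\<Sum>us\<in>lists_n J l. \<Sum>\<pi>\<in>Perms.
           of_real (1 / fact (n + l)) * \<sigma> (permute_list \<pi> (xs @ us)) (permute_list \<pi> (ys @ us)))"
          using that unfolding reduced_def perm_average_def Perms_def by (auto simp: append_lists_n intro!: sum.cong)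
        also have "\<dots> = (\<Sum>\<pi>\<in>Perms. \<Sum>us\<in>lists_n J l.
           of_real (1 / fact (n + l)) * \<sigma> (permute_list \<pi> (xs @ us)) (permute_list \<pi> (ys @ us)))" by (rule sum.swap)
        finally show ?thesis using that by (simp only: reduced_def sum_distrib_left simp_thms if_True)
      qed
      then have "pairing ?Ln G (reduced J n l (perm_average J (n + l) \<sigma>))
         = (\<Sum>xs\<in>?Ln. \<Sum>ys\<in>?Ln. \<Sum>\<pi>\<in>Perms. of_real (1 / fact (n + l)) * (G xs ys * ?s \<pi> xs ys))"
        unfolding pairing_def by (intro sum.cong refl) (simp add: sum_distrib_left mult_ac)
      also have "\<dots> = (\<Sum>\<pi>\<in>Perms. \<Sum>xs\<in>?Ln. \<Sum>ys\<in>?Ln. of_real (1 / fact (n + l)) * (G xs ys * ?s \<pi> xs ys))"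
        unfolding sum.swap[of _ _ Perms] ..
      also have "\<dots> = of_real (1 / fact (n + l)) * (\<Sum>\<pi>\<in>Perms. pairing ?Ln G (?s \<pi>))"
        unfolding pairing_def sum_distrib_left ..
      finally have "Re (pairing ?Ln G (reduced J n l (perm_average J (n + l) \<sigma>)))
         = 1 / fact (n + l) * Re (\<Sum>\<pi>\<in>Perms. pairing ?Ln G (?s \<pi>))" by (simp only: Re_complex_of_real times_complex.sel Im_complex_of_real)
      then show ?thesis by simp
    qed
    finally have int: "integral\<^sup>L \<mu> (\<lambda>c. Pbar_cet M1 c (avqc_ch A J B (n + l) N \<sigma>))
       = 1 - Re (pairing ?Ln G (reduced J n l (perm_average J (n + l) \<sigma>)))" .
    have av: "perm_average J (n + l) \<sigma> \<in> states ?L" by (rule perm_average_states[OF fin(2) \<sigma>])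
    have "Re (pairing ?Ln G (reduced J n l (perm_average J (n + l) \<sigma>)))
        \<le> 2 * (real (n + l) / l) ^ (card (J \<times> J) - 1) * \<epsilon> * Re (op_trace ?L (perm_average J (n + l) \<sigma>))"
    proof (rule bound[where G = G and \<omega> = "perm_average J (n + l) \<sigma>" and \<epsilon> = \<epsilon>])
      show "pos_kernel ?Ln G" unfolding G_def by (rule pos_kernel_err_kernel[OF fin N c])
      show "psd ?L (perm_average J (n + l) \<sigma>)" using av by (simp add: states_def)
    qed (simp_all add: perm_average_permute \<epsilon> Gs)
    then show "1 - 2 * (real (n + l) / l) ^ (card (J \<times> J) - 1) * \<epsilon> \<le> integral\<^sup>L \<mu> (\<lambda>c. Pbar_cet M1 c (avqc_ch A J B (n + l) N \<sigma>))"
      using av int by (simp add: states_def)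
  qed
qed

subsection \<open>Derandomisation\<close>

lemma (in prob_space) ex_le_expectation:
  fixes f :: "'a \<Rightarrow> real"
  assumes "integrable M f" "expectation f \<le> r"
  shows "\<exists>x\<in>space M. f x \<le> r"
proof (rule ccontr)
  assume "\<not> (\<exists>x\<in>space M. f x \<le> r)"
  then have "AE x in M. r < f x" by (intro AE_I2) auto
  then have "(\<integral>x. r \<partial>M) < expectation f"
    using assms(1) by (intro integral_less_AE_space) (auto simp: emeasure_space_1)
  then show False using assms(2) by (simp add: prob_space)
qed

text \<open>Greedy choice of the samples: conditioned on the earlier ones, a new sample increases the sum of
  the squared deviations by at most \<open>card S\<close> on average, because the cross terms have mean zero.\<close>
lemma (in prob_space) ex_samples:
  fixes F :: "'s \<Rightarrow> 'a \<Rightarrow> real"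
  assumes S: "finite S" and meas: "\<And>s. s \<in> S \<Longrightarrow> F s \<in> borel_measurable M"
    and bnd: "\<And>s x. s \<in> S \<Longrightarrow> x \<in> space M \<Longrightarrow> 0 \<le> F s x \<and> F s x \<le> 1"
  shows "\<exists>c. (\<forall>i<K. c i \<in> space M) \<and> (\<Sum>s\<in>S. (\<Sum>i<K. F s (c i) - expectation (F s))\<^sup>2) \<le> real K * real (card S)"
proof (induction K)
  case 0
  show ?case by simp
next
  case (Suc K)
  then obtain c where c: "\<And>i. i < K \<Longrightarrow> c i \<in> space M"
    and le: "(\<Sum>s\<in>S. (\<Sum>i<K. F s (c i) - expectation (F s))\<^sup>2) \<le> real K * real (card S)" by auto
  define D where "D = (\<lambda>s. \<Sum>i<K. F s (c i) - expectation (F s))"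
  define m where "m = (\<lambda>s. expectation (F s))"
  have int: "integrable M (F s)" if "s \<in> S" for s
    by (rule integrable_const_bound[where B = 1, OF _ meas[OF that]]) (use bnd that in \<open>auto intro!: AE_I2\<close>)
  have int2: "integrable M (\<lambda>x. (F s x)\<^sup>2)" if "s \<in> S" for s
  proof (rule integrable_const_bound[where B = 1])
    show "AE x in M. norm ((F s x)\<^sup>2) \<le> 1" using bnd[OF that] by (intro AE_I2) (auto simp: power_le_one)
    show "(\<lambda>x. (F s x)\<^sup>2) \<in> borel_measurable M" using meas[OF that] by measurable
  qed
  have eq: "(D s + (F s x - m s))\<^sup>2 = (F s x)\<^sup>2 + 2 * (D s - m s) * F s x + (D s - m s)\<^sup>2" for s x
    by (simp add: power2_eq_square algebra_simps)
  have i3: "integrable M (\<lambda>x. (D s + (F s x - m s))\<^sup>2)" if "s \<in> S" for s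
    unfolding eq using int[OF that] int2[OF that] by auto
  have e3: "expectation (\<lambda>x. (D s + (F s x - m s))\<^sup>2) \<le> (D s)\<^sup>2 + 1" if s: "s \<in> S" for s
  proof -
    have m0: "0 \<le> m s" unfolding m_def by (rule integral_nonneg_AE) (use bnd s in \<open>auto intro!: AE_I2\<close>)
    have "expectation (\<lambda>x. (F s x)\<^sup>2) \<le> expectation (\<lambda>x. F s x)"
      by (rule integral_mono_AE[OF int2[OF s] int[OF s]])
        (use bnd[OF s] in \<open>auto intro!: AE_I2 simp: power2_eq_square mult_left_le\<close>)
    also have "\<dots> \<le> expectation (\<lambda>x. 1)"
      by (rule integral_mono_AE[OF int[OF s]]) (use bnd[OF s] in \<open>auto intro!: AE_I2\<close>)
    finally have sq: "expectation (\<lambda>x. (F s x)\<^sup>2) \<le> 1" by (simp add: prob_space)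
    have "expectation (\<lambda>x. (D s + (F s x - m s))\<^sup>2)
       = expectation (\<lambda>x. (F s x)\<^sup>2) + 2 * (D s - m s) * m s + (D s - m s)\<^sup>2"
      unfolding eq using int[OF s] int2[OF s] by (simp add: prob_space m_def)
    also have "\<dots> = expectation (\<lambda>x. (F s x)\<^sup>2) + (D s)\<^sup>2 - (m s)\<^sup>2"
      by (simp add: power2_eq_square algebra_simps)
    finally show ?thesis using sq zero_le_power2[of "m s"] by linarith
  qed
  have "expectation (\<lambda>x. \<Sum>s\<in>S. (D s + (F s x - m s))\<^sup>2) = (\<Sum>s\<in>S. expectation (\<lambda>x. (D s + (F s x - m s))\<^sup>2))"
    by (rule Bochner_Integration.integral_sum) (rule i3)
  also have "\<dots> \<le> (\<Sum>s\<in>S. (D s)\<^sup>2 + 1)" by (intro sum_mono e3)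
  also have "\<dots> \<le> real K * real (card S) + real (card S)"
    using le by (simp add: sum.distrib D_def)
  finally have "expectation (\<lambda>x. \<Sum>s\<in>S. (D s + (F s x - m s))\<^sup>2) \<le> real K * real (card S) + real (card S)" .
  moreover have "integrable M (\<lambda>x. \<Sum>s\<in>S. (D s + (F s x - m s))\<^sup>2)"
    by (rule Bochner_Integration.integrable_sum) (rule i3)
  ultimately obtain x where x: "x \<in> space M"
      "(\<Sum>s\<in>S. (D s + (F s x - m s))\<^sup>2) \<le> real K * real (card S) + real (card S)"
    using ex_le_expectation by blast
  show ?case
  proof (intro exI[of _ "c(K := x)"] conjI allI impI)
    show "(c(K := x)) i \<in> space M" if "i < Suc K" for i using that c x by auto
    have dev: "(\<Sum>i<Suc K. F s ((c(K := x)) i) - expectation (F s)) = D s + (F s x - m s)" for s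
      by (simp add: D_def m_def)
    show "(\<Sum>s\<in>S. (\<Sum>i<Suc K. F s ((c(K := x)) i) - expectation (F s))\<^sup>2) \<le> real (Suc K) * real (card S)"
      unfolding dev of_nat_Suc distrib_right using x(2) by linarith
  qed
qed

lemma tensor_list_append:
  assumes "xs \<in> lists_n J n" "ys \<in> lists_n J n" "us \<in> lists_n J l" "vs \<in> lists_n J l"
  shows "tensor_list J (n + l) \<sigma> (xs @ us) (ys @ vs) = tensor_list J n \<sigma> xs ys * tensor_list J l \<sigma> us vs"
proof -
  have "(\<Prod>k<n + l. f k) = (\<Prod>k<n. f k) * (\<Prod>k<l. f (n + k))" for f :: "nat \<Rightarrow> complex"
    by (induction l) (simp_all add: mult.assoc)
  then show ?thesis using assms
    by (simp add: tensor_list_def append_lists_n nth_append lists_n_length)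
qed

lemma reduced_tensor_list:
  assumes fin: "finite J" and \<sigma>: "\<sigma> \<in> states J"
  shows "reduced J n l (tensor_list J (n + l) \<sigma>) = tensor_list J n \<sigma>"
proof (intro ext)
  fix xs ys
  show "reduced J n l (tensor_list J (n + l) \<sigma>) xs ys = tensor_list J n \<sigma> xs ys"
  proof (cases "xs \<in> lists_n J n \<and> ys \<in> lists_n J n")
    case True
    then have "reduced J n l (tensor_list J (n + l) \<sigma>) xs ys = tensor_list J n \<sigma> xs ys * op_trace (lists_n J l) (tensor_list J l \<sigma>)"
      by (simp add: reduced_def tensor_list_append op_trace_def sum_distrib_left)
    then show ?thesis using tensor_list_states[OF fin \<sigma>, of l] by (simp add: states_def)
  qed (auto simp: reduced_def tensor_list_def)
qed

lemma tensor_list_permute: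
  assumes \<pi>: "\<pi> permutes {..<m}" and xs: "xs \<in> lists_n J m" "ys \<in> lists_n J m"
  shows "tensor_list J m \<sigma> (permute_list \<pi> xs) (permute_list \<pi> ys) = tensor_list J m \<sigma> xs ys"
proof -
  have "tensor_list J m \<sigma> (permute_list \<pi> xs) (permute_list \<pi> ys) = (\<Prod>k<m. \<sigma> (xs ! \<pi> k) (ys ! \<pi> k))"
    using xs \<pi> permute_lists_n[OF \<pi>] by (auto simp: tensor_list_def permute_list_nth lists_n_length intro!: prod.cong)
  also have "\<dots> = (\<Prod>k<m. \<sigma> (xs ! k) (ys ! k))"
    by (rule prod.reindex_bij_betw[OF permutes_imp_bij[OF \<pi>], where g = "\<lambda>k. \<sigma> (xs ! k) (ys ! k)"])
  finally show ?thesis using xs by (simp add: tensor_list_def)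
qed

lemma ch_pow_jam_ch_fun:
  assumes "finite A" "finite J" "channel (A \<times> J) B N" "\<sigma> \<in> states J"
  shows "ch_pow A B n (jam_ch N \<sigma>) = avqc_ch A J B n N (tensor_list J n \<sigma>)"
  by (rule ext, rule ch_pow_jam_ch[OF assms(1,2)])
    (use assms(3,4) in \<open>simp_all add: states_def psd_def channel_def cp_map_def\<close>)

text \<open>The bound on card S from \<open>de_finetti_bound\<close> for l = n.\<close>

definition sample_bound :: "nat \<Rightarrow> nat \<Rightarrow> nat" where
  "sample_bound d n = (5 * (2 * n + d)\<^sup>2) ^ d * (2 * n + d) ^ d"

text \<open>The samples keep the total squared deviation over S below the square of \<eta> K, so
  every state in S has mean error at most \<epsilon> + \<eta>. Any other \<sigma> is reached by the
  de Finetti bound with l = n for the 2n-th tensor power, whose marginal is the n-th one; the factor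
  is 2 * 2 ^ (d - 1) = 2 ^ d.\<close>

lemma ex_code_family:
  fixes \<mu> :: "('a, 'b) cet_code measure" and N :: "('a \<times> 'j) op \<Rightarrow> 'b op"
  assumes fin: "finite A" "finite J" "finite B" and ne: "J \<noteq> {}" and N: "channel (A \<times> J) B N"
    and \<mu>: "prob_space \<mu>" "\<And>c. c \<in> space \<mu> \<Longrightarrow> is_cet_code A B n M1 M2 c"
    and meas: "\<And>\<sigma>. \<sigma> \<in> states (lists_n J n) \<Longrightarrow> (\<lambda>c. Pbar_cet M1 c (avqc_ch A J B n N \<sigma>)) \<in> borel_measurable \<mu>"
    and good: "\<And>\<sigma>. \<sigma> \<in> states (lists_n J n) \<Longrightarrow> 1 - \<epsilon> \<le> integral\<^sup>L \<mu> (\<lambda>c. Pbar_cet M1 c (avqc_ch A J B n N \<sigma>))"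
    and n: "n > 0" and \<eta>: "\<eta> > 0" "\<epsilon> \<ge> 0" and K: "real (sample_bound (card (J \<times> J)) n) \<le> \<eta>\<^sup>2 * real K"
  obtains c where "\<And>i. i < K \<Longrightarrow> is_cet_code A B n M1 M2 (c i)"
    "\<And>\<sigma>. \<sigma> \<in> states J \<Longrightarrow> (\<Sum>i<K. 1 - Pbar_cet M1 (c i) (ch_pow A B n (jam_ch N \<sigma>))) \<le> K * (2 ^ card (J \<times> J) * (\<epsilon> + \<eta>))"
proof -
  interpret prob_space \<mu> by (rule \<mu>)
  let ?L = "lists_n J n" and ?d = "card (J \<times> J)"
  have d: "?d > 0" using fin ne by (simp add: card_gt_0_iff del: card_cartesian_product)
  show thesis
  proof (rule de_finetti_bound[OF fin(2) ne n, of n])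
    fix S assume S: "finite S" "S \<subseteq> states J"
      and cS0: "card S \<le> (5 * (n + n + ?d)\<^sup>2) ^ ?d * (n + n + ?d) ^ ?d"
      and bound: "\<And>G \<omega> \<epsilon>. pos_kernel ?L G \<Longrightarrow> psd (lists_n J (n + n)) \<omega> \<Longrightarrow>
         (\<And>\<pi> xs ys. \<pi> permutes {..<n + n} \<Longrightarrow> xs \<in> lists_n J (n + n) \<Longrightarrow> ys \<in> lists_n J (n + n) \<Longrightarrow>
            \<omega> (permute_list \<pi> xs) (permute_list \<pi> ys) = \<omega> xs ys) \<Longrightarrow>
         \<epsilon> \<ge> 0 \<Longrightarrow> (\<And>\<sigma>. \<sigma> \<in> S \<Longrightarrow> Re (pairing ?L G (tensor_list J n \<sigma>)) \<le> \<epsilon>) \<Longrightarrow>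
         Re (pairing ?L G (reduced J n n \<omega>)) \<le> 2 * (real (n + n) / n) ^ (?d - 1) * \<epsilon> * Re (op_trace (lists_n J (n + n)) \<omega>)"
    have cS: "card S \<le> sample_bound ?d n" unfolding sample_bound_def mult_2 by (rule cS0)
    define F where "F = (\<lambda>s c. Pbar_cet M1 c (avqc_ch A J B n N (tensor_list J n s)))"
    have st: "tensor_list J n s \<in> states ?L" if "s \<in> states J" for s
      by (rule tensor_list_states[OF fin(2) that])
    have F01: "0 \<le> F s c \<and> F s c \<le> 1" if "s \<in> states J" "is_cet_code A B n M1 M2 c" for s c
      using Pbar_avqc(2,3)[OF fin N that(2), of "tensor_list J n s"] st[OF that(1)] by (simp add: F_def states_def)
    have "0 \<le> F s x \<and> F s x \<le> 1" if "s \<in> S" "x \<in> space \<mu>" for s x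
      using F01 that S \<mu>(2) by blast
    moreover have "F s \<in> borel_measurable \<mu>" if "s \<in> S" for s
      unfolding F_def using meas st that S by blast
    ultimately obtain c where c: "\<And>i. i < K \<Longrightarrow> c i \<in> space \<mu>"
        and dev: "(\<Sum>s\<in>S. (\<Sum>i<K. F s (c i) - expectation (F s))\<^sup>2) \<le> real K * real (card S)"
      using ex_samples[OF S(1), of F K] by blast
    have code: "is_cet_code A B n M1 M2 (c i)" if "i < K" for i using c[OF that] \<mu>(2) by blast
    have S_good: "(\<Sum>i<K. 1 - F s (c i)) \<le> K * (\<epsilon> + \<eta>)" if s: "s \<in> S" for s
    proof -
      have "(\<Sum>i<K. F s (c i) - expectation (F s))\<^sup>2 \<le> (\<Sum>s\<in>S. (\<Sum>i<K. F s (c i) - expectation (F s))\<^sup>2)"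
        using S(1) s by (intro member_le_sum) auto
      also have "\<dots> \<le> real K * real (card S)" by (rule dev)
      also have "\<dots> \<le> real K * (\<eta>\<^sup>2 * real K)" using cS K by (intro mult_left_mono) auto
      also have "\<dots> = (\<eta> * K)\<^sup>2" by (simp add: power2_eq_square)
      finally have "\<bar>\<Sum>i<K. F s (c i) - expectation (F s)\<bar> \<le> \<eta> * K"
        using \<eta> by (simp add: abs_le_square_iff[symmetric])
      then have "(\<Sum>i<K. F s (c i)) \<ge> K * expectation (F s) - \<eta> * K" by (simp add: sum_subtractf)
      moreover have "expectation (F s) \<ge> 1 - \<epsilon>"
        using good[OF st, of s] s S(2) by (auto simp: F_def)
      then have "K * expectation (F s) \<ge> K * (1 - \<epsilon>)" by (intro mult_left_mono) auto
      ultimately have "(\<Sum>i<K. F s (c i)) \<ge> K * (1 - \<epsilon>) - \<eta> * K" by linarith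
      then show ?thesis by (simp add: sum_subtractf algebra_simps)
    qed
    \<comment> \<open>The kernels of all samples are added first: only the total error of the family
      is controlled, not that of a single member.\<close>
    define G where "G = (\<lambda>xs ys. \<Sum>i<K. err_kernel A J B N n M1 (c i) xs ys)"
    have G: "pos_kernel ?L G"
      unfolding G_def by (rule pos_kernel_sum) (use pos_kernel_err_kernel[OF fin N code] in auto)
    have pG: "Re (pairing ?L G (tensor_list J n s)) = (\<Sum>i<K. 1 - F s (c i))" if s: "s \<in> states J" for s
    proof -
      have "pairing ?L G (tensor_list J n s) = (\<Sum>i<K. pairing ?L (err_kernel A J B N n M1 (c i)) (tensor_list J n s))"
        unfolding pairing_def G_def sum_distrib_right sum.swap[of _ _ "{..<K}"] ..
      also have "\<dots> = (\<Sum>i<K. of_real (1 - F s (c i)))"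
        using st[OF s] by (intro sum.cong refl) (simp add: pairing_err_kernel_psd[OF fin N code] F_def states_def)
      finally show ?thesis by simp
    qed
    show ?thesis
    proof (rule that[OF code])
      fix \<sigma> assume \<sigma>: "\<sigma> \<in> states J"
      have t2: "tensor_list J (n + n) \<sigma> \<in> states (lists_n J (n + n))" by (rule tensor_list_states[OF fin(2) \<sigma>])
      have "Re (pairing ?L G (reduced J n n (tensor_list J (n + n) \<sigma>)))
        \<le> 2 * (real (n + n) / n) ^ (?d - 1) * (K * (\<epsilon> + \<eta>)) * Re (op_trace (lists_n J (n + n)) (tensor_list J (n + n) \<sigma>))"
      proof (rule bound[OF G])
        show "psd (lists_n J (n + n)) (tensor_list J (n + n) \<sigma>)" using t2 by (simp add: states_def)
        show "0 \<le> K * (\<epsilon> + \<eta>)" using \<eta> by simp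
        show "Re (pairing ?L G (tensor_list J n s)) \<le> K * (\<epsilon> + \<eta>)" if "s \<in> S" for s
          using pG[of s] S_good[OF that] that S(2) by auto
      qed (simp add: tensor_list_permute)
      also have "\<dots> = 2 * 2 ^ (?d - 1) * (K * (\<epsilon> + \<eta>))" using t2 n by (simp add: states_def)
      also have "2 * 2 ^ (?d - 1) = (2::real) ^ ?d" using d by (simp add: power_eq_if)
      finally have "(\<Sum>i<K. 1 - F \<sigma> (c i)) \<le> 2 ^ ?d * (K * (\<epsilon> + \<eta>))"
        unfolding reduced_tensor_list[OF fin(2) \<sigma>] pG[OF \<sigma>] .
      then show "(\<Sum>i<K. 1 - Pbar_cet M1 (c i) (ch_pow A B n (jam_ch N \<sigma>))) \<le> K * (2 ^ ?d * (\<epsilon> + \<eta>))"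
        unfolding ch_pow_jam_ch_fun[OF fin(1,2) N \<sigma>] F_def by (simp add: mult_ac)
    qed
  qed
qed

subsection \<open>Relabelling the code spaces\<close>

definition relabel :: "'t set \<Rightarrow> ('t \<Rightarrow> 's) \<Rightarrow> 's op \<Rightarrow> 't op" where
  "relabel T f X = (\<lambda>a b. if a \<in> T \<and> b \<in> T then X (f a) (f b) else 0)"

lemma relabel_channel:
  assumes fin: "finite S" "finite T'" and T: "T \<subseteq> T'" and f: "bij_betw f T S"
  shows "channel S T' (relabel T f)"
proof -
  have lin: "lin_map S T' (relabel T f)"
    using T by (auto simp: lin_map_def is_op_def relabel_def fun_eq_iff)
  define u where "u = (\<lambda>(i, a). if a \<in> T \<and> f a = i then 1 else (0::complex))"
  have "pos_kernel (S \<times> T') (\<lambda>p q. u p * cnj (u q))" by (rule pos_kernel_outer)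
  then have "pos_kernel (S \<times> T') (map_kernel (relabel T f))"
    by (rule iffD1[OF pos_kernel_cong, rotated]) (auto simp: u_def relabel_def unit_op_def)
  then have "cp_map S T' (relabel T f)" using fin by (intro cp_mapI lin) auto
  moreover have "op_trace T' (relabel T f X) = op_trace S X" for X
  proof -
    have "op_trace T' (relabel T f X) = (\<Sum>a\<in>T. X (f a) (f a))"
      unfolding op_trace_def relabel_def using fin T by (intro sum.mono_neutral_cong_right) auto
    also have "\<dots> = op_trace S X"
      unfolding op_trace_def by (rule sum.reindex_bij_betw[OF f])
    finally show ?thesis .
  qed
  ultimately show ?thesis by (simp add: channel_def trace_pres_def)
qed

text \<open>Sampled codes may live on different spaces. To be selected by an index inside one code
  they need the same pair of spaces, and Q may be larger than necessary so that one value fits all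
  of them.\<close>

lemma ex_normalized_code:
  assumes fin: "finite A" "finite B" and c: "is_cet_code A B n M1 M2 (FA, FB, P, R)" and Q: "card FB \<le> Q"
  obtains P' R' where "is_cet_code A B n M1 M2 ({..<M2}, {..<Q}, P', R')"
    "\<And>M. code_fid M1 ({..<M2}, {..<Q}, P', R') M = code_fid M1 (FA, FB, P, R) M"
proof -
  note D = is_cet_codeD[OF c]
  define q where "q = card FB"
  have M2q: "M2 \<le> q" using D(1-3) card_mono by (auto simp: q_def)
  obtain g1 where g1: "bij_betw g1 {..<M2} FA"
    using ex_bij_betw_nat_finite[OF D(4)] D(3) by (auto simp: atLeast0LessThan)
  have "card {M2..<q} = card (FB - FA)" using D(1-4) by (simp add: q_def card_Diff_subset)
  then obtain g2 where g2: "bij_betw g2 {M2..<q} (FB - FA)"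
    using finite_same_card_bij[of "{M2..<q}" "FB - FA"] D(1) by auto
  \<comment> \<open>A bijection onto \<open>FB\<close> that maps the initial segment {..<M2} onto
    \<open>FA\<close>, so that the inclusion of the spaces becomes one of initial segments.\<close>
  define g where "g = (\<lambda>x. if x < M2 then g1 x else g2 x)"
  have gA: "bij_betw g {..<M2} FA" using g1 by (rule iffD1[OF bij_betw_cong, rotated]) (simp add: g_def)
  have "bij_betw g {M2..<q} (FB - FA)" using g2 by (rule iffD1[OF bij_betw_cong, rotated]) (simp add: g_def)
  from bij_betw_combine[OF gA this] have "bij_betw g ({..<M2} \<union> {M2..<q}) (FA \<union> (FB - FA))" by auto
  moreover have "{..<M2} \<union> {M2..<q} = {..<q}" "FA \<union> (FB - FA) = FB" using M2q D(2) by auto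
  ultimately have gB: "bij_betw g {..<q} FB" by simp
  define h where "h = inv_into {..<M2} g"
  have hA: "bij_betw h FA {..<M2}" unfolding h_def by (rule bij_betw_inv_into[OF gA])
  have hg: "h (g k) = k" if "k < M2" for k
    using that gA by (simp add: h_def bij_betw_inv_into_left)
  define P' where "P' = (\<lambda>m X. P m (relabel FA h X))"
  define R' where "R' = (\<lambda>m Y. relabel {..<q} g (R m Y))"
  have rB: "channel FB {..<Q} (relabel {..<q} g)"
    by (rule relabel_channel[OF D(1) _ _ gB]) (use Q in \<open>auto simp: q_def\<close>)
  have rA: "channel {..<M2} FA (relabel FA h)" by (rule relabel_channel[OF _ D(4) _ hA]) auto
  show ?thesis
  proof (rule that)
    show "is_cet_code A B n M1 M2 ({..<M2}, {..<Q}, P', R')"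
    proof (rule is_cet_codeI[OF fin(2)])
      fix m assume m: "m \<in> {1..M1}"
      show "channel {..<M2} (lists_n A n) (P' m)"
        unfolding P'_def by (rule channel_comp[OF _ D(4) _ rA D(5)[OF m]]) (use fin in auto)
      show "cp_map (lists_n B n) {..<Q} (R' m)"
        unfolding R'_def by (rule cp_map_comp[OF _ D(1) _ D(6)[OF m]]) (use fin rB in \<open>auto simp: channel_def\<close>)
    next
      have "op_trace {..<Q} (\<lambda>a b. \<Sum>m\<in>{1..M1}. R' m Y a b) = op_trace (lists_n B n) Y" if Y: "is_op (lists_n B n) Y" for Y
      proof -
        have "op_trace {..<Q} (\<lambda>a b. \<Sum>m\<in>{1..M1}. R' m Y a b) = (\<Sum>m\<in>{1..M1}. op_trace {..<Q} (relabel {..<q} g (R m Y)))"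
          unfolding op_trace_def R'_def by (rule sum.swap)
        also have "\<dots> = (\<Sum>m\<in>{1..M1}. op_trace FB (R m Y))"
          using rB lin_map_is_op[OF cp_map_lin[OF D(6)] Y] by (intro sum.cong refl) (simp add: channel_def trace_pres_def)
        also have "\<dots> = op_trace FB (\<lambda>a b. \<Sum>m\<in>{1..M1}. R m Y a b)"
          unfolding op_trace_def by (rule sum.swap)
        also have "\<dots> = op_trace (lists_n B n) Y" using D(8) Y by (simp add: trace_pres_def)
        finally show ?thesis .
      qed
      then show "trace_pres (lists_n B n) {..<Q} (\<lambda>Y a b. \<Sum>m\<in>{1..M1}. R' m Y a b)"
        by (simp add: trace_pres_def)
    qed (use M2q Q in \<open>auto simp: q_def\<close>)
    fix M
    have e: "R' m (M (P' m (unit_op k k'))) k k' = R m (M (P m (unit_op (g k) (g k')))) (g k) (g k')"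
      if "k < M2" "k' < M2" for m k k'
    proof -
      have "relabel FA h (unit_op k k') = unit_op (g k) (g k')"
      proof (intro ext)
        fix a b
        have "h x = j \<longleftrightarrow> x = g j" if "x \<in> FA" "j < M2" for x j
        proof
          assume "h x = j"
          then show "x = g j" using bij_betw_inv_into_right[OF gA that(1)] by (simp add: h_def)
        qed (use hg[OF that(2)] in simp)
        moreover have "g k \<in> FA" "g k' \<in> FA" using that gA by (auto simp: bij_betw_def)
        ultimately show "relabel FA h (unit_op k k') a b = unit_op (g k) (g k') a b"
          using that by (auto simp: relabel_def unit_op_def)
      qed
      then show ?thesis using that M2q by (simp add: P'_def R'_def relabel_def)
    qed
    have re: "(\<Sum>k<M2. f (g k)) = (\<Sum>k\<in>FA. f k)" for f :: "nat \<Rightarrow> complex"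
      by (rule sum.reindex_bij_betw[OF gA])
    have "(\<Sum>k\<in>{..<M2}. \<Sum>k'\<in>{..<M2}. R' m (M (P' m (unit_op k k'))) k k')
       = (\<Sum>k\<in>FA. \<Sum>k'\<in>FA. R m (M (P m (unit_op k k'))) k k')" for m
    proof -
      define X where "X = (\<lambda>k k'. R m (M (P m (unit_op k k'))) k k')"
      have "(\<Sum>k\<in>{..<M2}. \<Sum>k'\<in>{..<M2}. R' m (M (P' m (unit_op k k'))) k k') = (\<Sum>k<M2. \<Sum>k'<M2. X (g k) (g k'))"
        by (intro sum.cong refl) (simp add: e X_def)
      also have "\<dots> = (\<Sum>k<M2. \<Sum>k'\<in>FA. X (g k) k')" by (intro sum.cong refl re)
      also have "\<dots> = (\<Sum>k\<in>FA. \<Sum>k'\<in>FA. X k k')" by (rule re)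
      finally show ?thesis by (simp add: X_def)
    qed
    then show "code_fid M1 ({..<M2}, {..<Q}, P', R') M = code_fid M1 (FA, FB, P, R) M"
      using D(3) by (simp add: code_fid_def)
  qed
qed

subsection \<open>Concatenating blocks\<close>

definition app_op :: "'i set \<Rightarrow> nat \<Rightarrow> nat \<Rightarrow> 'i list op \<Rightarrow> 'i list op \<Rightarrow> 'i list op" where
  "app_op I n l X Y = (\<lambda>as as'. if as \<in> lists_n I (n + l) \<and> as' \<in> lists_n I (n + l)
     then X (take n as) (take n as') * Y (drop n as) (drop n as') else 0)"

lemma app_op_append:
  assumes "xs \<in> lists_n I n" "ys \<in> lists_n I n" "us \<in> lists_n I l" "vs \<in> lists_n I l"
  shows "app_op I n l X Y (xs @ us) (ys @ vs) = X xs ys * Y us vs"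
  using assms by (simp add: app_op_def append_lists_n lists_n_length)

lemma is_op_app_op: "is_op (lists_n I (n + l)) (app_op I n l X Y)"
  by (auto simp: is_op_def app_op_def)

lemma pos_kernel_app_op:
  assumes "finite I" "pos_kernel (lists_n I n) X" "pos_kernel (lists_n I l) Y"
  shows "pos_kernel (lists_n I (n + l)) (app_op I n l X Y)"
proof -
  have "pos_kernel (lists_n I (n + l)) (\<lambda>as as'. X (take n as) (take n as') * Y (drop n as) (drop n as'))"
    by (rule pos_kernel_mult_reindex[where f = "take n" and g = "drop n", OF _ _ _ assms(2,3)])
      (use assms(1) take_drop_lists_n in auto)
  then show ?thesis by (rule iffD1[OF pos_kernel_cong, rotated]) (simp add: app_op_def)
qed

lemma op_trace_app_op:
  assumes "finite I"
  shows "op_trace (lists_n I (n + l)) (app_op I n l X Y) = op_trace (lists_n I n) X * op_trace (lists_n I l) Y"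
  unfolding op_trace_def sum_lists_append[OF assms] sum_product
  by (intro sum.cong refl app_op_append)

lemma app_op_states:
  assumes "finite I" "X \<in> states (lists_n I n)" "Y \<in> states (lists_n I l)"
  shows "app_op I n l X Y \<in> states (lists_n I (n + l))"
  using assms by (simp add: states_def psd_iff is_op_app_op pos_kernel_app_op op_trace_app_op)

lemma pairing_app_op:
  assumes "finite I"
  shows "pairing (lists_n I (n + l)) (app_op I n l E F) (app_op I n l X Y)
    = pairing (lists_n I n) E X * pairing (lists_n I l) F Y"
proof -
  have "pairing (lists_n I (n + l)) (app_op I n l E F) (app_op I n l X Y)
    = (\<Sum>xs\<in>lists_n I n. \<Sum>us\<in>lists_n I l. \<Sum>ys\<in>lists_n I n. \<Sum>vs\<in>lists_n I l. (E xs ys * X xs ys) * (F us vs * Y us vs))"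
    unfolding pairing_def sum_lists_append[OF assms] by (intro sum.cong refl) (simp add: app_op_append)
  also have "\<dots> = (\<Sum>xs\<in>lists_n I n. \<Sum>ys\<in>lists_n I n. \<Sum>us\<in>lists_n I l. \<Sum>vs\<in>lists_n I l. (E xs ys * X xs ys) * (F us vs * Y us vs))"
    by (intro sum.cong refl sum.swap)
  finally show ?thesis
    by (simp only: sum_distrib_left[symmetric] sum_distrib_right[symmetric] pairing_def)
qed

lemma ch_pow_app_op:
  assumes "finite A"
  shows "ch_pow A B (n + l) T (app_op A n l X Y) = app_op B n l (ch_pow A B n T X) (ch_pow A B l T Y)"
proof (intro ext)
  fix zs ws
  show "ch_pow A B (n + l) T (app_op A n l X Y) zs ws = app_op B n l (ch_pow A B n T X) (ch_pow A B l T Y) zs ws"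
  proof (cases "zs \<in> lists_n B (n + l) \<and> ws \<in> lists_n B (n + l)")
    case True
    then have td: "take n zs \<in> lists_n B n" "take n ws \<in> lists_n B n" "drop n zs \<in> lists_n B l" "drop n ws \<in> lists_n B l"
      using take_drop_lists_n by auto
    define f where "f = (\<lambda>xs ys zs ws k. T (unit_op (xs ! k) (ys ! k)) (zs ! k) (ws ! k))"
    have split: "(\<Prod>k<n + l. f (xs @ us) (ys @ vs) zs ws k)
        = (\<Prod>k<n. f xs ys (take n zs) (take n ws) k) * (\<Prod>k<l. f us vs (drop n zs) (drop n ws) k)"
      if "xs \<in> lists_n A n" "ys \<in> lists_n A n" for xs ys us vs
    proof -
      have "(\<Prod>k<n + l. g k) = (\<Prod>k<n. g k) * (\<Prod>k<l. g (n + k))" for g :: "nat \<Rightarrow> complex"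
        by (induction l) (simp_all add: mult.assoc)
      moreover have "length zs = n + l" "length ws = n + l" "length xs = n" "length ys = n"
        using that True by (auto simp: lists_n_length)
      ultimately show ?thesis by (simp add: f_def nth_append)
    qed
    have "ch_pow A B (n + l) T (app_op A n l X Y) zs ws
      = (\<Sum>xs\<in>lists_n A n. \<Sum>us\<in>lists_n A l. \<Sum>ys\<in>lists_n A n. \<Sum>vs\<in>lists_n A l.
         (X xs ys * (\<Prod>k<n. f xs ys (take n zs) (take n ws) k)) * (Y us vs * (\<Prod>k<l. f us vs (drop n zs) (drop n ws) k)))"
    proof -
      have "ch_pow A B (n + l) T (app_op A n l X Y) zs ws
        = (\<Sum>xs\<in>lists_n A n. \<Sum>us\<in>lists_n A l. \<Sum>ys\<in>lists_n A n. \<Sum>vs\<in>lists_n A l.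
         app_op A n l X Y (xs @ us) (ys @ vs) * (\<Prod>k<n + l. f (xs @ us) (ys @ vs) zs ws k))"
        using True by (simp add: ch_pow_def f_def sum_lists_append[OF assms])
      then show ?thesis by (simp add: app_op_append split mult_ac cong: sum.cong)
    qed
    also have "\<dots> = (\<Sum>xs\<in>lists_n A n. \<Sum>ys\<in>lists_n A n. \<Sum>us\<in>lists_n A l. \<Sum>vs\<in>lists_n A l.
         (X xs ys * (\<Prod>k<n. f xs ys (take n zs) (take n ws) k)) * (Y us vs * (\<Prod>k<l. f us vs (drop n zs) (drop n ws) k)))"
      by (intro sum.cong refl sum.swap)
    also have "\<dots> = ch_pow A B n T X (take n zs) (take n ws) * ch_pow A B l T Y (drop n zs) (drop n ws)"
      by (simp only: ch_pow_def f_def td simp_thms if_True sum_distrib_left[symmetric] sum_distrib_right[symmetric])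
    finally show ?thesis using True by (simp add: app_op_def)
  qed (auto simp: ch_pow_def app_op_def)
qed

lemma pairing_sum_left: "pairing I (\<lambda>i j. \<Sum>s\<in>S. G s i j) X = (\<Sum>s\<in>S. pairing I (G s) X)"
  unfolding pairing_def sum_distrib_right sum.swap[of _ _ S] ..

text \<open>The Schur product of the two kernels, tested on the all-ones vector.\<close>

lemma pairing_nonneg:
  assumes "finite I" "pos_kernel I E" "pos_kernel I X"
  shows "Im (pairing I E X) = 0" "Re (pairing I E X) \<ge> 0"
proof -
  have "pairing I E X = sform I (\<lambda>i j. E i j * X i j) (\<lambda>_. 1) (\<lambda>_. 1)" by (simp add: pairing_def sform_def)
  then show "Im (pairing I E X) = 0" "Re (pairing I E X) \<ge> 0"
    using pos_kernel_mult[OF assms] unfolding pos_kernel_def by simp_all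
qed

lemma channel_ch_pow_jam:
  assumes fin: "finite A" "finite J" "finite B" and N: "channel (A \<times> J) B N" and \<sigma>: "\<sigma> \<in> states J"
  shows "channel (lists_n A n) (lists_n B n) (ch_pow A B n (jam_ch N \<sigma>))"
proof -
  have st: "tensor_list J n \<sigma> \<in> states (lists_n J n)" by (rule tensor_list_states[OF fin(2) \<sigma>])
  have N': "cp_map (A \<times> J) B N" "trace_pres (A \<times> J) B N" using N by (auto simp: channel_def)
  show ?thesis
    unfolding ch_pow_jam_ch_fun[OF fin(1,2) N \<sigma>] channel_def trace_pres_def
    using st cp_map_avqc_ch[OF fin N'(1), of n "tensor_list J n \<sigma>"] op_trace_avqc_ch[OF fin N'(2), of n "tensor_list J n \<sigma>"]
    by (simp add: states_def psd_iff)
qed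

subsection \<open>Classical codes and majority decoding\<close>

text \<open>Signal states \<tau> and a measurement E. Because \<open>pairing\<close> is bilinear, E
  w is the transpose of the usual measurement operator.\<close>

definition classical_code :: "'a set \<Rightarrow> 'b set \<Rightarrow> nat \<Rightarrow> 'w set \<Rightarrow> ('w \<Rightarrow> 'a list op) \<Rightarrow> ('w \<Rightarrow> 'b list op) \<Rightarrow> bool" where
  "classical_code A B p W \<tau> E \<longleftrightarrow> (\<forall>w\<in>W. \<tau> w \<in> states (lists_n A p)) \<and> (\<forall>w\<in>W. pos_kernel (lists_n B p) (E w)) \<and>
     (\<forall>zs\<in>lists_n B p. \<forall>ws\<in>lists_n B p. (\<Sum>w\<in>W. E w zs ws) = (if zs = ws then 1 else 0))"

definition outcome_prob :: "'a set \<Rightarrow> 'b set \<Rightarrow> nat \<Rightarrow> ('a op \<Rightarrow> 'b op) \<Rightarrow> ('w \<Rightarrow> 'a list op) \<Rightarrow> ('w \<Rightarrow> 'b list op) \<Rightarrow> 'w \<Rightarrow> 'w \<Rightarrow> real" where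
  "outcome_prob A B p T \<tau> E w w' = Re (pairing (lists_n B p) (E w') (ch_pow A B p T (\<tau> w)))"

lemma classical_code_pairing_sum:
  assumes "finite B" "classical_code A B p W \<tau> E"
  shows "(\<Sum>w\<in>W. pairing (lists_n B p) (E w) Y) = op_trace (lists_n B p) Y"
proof -
  have "(\<Sum>w\<in>W. pairing (lists_n B p) (E w) Y) = (\<Sum>zs\<in>lists_n B p. \<Sum>ws\<in>lists_n B p. (\<Sum>w\<in>W. E w zs ws) * Y zs ws)"
    unfolding pairing_def sum_distrib_right sum.swap[of _ _ W] ..
  also have "\<dots> = (\<Sum>zs\<in>lists_n B p. \<Sum>ws\<in>lists_n B p. if ws = zs then Y zs zs else 0)"
    using assms(2) by (intro sum.cong refl) (simp add: classical_code_def)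
  finally show ?thesis using assms(1) by (simp add: op_trace_def)
qed

lemma outcome_prob_props:
  assumes fin: "finite A" "finite B" and code: "classical_code A B p W \<tau> E"
    and T: "channel (lists_n A p) (lists_n B p) (ch_pow A B p T)" and w: "w \<in> W"
  shows "w' \<in> W \<Longrightarrow> pairing (lists_n B p) (E w') (ch_pow A B p T (\<tau> w)) = of_real (outcome_prob A B p T \<tau> E w w')"
    "w' \<in> W \<Longrightarrow> 0 \<le> outcome_prob A B p T \<tau> E w w'"
    "(\<Sum>w'\<in>W. outcome_prob A B p T \<tau> E w w') = 1"
proof -
  have st: "\<tau> w \<in> states (lists_n A p)" using code w by (simp add: classical_code_def)
  have psd: "psd (lists_n B p) (ch_pow A B p T (\<tau> w))"
    by (rule cp_map_psd[of "lists_n A p"]) (use fin T st in \<open>auto simp: channel_def states_def\<close>)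
  show "pairing (lists_n B p) (E w') (ch_pow A B p T (\<tau> w)) = of_real (outcome_prob A B p T \<tau> E w w')"
    "0 \<le> outcome_prob A B p T \<tau> E w w'" if "w' \<in> W"
    using pairing_nonneg[of "lists_n B p" "E w'" "ch_pow A B p T (\<tau> w)"] psd code that fin
    by (auto simp: outcome_prob_def classical_code_def psd_iff complex_eq_iff)
  have "(\<Sum>w'\<in>W. outcome_prob A B p T \<tau> E w w') = Re (op_trace (lists_n B p) (ch_pow A B p T (\<tau> w)))"
    unfolding outcome_prob_def Re_sum[symmetric] classical_code_pairing_sum[OF fin(2) code] ..
  also have "op_trace (lists_n B p) (ch_pow A B p T (\<tau> w)) = op_trace (lists_n A p) (\<tau> w)"
    using T st by (simp add: channel_def trace_pres_def states_def psd_def)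
  finally show "(\<Sum>w'\<in>W. outcome_prob A B p T \<tau> E w w') = 1" using st by (simp add: states_def)
qed

section \<open>Independent blocks and the majority vote\<close>

primrec rep_op :: "'i set \<Rightarrow> nat \<Rightarrow> (nat \<Rightarrow> 'i list op) \<Rightarrow> nat \<Rightarrow> 'i list op" where
  "rep_op I s X 0 = (\<lambda>xs ys. if xs = [] \<and> ys = [] then 1 else 0)"
| "rep_op I s X (Suc L) = app_op I (L * s) s (rep_op I s X L) (X L)"

lemma rep_op_cong:
  assumes "\<And>j. j < L \<Longrightarrow> X j = Y j"
  shows "rep_op I s X L = rep_op I s Y L"
  using assms by (induction L) auto

lemma pos_kernel_rep_op:
  assumes "finite I" "\<And>j. j < L \<Longrightarrow> pos_kernel (lists_n I s) (X j)"
  shows "pos_kernel (lists_n I (L * s)) (rep_op I s X L)"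
  using assms(2)
proof (induction L)
  case 0
  show ?case by (simp add: pos_kernel_def sform_def)
next
  case (Suc L)
  then show ?case using pos_kernel_app_op[OF assms(1), of "L * s" "rep_op I s X L" s "X L"] by (simp add: add.commute)
qed

lemma rep_op_states:
  assumes "finite I" "\<And>j. j < L \<Longrightarrow> X j \<in> states (lists_n I s)"
  shows "rep_op I s X L \<in> states (lists_n I (L * s))"
  using assms(2)
proof (induction L)
  case 0
  show ?case by (simp add: states_def psd_iff is_op_def pos_kernel_def sform_def op_trace_def)
next
  case (Suc L)
  then show ?case using app_op_states[OF assms(1), of "rep_op I s X L" "L * s" "X L" s] by (simp add: add.commute)
qed

lemma pairing_rep_op:
  assumes "finite A" "finite B"
  shows "pairing (lists_n B (L * s)) (rep_op B s E L) (ch_pow A B (L * s) T (rep_op A s X L))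
    = (\<Prod>j<L. pairing (lists_n B s) (E j) (ch_pow A B s T (X j)))"
proof (induction L)
  case 0
  show ?case by (simp add: pairing_def ch_pow_def)
next
  case (Suc L)
  have "pairing (lists_n B (L * s + s)) (rep_op B s E (Suc L)) (ch_pow A B (L * s + s) T (rep_op A s X (Suc L)))
     = pairing (lists_n B (L * s)) (rep_op B s E L) (ch_pow A B (L * s) T (rep_op A s X L))
       * pairing (lists_n B s) (E L) (ch_pow A B s T (X L))"
    by (simp add: ch_pow_app_op[OF assms(1)] pairing_app_op[OF assms(2)])
  then show ?case using Suc by (simp add: add.commute)
qed

lemma sum_lists_snoc:
  assumes "finite I"
  shows "(\<Sum>os\<in>lists_n I (Suc n). f os) = (\<Sum>os\<in>lists_n I n. \<Sum>x\<in>I. f (os @ [x]))"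
  using sum_lists_append[OF assms, of f n 1]
    sum.reindex_bij_betw[OF bij_betw_singleton_list, where g = "\<lambda>ys. f (_ @ ys)"] by simp

lemma rep_op_sum:
  assumes fin: "finite W" "finite B"
    and E: "\<And>j zs ws. j < L \<Longrightarrow> zs \<in> lists_n B s \<Longrightarrow> ws \<in> lists_n B s \<Longrightarrow> (\<Sum>w\<in>W. E j w zs ws) = (if zs = ws then 1 else 0)"
    and zs: "zs \<in> lists_n B (L * s)" "ws \<in> lists_n B (L * s)"
  shows "(\<Sum>os\<in>lists_n W L. rep_op B s (\<lambda>j. E j (os ! j)) L zs ws) = (if zs = ws then 1 else 0)"
  using E zs
proof (induction L arbitrary: zs ws)
  case 0
  then show ?case by simp
next
  case (Suc L)
  have zs: "zs \<in> lists_n B (L * s + s)" "ws \<in> lists_n B (L * s + s)" using Suc.prems by (simp_all add: add.commute)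
  let ?t = "take (L * s)" and ?d = "drop (L * s)"
  note td = take_drop_lists_n[OF zs(1)] take_drop_lists_n[OF zs(2)]
  have "(\<Sum>os\<in>lists_n W (Suc L). rep_op B s (\<lambda>j. E j (os ! j)) (Suc L) zs ws)
     = (\<Sum>os\<in>lists_n W L. \<Sum>w\<in>W. rep_op B s (\<lambda>j. E j (os ! j)) L (?t zs) (?t ws) * E L w (?d zs) (?d ws))"
    unfolding sum_lists_snoc[OF fin(1)]
  proof (intro sum.cong refl)
    fix os w assume os: "os \<in> lists_n W L"
    have "rep_op B s (\<lambda>j. E j ((os @ [w]) ! j)) L = rep_op B s (\<lambda>j. E j (os ! j)) L"
      by (rule rep_op_cong) (use os in \<open>simp add: nth_append lists_n_length\<close>)
    then show "rep_op B s (\<lambda>j. E j ((os @ [w]) ! j)) (Suc L) zs ws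
      = rep_op B s (\<lambda>j. E j (os ! j)) L (?t zs) (?t ws) * E L w (?d zs) (?d ws)"
      using lists_n_length[OF os] zs by (simp add: app_op_def nth_append)
  qed
  also have "\<dots> = (\<Sum>os\<in>lists_n W L. rep_op B s (\<lambda>j. E j (os ! j)) L (?t zs) (?t ws)) * (\<Sum>w\<in>W. E L w (?d zs) (?d ws))"
    by (simp add: sum_product)
  also have "\<dots> = (if ?t zs = ?t ws then 1 else 0) * (if ?d zs = ?d ws then 1 else 0)"
    using Suc.IH[OF Suc.prems(1) td(1,3)] Suc.prems(1)[OF _ td(2,4)] by simp
  also have "\<dots> = (if zs = ws then 1 else 0)"
  proof -
    have "zs = ?t zs @ ?d zs" "ws = ?t ws @ ?d ws" by simp_all
    then have "zs = ws \<longleftrightarrow> ?t zs = ?t ws \<and> ?d zs = ?d ws" by metis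
    then show ?thesis by auto
  qed
  finally show ?case .
qed

definition majority :: "'w \<Rightarrow> nat \<Rightarrow> 'w list \<Rightarrow> 'w" where
  "majority w0 L os = (if \<exists>w. L < 2 * card {j. j < L \<and> os ! j = w} then (SOME w. L < 2 * card {j. j < L \<and> os ! j = w}) else w0)"

lemma majority_eq:
  assumes "L < 2 * card {j. j < L \<and> os ! j = w}"
  shows "majority w0 L os = w"
proof -
  have uniq: "w' = w" if "L < 2 * card {j. j < L \<and> os ! j = w'}" for w'
  proof (rule ccontr)
    assume ne: "w' \<noteq> w"
    have "card {j. j < L \<and> os ! j = w} + card {j. j < L \<and> os ! j = w'}
       = card ({j. j < L \<and> os ! j = w} \<union> {j. j < L \<and> os ! j = w'})"
      using ne by (intro card_Un_disjoint[symmetric]) auto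
    also have "\<dots> \<le> card {..<L}" by (intro card_mono) auto
    finally show False using that assms by simp
  qed
  show ?thesis using someI[of "\<lambda>w. L < 2 * card {j. j < L \<and> os ! j = w}", OF assms] uniq assms
    by (auto simp: majority_def)
qed

lemma majority_error:
  fixes p :: "nat \<Rightarrow> 'w \<Rightarrow> real"
  assumes fin: "finite W" and w: "w \<in> W" and p: "\<And>j v. j < L \<Longrightarrow> v \<in> W \<Longrightarrow> 0 \<le> p j v"
    and p1: "\<And>j. j < L \<Longrightarrow> (\<Sum>v\<in>W. p j v) = 1" and L: "L > 0"
  shows "1 - (\<Sum>os\<in>{os\<in>lists_n W L. majority w0 L os = w}. \<Prod>j<L. p j (os ! j)) \<le> 2 / L * (\<Sum>j<L. 1 - p j w)"
proof -
  define q where "q = (\<lambda>os. \<Prod>j<L. p j (os ! j))"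
  let ?O = "lists_n W L" and ?ind = "\<lambda>os j. if os ! j = w then 0 else (1::real)"
  have q0: "q os \<ge> 0" if "os \<in> ?O" for os
    unfolding q_def using that p by (intro prod_nonneg) (auto simp: lists_n_nth)
  have q1: "(\<Sum>os\<in>?O. q os) = 1"
    unfolding q_def sum_lists_prod[OF fin] using p1 by simp
  \<comment> \<open>Inserting the indicator of a wrong j-th outcome as one more factor at i = j
    keeps the product form; the other factors then sum to 1.\<close>
  have wrong: "(\<Sum>os\<in>?O. q os * ?ind os j) = 1 - p j w" if j: "j < L" for j
  proof -
    have "(\<Sum>os\<in>?O. q os * ?ind os j) = (\<Sum>os\<in>?O. \<Prod>i<L. p i (os ! i) * (if i = j \<and> os ! i = w then 0 else 1))"
    proof (intro sum.cong refl)
      fix os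
      have "(\<Prod>i<L. if i = j \<and> os ! i = w then 0 else (1::real)) = (\<Prod>i<L. if i = j then ?ind os j else 1)"
        by (intro prod.cong) auto
      then show "q os * ?ind os j = (\<Prod>i<L. p i (os ! i) * (if i = j \<and> os ! i = w then 0 else 1))"
        using j by (simp add: q_def prod.distrib)
    qed
    also have "\<dots> = (\<Prod>i<L. \<Sum>v\<in>W. p i v * (if i = j \<and> v = w then 0 else 1))"
      by (rule sum_lists_prod[OF fin, where f = "\<lambda>i v. p i v * (if i = j \<and> v = w then 0 else 1)"])
    also have "\<dots> = (\<Prod>i<L. if i = j then 1 - p j w else 1)"
    proof (intro prod.cong refl)
      fix i assume i: "i \<in> {..<L}"
      show "(\<Sum>v\<in>W. p i v * (if i = j \<and> v = w then 0 else 1)) = (if i = j then 1 - p j w else 1)"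
      proof (cases "i = j")
        case True
        have "(\<Sum>v\<in>W. p i v * (if i = j \<and> v = w then 0 else 1)) = (\<Sum>v\<in>W. p j v - (if v = w then p j w else 0))"
          using True by (intro sum.cong) auto
        then show ?thesis using True w fin p1[OF j] by (simp add: sum_subtractf)
      qed (use p1 i in simp)
    qed
    finally show ?thesis using j by simp
  qed
  \<comment> \<open>If w does not win, at most half of the outcomes equal w, so at least L / 2 are
    wrong. The default \<open>w0\<close> needs no separate case.\<close>
  have bad: "1 \<le> 2 / L * (\<Sum>j<L. ?ind os j)" if "majority w0 L os \<noteq> w" for os
  proof -
    have "2 * card {j. j < L \<and> os ! j = w} \<le> L" using majority_eq[of L os w] that not_le by blast
    moreover have "card {j. j < L \<and> os ! j = w} + card {j. j < L \<and> os ! j \<noteq> w} = L"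
    proof -
      have "card {j. j < L \<and> os ! j = w} + card {j. j < L \<and> os ! j \<noteq> w}
         = card ({j. j < L \<and> os ! j = w} \<union> {j. j < L \<and> os ! j \<noteq> w})"
        by (intro card_Un_disjoint[symmetric]) auto
      also have "{j. j < L \<and> os ! j = w} \<union> {j. j < L \<and> os ! j \<noteq> w} = {..<L}" by auto
      finally show ?thesis by simp
    qed
    ultimately have "L \<le> 2 * card {j. j < L \<and> os ! j \<noteq> w}" by linarith
    then have "real L \<le> 2 * real (card {j. j < L \<and> os ! j \<noteq> w})" by linarith
    moreover have "(\<Sum>j<L. ?ind os j) = (\<Sum>j\<in>{j. j < L \<and> os ! j \<noteq> w}. 1)"
      by (intro sum.mono_neutral_cong_right) auto
    ultimately show ?thesis using L by (simp add: field_simps)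
  qed
  have "1 - (\<Sum>os\<in>{os\<in>?O. majority w0 L os = w}. q os) = (\<Sum>os\<in>?O. q os) - (\<Sum>os\<in>{os\<in>?O. majority w0 L os = w}. q os)"
    by (simp add: q1)
  also have "\<dots> = (\<Sum>os\<in>?O. if majority w0 L os = w then 0 else q os)"
  proof -
    have "(\<Sum>os\<in>{os\<in>?O. majority w0 L os = w}. q os) = (\<Sum>os\<in>?O. if majority w0 L os = w then q os else 0)"
      using fin by (intro sum.mono_neutral_cong_left) auto
    then show ?thesis by (simp add: sum_subtractf[symmetric] if_distrib cong: if_cong)
  qed
  also have "\<dots> \<le> (\<Sum>os\<in>?O. q os * (2 / L * (\<Sum>j<L. ?ind os j)))"
  proof (intro sum_mono)
    fix os assume os: "os \<in> ?O"
    show "(if majority w0 L os = w then 0 else q os) \<le> q os * (2 / L * (\<Sum>j<L. ?ind os j))"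
    proof (cases "majority w0 L os = w")
      case True
      then show ?thesis using q0[OF os] by (simp add: sum_nonneg)
    next
      case False
      then show ?thesis using mult_left_mono[OF bad[OF False] q0[OF os]] by simp
    qed
  qed
  also have "\<dots> = 2 / L * (\<Sum>os\<in>?O. \<Sum>j<L. q os * ?ind os j)"
    unfolding sum_distrib_left by (intro sum.cong refl) simp
  also have "(\<Sum>os\<in>?O. \<Sum>j<L. q os * ?ind os j) = (\<Sum>j<L. \<Sum>os\<in>?O. q os * ?ind os j)"
    by (rule sum.swap)
  also have "\<dots> = (\<Sum>j<L. 1 - p j w)" by (intro sum.cong refl wrong) simp
  finally show ?thesis by (simp add: q_def)
qed

text \<open>If the majority is wrong, at least half of the \<open>L\<close> outcomes are, so Markov's inequality applies.\<close>
lemma classical_code_repetition: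
  assumes fin: "finite A" "finite B" "finite W" and w0: "w0 \<in> W" and L: "L > 0"
    and code: "\<And>j. j < L \<Longrightarrow> classical_code A B s W (\<tau> j) (E j)"
  defines "\<tau>' \<equiv> \<lambda>w. rep_op A s (\<lambda>j. \<tau> j w) L"
    and "E' \<equiv> \<lambda>w zs ws. \<Sum>os\<in>{os\<in>lists_n W L. majority w0 L os = w}. rep_op B s (\<lambda>j. E j (os ! j)) L zs ws"
  shows "classical_code A B (L * s) W \<tau>' E'"
    "\<And>T w. w \<in> W \<Longrightarrow> channel (lists_n A s) (lists_n B s) (ch_pow A B s T) \<Longrightarrow>
       1 - outcome_prob A B (L * s) T \<tau>' E' w w \<le> 2 / L * (\<Sum>j<L. 1 - outcome_prob A B s T (\<tau> j) (E j) w w)"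
proof -
  have mem: "majority w0 L os \<in> W" if "os \<in> lists_n W L" for os
  proof (cases "\<exists>w. L < 2 * card {j. j < L \<and> os ! j = w}")
    case True
    then obtain w where w: "L < 2 * card {j. j < L \<and> os ! j = w}" by blast
    then have "{j. j < L \<and> os ! j = w} \<noteq> {}" by (metis card.empty mult_0_right not_less_zero)
    then have "w \<in> W" using that by (auto simp: lists_n_nth)
    then show ?thesis by (simp add: majority_eq[OF w])
  qed (use w0 in \<open>simp add: majority_def\<close>)
  show "classical_code A B (L * s) W \<tau>' E'"
    unfolding classical_code_def
  proof (intro conjI ballI)
    fix w assume w: "w \<in> W"
    show "\<tau>' w \<in> states (lists_n A (L * s))"
      unfolding \<tau>'_def by (rule rep_op_states[OF fin(1)]) (use code w in \<open>simp add: classical_code_def\<close>)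
    show "pos_kernel (lists_n B (L * s)) (E' w)"
      unfolding E'_def
      by (rule pos_kernel_sum, rule pos_kernel_rep_op[OF fin(2)]) (use code in \<open>auto simp: classical_code_def lists_n_nth\<close>)
  next
    fix zs ws assume zs: "zs \<in> lists_n B (L * s)" "ws \<in> lists_n B (L * s)"
    have "(\<Sum>w\<in>W. E' w zs ws) = (\<Sum>os\<in>lists_n W L. rep_op B s (\<lambda>j. E j (os ! j)) L zs ws)"
      unfolding E'_def by (rule sum.group) (use fin mem in auto)
    also have "\<dots> = (if zs = ws then 1 else 0)"
      by (rule rep_op_sum[OF fin(3,2) _ zs]) (use code in \<open>simp add: classical_code_def\<close>)
    finally show "(\<Sum>w\<in>W. E' w zs ws) = (if zs = ws then 1 else 0)" .
  qed
  fix T w assume w: "w \<in> W" and T: "channel (lists_n A s) (lists_n B s) (ch_pow A B s T)"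
  define p where "p = (\<lambda>j. outcome_prob A B s T (\<tau> j) (E j) w)"
  note props = outcome_prob_props[OF fin(1,2) code T w]
  have "pairing (lists_n B (L * s)) (E' w) (ch_pow A B (L * s) T (\<tau>' w))
     = (\<Sum>os\<in>{os\<in>lists_n W L. majority w0 L os = w}. \<Prod>j<L. pairing (lists_n B s) (E j (os ! j)) (ch_pow A B s T (\<tau> j w)))"
    unfolding E'_def pairing_sum_left \<tau>'_def by (intro sum.cong refl pairing_rep_op[OF fin(1,2)])
  also have "\<dots> = (\<Sum>os\<in>{os\<in>lists_n W L. majority w0 L os = w}. \<Prod>j<L. of_real (p j (os ! j)))"
  proof (intro sum.cong prod.cong refl)
    fix os j assume "os \<in> {os\<in>lists_n W L. majority w0 L os = w}" and j: "j \<in> {..<L}"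
    then have "os ! j \<in> W" using lists_n_nth[of os W L j] by simp
    then show "pairing (lists_n B s) (E j (os ! j)) (ch_pow A B s T (\<tau> j w)) = of_real (p j (os ! j))"
      using props(1) j by (simp add: p_def)
  qed
  finally have "outcome_prob A B (L * s) T \<tau>' E' w w = (\<Sum>os\<in>{os\<in>lists_n W L. majority w0 L os = w}. \<Prod>j<L. p j (os ! j))"
    by (simp add: outcome_prob_def flip: of_real_prod)
  then show "1 - outcome_prob A B (L * s) T \<tau>' E' w w \<le> 2 / L * (\<Sum>j<L. 1 - outcome_prob A B s T (\<tau> j) (E j) w w)"
    using majority_error[OF fin(3) w, of L p w0] props(2,3) L by (simp add: p_def)
qed

text \<open>Sending basis states of \<open>FA\<close> and measuring in that basis turns both parts
  of the message into classical ones, so M1 * M2 messages are available and it is enough that one of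
  the rates is positive. Outcomes outside \<open>FA\<close> are assigned to (1, 0) to complete the
  measurement, which can only help that message.\<close>

lemma classical_code_of_cet:
  fixes P :: "nat \<Rightarrow> nat op \<Rightarrow> 'a list op" and R :: "nat \<Rightarrow> 'b list op \<Rightarrow> nat op"
  assumes fin: "finite A" "finite B" and c: "is_cet_code A B n M1 M2 ({..<M2}, {..<Q}, P, R)" and M: "M1 > 0" "M2 > 0"
  defines "\<tau> \<equiv> \<lambda>w. P (fst w) (unit_op (snd w) (snd w))"
    and "E \<equiv> \<lambda>w zs ws. R (fst w) (unit_op zs ws) (snd w) (snd w)
       + (if w = (1, 0) then \<Sum>m\<in>{1..M1}. \<Sum>x\<in>{M2..<Q}. R m (unit_op zs ws) x x else 0)"
    and "W \<equiv> {1..M1} \<times> {..<M2}"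
  shows "classical_code A B n W \<tau> E"
    "\<And>T. channel (lists_n A n) (lists_n B n) (ch_pow A B n T) \<Longrightarrow>
       (\<Sum>w\<in>W. 1 - outcome_prob A B n T \<tau> E w w) \<le> card W * (1 - Pbar_cet M1 ({..<M2}, {..<Q}, P, R) (ch_pow A B n T))"
proof -
  note D = is_cet_codeD[OF c]
  have M2Q: "M2 \<le> Q" using D(2) M(2) by (metis card_lessThan card_mono finite_lessThan)
  have finL: "finite (lists_n B n)" using fin by simp
  have R1: "pos_kernel (lists_n B n) (\<lambda>zs ws. R m (unit_op zs ws) x x)" if "m \<in> {1..M1}" "x < Q" for m x
    using pos_kernel_reindex[where f = "\<lambda>zs. (zs, x)", OF _ finL _ cp_map_kernel[OF finL D(1) D(6)[OF that(1)]]] that finL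
    by auto
  show "classical_code A B n W \<tau> E"
    unfolding classical_code_def
  proof (intro conjI ballI)
    fix w assume w: "w \<in> W"
    then have m: "fst w \<in> {1..M1}" and k: "snd w < M2" by (auto simp: W_def)
    have u: "psd {..<M2} (unit_op (snd w) (snd w))" using k by (intro psd_unit) simp
    have "psd (lists_n A n) (\<tau> w)"
      unfolding \<tau>_def by (rule cp_map_psd[OF D(4) _ _ u]) (use fin D(5)[OF m] in \<open>auto simp: channel_def\<close>)
    moreover have "op_trace (lists_n A n) (\<tau> w) = 1"
      unfolding \<tau>_def using D(5)[OF m] u k by (simp add: channel_def trace_pres_def psd_def op_trace_unit)
    ultimately show "\<tau> w \<in> states (lists_n A n)" by (simp add: states_def)
    have "pos_kernel (lists_n B n) (\<lambda>zs ws. \<Sum>m\<in>{1..M1}. \<Sum>x\<in>{M2..<Q}. R m (unit_op zs ws) x x)"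
      by (rule pos_kernel_sum, rule pos_kernel_sum, rule R1) auto
    then show "pos_kernel (lists_n B n) (E w)"
      unfolding E_def using R1[OF m, of "snd w"] k M2Q by (cases "w = (1, 0)") (simp_all add: pos_kernel_add)
  next
    fix zs ws assume zs: "zs \<in> lists_n B n" "ws \<in> lists_n B n"
    have split: "(\<Sum>x<M2. f x) + (\<Sum>x\<in>{M2..<Q}. f x) = (\<Sum>x<Q. f x)" for f :: "nat \<Rightarrow> complex"
      using M2Q by (simp add: lessThan_atLeast0 sum.atLeastLessThan_concat)
    have "(1, 0) \<in> W" using M by (simp add: W_def)
    then have "(\<Sum>w\<in>W. E w zs ws) = (\<Sum>w\<in>W. R (fst w) (unit_op zs ws) (snd w) (snd w))
       + (\<Sum>m\<in>{1..M1}. \<Sum>x\<in>{M2..<Q}. R m (unit_op zs ws) x x)"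
      unfolding E_def by (simp add: sum.distrib W_def)
    also have "\<dots> = (\<Sum>m\<in>{1..M1}. \<Sum>x<Q. R m (unit_op zs ws) x x)"
      by (simp add: W_def sum_Times sum.distrib[symmetric] split)
    also have "\<dots> = op_trace {..<Q} (\<lambda>a b. \<Sum>m\<in>{1..M1}. R m (unit_op zs ws) a b)"
      unfolding op_trace_def by (rule sum.swap)
    also have "\<dots> = (if zs = ws then 1 else 0)"
      using D(8) is_op_unit[OF zs] op_trace_unit[OF finL zs(1)] by (simp add: trace_pres_def)
    finally show "(\<Sum>w\<in>W. E w zs ws) = (if zs = ws then 1 else 0)" .
  qed
  fix T assume T: "channel (lists_n A n) (lists_n B n) (ch_pow A B n T)"
  then have cpT: "cp_map (lists_n A n) (lists_n B n) (ch_pow A B n T)" by (simp add: channel_def)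
  have diag: "Re (R (fst w) (ch_pow A B n T (\<tau> w)) (snd w) (snd w)) \<le> outcome_prob A B n T \<tau> E w w" if w: "w \<in> W" for w
  proof -
    have m: "fst w \<in> {1..M1}" and k: "snd w < M2" using w by (auto simp: W_def)
    let ?Y = "ch_pow A B n T (\<tau> w)"
    have "psd {..<M2} (unit_op (snd w) (snd w))" using k by (intro psd_unit) simp
    then have "psd (lists_n A n) (\<tau> w)"
      unfolding \<tau>_def by (rule cp_map_psd[OF D(4), rotated 2]) (use fin D(5)[OF m] in \<open>auto simp: channel_def\<close>)
    then have Y: "psd (lists_n B n) ?Y"
      by (rule cp_map_psd[OF _ finL cpT, rotated]) (use fin in simp)
    have Rx: "R m' ?Y x x = pairing (lists_n B n) (\<lambda>zs ws. R m' (unit_op zs ws) x x) ?Y" if "m' \<in> {1..M1}" for m' x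
      using lin_map_expand[OF cp_map_lin[OF D(6)[OF that]] finL, of ?Y] Y by (simp add: pairing_def psd_def mult.commute)
    have "pairing (lists_n B n) (E w) ?Y = R (fst w) ?Y (snd w) (snd w)
        + pairing (lists_n B n) (\<lambda>zs ws. if w = (1, 0) then \<Sum>m\<in>{1..M1}. \<Sum>x\<in>{M2..<Q}. R m (unit_op zs ws) x x else 0) ?Y"
      unfolding Rx[OF m] by (simp add: pairing_def E_def distrib_right sum.distrib)
    moreover have "Re (pairing (lists_n B n) (\<lambda>zs ws. if w = (1, 0) then \<Sum>m\<in>{1..M1}. \<Sum>x\<in>{M2..<Q}. R m (unit_op zs ws) x x else 0) ?Y) \<ge> 0"
    proof (rule pairing_nonneg(2)[OF finL])
      have "pos_kernel (lists_n B n) (\<lambda>zs ws. \<Sum>m\<in>{1..M1}. \<Sum>x\<in>{M2..<Q}. R m (unit_op zs ws) x x)"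
        by (rule pos_kernel_sum, rule pos_kernel_sum, rule R1) auto
      then show "pos_kernel (lists_n B n) (\<lambda>zs ws. if w = (1, 0) then \<Sum>m\<in>{1..M1}. \<Sum>x\<in>{M2..<Q}. R m (unit_op zs ws) x x else 0)"
        by (cases "w = (1, 0)") (simp_all add: pos_kernel_zero)
    qed (use Y in \<open>simp add: psd_iff\<close>)
    ultimately show ?thesis by (simp add: outcome_prob_def)
  qed
  have "Pbar_cet M1 ({..<M2}, {..<Q}, P, R) (ch_pow A B n T) \<le> (\<Sum>m\<in>{1..M1}. \<Sum>k\<in>{..<M2}. Re (R m (ch_pow A B n T (P m (unit_op k k))) k k)) / (real M1 * real M2)"
    using code_fid_le_diag[OF fin c cpT] Pbar_cet_eq[OF fin c cpT] by simp
  also have "\<dots> = (\<Sum>w\<in>W. Re (R (fst w) (ch_pow A B n T (\<tau> w)) (snd w) (snd w))) / card W"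
    by (simp add: W_def \<tau>_def sum_Times)
  also have "\<dots> \<le> (\<Sum>w\<in>W. outcome_prob A B n T \<tau> E w w) / card W"
    by (intro divide_right_mono sum_mono diag) auto
  finally have "card W * Pbar_cet M1 ({..<M2}, {..<Q}, P, R) (ch_pow A B n T) \<le> (\<Sum>w\<in>W. outcome_prob A B n T \<tau> E w w)"
    using M by (simp add: W_def field_simps)
  then show "(\<Sum>w\<in>W. 1 - outcome_prob A B n T \<tau> E w w) \<le> card W * (1 - Pbar_cet M1 ({..<M2}, {..<Q}, P, R) (ch_pow A B n T))"
    by (simp add: sum_subtractf algebra_simps)
qed

subsection \<open>Sending the index of the code ahead\<close>

text \<open>The unnormalised state of the last n systems after the outcome E on the first p.\<close>

definition slice :: "'b set \<Rightarrow> nat \<Rightarrow> nat \<Rightarrow> 'b list op \<Rightarrow> 'b list op \<Rightarrow> 'b list op" where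
  "slice B p n E Y = (\<lambda>zs ws. if zs \<in> lists_n B n \<and> ws \<in> lists_n B n
     then \<Sum>us\<in>lists_n B p. \<Sum>vs\<in>lists_n B p. E us vs * Y (us @ zs) (vs @ ws) else 0)"

lemma cp_map_slice:
  fixes B :: "'b set"
  assumes fin: "finite B" and E: "pos_kernel (lists_n B p) E"
  shows "cp_map (lists_n B (p + n)) (lists_n B n) (slice B p n E)"
proof -
  let ?L = "lists_n B (p + n)" and ?Ln = "lists_n B n" and ?Lp = "lists_n B p"
  have finL: "finite ?L" "finite ?Ln" "finite ?Lp" using fin by simp_all
  have lin: "lin_map ?L ?Ln (slice B p n E)"
    by (auto simp: lin_map_def is_op_def slice_def algebra_simps sum.distrib sum_distrib_left fun_eq_iff)
  \<comment> \<open>The Choi matrix is E times the indicator that the prefix followed by the output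
    is the input, with the prefix systems summed out.\<close>
  define u where "u = (\<lambda>((bs :: 'b list, zs), us). if us @ zs = bs then 1 else (0::complex))"
  have u: "pos_kernel ((?L \<times> ?Ln) \<times> ?Lp) (\<lambda>a b. u a * cnj (u b))" by (rule pos_kernel_outer)
  have "pos_kernel ((?L \<times> ?Ln) \<times> ?Lp) (\<lambda>a b. E (snd a) (snd b) * (u a * cnj (u b)))"
    by (rule pos_kernel_mult_reindex[where f = snd and g = id and K = "(?L \<times> ?Ln) \<times> ?Lp"
          and Y = "\<lambda>a b. u a * cnj (u b)", OF _ _ _ E, simplified id_apply])
      (use finL u in auto)
  from pos_kernel_contract[OF _ finL(3) this]
  have "pos_kernel (?L \<times> ?Ln) (\<lambda>s t. \<Sum>us\<in>?Lp. \<Sum>vs\<in>?Lp. E us vs * (u (s, us) * cnj (u (t, vs))))"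
    using finL by simp
  then have "pos_kernel (?L \<times> ?Ln) (map_kernel (slice B p n E))"
    by (rule iffD1[OF pos_kernel_cong, rotated]) (auto simp: u_def slice_def unit_op_def intro!: sum.cong)
  then show ?thesis by (intro cp_mapI finL lin)
qed

lemma slice_app_op:
  assumes "is_op (lists_n B n) Y"
  shows "slice B p n E (app_op B p n X Y) = (\<lambda>zs ws. pairing (lists_n B p) E X * Y zs ws)"
proof (intro ext)
  fix zs ws
  show "slice B p n E (app_op B p n X Y) zs ws = pairing (lists_n B p) E X * Y zs ws"
  proof (cases "zs \<in> lists_n B n \<and> ws \<in> lists_n B n")
    case True
    then have "slice B p n E (app_op B p n X Y) zs ws
       = (\<Sum>us\<in>lists_n B p. \<Sum>vs\<in>lists_n B p. E us vs * X us vs * Y zs ws)"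
      unfolding slice_def by (simp add: app_op_append mult.assoc)
    then show ?thesis by (simp only: pairing_def sum_distrib_right)
  qed (use assms in \<open>auto simp: slice_def is_op_def\<close>)
qed

lemma sum_trace_slice:
  assumes fin: "finite B" and code: "classical_code A B p W \<tau> E"
  shows "(\<Sum>w\<in>W. op_trace (lists_n B n) (slice B p n (E w) Y)) = op_trace (lists_n B (p + n)) Y"
proof -
  let ?Ln = "lists_n B n" and ?Lp = "lists_n B p"
  have "(\<Sum>w\<in>W. op_trace ?Ln (slice B p n (E w) Y))
     = (\<Sum>zs\<in>?Ln. \<Sum>w\<in>W. pairing ?Lp (E w) (\<lambda>us vs. Y (us @ zs) (vs @ zs)))"
    unfolding op_trace_def pairing_def slice_def by (subst sum.swap) simp
  also have "\<dots> = (\<Sum>zs\<in>?Ln. \<Sum>us\<in>?Lp. Y (us @ zs) (us @ zs))"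
    unfolding classical_code_pairing_sum[OF fin code] op_trace_def ..
  also have "\<dots> = op_trace (lists_n B (p + n)) Y"
    unfolding op_trace_def sum_lists_append[OF fin] by (rule sum.swap)
  finally show ?thesis .
qed

lemma lin_map_scaled_sum:
  assumes "\<And>s. s \<in> S \<Longrightarrow> lin_map I Out (T s)"
  shows "lin_map I Out (\<lambda>X a b. \<Sum>s\<in>S. c s * T s X a b)"
  using assms unfolding lin_map_def is_op_def
  by (auto simp: fun_eq_iff algebra_simps sum.distrib sum_distrib_left intro!: sum.neutral)

lemma cp_map_scaled_sum:
  assumes fin: "finite I" "finite Out" and T: "\<And>s. s \<in> S \<Longrightarrow> cp_map I Out (T s)" and c: "\<And>s. s \<in> S \<Longrightarrow> c s \<ge> 0"
  shows "cp_map I Out (\<lambda>X a b. \<Sum>s\<in>S. complex_of_real (c s) * T s X a b)"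
proof (rule cp_mapI[OF fin lin_map_scaled_sum[OF cp_map_lin[OF T]]])
  have "pos_kernel (I \<times> Out) (\<lambda>p q. \<Sum>s\<in>S. complex_of_real (c s) * map_kernel (T s) p q)"
    by (intro pos_kernel_sum pos_kernel_scale cp_map_kernel[OF fin T] c)
  then show "pos_kernel (I \<times> Out) (map_kernel (\<lambda>X a b. \<Sum>s\<in>S. complex_of_real (c s) * T s X a b))"
    by (simp add: map_kernel_def case_prod_unfold)
qed

lemma channel_app_op:
  fixes A :: "'a set"
  assumes fin: "finite A" and \<tau>: "\<tau> \<in> states (lists_n A p)"
  shows "channel (lists_n A n) (lists_n A (p + n)) (app_op A p n \<tau>)"
proof -
  let ?L = "lists_n A (p + n)" and ?Ln = "lists_n A n" and ?Lp = "lists_n A p"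
  have finL: "finite ?L" "finite ?Ln" "finite ?Lp" using fin by simp_all
  have lin: "lin_map ?Ln ?L (app_op A p n \<tau>)"
    by (auto simp: lin_map_def is_op_def app_op_def algebra_simps fun_eq_iff)
  define u where "u = (\<lambda>(bs :: 'a list, as). if drop p as = bs then 1 else (0::complex))"
  have u: "pos_kernel (?Ln \<times> ?L) (\<lambda>a b. u a * cnj (u b))" by (rule pos_kernel_outer)
  have \<tau>': "pos_kernel ?Lp \<tau>" using \<tau> by (simp add: states_def psd_iff)
  have "pos_kernel (?Ln \<times> ?L) (\<lambda>a b. \<tau> (take p (snd a)) (take p (snd b)) * (u a * cnj (u b)))"
    by (rule pos_kernel_mult[OF _ pos_kernel_reindex[where f = "\<lambda>a. take p (snd a)", OF _ _ _ \<tau>'] u])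
      (use finL take_drop_lists_n in auto)
  then have "pos_kernel (?Ln \<times> ?L) (map_kernel (app_op A p n \<tau>))"
    by (rule iffD1[OF pos_kernel_cong, rotated]) (auto simp: u_def app_op_def unit_op_def)
  then have "cp_map ?Ln ?L (app_op A p n \<tau>)" by (intro cp_mapI finL lin)
  then show ?thesis
    using op_trace_app_op[OF fin, of p n \<tau>] \<tau> by (simp add: channel_def trace_pres_def states_def)
qed

text \<open>A fibre has at most V / K + 1 elements, and K \<le> V makes the 1 at most V / K.\<close>

lemma card_mod_fibre:
  assumes "0 < K" "K \<le> V"
  shows "real (card {r. r < V \<and> r mod K = i}) \<le> 2 * real V / real K"
proof -
  have inj: "inj_on (\<lambda>r. r div K) {r. r < V \<and> r mod K = i}"
    by (rule inj_onI) (metis (mono_tags, lifting) div_mult_mod_eq mem_Collect_eq)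
  have "(\<lambda>r. r div K) ` {r. r < V \<and> r mod K = i} \<subseteq> {..V div K}"
    by (auto intro: div_le_mono)
  then have "card {r. r < V \<and> r mod K = i} \<le> V div K + 1"
    using card_inj_on_le[OF inj, of "{..V div K}"] by simp
  also have "real (V div K + 1) \<le> real V / K + 1" using of_nat_div_le_of_nat[of V K, where ?'a = real] by simp
  finally have "real (card {r. r < V \<and> r mod K = i}) \<le> real V / K + 1" by simp
  moreover have "1 \<le> real V / K" using assms by simp
  ultimately show ?thesis by simp
qed

text \<open>The prefix carries a uniformly random \<open>w\<close>, of which \<open>w mod K\<close> selects the code: hence only the average
  error of the prefix code enters, and every code is selected with probability at most \<open>2 / K\<close>.\<close>
lemma ex_prefixed_code:
  fixes A :: "'a set" and B :: "'b set" and W :: "'w set"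
  assumes fin: "finite A" "finite B" "finite W" and W: "W \<noteq> {}"
    and cc: "classical_code A B p W \<tau> E" and K: "0 < K" "K \<le> card W"
    and code: "\<And>i. i < K \<Longrightarrow> is_cet_code A B n M1 M2 ({..<M2}, {..<Q}, P i, R i)"
  obtains c :: "('a, 'b) cet_code" where "is_cet_code A B (p + n) M1 M2 c"
    "\<And>T. (\<And>m. channel (lists_n A m) (lists_n B m) (ch_pow A B m T)) \<Longrightarrow>
       1 - Pbar_cet M1 c (ch_pow A B (p + n) T) \<le> (\<Sum>w\<in>W. 1 - outcome_prob A B p T \<tau> E w w) / card W
         + 2 / K * (\<Sum>i<K. 1 - Pbar_cet M1 ({..<M2}, {..<Q}, P i, R i) (ch_pow A B n T))"
proof -
  define V where "V = card W"
  have V0: "V > 0" using fin W by (simp add: V_def card_gt_0_iff)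
  obtain b where b: "bij_betw b W {..<V}"
    using ex_bij_betw_finite_nat[OF fin(3)] by (auto simp: V_def atLeast0LessThan)
  define \<kappa> where "\<kappa> = (\<lambda>w. b w mod K)"
  have \<kappa>: "\<kappa> w < K" for w using K by (simp add: \<kappa>_def)
  \<comment> \<open>The encoder draws w uniformly by itself, as a mixture of channels, and the
    decoder learns it from the prefix: no shared randomness remains.\<close>
  define P' where "P' = (\<lambda>m X as as'. \<Sum>w\<in>W. complex_of_real (1 / V) * app_op A p n (\<tau> w) (P (\<kappa> w) m X) as as')"
  define R' where "R' = (\<lambda>m Y x x'. \<Sum>w\<in>W. complex_of_real 1 * R (\<kappa> w) m (slice B p n (E w) Y) x x')"
  note D = is_cet_codeD[OF code[OF \<kappa>]]
  have finL: "finite (lists_n A m)" "finite (lists_n B m)" for m using fin by simp_all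
  have st: "\<tau> w \<in> states (lists_n A p)" and pE: "pos_kernel (lists_n B p) (E w)" if "w \<in> W" for w
    using cc that by (auto simp: classical_code_def)
  have chP: "channel {..<M2} (lists_n A (p + n)) (\<lambda>X. app_op A p n (\<tau> w) (P (\<kappa> w) m X))"
    if "w \<in> W" "m \<in> {1..M1}" for w m
    by (rule channel_comp[OF _ finL(1) finL(1) D(5)[OF that(2)] channel_app_op[OF fin(1) st[OF that(1)]]]) simp
  have cpR: "cp_map (lists_n B (p + n)) {..<Q} (\<lambda>Y. R i m (slice B p n (E w) Y))"
    if "w \<in> W" "m \<in> {1..M1}" "i < K" for w m i
    by (rule cp_map_comp[OF finL(2) finL(2) _ cp_map_slice[OF fin(2) pE[OF that(1)]] is_cet_codeD(6)[OF code[OF that(3)] that(2)]]) simp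
  have code': "is_cet_code A B (p + n) M1 M2 ({..<M2}, {..<Q}, P', R')"
  proof (rule is_cet_codeI[OF fin(2)])
    show "{..<M2} \<subseteq> {..<Q}" using D(2) by simp
    fix m assume m: "m \<in> {1..M1}"
    have "cp_map {..<M2} (lists_n A (p + n)) (P' m)"
      unfolding P'_def by (rule cp_map_scaled_sum[OF _ finL(1)]) (use chP[OF _ m] in \<open>auto simp: channel_def\<close>)
    moreover have "trace_pres {..<M2} (lists_n A (p + n)) (P' m)"
      unfolding trace_pres_def
    proof (intro allI impI)
      fix X assume X: "is_op {..<M2} X"
      have "op_trace (lists_n A (p + n)) (P' m X)
         = (\<Sum>w\<in>W. complex_of_real (1 / V) * op_trace (lists_n A (p + n)) (app_op A p n (\<tau> w) (P (\<kappa> w) m X)))"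
        unfolding op_trace_def P'_def sum_distrib_left by (rule sum.swap)
      also have "\<dots> = (\<Sum>w\<in>W. complex_of_real (1 / V) * op_trace {..<M2} X)"
        using chP[OF _ m] X by (intro sum.cong refl) (simp add: channel_def trace_pres_def)
      also have "\<dots> = op_trace {..<M2} X" using V0 by (simp add: V_def)
      finally show "op_trace (lists_n A (p + n)) (P' m X) = op_trace {..<M2} X" .
    qed
    ultimately show "channel {..<M2} (lists_n A (p + n)) (P' m)" by (simp add: channel_def)
    show "cp_map (lists_n B (p + n)) {..<Q} (R' m)"
      unfolding R'_def by (rule cp_map_scaled_sum[OF finL(2)]) (use cpR[OF _ m \<kappa>] in auto)
  next
    show "trace_pres (lists_n B (p + n)) {..<Q} (\<lambda>Y x x'. \<Sum>m\<in>{1..M1}. R' m Y x x')"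
      unfolding trace_pres_def
    proof (intro allI impI)
      fix Y assume Y: "is_op (lists_n B (p + n)) Y"
      have "op_trace {..<Q} (\<lambda>x x'. \<Sum>m\<in>{1..M1}. R' m Y x x')
         = (\<Sum>x<Q. \<Sum>w\<in>W. \<Sum>m\<in>{1..M1}. R (\<kappa> w) m (slice B p n (E w) Y) x x)"
        unfolding op_trace_def R'_def by (intro sum.cong refl) (simp add: sum.swap[of _ _ W])
      also have "\<dots> = (\<Sum>w\<in>W. op_trace {..<Q} (\<lambda>x x'. \<Sum>m\<in>{1..M1}. R (\<kappa> w) m (slice B p n (E w) Y) x x'))"
        unfolding op_trace_def by (rule sum.swap)
      also have "\<dots> = (\<Sum>w\<in>W. op_trace (lists_n B n) (slice B p n (E w) Y))"
        using D(8) by (intro sum.cong refl) (auto simp: trace_pres_def slice_def is_op_def)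
      also have "\<dots> = op_trace (lists_n B (p + n)) Y" by (rule sum_trace_slice[OF fin(2) cc])
      finally show "op_trace {..<Q} (\<lambda>x x'. \<Sum>m\<in>{1..M1}. R' m Y x x') = op_trace (lists_n B (p + n)) Y" .
    qed
  qed simp_all
  show ?thesis
  proof (rule that[OF code'])
    fix T assume T: "\<And>m. channel (lists_n A m) (lists_n B m) (ch_pow A B m T)"
    have cpT: "cp_map (lists_n A m) (lists_n B m) (ch_pow A B m T)" for m using T by (simp add: channel_def)
    define pr where "pr = outcome_prob A B p T \<tau> E"
    note props = outcome_prob_props[OF fin(1,2) cc T, folded pr_def]
    define cf where "cf = (\<lambda>i j. code_fid M1 ({..<M2}, {..<Q}, P i, R j) (ch_pow A B n T))"
    have cross: "is_cet_code A B n M1 M2 ({..<M2}, {..<Q}, P i, R j)" if "i < K" "j < K" for i j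
      using code[OF that(1)] code[OF that(2)] by (simp add: is_cet_code_def)
    have cf0: "Im (cf i j) = 0" "Re (cf i j) \<ge> 0" if "i < K" "j < K" for i j
      unfolding cf_def by (rule code_fid_nonneg[OF fin(1,2) cross[OF that] cpT])+
    define C where "C = (of_nat M1 * (of_nat M2)\<^sup>2 :: complex)"
    have entry: "R' m (ch_pow A B (p + n) T (P' m (unit_op k k'))) x x'
       = (\<Sum>w'\<in>W. \<Sum>w\<in>W. complex_of_real (1 / V) * of_real (pr w w') * R (\<kappa> w') m (ch_pow A B n T (P (\<kappa> w) m (unit_op k k'))) x x')"
      if m: "m \<in> {1..M1}" and k: "k < M2" "k' < M2" for m k k' x x'
    proof -
      have opP: "is_op (lists_n A n) (P (\<kappa> w) m (unit_op k k'))" for w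
      proof (rule lin_map_is_op[where I = "{..<M2}" and T = "P (\<kappa> w) m" and X = "unit_op k k'"])
        show "lin_map {..<M2} (lists_n A n) (P (\<kappa> w) m)" using D(5)[OF m] by (simp add: channel_def cp_map_def)
        show "is_op {..<M2} (unit_op k k')" using k by (intro is_op_unit) auto
      qed
      have "R (\<kappa> w') m (slice B p n (E w') (ch_pow A B (p + n) T (P' m (unit_op k k')))) x x'
         = (\<Sum>w\<in>W. complex_of_real (1 / V) * of_real (pr w w') * R (\<kappa> w') m (ch_pow A B n T (P (\<kappa> w) m (unit_op k k'))) x x')"
        if w': "w' \<in> W" for w'
      proof -
        let ?S = "\<lambda>X. R (\<kappa> w') m (slice B p n (E w') (ch_pow A B (p + n) T X))"
        have lin: "lin_map (lists_n A (p + n)) {..<Q} ?S"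
          by (rule lin_map_comp[OF cp_map_lin[OF cpT] cp_map_lin[OF cpR[OF w' m \<kappa>]]])
        have "?S (P' m (unit_op k k')) x x' = (\<Sum>w\<in>W. complex_of_real (1 / V) * ?S (app_op A p n (\<tau> w) (P (\<kappa> w) m (unit_op k k'))) x x')"
          unfolding P'_def by (subst lin_map_sum[OF lin is_op_app_op]) simp
        also have "\<dots> = (\<Sum>w\<in>W. complex_of_real (1 / V) * of_real (pr w w') * R (\<kappa> w') m (ch_pow A B n T (P (\<kappa> w) m (unit_op k k'))) x x')"
        proof (intro sum.cong refl)
          fix w assume w: "w \<in> W"
          have opT: "is_op (lists_n B n) (ch_pow A B n T (P (\<kappa> w) m (unit_op k k')))"
            by (rule lin_map_is_op[OF cp_map_lin[OF cpT] opP])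
          have "?S (app_op A p n (\<tau> w) (P (\<kappa> w) m (unit_op k k')))
             = R (\<kappa> w') m (\<lambda>zs ws. of_real (pr w w') * ch_pow A B n T (P (\<kappa> w) m (unit_op k k')) zs ws)"
            unfolding ch_pow_app_op[OF fin(1)] slice_app_op[OF opT] props(1)[OF w w'] ..
          also have "\<dots> = (\<lambda>x x'. of_real (pr w w') * R (\<kappa> w') m (ch_pow A B n T (P (\<kappa> w) m (unit_op k k'))) x x')"
            by (rule lin_map_scale[OF cp_map_lin[OF D(6)[OF m]] opT])
          finally show "complex_of_real (1 / V) * ?S (app_op A p n (\<tau> w) (P (\<kappa> w) m (unit_op k k'))) x x'
             = complex_of_real (1 / V) * of_real (pr w w') * R (\<kappa> w') m (ch_pow A B n T (P (\<kappa> w) m (unit_op k k'))) x x'"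
            by (simp add: mult.assoc)
        qed
        finally show ?thesis .
      qed
      then show ?thesis by (simp add: R'_def)
    qed
    have "code_fid M1 ({..<M2}, {..<Q}, P', R') (ch_pow A B (p + n) T)
       = (\<Sum>m\<in>{1..M1}. \<Sum>q\<in>{..<M2} \<times> {..<M2}. \<Sum>w'\<in>W. \<Sum>w\<in>W. complex_of_real (1 / V) * of_real (pr w w') *
           R (\<kappa> w') m (ch_pow A B n T (P (\<kappa> w) m (unit_op (fst q) (snd q)))) (fst q) (snd q)) / C"
      unfolding code_fid_def prod.case C_def card_lessThan
      by (intro arg_cong2[of _ _ _ _ divide] refl sum.cong) (simp add: sum_Times entry)
    also have "(\<Sum>m\<in>{1..M1}. \<Sum>q\<in>{..<M2} \<times> {..<M2}. \<Sum>w'\<in>W. \<Sum>w\<in>W. complex_of_real (1 / V) * of_real (pr w w') *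
           R (\<kappa> w') m (ch_pow A B n T (P (\<kappa> w) m (unit_op (fst q) (snd q)))) (fst q) (snd q))
       = (\<Sum>w'\<in>W. \<Sum>w\<in>W. \<Sum>m\<in>{1..M1}. \<Sum>q\<in>{..<M2} \<times> {..<M2}. complex_of_real (1 / V) * of_real (pr w w') *
           R (\<kappa> w') m (ch_pow A B n T (P (\<kappa> w) m (unit_op (fst q) (snd q)))) (fst q) (snd q))"
      by (rule sum_swap_pairs)
    also have "\<dots> / C = (\<Sum>w'\<in>W. \<Sum>w\<in>W. complex_of_real (1 / V * pr w w') * cf (\<kappa> w) (\<kappa> w'))"
      unfolding sum_divide_distrib cf_def code_fid_def prod.case C_def card_lessThan sum_distrib_left
      by (intro sum.cong refl) (simp add: sum_Times sum_distrib_left)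
    finally have fid: "code_fid M1 ({..<M2}, {..<Q}, P', R') (ch_pow A B (p + n) T)
       = (\<Sum>w'\<in>W. \<Sum>w\<in>W. complex_of_real (1 / V * pr w w') * cf (\<kappa> w) (\<kappa> w'))" .
    define F where "F = (\<lambda>i. Pbar_cet M1 ({..<M2}, {..<Q}, P i, R i) (ch_pow A B n T))"
    have F: "F i = Re (cf i i)" if "i < K" for i
      unfolding F_def cf_def by (rule Pbar_cet_code_fid(1)[OF fin(1,2) code[OF that] cpT])
    have F1: "F i \<le> 1" if "i < K" for i
      unfolding F_def by (rule Pbar_cet_le[OF fin(1,2) code[OF that] cpT]) (use T in \<open>auto simp: channel_def trace_pres_def\<close>)
    have pr1: "pr w w \<le> 1" "0 \<le> pr w w" if w: "w \<in> W" for w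
    proof -
      have "pr w w \<le> (\<Sum>w'\<in>W. pr w w')" using props(2)[OF w] fin(3) w by (intro member_le_sum) auto
      then show "pr w w \<le> 1" using props(3)[OF w] by simp
      show "0 \<le> pr w w" using props(2)[OF w w] .
    qed
    have "(\<Sum>w\<in>W. 1 / V * (pr w w + F (\<kappa> w) - 1)) \<le> (\<Sum>w\<in>W. 1 / V * pr w w * Re (cf (\<kappa> w) (\<kappa> w)))"
    proof (intro sum_mono)
      fix w assume w: "w \<in> W"
      \<comment> \<open>A product of two numbers at most 1 is at least their sum minus 1, so prefix
        error and code error can be averaged separately.\<close>
      have "0 \<le> (1 - pr w w) * (1 - F (\<kappa> w))" using pr1[OF w] F1[OF \<kappa>] by (intro mult_nonneg_nonneg) auto
      then have "pr w w + F (\<kappa> w) - 1 \<le> pr w w * F (\<kappa> w)" by (simp add: algebra_simps)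
      then have "1 / V * (pr w w + F (\<kappa> w) - 1) \<le> 1 / V * (pr w w * F (\<kappa> w))" by (intro mult_left_mono) auto
      then show "1 / V * (pr w w + F (\<kappa> w) - 1) \<le> 1 / V * pr w w * Re (cf (\<kappa> w) (\<kappa> w))"
        by (simp only: F[OF \<kappa>] mult.assoc)
    qed
    also have "\<dots> \<le> (\<Sum>w'\<in>W. \<Sum>w\<in>W. 1 / V * pr w w' * Re (cf (\<kappa> w) (\<kappa> w')))"
    proof (intro sum_mono)
      fix w' assume w': "w' \<in> W"
      show "1 / V * pr w' w' * Re (cf (\<kappa> w') (\<kappa> w')) \<le> (\<Sum>w\<in>W. 1 / V * pr w w' * Re (cf (\<kappa> w) (\<kappa> w')))"
        using props(2)[OF _ w'] cf0(2)[OF \<kappa> \<kappa>] fin(3) w'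
        by (intro member_le_sum[where f = "\<lambda>w. 1 / V * pr w w' * Re (cf (\<kappa> w) (\<kappa> w'))"]) auto
    qed
    also have "\<dots> = Re (code_fid M1 ({..<M2}, {..<Q}, P', R') (ch_pow A B (p + n) T))"
    proof -
      have "Re (complex_of_real a * z) = a * Re z" for a z by simp
      then show ?thesis unfolding fid Re_sum by (intro sum.cong refl) (simp only:)
    qed
    also have "\<dots> = Pbar_cet M1 ({..<M2}, {..<Q}, P', R') (ch_pow A B (p + n) T)"
      by (rule Pbar_cet_code_fid(1)[OF fin(1,2) code' cpT, symmetric])
    finally have main: "(\<Sum>w\<in>W. 1 / V * (pr w w + F (\<kappa> w) - 1)) \<le> Pbar_cet M1 ({..<M2}, {..<Q}, P', R') (ch_pow A B (p + n) T)" .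
    have "(\<Sum>w\<in>W. 1 - F (\<kappa> w)) = (\<Sum>r<V. 1 - F (r mod K))"
      unfolding \<kappa>_def by (rule sum.reindex_bij_betw[OF b, where g = "\<lambda>r. 1 - F (r mod K)"])
    also have "\<dots> = (\<Sum>i<K. \<Sum>r\<in>{r\<in>{..<V}. r mod K = i}. 1 - F (r mod K))"
      by (rule sum.group[symmetric]) (use K in auto)
    also have "\<dots> = (\<Sum>i<K. real (card {r. r < V \<and> r mod K = i}) * (1 - F i))"
    proof (intro sum.cong refl)
      fix i
      have "(\<Sum>r\<in>{r\<in>{..<V}. r mod K = i}. 1 - F (r mod K)) = (\<Sum>r\<in>{r. r < V \<and> r mod K = i}. 1 - F i)"
        by (intro sum.cong) auto
      then show "(\<Sum>r\<in>{r\<in>{..<V}. r mod K = i}. 1 - F (r mod K)) = real (card {r. r < V \<and> r mod K = i}) * (1 - F i)"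
        by simp
    qed
    also have "\<dots> \<le> (\<Sum>i<K. 2 * real V / real K * (1 - F i))"
      using F1 K by (intro sum_mono mult_right_mono card_mod_fibre) (auto simp: V_def)
    finally have fib: "(\<Sum>w\<in>W. 1 - F (\<kappa> w)) \<le> 2 * real V / real K * (\<Sum>i<K. 1 - F i)"
      by (simp only: sum_distrib_left)
    have "(\<Sum>w\<in>W. 1 / V * (pr w w + F (\<kappa> w) - 1)) = 1 / V * (\<Sum>w\<in>W. 1 - (1 - pr w w) - (1 - F (\<kappa> w)))"
      unfolding sum_distrib_left by (intro sum.cong refl) (simp add: algebra_simps)
    also have "\<dots> = 1 - (\<Sum>w\<in>W. 1 - pr w w) / V - (\<Sum>w\<in>W. 1 - F (\<kappa> w)) / V"
      unfolding sum_subtractf[of _ "\<lambda>w. 1 - F (\<kappa> w)"] sum_subtractf[of "\<lambda>_. 1"]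
      using V0 by (simp add: V_def[symmetric] field_simps)
    finally have "1 - Pbar_cet M1 ({..<M2}, {..<Q}, P', R') (ch_pow A B (p + n) T)
       \<le> (\<Sum>w\<in>W. 1 - pr w w) / V + (\<Sum>w\<in>W. 1 - F (\<kappa> w)) / V" using main by linarith
    also have "\<dots> \<le> (\<Sum>w\<in>W. 1 - pr w w) / V + (2 * real V / real K * (\<Sum>i<K. 1 - F i)) / V"
      using fib by (intro add_left_mono divide_right_mono) auto
    also have "(2 * real V / real K * (\<Sum>i<K. 1 - F i)) / V = 2 / K * (\<Sum>i<K. 1 - F i)" using V0 by simp
    finally show "1 - Pbar_cet M1 ({..<M2}, {..<Q}, P', R') (ch_pow A B (p + n) T) \<le> (\<Sum>w\<in>W. 1 - outcome_prob A B p T \<tau> E w w) / card W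
         + 2 / K * (\<Sum>i<K. 1 - Pbar_cet M1 ({..<M2}, {..<Q}, P i, R i) (ch_pow A B n T))"
      by (simp only: pr_def V_def F_def)
  qed
qed

subsection \<open>From compound codes to random codes for the jammed channel\<close>

lemma unit_states: "finite I \<Longrightarrow> i \<in> I \<Longrightarrow> unit_op i i \<in> states I"
  by (simp add: states_def psd_unit op_trace_unit)

lemma states_nonempty:
  assumes "finite J" "J \<noteq> {}"
  shows "states (lists_n J n) \<noteq> {}"
proof -
  obtain j where j: "j \<in> J" using assms(2) by blast
  have "replicate n j \<in> lists_n J n" using j by (auto simp: lists_n_eq)
  from unit_states[OF finite_lists_n[OF assms(1)] this] show ?thesis by blast
qed

lemma ex_trivial_code:
  fixes A :: "'a set" and B :: "'b set"
  assumes fin: "finite A" "finite B" and ne: "A \<noteq> {}"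
  obtains c :: "('a, 'b) cet_code" where "is_cet_code A B n 1 1 c"
    "\<And>M. channel (lists_n A n) (lists_n B n) M \<Longrightarrow> Pbar_cet 1 c M = 1"
proof -
  obtain a where a: "a \<in> A" using ne by blast
  define \<tau> where "\<tau> = replicate n a"
  have \<tau>: "\<tau> \<in> lists_n A n" using a by (auto simp: \<tau>_def lists_n_eq)
  have finL: "finite (lists_n A n)" "finite (lists_n B n)" using fin by simp_all
  define P where "P = (\<lambda>(m::nat) (X :: nat op) as as'. X 0 0 * unit_op \<tau> \<tau> as as')"
  define R where "R = (\<lambda>(m::nat) (Y :: 'b list op) x x'. op_trace (lists_n B n) Y * unit_op (0::nat) 0 x x')"
  have linP: "lin_map {0} (lists_n A n) (P m)" for m
    using \<tau> by (auto simp: lin_map_def is_op_def P_def unit_op_def algebra_simps fun_eq_iff)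
  have linR: "lin_map (lists_n B n) {0} (R m)" for m
    by (auto simp: lin_map_def is_op_def R_def unit_op_def op_trace_def algebra_simps sum.distrib sum_distrib_left fun_eq_iff)
  have "pos_kernel ({0} \<times> lists_n A n) (\<lambda>p q. (if snd p = \<tau> then 1 else 0) * cnj (if snd q = \<tau> then 1 else 0))"
    by (rule pos_kernel_outer)
  then have "pos_kernel ({0} \<times> lists_n A n) (map_kernel (P m))" for m
    by (rule iffD1[OF pos_kernel_cong, rotated]) (auto simp: P_def unit_op_def)
  then have "cp_map {0} (lists_n A n) (P m)" for m by (intro cp_mapI finL linP) simp
  moreover have "op_trace (lists_n A n) (P m X) = op_trace {0} X" for m X
    using op_trace_unit[OF finL(1) \<tau>, of \<tau>] by (simp add: op_trace_def P_def sum_distrib_left[symmetric])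
  ultimately have chP: "channel {0} (lists_n A n) (P m)" for m by (simp add: channel_def trace_pres_def)
  have "pos_kernel (lists_n B n \<times> {0}) (\<lambda>p q. \<Sum>us\<in>lists_n B n. (if fst p = us then 1 else 0) * cnj (if fst q = us then 1 else 0))"
    by (intro pos_kernel_sum, rule pos_kernel_outer)
  then have "pos_kernel (lists_n B n \<times> {0}) (map_kernel (R m))" for m
    by (rule iffD1[OF pos_kernel_cong, rotated]) (auto simp: R_def op_trace_def unit_op_def intro!: sum.cong)
  then have cpR: "cp_map (lists_n B n) {0} (R m)" for m by (intro cp_mapI finL linR) simp
  have code: "is_cet_code A B n 1 1 ({0}, {0}, P, R)"
    by (rule is_cet_codeI[OF fin(2)]) (use chP cpR in \<open>auto simp: trace_pres_def op_trace_def R_def unit_op_def\<close>)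
  show ?thesis
  proof (rule that[OF code])
    fix M assume M: "channel (lists_n A n) (lists_n B n) M"
    have "is_op (lists_n A n) (P 1 (unit_op 0 0))" by (rule lin_map_is_op[OF linP is_op_unit]) simp_all
    then have tr: "op_trace (lists_n B n) (M (P 1 (unit_op 0 0))) = op_trace (lists_n A n) (P 1 (unit_op 0 0))"
      using M by (simp add: channel_def trace_pres_def)
    have "code_fid 1 ({0}, {0}, P, R) M = op_trace (lists_n B n) (M (P 1 (unit_op 0 0))) * unit_op (0::nat) 0 0 0"
      by (simp add: code_fid_def R_def)
    also have "\<dots> = op_trace (lists_n A n) (P 1 (unit_op 0 0))"
      unfolding tr by (simp add: unit_op_def)
    also have "\<dots> = 1"
      using chP[of 1] is_op_unit[of "0::nat" "{0}" 0] op_trace_unit[of "{0}" "0::nat" 0] by (simp add: channel_def trace_pres_def)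
    finally show "Pbar_cet 1 ({0}, {0}, P, R) M = 1"
      using Pbar_cet_code_fid(1)[OF fin code] M by (simp add: channel_def)
  qed
qed

text \<open>Measuring the rate over m instead of n costs at most \<beta> R. If R - \<delta> / 2 is
  negative the comparison of lengths points the wrong way, but then the target rate is negative
  too.\<close>

lemma rate_shrink:
  fixes R \<delta> \<beta> :: real
  assumes L: "L \<ge> 0" "L / real n \<ge> R - \<delta> / 2" and n: "0 < n" "n \<le> m" "(1 - \<beta>) * real m \<le> real n"
    and R: "R \<ge> 0" "\<beta> * R \<le> \<delta> / 2" and \<beta>: "\<beta> \<ge> 0" and \<delta>: "\<delta> > 0"
  shows "L / real m \<ge> R - \<delta>"
proof (cases "R - \<delta> / 2 \<ge> 0")
  case True
  have "(R - \<delta>) * m \<le> (R - \<delta> / 2 - \<beta> * R) * m" using R by (intro mult_right_mono) auto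
  also have "\<dots> \<le> (R - \<delta> / 2) * (1 - \<beta>) * m"
    using \<beta> \<delta> by (intro mult_right_mono) (auto simp: algebra_simps)
  also have "\<dots> \<le> (R - \<delta> / 2) * n" using True n(3) by (simp add: mult.assoc mult_left_mono)
  also have "\<dots> \<le> L" using L(2) n(1) by (simp add: field_simps)
  finally show ?thesis using n by (simp add: field_simps)
next
  case False
  then have "R - \<delta> \<le> 0" using \<delta> by linarith
  also have "0 \<le> L / real m" using L(1) by simp
  finally show ?thesis .
qed

lemma ex_small_fraction:
  fixes R1 R2 \<eta> :: real
  assumes "R1 \<ge> 0" "R2 \<ge> 0" "\<eta> > 0"
  obtains \<beta> where "0 < \<beta>" "\<beta> \<le> 1/2" "\<beta> * R1 \<le> \<eta> / 2" "\<beta> * R2 \<le> \<eta> / 2"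
proof -
  \<comment> \<open>The + 1 keeps the denominator positive when both rates vanish.\<close>
  define \<beta> where "\<beta> = min (1/2) (\<eta> / (2 * (R1 + R2 + 1)))"
  have \<beta>: "0 < \<beta>" using assms by (auto simp: \<beta>_def)
  have "\<beta> * r \<le> \<eta> / 2" if "0 \<le> r" "r \<le> R1 + R2" for r
  proof -
    have "\<beta> * r \<le> \<eta> / (2 * (R1 + R2 + 1)) * (R1 + R2 + 1)"
      using that assms \<beta> by (intro mult_mono) (auto simp: \<beta>_def)
    also have "\<dots> = \<eta> / 2" using assms by (simp add: divide_simps)
    finally show ?thesis .
  qed
  moreover have "\<beta> \<le> 1/2" unfolding \<beta>_def by (rule min.cobounded1)
  ultimately show thesis using that[of \<beta>] \<beta> assms by simp
qed

text \<open>This includes M = 0, where \<open>log\<close> takes the value 0.\<close>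

lemma log_nat_nonneg: "0 \<le> log 2 (real M)"
  by (cases "M = 0") (auto simp: log_def)

definition random_code :: "'a set \<Rightarrow> 'j set \<Rightarrow> 'b set \<Rightarrow> (('a \<times> 'j) op \<Rightarrow> 'b op) \<Rightarrow> nat \<Rightarrow> nat \<Rightarrow> nat \<Rightarrow> ('a, 'b) cet_code measure \<Rightarrow> bool" where
  "random_code A J B N n M1 M2 \<mu> \<longleftrightarrow> prob_space \<mu> \<and> (\<forall>c\<in>space \<mu>. is_cet_code A B n M1 M2 c) \<and>
     (\<forall>\<sigma>\<in>states (lists_n J n). (\<lambda>c. Pbar_cet M1 c (avqc_ch A J B n N \<sigma>)) \<in> borel_measurable \<mu>)"

definition mean_success :: "'a set \<Rightarrow> 'j set \<Rightarrow> 'b set \<Rightarrow> (('a \<times> 'j) op \<Rightarrow> 'b op) \<Rightarrow> nat \<Rightarrow> nat \<Rightarrow> ('a, 'b) cet_code measure \<Rightarrow> 'j list op \<Rightarrow> real" where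
  "mean_success A J B N n M1 \<mu> \<sigma> = integral\<^sup>L \<mu> (\<lambda>c. Pbar_cet M1 c (avqc_ch A J B n N \<sigma>))"

context
  fixes A :: "'a set" and J :: "'j set" and B :: "'b set" and N :: "('a \<times> 'j) op \<Rightarrow> 'b op"
  assumes fin: "finite A" "finite J" "finite B" and ne: "A \<noteq> {}" "J \<noteq> {}" and N: "channel (A \<times> J) B N"
begin

lemma mean_success_bounds:
  assumes rc: "random_code A J B N n M1 M2 \<mu>" and \<sigma>: "\<sigma> \<in> states (lists_n J n)"
  shows "0 \<le> mean_success A J B N n M1 \<mu> \<sigma>" "mean_success A J B N n M1 \<mu> \<sigma> \<le> 1"
proof -
  interpret prob_space \<mu> using rc by (simp add: random_code_def)
  have b: "0 \<le> Pbar_cet M1 c (avqc_ch A J B n N \<sigma>)" "Pbar_cet M1 c (avqc_ch A J B n N \<sigma>) \<le> 1" if "c \<in> space \<mu>" for c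
    using Pbar_avqc(2,3)[OF fin N, of n M1 M2 c \<sigma>] rc that \<sigma> by (auto simp: random_code_def states_def)
  show "0 \<le> mean_success A J B N n M1 \<mu> \<sigma>"
    unfolding mean_success_def by (rule integral_nonneg_AE) (use b in \<open>auto intro!: AE_I2\<close>)
  have m: "(\<lambda>c. Pbar_cet M1 c (avqc_ch A J B n N \<sigma>)) \<in> borel_measurable \<mu>"
    using rc \<sigma> by (auto simp: random_code_def)
  have "integrable \<mu> (\<lambda>c. Pbar_cet M1 c (avqc_ch A J B n N \<sigma>))"
    by (rule integrable_const_bound[where B = 1, OF _ m]) (use b in \<open>auto intro!: AE_I2\<close>)
  then have "mean_success A J B N n M1 \<mu> \<sigma> \<le> expectation (\<lambda>_. 1)"
    unfolding mean_success_def by (rule integral_mono_AE) (use b in \<open>auto intro!: AE_I2\<close>)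
  then show "mean_success A J B N n M1 \<mu> \<sigma> \<le> 1" by (simp add: prob_space)
qed

lemma mean_success_INF:
  assumes rc: "random_code A J B N n M1 M2 \<mu>" and \<sigma>: "\<sigma> \<in> states (lists_n J n)"
  shows "(INF \<sigma>\<in>states (lists_n J n). mean_success A J B N n M1 \<mu> \<sigma>) \<le> mean_success A J B N n M1 \<mu> \<sigma>"
  by (rule cINF_lower[OF bdd_belowI2[where m = 0] \<sigma>]) (rule mean_success_bounds[OF rc])

lemma compound_INF:
  assumes c: "is_cet_code A B n M1 M2 c" and \<sigma>: "\<sigma> \<in> states J"
  shows "(INF \<sigma>\<in>states J. Pbar_cet M1 c (ch_pow A B n (jam_ch N \<sigma>))) \<le> Pbar_cet M1 c (ch_pow A B n (jam_ch N \<sigma>))"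
proof (rule cINF_lower[OF bdd_belowI2[where m = 0] \<sigma>])
  fix \<sigma> assume "\<sigma> \<in> states J"
  then show "0 \<le> Pbar_cet M1 c (ch_pow A B n (jam_ch N \<sigma>))"
    using Pbar_cet_code_fid(3)[OF fin(1,3) c] channel_ch_pow_jam[OF fin N] by (simp add: channel_def)
qed

lemma compound_CET_regionD:
  assumes "(R1, R2) \<in> compound_CET_region A B T F" "\<epsilon> > 0" "\<delta> > 0"
  shows "\<exists>n0. \<forall>n\<ge>n0. \<exists>M1 M2 (c :: ('a, 'b) cet_code). is_cet_code A B n M1 M2 c \<and>
        log 2 (real M1) / real n \<ge> R1 - \<delta> \<and> log 2 (real M2) / real n \<ge> R2 - \<delta> \<and>
        (INF t\<in>T. Pbar_cet M1 c (ch_pow A B n (F t))) \<ge> 1 - \<epsilon>"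
  using assms unfolding compound_CET_region_def by blast

lemma random_codes_of_compound:
  assumes R: "(R1, R2) \<in> compound_CET_region A B (states J) (jam_ch N)" and \<eta>: "\<eta> > 0"
  shows "\<exists>m0. \<forall>m\<ge>m0. \<exists>M1 M2 \<mu>. random_code A J B N m M1 M2 \<mu> \<and>
     log 2 (real M1) / real m \<ge> R1 - \<eta> \<and> log 2 (real M2) / real m \<ge> R2 - \<eta> \<and>
     (\<forall>\<sigma>\<in>states (lists_n J m). mean_success A J B N m M1 \<mu> \<sigma> \<ge> 1 - \<eta>)"
proof -
  have R0: "R1 \<ge> 0" "R2 \<ge> 0" using R by (auto simp: compound_CET_region_def)
  obtain \<beta> where \<beta>: "0 < \<beta>" and \<beta>2: "\<beta> \<le> 1/2" and \<beta>R: "\<beta> * R1 \<le> \<eta> / 2" "\<beta> * R2 \<le> \<eta> / 2"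
    by (rule ex_small_fraction[OF R0 \<eta>])
  \<comment> \<open>With l at least \<beta> m / 2 the quotient m / l is at most 2 / \<beta>, so C
    bounds the de Finetti factor for every m and \<epsilon> can be fixed before the length.\<close>
  define C where "C = 2 * (2 / \<beta>) ^ (card (J \<times> J) - 1)"
  have C0: "C > 0" using \<beta> by (simp add: C_def)
  define \<epsilon> where "\<epsilon> = \<eta> / C"
  have \<epsilon>: "\<epsilon> > 0" using \<eta> C0 by (simp add: \<epsilon>_def)
  obtain n0 where n0: "\<And>n. n \<ge> n0 \<Longrightarrow> \<exists>M1 M2 (c :: ('a, 'b) cet_code). is_cet_code A B n M1 M2 c \<and>
        log 2 (real M1) / real n \<ge> R1 - \<eta> / 2 \<and> log 2 (real M2) / real n \<ge> R2 - \<eta> / 2 \<and>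
        (INF \<sigma>\<in>states J. Pbar_cet M1 c (ch_pow A B n (jam_ch N \<sigma>))) \<ge> 1 - \<epsilon>"
    using compound_CET_regionD[OF R \<epsilon> half_gt_zero[OF \<eta>]] by blast
  show ?thesis
  proof (rule exI, rule allI, rule impI)
    \<comment> \<open>The first summand makes \<beta> m \<ge> 2, so rounding down loses at most half
      of it; the others ensure that the remaining length n, at least m / 2, is positive and at least
      \<open>n0\<close>.\<close>
    fix m assume m: "m \<ge> nat \<lceil>2 / \<beta>\<rceil> + 2 * n0 + 2"
    define l where "l = nat \<lfloor>\<beta> * m\<rfloor>"
    define n where "n = m - l"
    have "2 / \<beta> \<le> real m" using m by linarith
    then have bm: "2 \<le> \<beta> * m" using \<beta> by (simp add: field_simps)
    have l1: "real l \<le> \<beta> * m" and l2: "\<beta> * m - 1 \<le> real l" using bm by (auto simp: l_def)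
    have l3: "\<beta> * m / 2 \<le> real l" and l0: "l > 0" using l2 bm by linarith+
    have "real l \<le> m / 2" using l1 mult_right_mono[OF \<beta>2, of "real m"] by simp
    then have lm: "l \<le> m" and nn0: "n \<ge> n0" and npos: "n > 0" using m by (auto simp: n_def)
    have nm: "n + l = m" using lm by (simp add: n_def)
    have nr: "(1 - \<beta>) * real m \<le> real n" using l1 nm by (simp add: algebra_simps flip: nm)
    obtain M1 M2 and c :: "('a, 'b) cet_code" where c: "is_cet_code A B n M1 M2 c"
      and r1: "log 2 (real M1) / real n \<ge> R1 - \<eta> / 2" and r2: "log 2 (real M2) / real n \<ge> R2 - \<eta> / 2"
      and inf: "(INF \<sigma>\<in>states J. Pbar_cet M1 c (ch_pow A B n (jam_ch N \<sigma>))) \<ge> 1 - \<epsilon>"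
      using n0[OF nn0] by blast
    have good: "Pbar_cet M1 c (ch_pow A B n (jam_ch N \<sigma>)) \<ge> 1 - \<epsilon>" if "\<sigma> \<in> states J" for \<sigma>
      using compound_INF[OF c that] inf by linarith
    obtain \<mu> :: "('a, 'b) cet_code measure" where \<mu>: "prob_space \<mu>" "\<And>c. c \<in> space \<mu> \<Longrightarrow> is_cet_code A B (n + l) M1 M2 c"
      "\<And>f :: ('a, 'b) cet_code \<Rightarrow> real. f \<in> borel_measurable \<mu>"
      and s: "\<And>\<sigma>. \<sigma> \<in> states (lists_n J (n + l)) \<Longrightarrow>
       1 - 2 * (real (n + l) / l) ^ (card (J \<times> J) - 1) * \<epsilon> \<le> integral\<^sup>L \<mu> (\<lambda>c. Pbar_cet M1 c (avqc_ch A J B (n + l) N \<sigma>))"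
      by (rule random_code_of_code[OF fin ne N c l0 _ good]) (use \<epsilon> in auto)
    have "real m / l \<le> 2 / \<beta>" using l3 l0 \<beta> by (simp add: field_simps)
    then have "2 * (real m / l) ^ (card (J \<times> J) - 1) * \<epsilon> \<le> C * \<epsilon>"
      unfolding C_def using \<epsilon> by (intro mult_right_mono mult_left_mono power_mono) auto
    also have "\<dots> = \<eta>" using C0 by (simp add: \<epsilon>_def)
    finally have "\<forall>\<sigma>\<in>states (lists_n J m). mean_success A J B N m M1 \<mu> \<sigma> \<ge> 1 - \<eta>"
      using s unfolding nm mean_success_def by fastforce
    moreover have "random_code A J B N m M1 M2 \<mu>"
      using \<mu> by (auto simp: random_code_def nm)
    moreover have "log 2 (real M1) / real m \<ge> R1 - \<eta>" "log 2 (real M2) / real m \<ge> R2 - \<eta>"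
      using rate_shrink[OF log_nat_nonneg r1 npos _ nr R0(1) _ _ \<eta>] rate_shrink[OF log_nat_nonneg r2 npos _ nr R0(2) _ _ \<eta>]
        \<beta>R R0 \<beta> nm by auto
    ultimately show "\<exists>M1 M2 \<mu>. random_code A J B N m M1 M2 \<mu> \<and>
     log 2 (real M1) / real m \<ge> R1 - \<eta> \<and> log 2 (real M2) / real m \<ge> R2 - \<eta> \<and>
     (\<forall>\<sigma>\<in>states (lists_n J m). mean_success A J B N m M1 \<mu> \<sigma> \<ge> 1 - \<eta>)" by blast
  qed
qed

lemma ex_trivial_random_code: "\<exists>\<mu>. random_code A J B N n 1 1 \<mu>"
proof -
  obtain c :: "('a, 'b) cet_code" where c: "is_cet_code A B n 1 1 c"
    by (rule ex_trivial_code[OF fin(1,3) ne(1), of n])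
  have "random_code A J B N n 1 1 (uniform_count_measure {c})"
    using c prob_space_uniform_count_measure[of "{c}"]
    by (auto simp: random_code_def space_uniform_count_measure measurable_def sets_uniform_count_measure)
  then show ?thesis by blast
qed

text \<open>Diagonalisation: at length \<open>m\<close> use the random code that is \<open>1 / Suc k\<close>-good for the largest possible \<open>k \<le> m\<close>.\<close>
lemma compound_subset:
  assumes R: "(R1, R2) \<in> compound_CET_region A B (states J) (jam_ch N)"
  shows "(R1, R2) \<in> AVQC_random_CET_region A J B N"
proof -
  have R0: "R1 \<ge> 0" "R2 \<ge> 0" using R by (auto simp: compound_CET_region_def)
  define good where "good = (\<lambda>(k::nat) m (x :: nat \<times> nat \<times> ('a, 'b) cet_code measure).
     log 2 (real (fst x)) / real m \<ge> R1 - 1 / Suc k \<and> log 2 (real (fst (snd x))) / real m \<ge> R2 - 1 / Suc k \<and>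
     (\<forall>\<sigma>\<in>states (lists_n J m). mean_success A J B N m (fst x) (snd (snd x)) \<sigma> \<ge> 1 - 1 / Suc k))"
  define rc where "rc = (\<lambda>m (x :: nat \<times> nat \<times> ('a, 'b) cet_code measure). random_code A J B N m (fst x) (fst (snd x)) (snd (snd x)))"
  have ev: "\<exists>m0. \<forall>m\<ge>m0. \<exists>x. rc m x \<and> good k m x" for k
    using random_codes_of_compound[OF R, of "1 / Suc k"] unfolding rc_def good_def by fastforce
  have mono: "good k m x" if "good k' m x" "k \<le> k'" for k k' m x
  proof -
    have "1 / real (Suc k') \<le> 1 / real (Suc k)" using that(2) by (simp add: field_simps)
    then show ?thesis using that(1) unfolding good_def by fastforce
  qed
  have "\<exists>x. rc m x \<and> (\<forall>k\<le>m. (\<exists>y. rc m y \<and> good k m y) \<longrightarrow> good k m x)" for m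
  proof -
    define S where "S = {k. k \<le> m \<and> (\<exists>y. rc m y \<and> good k m y)}"
    have finS: "finite S" unfolding S_def by (rule finite_subset[of _ "{..m}"]) auto
    show ?thesis
    proof (cases "S = {}")
      case True
      \<comment> \<open>Every length needs some random code; where none is good even for k = 0 the
        trivial one is used.\<close>
      obtain \<mu> where "rc m (1, 1, \<mu>)" using ex_trivial_random_code[of m] by (auto simp: rc_def)
      then show ?thesis using True unfolding S_def by (intro exI[of _ "(1, 1, \<mu>)"]) blast
    next
      case False
      then have "Max S \<in> S" using finS by simp
      then obtain y where y: "rc m y" "good (Max S) m y" by (auto simp: S_def)
      have "good k m y" if "k \<le> m" "\<exists>y. rc m y \<and> good k m y" for k
        using that mono[OF y(2), of k] Max_ge[OF finS, of k] by (auto simp: S_def)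
      then show ?thesis using y(1) by blast
    qed
  qed
  then obtain x where x: "\<And>m. rc m (x m)" and gx: "\<And>m k. k \<le> m \<Longrightarrow> (\<exists>y. rc m y \<and> good k m y) \<Longrightarrow> good k m (x m)"
    by metis
  have evx: "eventually (\<lambda>m. good k m (x m)) sequentially" for k
  proof -
    obtain m0 where m0: "\<And>m. m \<ge> m0 \<Longrightarrow> \<exists>y. rc m y \<and> good k m y" using ev[of k] by blast
    show ?thesis by (rule eventually_sequentiallyI[of "max m0 k"]) (use m0 gx in auto)
  qed
  define M1 where "M1 = (\<lambda>m. fst (x m))"
  define M2 where "M2 = (\<lambda>m. fst (snd (x m)))"
  define \<mu> where "\<mu> = (\<lambda>m. snd (snd (x m)))"
  have lim: "Liminf sequentially (\<lambda>n. ereal (f n)) \<ge> ereal r"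
    if "\<And>k::nat. eventually (\<lambda>n. f n \<ge> r - 1 / Suc k) sequentially" for f and r :: real
  proof (rule ereal_le_epsilon2)
    fix e :: real assume "0 < e"
    then obtain k :: nat where k: "1 / Suc k < e" using nat_approx_posE by (metis of_nat_Suc)
    have "ereal (r - 1 / Suc k) \<le> Liminf sequentially (\<lambda>n. ereal (f n))"
      by (rule Liminf_bounded) (use that[of k] in \<open>simp add: eventually_mono\<close>)
    then have "ereal r \<le> Liminf sequentially (\<lambda>n. ereal (f n)) + ereal (1 / Suc k)"
      by (cases "Liminf sequentially (\<lambda>n. ereal (f n))") auto
    also have "\<dots> \<le> Liminf sequentially (\<lambda>n. ereal (f n)) + ereal e"
      using k by (intro add_left_mono) simp
    finally show "ereal r \<le> Liminf sequentially (\<lambda>n. ereal (f n)) + ereal e" .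
  qed
  have L1: "Liminf sequentially (\<lambda>n. ereal (log 2 (real (M1 n)) / real n)) \<ge> ereal R1"
  proof (rule lim)
    fix k :: nat
    show "\<forall>\<^sub>F n in sequentially. R1 - 1 / Suc k \<le> log 2 (real (M1 n)) / real n"
      by (rule eventually_mono[OF evx[of k]]) (simp add: good_def M1_def)
  qed
  have L2: "Liminf sequentially (\<lambda>n. ereal (log 2 (real (M2 n)) / real n)) \<ge> ereal R2"
  proof (rule lim)
    fix k :: nat
    show "\<forall>\<^sub>F n in sequentially. R2 - 1 / Suc k \<le> log 2 (real (M2 n)) / real n"
      by (rule eventually_mono[OF evx[of k]]) (simp add: good_def M2_def)
  qed
  have rcx: "random_code A J B N m (M1 m) (M2 m) (\<mu> m)" for m using x[of m] by (simp add: rc_def M1_def M2_def \<mu>_def)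
  let ?I = "\<lambda>n. INF \<sigma>\<in>states (lists_n J n). mean_success A J B N n (M1 n) (\<mu> n) \<sigma>"
  have I1: "?I n \<le> 1" for n
  proof -
    obtain \<sigma> where \<sigma>: "\<sigma> \<in> states (lists_n J n)" using states_nonempty[OF fin(2) ne(2)] by blast
    show ?thesis using mean_success_INF[OF rcx \<sigma>] mean_success_bounds(2)[OF rcx \<sigma>] by linarith
  qed
  have "?I \<longlonglongrightarrow> 1"
  proof (rule LIMSEQ_I)
    fix e :: real assume "0 < e"
    then obtain k :: nat where k: "1 / Suc k < e" using nat_approx_posE by (metis of_nat_Suc)
    obtain m0 where m0: "\<And>m. m \<ge> m0 \<Longrightarrow> good k m (x m)" using evx[of k] by (auto simp: eventually_sequentially)
    have "norm (?I m - 1) < e" if "m \<ge> m0" for m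
    proof -
      have "1 - 1 / Suc k \<le> ?I m"
        by (rule cINF_greatest[OF states_nonempty[OF fin(2) ne(2)]]) (use m0[OF that] in \<open>auto simp: good_def M1_def \<mu>_def\<close>)
      then show ?thesis using I1[of m] k by simp
    qed
    then show "\<exists>m0. \<forall>m\<ge>m0. norm (?I m - 1) < e" by blast
  qed
  then show ?thesis
    using R0 L1 L2 rcx unfolding AVQC_random_CET_region_def random_code_def mean_success_def by blast
qed

end

subsection \<open>From random codes for the jammed channel to compound codes\<close>

lemma sample_bound_mono: "m \<le> n \<Longrightarrow> sample_bound d m \<le> sample_bound d n"
  unfolding sample_bound_def by (intro mult_mono power_mono) auto

lemma sample_bound_le:
  assumes "n > 0"
  shows "sample_bound d n \<le> (5 * (2 + d) ^ 3) ^ d * n ^ (3 * d)"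
proof -
  have "d * 1 \<le> d * n" using assms by (intro mult_le_mono2) simp
  then have "2 * n + d \<le> (2 + d) * n" by (simp add: algebra_simps)
  then have "sample_bound d n \<le> (5 * ((2 + d) * n)\<^sup>2) ^ d * ((2 + d) * n) ^ d"
    unfolding sample_bound_def by (intro mult_mono power_mono) auto
  also have "\<dots> = (5 * (2 + d) ^ 3) ^ d * n ^ (3 * d)"
    by (simp only: power_mult power_mult_distrib[symmetric]) (simp add: power2_eq_square power3_eq_cube algebra_simps)
  finally show ?thesis .
qed

lemma sample_bound_pos: "n > 0 \<Longrightarrow> sample_bound d n > 0"
  by (simp add: sample_bound_def)

text \<open>The prefix length is chosen as \<open>s ^ (3 * d + 1)\<close> up to a constant, with \<open>s ^ (3 * d + 2)\<close> close to \<open>n\<close>: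
  negligible compared to \<open>n\<close>, while \<open>2 powr (b * s)\<close> still exceeds the number of codes, polynomial in \<open>n\<close>.\<close>
lemma ex_prefix_length:
  fixes b e :: real
  assumes b: "b > 0" and e: "e > 0" and H: "H > (0::nat)"
  shows "\<exists>n0. \<forall>n\<ge>n0. \<exists>s\<ge>s0. real (sample_bound d s * H * s) \<le> e * real n \<and> real (sample_bound d n * H) \<le> 2 powr (b * real s)"
proof -
  define C where "C = (5 * (2 + d) ^ 3) ^ d * H"
  define q where "q = 3 * d + 2"
  have C0: "real C > 0" using H by (simp add: C_def)
  have Cle: "sample_bound d n * H \<le> C * n ^ (3 * d)" if "n > 0" for n
    using mult_le_mono1[OF sample_bound_le[OF that, of d], of H] by (simp add: C_def ac_simps)
  have E1: "eventually (\<lambda>s::nat. real C * (real s + 1) ^ (q * (3 * d)) \<le> 2 powr (b * real s)) at_top"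
    using C0 b by real_asymp
  have E2: "eventually (\<lambda>s::nat. real C / real s \<le> e) at_top"
    using C0 e by real_asymp
  obtain S where S: "\<And>s. s \<ge> S \<Longrightarrow> real C * (real s + 1) ^ (q * (3 * d)) \<le> 2 powr (b * real s) \<and> real C / real s \<le> e"
    using eventually_conj[OF E1 E2] by (auto simp: eventually_sequentially)
  define S' where "S' = max (max S s0) 1"
  show ?thesis
  proof (rule exI[of _ "S' ^ q"], rule allI, rule impI)
    fix n assume n: "n \<ge> S' ^ q"
    have "n < (n + 1) ^ q" by (rule less_le_trans[OF _ self_le_power]) (auto simp: q_def)
    \<comment> \<open>Thus s = t - 1 is the integer part of the q-th root of n: s ^ q \<le> n < (s +
      1) ^ q.\<close>
    define t where "t = (LEAST t. n < t ^ q)"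
    have t: "n < t ^ q" unfolding t_def by (rule LeastI[of "\<lambda>t. n < t ^ q"]) fact
    have t0: "t > 0" using t by (cases "t = 0") (auto simp: q_def)
    define s where "s = t - 1"
    have sn: "s ^ q \<le> n" using not_less_Least[of s "\<lambda>t. n < t ^ q"] t0 by (simp add: t_def[symmetric] s_def)
    have "\<not> t \<le> S'" using power_mono[of t S' q] t n by auto
    then have s: "s \<ge> S'" by (simp add: s_def)
    then have s0: "s > 0" "n > 0" using sn by (auto simp: S'_def q_def intro: gr0I)
    have eS: "real C \<le> e * real s" using S[of s] s s0 by (simp add: S'_def field_simps)
    have "real (sample_bound d s * H * s) \<le> real (C * s ^ (3 * d) * s)"
      using mult_le_mono1[OF Cle[OF s0(1)], of s] by (simp only: of_nat_le_iff)
    also have "\<dots> = real C * real (s ^ (3 * d + 1))" by simp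
    also have "\<dots> \<le> e * real s * real (s ^ (3 * d + 1))" using eS by (rule mult_right_mono) simp
    also have "\<dots> = e * real (s ^ q)" by (simp add: q_def)
    also have "\<dots> \<le> e * real n" using sn e by (intro mult_left_mono) (auto simp only: of_nat_le_iff)
    finally have 1: "real (sample_bound d s * H * s) \<le> e * real n" .
    have "n \<le> (s + 1) ^ q" using t t0 by (simp add: s_def)
    then have "n ^ (3 * d) \<le> (s + 1) ^ (q * (3 * d))" by (simp only: power_mult power_mono)
    then have "sample_bound d n * H \<le> C * (s + 1) ^ (q * (3 * d))"
      by (rule order_trans[OF Cle[OF s0(2)] mult_le_mono2])
    then have "real (sample_bound d n * H) \<le> real (C * (s + 1) ^ (q * (3 * d)))" by (simp only: of_nat_le_iff)
    also have "\<dots> = real C * (real s + 1) ^ (q * (3 * d))" by (simp add: add.commute)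
    also have "\<dots> \<le> 2 powr (b * real s)" using S[of s] s by (simp add: S'_def)
    finally show "\<exists>s\<ge>s0. real (sample_bound d s * H * s) \<le> e * real n \<and> real (sample_bound d n * H) \<le> 2 powr (b * real s)"
      using 1 s by (auto simp: S'_def)
  qed
qed

context
  fixes A :: "'a set" and J :: "'j set" and B :: "'b set" and N :: "('a \<times> 'j) op \<Rightarrow> 'b op"
  assumes fin: "finite A" "finite J" "finite B" and ne: "A \<noteq> {}" "J \<noteq> {}" and N: "channel (A \<times> J) B N"
begin

text \<open>If M1 or M2 is zero, empty sums make the fidelity vanish. Positivity is needed to add
  the logarithms of the two sizes.\<close>

lemma random_code_sizes_pos:
  assumes rc: "random_code A J B N n M1 M2 \<mu>" and \<sigma>: "\<sigma> \<in> states (lists_n J n)"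
    and pos: "mean_success A J B N n M1 \<mu> \<sigma> > 0"
  shows "M1 > 0" "M2 > 0"
proof -
  have "\<not> M1 * M2 = 0"
  proof
    assume 0: "M1 * M2 = 0"
    have "Pbar_cet M1 c (avqc_ch A J B n N \<sigma>) = 0" if "c \<in> space \<mu>" for c
    proof -
      have c: "is_cet_code A B n M1 M2 c" using rc that by (simp add: random_code_def)
      obtain FA FB P R where c': "c = (FA, FB, P, R)" by (cases c)
      have "code_fid M1 c (avqc_ch A J B n N \<sigma>) = 0"
        using 0 is_cet_codeD[OF c[unfolded c']] by (auto simp: code_fid_def c')
      then show ?thesis using Pbar_avqc(1)[OF fin N c, of \<sigma>] \<sigma> by (simp add: states_def)
    qed
    then have "mean_success A J B N n M1 \<mu> \<sigma> = integral\<^sup>L \<mu> (\<lambda>_. 0)"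
      unfolding mean_success_def by (rule Bochner_Integration.integral_cong[OF refl])
    then show False using pos by simp
  qed
  then show "M1 > 0" "M2 > 0" by simp_all
qed

lemma ex_normalized_family:
  assumes rc: "random_code A J B N n M1 M2 \<mu>" and good: "\<forall>\<sigma>\<in>states (lists_n J n). mean_success A J B N n M1 \<mu> \<sigma> \<ge> 1 - \<eta>"
    and n: "n > 0" and \<eta>: "\<eta> > 0" and K: "real (sample_bound (card (J \<times> J)) n) \<le> \<eta>\<^sup>2 * real K"
  obtains Q P R where "\<And>i. i < K \<Longrightarrow> is_cet_code A B n M1 M2 ({..<M2}, {..<Q}, P i, R i)"
    "\<And>\<sigma>. \<sigma> \<in> states J \<Longrightarrow> (\<Sum>i<K. 1 - Pbar_cet M1 ({..<M2}, {..<Q}, P i, R i) (ch_pow A B n (jam_ch N \<sigma>)))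
        \<le> K * (2 ^ card (J \<times> J) * (2 * \<eta>))"
proof -
  have \<mu>: "prob_space \<mu>" "\<And>c. c \<in> space \<mu> \<Longrightarrow> is_cet_code A B n M1 M2 c"
    "\<And>\<sigma>. \<sigma> \<in> states (lists_n J n) \<Longrightarrow> (\<lambda>c. Pbar_cet M1 c (avqc_ch A J B n N \<sigma>)) \<in> borel_measurable \<mu>"
    using rc by (auto simp: random_code_def)
  have good': "1 - \<eta> \<le> integral\<^sup>L \<mu> (\<lambda>c. Pbar_cet M1 c (avqc_ch A J B n N \<sigma>))" if "\<sigma> \<in> states (lists_n J n)" for \<sigma>
    using good that by (simp add: mean_success_def)
  obtain c :: "nat \<Rightarrow> ('a, 'b) cet_code" where c: "\<And>i. i < K \<Longrightarrow> is_cet_code A B n M1 M2 (c i)"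
    and err: "\<And>\<sigma>. \<sigma> \<in> states J \<Longrightarrow> (\<Sum>i<K. 1 - Pbar_cet M1 (c i) (ch_pow A B n (jam_ch N \<sigma>))) \<le> K * (2 ^ card (J \<times> J) * (\<eta> + \<eta>))"
    by (rule ex_code_family[OF fin ne(2) N \<mu> good' n \<eta> less_imp_le[OF \<eta>] K]) (assumption+, erule that, simp only:)
  \<comment> \<open>A common upper bound for the dimensions of all decoder spaces in the
    family.\<close>
  define Q where "Q = (\<Sum>i<K. card (fst (snd (c i))))"
  have "\<exists>P R. is_cet_code A B n M1 M2 ({..<M2}, {..<Q}, P, R) \<and> (\<forall>M. code_fid M1 ({..<M2}, {..<Q}, P, R) M = code_fid M1 (c i) M)"
    if i: "i < K" for i
  proof -
    obtain FA FB P R where ci: "c i = (FA, FB, P, R)" by (cases "c i")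
    have Q: "card FB \<le> Q" using member_le_sum[of i "{..<K}" "\<lambda>i. card (fst (snd (c i)))"] i ci by (simp add: Q_def)
    show ?thesis
      by (rule ex_normalized_code[OF fin(1,3) c[OF i, unfolded ci] Q]) (unfold ci, blast)
  qed
  then obtain P R where PR: "\<And>i. i < K \<Longrightarrow> is_cet_code A B n M1 M2 ({..<M2}, {..<Q}, P i, R i)"
    "\<And>i M. i < K \<Longrightarrow> code_fid M1 ({..<M2}, {..<Q}, P i, R i) M = code_fid M1 (c i) M"
    by metis
  show thesis
  proof (rule that[of Q P R])
    fix \<sigma> assume \<sigma>: "\<sigma> \<in> states J"
    have cp: "cp_map (lists_n A n) (lists_n B n) (ch_pow A B n (jam_ch N \<sigma>))"
      using channel_ch_pow_jam[OF fin N \<sigma>] by (simp add: channel_def)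
    have "Pbar_cet M1 ({..<M2}, {..<Q}, P i, R i) (ch_pow A B n (jam_ch N \<sigma>)) = Pbar_cet M1 (c i) (ch_pow A B n (jam_ch N \<sigma>))"
      if "i < K" for i
      unfolding Pbar_cet_code_fid(1)[OF fin(1,3) PR(1)[OF that] cp] Pbar_cet_code_fid(1)[OF fin(1,3) c[OF that] cp] PR(2)[OF that] ..
    then have "(\<Sum>i<K. 1 - Pbar_cet M1 ({..<M2}, {..<Q}, P i, R i) (ch_pow A B n (jam_ch N \<sigma>)))
        = (\<Sum>i<K. 1 - Pbar_cet M1 (c i) (ch_pow A B n (jam_ch N \<sigma>)))" by (intro sum.cong) auto
    also have "\<dots> \<le> K * (2 ^ card (J \<times> J) * (2 * \<eta>))" using err[OF \<sigma>] by (simp only: mult_2)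
    finally show "(\<Sum>i<K. 1 - Pbar_cet M1 ({..<M2}, {..<Q}, P i, R i) (ch_pow A B n (jam_ch N \<sigma>)))
        \<le> K * (2 ^ card (J \<times> J) * (2 * \<eta>))" .
  qed (rule PR(1))
qed

text \<open>Each of the two families has mean error at most e = 2 ^ d * 2 \<eta>. The prefix loses a
  factor 2 in the majority vote, the main block a factor 2 because some indices are selected more
  often than others; together 4 e.\<close>

lemma ex_derandomized_code:
  assumes rcs: "random_code A J B N s m1 m2 \<nu>" and goods: "\<forall>\<sigma>\<in>states (lists_n J s). mean_success A J B N s m1 \<nu> \<sigma> \<ge> 1 - \<eta>"
    and rcn: "random_code A J B N n M1 M2 \<mu>" and goodn: "\<forall>\<sigma>\<in>states (lists_n J n). mean_success A J B N n M1 \<mu> \<sigma> \<ge> 1 - \<eta>"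
    and pos: "s > 0" "n > 0" "L > 0" "K > 0" and \<eta>: "\<eta> > 0"
    and L: "real (sample_bound (card (J \<times> J)) s) \<le> \<eta>\<^sup>2 * real L" and K: "real (sample_bound (card (J \<times> J)) n) \<le> \<eta>\<^sup>2 * real K"
    and KW: "K \<le> m1 * m2"
  obtains c :: "('a, 'b) cet_code" where "is_cet_code A B (L * s + n) M1 M2 c"
    "\<And>\<sigma>. \<sigma> \<in> states J \<Longrightarrow> 1 - Pbar_cet M1 c (ch_pow A B (L * s + n) (jam_ch N \<sigma>)) \<le> 2 ^ card (J \<times> J) * 8 * \<eta>"
proof -
  define e where "e = 2 ^ card (J \<times> J) * (2 * \<eta>)"
  define W where "W = {1..m1} \<times> {..<m2}"
  have m: "m1 > 0" "m2 > 0" using KW pos(4) by (auto intro: gr0I)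
  have W: "finite W" "W \<noteq> {}" "card W = m1 * m2" using m by (auto simp: W_def)
  have w0: "(1, 0) \<in> W" using m by (simp add: W_def)
  obtain q p r where pr: "\<And>i. i < L \<Longrightarrow> is_cet_code A B s m1 m2 ({..<m2}, {..<q}, p i, r i)"
    "\<And>\<sigma>. \<sigma> \<in> states J \<Longrightarrow> (\<Sum>i<L. 1 - Pbar_cet m1 ({..<m2}, {..<q}, p i, r i) (ch_pow A B s (jam_ch N \<sigma>))) \<le> L * e"
    by (rule ex_normalized_family[OF rcs goods pos(1) \<eta> L, folded e_def]) (erule that, simp only:)
  obtain Q P R where PR: "\<And>i. i < K \<Longrightarrow> is_cet_code A B n M1 M2 ({..<M2}, {..<Q}, P i, R i)"
    "\<And>\<sigma>. \<sigma> \<in> states J \<Longrightarrow> (\<Sum>i<K. 1 - Pbar_cet M1 ({..<M2}, {..<Q}, P i, R i) (ch_pow A B n (jam_ch N \<sigma>))) \<le> K * e"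
    by (rule ex_normalized_family[OF rcn goodn pos(2) \<eta> K, folded e_def]) (erule that, simp only:)
  define \<tau> where "\<tau> = (\<lambda>j w. p j (fst w) (unit_op (snd w) (snd w)))"
  define E :: "nat \<Rightarrow> nat \<times> nat \<Rightarrow> 'b list op" where "E = (\<lambda>j w zs ws. r j (fst w) (unit_op zs ws) (snd w) (snd w)
       + (if w = (1, 0) then \<Sum>m\<in>{1..m1}. \<Sum>x\<in>{m2..<q}. r j m (unit_op zs ws) x x else 0))"
  have cc: "classical_code A B s W (\<tau> j) (E j)" if "j < L" for j
    unfolding \<tau>_def E_def W_def by (rule classical_code_of_cet(1)[OF fin(1,3) pr(1)[OF that] m])
  have ce: "(\<Sum>w\<in>W. 1 - outcome_prob A B s T (\<tau> j) (E j) w w) \<le> card W * (1 - Pbar_cet m1 ({..<m2}, {..<q}, p j, r j) (ch_pow A B s T))"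
    if "j < L" "channel (lists_n A s) (lists_n B s) (ch_pow A B s T)" for j T
    unfolding \<tau>_def E_def W_def by (rule classical_code_of_cet(2)[OF fin(1,3) pr(1)[OF that(1)] m that(2)])
  define \<tau>' where "\<tau>' = (\<lambda>w. rep_op A s (\<lambda>j. \<tau> j w) L)"
  define E' where "E' = (\<lambda>w zs ws. \<Sum>os\<in>{os\<in>lists_n W L. majority (1, 0) L os = w}. rep_op B s (\<lambda>j. E j (os ! j)) L zs ws)"
  have cc': "classical_code A B (L * s) W \<tau>' E'"
    unfolding \<tau>'_def E'_def by (rule classical_code_repetition(1)[OF fin(1,3) W(1) w0 pos(3) cc])
  have ce': "1 - outcome_prob A B (L * s) T \<tau>' E' w w \<le> 2 / L * (\<Sum>j<L. 1 - outcome_prob A B s T (\<tau> j) (E j) w w)"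
    if "w \<in> W" "channel (lists_n A s) (lists_n B s) (ch_pow A B s T)" for w T
    unfolding \<tau>'_def E'_def by (rule classical_code_repetition(2)[OF fin(1,3) W(1) w0 pos(3) cc that])
  obtain c :: "('a, 'b) cet_code" where c: "is_cet_code A B (L * s + n) M1 M2 c"
    and err: "\<And>T. (\<And>m. channel (lists_n A m) (lists_n B m) (ch_pow A B m T)) \<Longrightarrow>
       1 - Pbar_cet M1 c (ch_pow A B (L * s + n) T) \<le> (\<Sum>w\<in>W. 1 - outcome_prob A B (L * s) T \<tau>' E' w w) / card W
         + 2 / K * (\<Sum>i<K. 1 - Pbar_cet M1 ({..<M2}, {..<Q}, P i, R i) (ch_pow A B n T))"
    by (rule ex_prefixed_code[OF fin(1,3) W(1,2) cc' pos(4) _ PR(1)]) (use KW W in auto)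
  show thesis
  proof (rule that[OF c])
    fix \<sigma> assume \<sigma>: "\<sigma> \<in> states J"
    let ?T = "jam_ch N \<sigma>"
    have ch: "channel (lists_n A m) (lists_n B m) (ch_pow A B m ?T)" for m by (rule channel_ch_pow_jam[OF fin N \<sigma>])
    have "(\<Sum>w\<in>W. 1 - outcome_prob A B (L * s) ?T \<tau>' E' w w)
        \<le> (\<Sum>w\<in>W. 2 / L * (\<Sum>j<L. 1 - outcome_prob A B s ?T (\<tau> j) (E j) w w))"
      by (intro sum_mono ce' ch)
    also have "\<dots> = 2 / L * (\<Sum>j<L. \<Sum>w\<in>W. 1 - outcome_prob A B s ?T (\<tau> j) (E j) w w)"
      by (subst sum.swap) (simp only: sum_distrib_left)
    also have "\<dots> \<le> 2 / L * (\<Sum>j<L. card W * (1 - Pbar_cet m1 ({..<m2}, {..<q}, p j, r j) (ch_pow A B s ?T)))"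
      by (intro mult_left_mono sum_mono ce ch) auto
    also have "\<dots> = 2 / L * (card W * (\<Sum>j<L. 1 - Pbar_cet m1 ({..<m2}, {..<q}, p j, r j) (ch_pow A B s ?T)))"
      by (simp only: sum_distrib_left)
    also have "\<dots> \<le> 2 / L * (card W * (L * e))"
      by (intro mult_left_mono pr(2)[OF \<sigma>]) auto
    also have "\<dots> = 2 * e * card W" using pos by simp
    finally have "(\<Sum>w\<in>W. 1 - outcome_prob A B (L * s) ?T \<tau>' E' w w) / card W \<le> 2 * e"
      using m W(3) by (simp add: divide_le_eq)
    moreover have "2 / K * (\<Sum>i<K. 1 - Pbar_cet M1 ({..<M2}, {..<Q}, P i, R i) (ch_pow A B n ?T)) \<le> 2 / K * (K * e)"
      by (intro mult_left_mono PR(2)[OF \<sigma>]) auto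
    then have "2 / K * (\<Sum>i<K. 1 - Pbar_cet M1 ({..<M2}, {..<Q}, P i, R i) (ch_pow A B n ?T)) \<le> 2 * e"
      using pos by simp
    ultimately have "1 - Pbar_cet M1 c (ch_pow A B (L * s + n) ?T) \<le> 4 * e" using err[OF ch] by linarith
    then show "1 - Pbar_cet M1 c (ch_pow A B (L * s + n) ?T) \<le> 2 ^ card (J \<times> J) * 8 * \<eta>"
      by (simp add: e_def)
  qed
qed

lemma AVQC_regionD:
  assumes "(R1, R2) \<in> AVQC_random_CET_region A J B N"
  obtains M1 M2 \<mu> where "\<And>n. random_code A J B N n (M1 n) (M2 n) (\<mu> n)"
    "\<And>\<eta>. \<eta> > 0 \<Longrightarrow> \<exists>n0. \<forall>n\<ge>n0. log 2 (real (M1 n)) / real n \<ge> R1 - \<eta> \<and> log 2 (real (M2 n)) / real n \<ge> R2 - \<eta> \<and>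
       (\<forall>\<sigma>\<in>states (lists_n J n). mean_success A J B N n (M1 n) (\<mu> n) \<sigma> \<ge> 1 - \<eta>)"
proof -
  obtain M1 M2 :: "nat \<Rightarrow> nat" and \<mu> :: "nat \<Rightarrow> ('a, 'b) cet_code measure"
    where rc: "\<And>n. random_code A J B N n (M1 n) (M2 n) (\<mu> n)"
      and L: "Liminf sequentially (\<lambda>n. ereal (log 2 (real (M1 n)) / real n)) \<ge> ereal R1"
        "Liminf sequentially (\<lambda>n. ereal (log 2 (real (M2 n)) / real n)) \<ge> ereal R2"
      and I: "(\<lambda>n. INF \<sigma>\<in>states (lists_n J n). mean_success A J B N n (M1 n) (\<mu> n) \<sigma>) \<longlonglongrightarrow> 1"
    using assms unfolding AVQC_random_CET_region_def mean_success_def random_code_def by blast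
  show thesis
  proof (rule that[OF rc])
    fix \<eta> :: real assume \<eta>: "\<eta> > 0"
    have "ereal (R1 - \<eta>) < Liminf sequentially (\<lambda>n. ereal (log 2 (real (M1 n)) / real n))"
      using L(1) by (rule less_le_trans[rotated]) (simp add: \<eta>)
    from less_LiminfD[OF this] have 1: "\<forall>\<^sub>F n in sequentially. R1 - \<eta> < log 2 (real (M1 n)) / real n" by simp
    have "ereal (R2 - \<eta>) < Liminf sequentially (\<lambda>n. ereal (log 2 (real (M2 n)) / real n))"
      using L(2) by (rule less_le_trans[rotated]) (simp add: \<eta>)
    from less_LiminfD[OF this] have 2: "\<forall>\<^sub>F n in sequentially. R2 - \<eta> < log 2 (real (M2 n)) / real n" by simp
    have "1 - \<eta> < 1" using \<eta> by simp
    from order_tendstoD(1)[OF I this]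
    have "\<forall>\<^sub>F n in sequentially. \<forall>\<sigma>\<in>states (lists_n J n). mean_success A J B N n (M1 n) (\<mu> n) \<sigma> \<ge> 1 - \<eta>"
      by (rule eventually_mono) (meson mean_success_INF[OF fin ne N rc] less_le_trans less_imp_le)
    from eventually_conj[OF 1 eventually_conj[OF 2 this]]
    show "\<exists>n0. \<forall>n\<ge>n0. log 2 (real (M1 n)) / real n \<ge> R1 - \<eta> \<and> log 2 (real (M2 n)) / real n \<ge> R2 - \<eta> \<and>
       (\<forall>\<sigma>\<in>states (lists_n J n). mean_success A J B N n (M1 n) (\<mu> n) \<sigma> \<ge> 1 - \<eta>)"
      unfolding eventually_sequentially by (meson less_imp_le)
  qed
qed

lemma compound_codes_of_random:
  assumes R: "(R1, R2) \<in> AVQC_random_CET_region A J B N" and Rpos: "R1 + R2 > 0"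
    and \<epsilon>: "\<epsilon> > 0" and \<delta>: "\<delta> > 0"
  shows "\<exists>n0. \<forall>n\<ge>n0. \<exists>M1 M2 (c :: ('a, 'b) cet_code). is_cet_code A B n M1 M2 c \<and>
        log 2 (real M1) / real n \<ge> R1 - \<delta> \<and> log 2 (real M2) / real n \<ge> R2 - \<delta> \<and>
        (\<forall>\<sigma>\<in>states J. Pbar_cet M1 c (ch_pow A B n (jam_ch N \<sigma>)) \<ge> 1 - \<epsilon>)"
proof -
  have R0: "R1 \<ge> 0" "R2 \<ge> 0" using R by (auto simp: AVQC_random_CET_region_def)
  define d where "d = card (J \<times> J)"
  \<comment> \<open>The minimum with 1/2 makes 1 - \<eta> positive, which forces the code sizes at
    length s to be positive.\<close>
  define \<eta> where "\<eta> = min (\<epsilon> / (2 ^ d * 8)) (1/2)"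
  have \<eta>: "\<eta> > 0" "\<eta> < 1" using \<epsilon> by (auto simp: \<eta>_def)
  have "\<eta> \<le> \<epsilon> / (2 ^ d * 8)" by (simp add: \<eta>_def)
  then have \<eta>\<epsilon>: "2 ^ d * 8 * \<eta> \<le> \<epsilon>" by (simp add: field_simps)
  \<comment> \<open>Sampling needs at least \<open>sample_bound\<close> divided by the square of
    \<eta> codes; H rounds this factor up, once for both families.\<close>
  define H where "H = nat \<lceil>1 / \<eta>\<^sup>2\<rceil>"
  have "1 / \<eta>\<^sup>2 \<le> real H" by (simp add: H_def)
  then have H1: "1 \<le> \<eta>\<^sup>2 * real H" using \<eta> by (simp add: field_simps)
  then have H: "H > 0" by (auto intro: gr0I)
  have K: "real (sample_bound d n) \<le> \<eta>\<^sup>2 * real (sample_bound d n * H)" for n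
    using mult_left_mono[OF H1, of "real (sample_bound d n)"] by (simp add: ac_simps)
  obtain \<beta> where \<beta>: "0 < \<beta>" and \<beta>2: "\<beta> \<le> 1/2" and \<beta>R: "\<beta> * R1 \<le> \<delta> / 2" "\<beta> * R2 \<le> \<delta> / 2"
    by (rule ex_small_fraction[OF R0 \<delta>])
  obtain M1 M2 \<mu> where rc: "\<And>n. random_code A J B N n (M1 n) (M2 n) (\<mu> n)"
    and ev: "\<And>\<eta>. \<eta> > 0 \<Longrightarrow> \<exists>n0. \<forall>n\<ge>n0. log 2 (real (M1 n)) / real n \<ge> R1 - \<eta> \<and> log 2 (real (M2 n)) / real n \<ge> R2 - \<eta> \<and>
       (\<forall>\<sigma>\<in>states (lists_n J n). mean_success A J B N n (M1 n) (\<mu> n) \<sigma> \<ge> 1 - \<eta>)"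
    by (rule AVQC_regionD[OF R]) (erule that, simp only:)
  \<comment> \<open>Half of the total rate: if each rate falls short by at most b / 2, a code of
    length s still carries 2 powr (b * s) messages for the index.\<close>
  define b where "b = (R1 + R2) / 2"
  have b: "b > 0" using Rpos by (simp add: b_def)
  obtain n1 where good: "\<And>n \<sigma>. n \<ge> n1 \<Longrightarrow> \<sigma> \<in> states (lists_n J n) \<Longrightarrow> mean_success A J B N n (M1 n) (\<mu> n) \<sigma> \<ge> 1 - \<eta>"
    using ev[OF \<eta>(1)] by blast
  obtain n2 where rate: "\<And>n. n \<ge> n2 \<Longrightarrow> log 2 (real (M1 n)) / real n \<ge> R1 - \<delta> / 2 \<and> log 2 (real (M2 n)) / real n \<ge> R2 - \<delta> / 2"
    using ev[OF half_gt_zero[OF \<delta>]] by blast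
  obtain n3 where rate': "\<And>n. n \<ge> n3 \<Longrightarrow> log 2 (real (M1 n)) / real n \<ge> R1 - b / 2 \<and> log 2 (real (M2 n)) / real n \<ge> R2 - b / 2"
    using ev[OF half_gt_zero[OF b]] by blast
  obtain n4 where n4: "\<And>n. n \<ge> n4 \<Longrightarrow> \<exists>s\<ge>n1 + n3 + 1. real (sample_bound d s * H * s) \<le> \<beta> * real n \<and> real (sample_bound d n * H) \<le> 2 powr (b * real s)"
    using ex_prefix_length[OF b \<beta> H, of "n1 + n3 + 1" d] by blast
  have "\<exists>M1 M2 (c :: ('a, 'b) cet_code). is_cet_code A B m M1 M2 c \<and>
        log 2 (real M1) / real m \<ge> R1 - \<delta> \<and> log 2 (real M2) / real m \<ge> R2 - \<delta> \<and>
        (\<forall>\<sigma>\<in>states J. Pbar_cet M1 c (ch_pow A B m (jam_ch N \<sigma>)) \<ge> 1 - \<epsilon>)" if m: "m \<ge> n4 + 2 * (n1 + n2 + 1)" for m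
  proof -
    obtain s where s: "s \<ge> n1 + n3 + 1" and p: "real (sample_bound d s * H * s) \<le> \<beta> * real m"
      and Km: "real (sample_bound d m * H) \<le> 2 powr (b * real s)"
      using n4[of m] m by auto
    define L where "L = sample_bound d s * H"
    \<comment> \<open>The prefix uses \<open>L\<close> blocks of length s, one for each member of
      the short family, and at most a fraction \<beta> of m; the rest is left to the main code,
      which is how \<open>rate_shrink\<close> becomes applicable.\<close>
    define n where "n = m - L * s"
    have "real (L * s) \<le> real m / 2" using p mult_right_mono[OF \<beta>2, of "real m"] by (simp add: L_def)
    then have Ls: "L * s \<le> m" and n: "n \<ge> n1" "n \<ge> n2" "n > 0" using m by (auto simp: n_def simp del: of_nat_mult)
    have nm: "L * s + n = m" using Ls by (simp add: n_def)
    have nr: "(1 - \<beta>) * real m \<le> real n" using p Ls by (simp add: n_def L_def of_nat_diff algebra_simps)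
    have gs: "\<forall>\<sigma>\<in>states (lists_n J s). mean_success A J B N s (M1 s) (\<mu> s) \<sigma> \<ge> 1 - \<eta>" using good s by simp
    have gn: "\<forall>\<sigma>\<in>states (lists_n J n). mean_success A J B N n (M1 n) (\<mu> n) \<sigma> \<ge> 1 - \<eta>" using good n by simp
    obtain \<sigma> where \<sigma>: "\<sigma> \<in> states (lists_n J s)" using states_nonempty[OF fin(2) ne(2)] by blast
    have "mean_success A J B N s (M1 s) (\<mu> s) \<sigma> > 0" using gs \<sigma> \<eta>(2) by fastforce
    note pos = random_code_sizes_pos[OF rc \<sigma> this]
    have "R1 + R2 - b \<le> log 2 (real (M1 s)) / real s + log 2 (real (M2 s)) / real s" using rate'[of s] s by simp
    also have "\<dots> = log 2 (real (M1 s * M2 s)) / real s" using pos by (simp add: log_mult add_divide_distrib)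
    finally have "b * real s \<le> log 2 (real (M1 s * M2 s))" using s by (simp add: b_def field_simps)
    then have "2 powr (b * real s) \<le> real (M1 s * M2 s)" using pos by (subst (asm) le_log_iff) auto
    moreover have "sample_bound d n * H \<le> sample_bound d m * H" using sample_bound_mono[of n m d] nm by simp
    ultimately have KW: "sample_bound d n * H \<le> M1 s * M2 s" using Km by linarith
    have pos': "s > 0" "L > 0" "sample_bound d n * H > 0"
      using s H n sample_bound_pos[of s d] sample_bound_pos[of n d] by (auto simp: L_def)
    obtain c :: "('a, 'b) cet_code" where c: "is_cet_code A B (L * s + n) (M1 n) (M2 n) c"
      and err: "\<And>\<sigma>. \<sigma> \<in> states J \<Longrightarrow> 1 - Pbar_cet (M1 n) c (ch_pow A B (L * s + n) (jam_ch N \<sigma>)) \<le> 2 ^ card (J \<times> J) * 8 * \<eta>"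
      by (rule ex_derandomized_code[OF rc[of s] gs rc[of n] gn pos'(1) n(3) pos'(2) pos'(3)[unfolded d_def] \<eta>(1) K[of s, folded L_def, unfolded d_def] K[of n, unfolded d_def] KW[unfolded d_def]]) (erule that, simp only:)
    have "\<forall>\<sigma>\<in>states J. Pbar_cet (M1 n) c (ch_pow A B m (jam_ch N \<sigma>)) \<ge> 1 - \<epsilon>"
      using err \<eta>\<epsilon> unfolding nm d_def by fastforce
    moreover have "log 2 (real (M1 n)) / real m \<ge> R1 - \<delta>" "log 2 (real (M2 n)) / real m \<ge> R2 - \<delta>"
      using rate_shrink[OF log_nat_nonneg _ n(3) _ nr R0(1) \<beta>R(1) _ \<delta>] rate_shrink[OF log_nat_nonneg _ n(3) _ nr R0(2) \<beta>R(2) _ \<delta>]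
        rate[OF n(2)] \<beta> nm by auto
    ultimately show ?thesis using c unfolding nm by blast
  qed
  then show ?thesis by blast
qed

lemma AVQC_subset:
  assumes R: "(R1, R2) \<in> AVQC_random_CET_region A J B N"
  shows "(R1, R2) \<in> compound_CET_region A B (states J) (jam_ch N)"
proof -
  have R0: "R1 \<ge> 0" "R2 \<ge> 0" using R by (auto simp: AVQC_random_CET_region_def)
  have neJ: "states J \<noteq> {}" using unit_states[OF fin(2)] ne(2) by blast
  have main: "\<exists>n0. \<forall>n\<ge>n0. \<exists>M1 M2 (c :: ('a, 'b) cet_code). is_cet_code A B n M1 M2 c \<and>
        log 2 (real M1) / real n \<ge> R1 - \<delta> \<and> log 2 (real M2) / real n \<ge> R2 - \<delta> \<and>
        (\<forall>\<sigma>\<in>states J. Pbar_cet M1 c (ch_pow A B n (jam_ch N \<sigma>)) \<ge> 1 - \<epsilon>)" if pos: "\<epsilon> > 0" "\<delta> > 0" for \<epsilon> \<delta> :: real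
  proof (cases "R1 + R2 > 0")
    case True
    then show ?thesis by (rule compound_codes_of_random[OF R _ pos])
  next
    case False
    then have 0: "R1 = 0" "R2 = 0" using R0 by auto
    have "\<exists>M1 M2 (c :: ('a, 'b) cet_code). is_cet_code A B n M1 M2 c \<and>
        log 2 (real M1) / real n \<ge> R1 - \<delta> \<and> log 2 (real M2) / real n \<ge> R2 - \<delta> \<and>
        (\<forall>\<sigma>\<in>states J. Pbar_cet M1 c (ch_pow A B n (jam_ch N \<sigma>)) \<ge> 1 - \<epsilon>)" for n
    proof -
      obtain c :: "('a, 'b) cet_code" where c: "is_cet_code A B n 1 1 c"
        "\<And>M. channel (lists_n A n) (lists_n B n) M \<Longrightarrow> Pbar_cet 1 c M = 1"
        by (rule ex_trivial_code[OF fin(1,3) ne(1), of n]) (erule that, simp only:)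
      have "\<forall>\<sigma>\<in>states J. Pbar_cet 1 c (ch_pow A B n (jam_ch N \<sigma>)) \<ge> 1 - \<epsilon>"
        using c(2)[OF channel_ch_pow_jam[OF fin N]] pos by simp
      moreover have "log 2 (real 1) / real n \<ge> R1 - \<delta>" "log 2 (real 1) / real n \<ge> R2 - \<delta>" using 0 pos by simp_all
      ultimately show ?thesis using c(1) by blast
    qed
    then show ?thesis by blast
  qed
  have INF: "(INF \<sigma>\<in>states J. f \<sigma>) \<ge> x" if "\<forall>\<sigma>\<in>states J. f \<sigma> \<ge> x" for f :: "'j op \<Rightarrow> real" and x
    using that by (intro cINF_greatest[OF neJ]) simp
  show ?thesis
    unfolding compound_CET_region_def using R0 main INF by simp meson
qed

end

theorem mainTheorem16:
  fixes A :: "'a set" and J :: "'j set" and B :: "'b set"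
    and N :: "('a \<times> 'j) op \<Rightarrow> 'b op"
  assumes "finite A" "A \<noteq> {}" "finite J" "J \<noteq> {}" "finite B" "B \<noteq> {}"
    and "channel (A \<times> J) B N"
  shows "AVQC_random_CET_region A J B N
         = compound_CET_region A B (states J) (jam_ch N)"
proof (intro subset_antisym subrelI)
  fix R1 R2
  show "(R1, R2) \<in> compound_CET_region A B (states J) (jam_ch N)" if "(R1, R2) \<in> AVQC_random_CET_region A J B N"
    using that by (rule AVQC_subset[OF assms(1,3,5,2,4,7)])
  show "(R1, R2) \<in> AVQC_random_CET_region A J B N" if "(R1, R2) \<in> compound_CET_region A B (states J) (jam_ch N)"
    using that by (rule compound_subset[OF assms(1,3,5,2,4,7)])
qed

end
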